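(* (Local occupation probabilities in the temperate zone of the $\mathfrak{abc}$-hexagon.) Consider a vertical line $\mathcal L_m$ with $N$ points in the $\mathfrak{abc}$-hexagon with $\mathfrak a=\mathfrak An$, $\mathfrak b=\mathfrak Bn$, $\mathfrak c=\mathfrak Cn$, $m=\tau n$ for fixed positive $\mathfrak A,\mathfrak B,\mathfrak C,\tau$. Let $x>0$ be fixed such that $Nx\in\mathbb Z_N=\{0,1,\dots,N-1\}$ and such that the location $\xi=Nx$ units above $Q_m$ in $\mathcal L_m$ lies in the temperate zone, bounded away from the expected boundary between the polar and temperate zones by a distance proportional to $n$. Let $B_n=\{Nx,Nx+j_1,Nx+j_2,\dots,Nx+j_M\}$ (locations given by distance above $Q_m$), where $\mathbb B=\{0,j_1,\dots,j_M\}\subset\mathbb Z_N$ is a fixed set of integers. Then $$\lim_{n\to\infty}\mathbb P(\text{there are precisely }p\text{ holes in the set }B_n)=\frac1{p!}\left(-\frac d{dt}\right)^p\bigg|_{t=1}\det\left(1-t\,\mathcal S(x)|_{\mathbb B}\right),$$ where $\mathcal S(x)$ acts on $\ell^2(\mathbb Z)$ with the kernel $$\mathcal S_{ij}(x)=\frac{\sin(\pi q(x)(i-j))}{\pi(i-j)},\qquad i,j\in\mathbb Z$$ (with $\mathcal S_{ii}(x)=q(x)$), and $q(x)=c\,d\mu^c_{\min}/dx(x)$ is the limiting one-point function, or density of states, at $x$.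
   Context: **Tilings.** Let $\mathfrak a\ge\mathfrak b$, $\mathfrak c$ be positive integers. The $\mathfrak{abc}$-hexagon has vertices (in $\mathbb C$) $P_1=0$, $P_2=\mathfrak be^{-i\pi/6}$, $P_3=P_2+\mathfrak ae^{i\pi/6}$, $P_4=P_3+i\mathfrak c$, $P_5=P_4+\mathfrak be^{5\pi i/6}$, $P_6=i\mathfrak c$. $\mathcal L$ is the set of points of the lattice $\{ke^{i\pi/6}+je^{-i\pi/6}\}_{k,j\in\mathbb Z}$ in the hexagon, including the sides $(P_6,P_1),(P_1,P_2),(P_2,P_3),(P_3,P_4)$ but excluding $(P_4,P_5),(P_5,P_6)$. A rhombus tiling is a tiling by unit-side rhombi with lattice vertices; the two "horizontal" types (I, II) have two vertical sides, the "vertical" type (III) has sides parallel to $e^{\pm i\pi/6}$. The position of a type I or II rhombus is the lower endpoint of its left vertical side; the position of a type III rhombus is its lowest vertex. A tiling is chosen uniformly at random. $\mathcal L_m$ is the set of points of $\mathcal L$ with $\Re z=\frac{\sqrt3}2m$, and $Q_m$ is its lowest point. With $\mathfrak a_m=|m-\mathfrak a|$, $\mathfrak b_m=|m-\mathfrak b|$, $\mathcal L_m$ has $N=\mathfrak c+\frac{\mathfrak a-\mathfrak a_m}2+\frac{\mathfrak b-\mathfrak b_m}2$ points, at distances $0,1,\dots,N-1$ from $Q_m$; each is the position of a horizontal rhombus (a particle; there are $\mathfrak c$ of them) or of a vertical rhombus (a hole; there are $N-\mathfrak c$). **Scaling.** $\mathfrak a=\mathfrak An$, $\mathfrak b=\mathfrak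 Bn$, $\mathfrak c=\mathfrak Cn$, $m=\tau n$ (with $n$ such that these are integers), $0<\tau<\mathfrak A+\mathfrak B$. Then $c:=(N-\mathfrak c)/N$, $A:=\mathfrak a_m/N$, $B:=\mathfrak b_m/N$ do not depend on $n$. Standing assumptions: $A,B>0$ and $c\ne c_A,c_B$, where $c_A=\frac{-(A+B)+\sqrt{(A+B)^2+4A}}2$, $c_B=\frac{-(A+B)+\sqrt{(A+B)^2+4B}}2$. **Equilibrium measure.** $\mu^c_{\min}$ is the unique minimizer of $E_c[\mu]=c\iint\log\frac1{|x-y|}d\mu(x)d\mu(y)+\int\varphi\,d\mu$ over Borel probability measures on $[0,1]$ with $\mu(\mathcal B)\le\frac1c|\mathcal B|$ (Lebesgue measure) for all Borel $\mathcal B$, where $\varphi(x)=V(x)+\int_0^1\log|x-y|dy$ and $V(x)=A\log A+(B+1)\log(B+1)-(A+x)\log(A+x)-(B+1-x)\log(B+1-x)$. There is exactly one interval $(\alpha,\beta)\subset(0,1)$ (band) where $0<d\mu^c_{\min}/dx<1/c$; on each of $(0,\alpha)$, $(\beta,1)$ the density is identically $0$ or identically $1/c$. On $\mathcal L_m$, the temperate zone is the set of locations with $\xi/N\in(\alpha,\beta)$, the polar zones are $\xi/N<\alpha$ and $\xi/N>\beta$, and the expected boundary is at heights $N\alpha$, $N\beta$.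
   Formalization: A and B are interchanged in the potential V: with heights measured up from the lowest point Q_m, B belongs to the end x=0 and A to x=1; with V as given the limit would be q(1-x) instead of q(x) when A and B differ. *)

theory Defs
  imports "Jordan_Normal_Form.Determinant" "HOL-Probability.Probability"
begin

section \<open>Rhombus tilings of the hexagon\<close>

definition tri_lattice :: "complex set" where
  "tri_lattice =
     {of_int k * cis (pi / 6) + of_int j * cis (- pi / 6) | k j :: int. True}"

definition P1 :: "nat \<Rightarrow> nat \<Rightarrow> nat \<Rightarrow> complex" where
  "P1 a b c = 0"
definition P2 :: "nat \<Rightarrow> nat \<Rightarrow> nat \<Rightarrow> complex" where
  "P2 a b c = of_nat b * cis (- pi / 6)"
definition P3 :: "nat \<Rightarrow> nat \<Rightarrow> nat \<Rightarrow> complex" where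
  "P3 a b c = P2 a b c + of_nat a * cis (pi / 6)"
definition P4 :: "nat \<Rightarrow> nat \<Rightarrow> nat \<Rightarrow> complex" where
  "P4 a b c = P3 a b c + \<i> * of_nat c"
definition P5 :: "nat \<Rightarrow> nat \<Rightarrow> nat \<Rightarrow> complex" where
  "P5 a b c = P4 a b c + of_nat b * cis (5 * pi / 6)"
definition P6 :: "nat \<Rightarrow> nat \<Rightarrow> nat \<Rightarrow> complex" where
  "P6 a b c = \<i> * of_nat c"

definition hexagon :: "nat \<Rightarrow> nat \<Rightarrow> nat \<Rightarrow> complex set" where
  "hexagon a b c =
     convex hull {P1 a b c, P2 a b c, P3 a b c, P4 a b c, P5 a b c, P6 a b c}"

text \<open>
  The excluded sides are excluded together with their endpoints; in particular
  \<open>P4\<close> and \<open>P6\<close> do not belong to the region, so that the leftmost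
  and the rightmost vertical lines contain exactly \<open>c\<close> points.
\<close>

definition lattice_region :: "nat \<Rightarrow> nat \<Rightarrow> nat \<Rightarrow> complex set" where
  "lattice_region a b c =
     (tri_lattice \<inter> hexagon a b c)
       - (closed_segment (P4 a b c) (P5 a b c) \<union> closed_segment (P5 a b c) (P6 a b c))"

definition vline :: "nat \<Rightarrow> nat \<Rightarrow> nat \<Rightarrow> nat \<Rightarrow> complex set" where
  "vline a b c m = {z \<in> lattice_region a b c. Re z = sqrt 3 / 2 * real m}"

definition lowest_point :: "nat \<Rightarrow> nat \<Rightarrow> nat \<Rightarrow> nat \<Rightarrow> complex" where
  "lowest_point a b c m = arg_min_on Im (vline a b c m)"

datatype rhombus_type = TypeI | TypeII | TypeIII

text \<open>
  A unit rhombus with lattice vertices is encoded by its type and its position. With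
  the side vectors below, the base point \<open>z\<close> is the lower endpoint of the left vertical
  side for types I and II, and the lowest vertex for type III.
\<close>

fun side_vectors :: "rhombus_type \<Rightarrow> complex \<times> complex" where
  "side_vectors TypeI = (cis (pi / 6), \<i>)"
| "side_vectors TypeII = (cis (- pi / 6), \<i>)"
| "side_vectors TypeIII = (cis (pi / 6), cis (5 * pi / 6))"

fun rhombus :: "rhombus_type \<times> complex \<Rightarrow> complex set" where
  "rhombus (ty, z) =
     (let (u, v) = side_vectors ty in convex hull {z, z + u, z + u + v, z + v})"

definition tilings :: "nat \<Rightarrow> nat \<Rightarrow> nat \<Rightarrow> (rhombus_type \<times> complex) set set" where
  "tilings a b c =
     {T. T \<subseteq> UNIV \<times> tri_lattice
       \<and> (\<Union>r\<in>T. rhombus r) = hexagon a b c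
       \<and> (\<forall>r\<in>T. \<forall>s\<in>T. r \<noteq> s \<longrightarrow> interior (rhombus r) \<inter> interior (rhombus s) = {})}"

definition random_tiling :: "nat \<Rightarrow> nat \<Rightarrow> nat \<Rightarrow> (rhombus_type \<times> complex) set pmf" where
  "random_tiling a b c = pmf_of_set (tilings a b c)"

text \<open>The argument \<open>\<xi>\<close> is the distance above the lowest point of the vertical line.\<close>

definition is_hole ::
  "nat \<Rightarrow> nat \<Rightarrow> nat \<Rightarrow> nat \<Rightarrow> (rhombus_type \<times> complex) set \<Rightarrow> real \<Rightarrow> bool" where
  "is_hole a b c m T \<xi> \<longleftrightarrow>
     (TypeIII, lowest_point a b c m + \<i> * of_real \<xi>) \<in> T"

section \<open>The equilibrium measure\<close>

text \<open>
  Below, \<open>A\<close> and \<open>B\<close> stand for \<open>\<bar>m - a\<bar> / N\<close> and \<open>\<bar>m - b\<bar> / N\<close>. For the hexagon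
  with vertices \<open>P1, ..., P6\<close> above, the holes \<open>h\<^sub>1, h\<^sub>2, ...\<close> on the \<open>m\<close>-th line, measured from its
  lowest point, have joint law proportional to
  \[ \prod_{i<j} (h_i - h_j)^2 \prod_i
       \frac{(h_i + |m-b|)!}{h_i!} \frac{(N - 1 - h_i + |m-a|)!}{(N - 1 - h_i)!} , \]
  so that it is \<open>B\<close> that goes with the lower end \<open>x = 0\<close> and \<open>A\<close> with the upper
  end \<open>x = 1\<close>. (For \<open>c = m = 1\<close> the single path rises with probability
  \<open>a / (a + b)\<close>, and the hole is then at distance 0.) In the literature the potential also appears
  with \<open>A\<close> and \<open>B\<close> interchanged, which amounts to measuring distances from the highest point.
\<close>

definition potential :: "real \<Rightarrow> real \<Rightarrow> real \<Rightarrow> real" where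
  "potential A B x = B * ln B + (A + 1) * ln (A + 1)
     - (B + x) * ln (B + x) - (A + 1 - x) * ln (A + 1 - x)"

definition ext_field :: "real \<Rightarrow> real \<Rightarrow> real \<Rightarrow> real" where
  "ext_field A B x = potential A B x + (LBINT y:{0..1}. ln \<bar>x - y\<bar>)"

text \<open>
  An admissible measure has a bounded density, hence the diagonal is null (where
  \<open>ln\<close> takes the value \<open>0\<close> instead of \<open>-\<infinity>\<close>) and all integrals below converge absolutely.
\<close>

definition energy :: "real \<Rightarrow> real \<Rightarrow> real \<Rightarrow> real measure \<Rightarrow> real" where
  "energy A B c \<mu> =
     c * (\<integral>x. (\<integral>y. ln (1 / \<bar>x - y\<bar>) \<partial>\<mu>) \<partial>\<mu>) + (\<integral>x. ext_field A B x \<partial>\<mu>)"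

definition admissible :: "real \<Rightarrow> real measure \<Rightarrow> bool" where
  "admissible c \<mu> \<longleftrightarrow>
     prob_space \<mu> \<and> sets \<mu> = sets borel \<and> emeasure \<mu> {0..1} = 1
     \<and> (\<forall>S\<in>sets borel. emeasure \<mu> S \<le> ennreal (1 / c) * emeasure lborel S)"

definition is_equilibrium_measure :: "real \<Rightarrow> real \<Rightarrow> real \<Rightarrow> real measure \<Rightarrow> bool" where
  "is_equilibrium_measure A B c \<mu> \<longleftrightarrow>
     admissible c \<mu> \<and> (\<forall>\<nu>. admissible c \<nu> \<longrightarrow> energy A B c \<mu> \<le> energy A B c \<nu>)"

text \<open>
  A Radon-Nikodym density is only determined almost everywhere. The derivative of the
  distribution function is the version with definite pointwise values; it agrees with
  any density at each continuity point of that density.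
\<close>

definition density_at :: "real measure \<Rightarrow> real \<Rightarrow> real" where
  "density_at \<mu> x = deriv (\<lambda>t. measure \<mu> {..t}) x"

definition is_band :: "real \<Rightarrow> real measure \<Rightarrow> real \<Rightarrow> real \<Rightarrow> bool" where
  "is_band c \<mu> \<alpha> \<beta> \<longleftrightarrow>
     0 \<le> \<alpha> \<and> \<alpha> < \<beta> \<and> \<beta> \<le> 1
     \<and> (\<forall>y\<in>{\<alpha><..<\<beta>}. 0 < density_at \<mu> y \<and> density_at \<mu> y < 1 / c)
     \<and> ((\<forall>y\<in>{0<..<\<alpha>}. density_at \<mu> y = 0) \<or> (\<forall>y\<in>{0<..<\<alpha>}. density_at \<mu> y = 1 / c))
     \<and> ((\<forall>y\<in>{\<beta><..<1}. density_at \<mu> y = 0) \<or> (\<forall>y\<in>{\<beta><..<1}. density_at \<mu> y = 1 / c))"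

definition c_crit_A :: "real \<Rightarrow> real \<Rightarrow> real" where
  "c_crit_A A B = (- (A + B) + sqrt ((A + B)\<^sup>2 + 4 * A)) / 2"

definition c_crit_B :: "real \<Rightarrow> real \<Rightarrow> real" where
  "c_crit_B A B = (- (A + B) + sqrt ((A + B)\<^sup>2 + 4 * B)) / 2"

section \<open>The discrete sine kernel\<close>

definition sine_kernel :: "real \<Rightarrow> int \<Rightarrow> int \<Rightarrow> real" where
  "sine_kernel q i j =
     (if i = j then q else sin (pi * q * of_int (i - j)) / (pi * of_int (i - j)))"

definition sine_matrix :: "real \<Rightarrow> nat \<Rightarrow> (nat \<Rightarrow> nat) \<Rightarrow> real mat" where
  "sine_matrix q M j =
     Matrix.mat (Suc M) (Suc M) (\<lambda>(u, v). sine_kernel q (int (j u)) (int (j v)))"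

end

theory Submission
  imports Defs
begin

text \<open>
  Reading the horizontal rhombi along the vertical lines turns a tiling into a family of non-intersecting
  paths. Expanding a Vandermonde determinant column by column shows that the number of such families with prescribed
  particles \<open>Y\<close> on one line is \<open>\<Delta>(Y)\<^sup>2\<close> times a product of Hahn weights, up to a constant. The generating
  function of the number of holes in a window is therefore \<open>det (1 - z (1 - K))\<close> with the projection \<open>K\<close> onto the first
  \<open>\<cc>\<close> eigenfunctions of the difference operator of the Hahn polynomials. The matrix elements of the
  rescaled operator converge to those of a Toeplitz operator with symbol \<open>b + 2 a cos \<theta>\<close> (moments, by the three
  term recurrence), so that \<open>K\<close> converges to a discrete sine kernel with explicit density \<open>\<rho>\<close>. Finally, comparing the mean energy of the
  ensemble with the energy of lattice approximations to an arbitrary competitor shows that \<open>\<rho>\<close> minimizes the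
  logarithmic energy of the particles; strict convexity of that energy identifies \<open>1 - \<rho>\<close> with \<open>c\<close> times the density of the
  equilibrium measure.
\<close>

text \<open>Path counting yields the law of the particles; holes enter by complementation, and the
  signs (-1)^(i-j) that distinguish the complement of a sine kernel from a sine kernel are removed
  by a diagonal conjugation. The difference operator is read as a tridiagonal matrix in the site,
  not in the degree. Its eigenvalues increase with the degree, so keeping the lowest degrees is a
  cutoff in energy, and near a fixed location its entries divided by N^2 become constant. The local
  limit is therefore governed by two limiting rates and one threshold. The density found in this way
  carries no trace of the variational problem, whose solution changes shape according to which outer
  zones are void or saturated. This is why energies are compared instead of minimizers. The
  comparison rests on two estimates: Stirling's formula with an error of smaller order than N, and
  positivity of the logarithmic energy in the quantitative form \<open>log_energy_ge\<close>, by
  which an energy \<le> 0 forces equal distribution functions.\<close>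

abbreviation mdet where "mdet \<equiv> Determinant.det"

lemmas bochner_cong = Bochner_Integration.integral_cong

section \<open>Determinantal identities\<close>

text \<open>The matrix is the Vandermonde matrix times the upper triangular matrix of coefficients.
  A drop in degree is allowed: then the coefficient at \<open>j\<close> is 0 and so is the
  determinant.\<close>

lemma det_poly_eval:
  fixes P :: "nat \<Rightarrow> 'a :: idom poly" and y :: "nat \<Rightarrow> 'a"
  assumes deg: "\<And>j. j < n \<Longrightarrow> degree (P j) \<le> j"
  shows "mdet (Matrix.mat n n (\<lambda>(i,j). poly (P j) (y i)))
       = (\<Prod>j<n. coeff (P j) j) * mdet (Matrix.mat n n (\<lambda>(i,j). y i ^ j))"
proof -
  define V where "V = Matrix.mat n n (\<lambda>(i,j). y i ^ j)"
  define U where "U = Matrix.mat n n (\<lambda>(k,j). coeff (P j) k)"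
  have VU: "V \<in> carrier_mat n n" "U \<in> carrier_mat n n" by (simp_all add: V_def U_def)
  have "Matrix.mat n n (\<lambda>(i,j). poly (P j) (y i)) = V * U"
  proof (rule eq_matI)
    fix i j assume "i < dim_row (V * U)" "j < dim_col (V * U)"
    then have ij: "i < n" "j < n" by (auto simp: V_def U_def)
    have "poly (P j) (y i) = (\<Sum>k\<le>degree (P j). coeff (P j) k * y i ^ k)"
      by (rule poly_altdef)
    also have "\<dots> = (\<Sum>k\<in>{0..<n}. coeff (P j) k * y i ^ k)"
      by (rule sum.mono_neutral_left) (use deg[OF ij(2)] ij in \<open>auto simp: coeff_eq_0\<close>)
    finally show "Matrix.mat n n (\<lambda>(i,j). poly (P j) (y i)) $$ (i,j) = (V * U) $$ (i,j)"
      using ij by (simp add: V_def U_def scalar_prod_def mult.commute)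
  qed (auto simp: V_def U_def)
  moreover have "Determinant.det U = (\<Prod>j<n. coeff (P j) j)"
  proof -
    have "upper_triangular U"
      using deg by (auto simp: upper_triangular_def U_def intro!: coeff_eq_0) (meson le_less_trans order.strict_trans)
    then have "Determinant.det U = prod_list (diag_mat U)" using VU(2) by (rule det_upper_triangular)
    also have "\<dots> = (\<Prod>j<n. coeff (P j) j)"
      by (simp add: prod_list_diag_prod U_def atLeast0LessThan)
    finally show ?thesis .
  qed
  ultimately show ?thesis using det_mult[OF VU] by (simp add: V_def mult.commute)
qed

text \<open>In the Newton basis built on the nodes themselves the evaluation matrix is lower
  triangular, and a monic change of basis does not alter the determinant.\<close>

lemma det_vandermonde:
  fixes y :: "nat \<Rightarrow> 'a :: idom"
  shows "mdet (Matrix.mat n n (\<lambda>(i,j). y i ^ j)) = (\<Prod>j<n. \<Prod>l<j. y j - y l)"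
proof -
  define P where "P j = (\<Prod>l<j. [:- y l, 1:])" for j
  have deg: "degree (P j) = j" for j
    unfolding P_def by (subst degree_prod_sum_eq) auto
  have lead: "coeff (P j) j = 1" for j
  proof -
    have "lead_coeff (P j) = 1" unfolding P_def by (simp add: lead_coeff_prod)
    then show ?thesis by (simp add: deg)
  qed
  define U where "U = Matrix.mat n n (\<lambda>(i,j). poly (P j) (y i))"
  have "Determinant.det U = mdet (Matrix.mat n n (\<lambda>(i,j). y i ^ j))"
    unfolding U_def by (subst det_poly_eval) (auto simp: deg lead)
  moreover have "Determinant.det U = prod_list (diag_mat U)"
    by (rule det_lower_triangular[of n])
       (auto simp: U_def P_def poly_prod intro!: prod_zero)
  moreover have "prod_list (diag_mat U) = (\<Prod>j<n. \<Prod>l<j. y j - y l)"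
    by (simp add: prod_list_diag_prod U_def atLeast0LessThan P_def poly_prod)
  ultimately show ?thesis by simp
qed

text \<open>Sylvester's identity. The block matrices \<open>M\<close> and \<open>T\<close> multiply
  to a block triangular matrix in either order, and both products have the same determinant.\<close>

lemma det_one_plus_mult_commute:
  fixes A B :: "'a :: idom mat"
  assumes A: "A \<in> carrier_mat n m" and B: "B \<in> carrier_mat m n"
  shows "mdet (1\<^sub>m n + A * B) = mdet (1\<^sub>m m + B * A)"
proof -
  define M where "M = four_block_mat (1\<^sub>m n) (- A) B (1\<^sub>m m)"
  define T where "T = four_block_mat (1\<^sub>m n) A (0\<^sub>m m n) (1\<^sub>m m)"
  have M: "M \<in> carrier_mat (n + m) (n + m)" and T: "T \<in> carrier_mat (n + m) (n + m)"
    using A B by (auto simp: M_def T_def)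
  have BA: "B * A + 1\<^sub>m m = 1\<^sub>m m + B * A" using A B by (intro comm_add_mat[of _ m m]) auto
  have "M * T = four_block_mat (1\<^sub>m n) (0\<^sub>m n m) B (1\<^sub>m m + B * A)"
    unfolding M_def T_def using A B
    by (subst mult_four_block_mat[of _ n n _ m _ m _ _ n _ m])
       (auto simp: BA intro!: cong_four_block_mat)
  then have 1: "mdet (M * T) = mdet (1\<^sub>m m + B * A)"
    using A B by (simp add: det_four_block_mat_upper_right_zero[of _ n _ m])
  have "T * M = four_block_mat (1\<^sub>m n + A * B) (0\<^sub>m n m) B (1\<^sub>m m)"
    unfolding M_def T_def using A B
    by (subst mult_four_block_mat[of _ n n _ m _ m _ _ n _ m])
       (auto intro!: cong_four_block_mat)
  then have 2: "mdet (T * M) = mdet (1\<^sub>m n + A * B)"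
    using A B by (simp add: det_four_block_mat_upper_right_zero[of _ n _ m])
  show ?thesis using 1 2 det_mult[OF M T] det_mult[OF T M] by (simp add: mult.commute)
qed

lemma permutes_nat_less: "\<pi> permutes {0..<n} \<Longrightarrow> i < n \<Longrightarrow> \<pi> i < (n::nat)"
  using permutes_in_image[of \<pi> "{0..<n}" i] by simp

text \<open>Andreief's form of the Cauchy-Binet identity, summed over all functions so that no order
  of the sites is involved. One Leibniz expansion gives a diagonal product times \<open>D f\<close>;
  averaging over all relabellings of \<open>f\<close> turns the diagonal product into a second copy
  of \<open>D f\<close>.\<close>

lemma andreief_functions:
  fixes \<phi> :: "nat \<Rightarrow> 'b \<Rightarrow> real" and h :: "'b \<Rightarrow> real"
  assumes S: "finite S"
  shows "fact n * mdet (Matrix.mat n n (\<lambda>(i,j). \<Sum>s\<in>S. h s * \<phi> i s * \<phi> j s))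
       = (\<Sum>f\<in>PiE {..<n} (\<lambda>_. S). (\<Prod>i<n. h (f i)) *
            (mdet (Matrix.mat n n (\<lambda>(i,j). \<phi> j (f i))))\<^sup>2)"
proof -
  define F where "F = PiE {..<n} (\<lambda>_. S)"
  define D where "D f = mdet (Matrix.mat n n (\<lambda>(i,j). \<phi> j (f i)))" for f
  define G where "G = Matrix.mat n n (\<lambda>(i,j). \<Sum>s\<in>S. h s * \<phi> i s * \<phi> j s)"
  define Pm where "Pm = {\<sigma>. \<sigma> permutes {0..<n}}"
  have finF: "finite F" unfolding F_def using S by (intro finite_PiE) auto
  have cardPm: "card Pm = fact n" unfolding Pm_def by (rule card_permutations) auto
  have D1: "D f = (\<Sum>\<pi>\<in>Pm. signof \<pi> * (\<Prod>i<n. \<phi> (\<pi> i) (f i)))" for f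
    unfolding D_def Pm_def
    by (subst det_def'[of _ n]) (auto simp: atLeast0LessThan permutes_nat_less intro!: sum.cong prod.cong)
  have D2: "D f = (\<Sum>\<sigma>\<in>Pm. signof \<sigma> * (\<Prod>i<n. \<phi> i (f (\<sigma> i))))" for f
    unfolding D_def Pm_def
    by (subst det_col[of _ n]) (auto simp: atLeast0LessThan permutes_nat_less intro!: sum.cong prod.cong)
  have G1: "Determinant.det G = (\<Sum>f\<in>F. (\<Prod>i<n. h (f i)) * (\<Prod>i<n. \<phi> i (f i)) * D f)"
  proof -
    have "Determinant.det G = (\<Sum>\<pi>\<in>Pm. signof \<pi> * (\<Prod>i<n. \<Sum>s\<in>S. h s * \<phi> i s * \<phi> (\<pi> i) s))"
      unfolding G_def Pm_def
      by (subst det_def'[of _ n]) (auto simp: atLeast0LessThan permutes_nat_less intro!: sum.cong prod.cong)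
    also have "\<dots> = (\<Sum>\<pi>\<in>Pm. signof \<pi> * (\<Sum>f\<in>F. \<Prod>i<n. h (f i) * \<phi> i (f i) * \<phi> (\<pi> i) (f i)))"
      unfolding F_def using S by (subst prod_sum_PiE) auto
    also have "\<dots> = (\<Sum>f\<in>F. (\<Prod>i<n. h (f i)) * (\<Prod>i<n. \<phi> i (f i)) * D f)"
      unfolding D1 sum_distrib_left
      by (subst sum.swap) (simp add: prod.distrib mult.assoc mult.left_commute)
    finally show ?thesis .
  qed
  \<comment> \<open>Relabelling the arguments of \<open>f\<close> by \<sigma> permutes the summands
    of \<open>G1\<close>: the product of \<open>h\<close> is unaffected, and \<open>D\<close> picks
    up the sign of \<sigma>, as the expansion \<open>D2\<close> requires.\<close>
  have G2: "Determinant.det G = (\<Sum>f\<in>F. (\<Prod>i<n. h (f i)) * (\<Prod>i<n. \<phi> i (f (\<sigma> i))) * (signof \<sigma> * D f))"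
    if \<sigma>: "\<sigma> \<in> Pm" for \<sigma>
  proof -
    have perm: "\<sigma> permutes {..<n}" using \<sigma> by (simp add: Pm_def atLeast0LessThan)
    define r where "r \<tau> f = restrict (f \<circ> \<tau>) {..<n}" for \<tau> and f :: "nat \<Rightarrow> 'b"
    have bij: "bij_betw (r \<sigma>) F F"
    proof (rule bij_betw_byWitness[where f' = "r (Hilbert_Choice.inv \<sigma>)"])
      have inv: "Hilbert_Choice.inv \<sigma> permutes {..<n}" by (rule permutes_inv[OF perm])
      have ran: "\<sigma> i < n" "Hilbert_Choice.inv \<sigma> i < n" if "i < n" for i
        using permutes_in_image[OF perm, of i] permutes_in_image[OF inv, of i] that by auto
      have canc: "\<sigma> (Hilbert_Choice.inv \<sigma> i) = i" "Hilbert_Choice.inv \<sigma> (\<sigma> i) = i" for i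
        using permutes_inverses[OF perm] by auto
      have ext: "f i = undefined" if "f \<in> F" "\<not> i < n" for f i
        using that by (auto simp: F_def PiE_def extensional_def)
      show "\<forall>f\<in>F. r (Hilbert_Choice.inv \<sigma>) (r \<sigma> f) = f" "\<forall>f\<in>F. r \<sigma> (r (Hilbert_Choice.inv \<sigma>) f) = f"
        by (intro ballI HOL.ext, simp add: r_def ran canc ext)+
      show "r \<sigma> ` F \<subseteq> F" "r (Hilbert_Choice.inv \<sigma>) ` F \<subseteq> F"
        using ran by (fastforce simp: r_def F_def PiE_iff extensional_def)+
    qed
    have Dr: "D (r \<sigma> f) = signof \<sigma> * D f" for f
    proof -
      have "D (r \<sigma> f) = mdet (Matrix.mat n n (\<lambda>(i,j).
              Matrix.mat n n (\<lambda>(i,j). \<phi> j (f i)) $$ (\<sigma> i, j)))"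
        unfolding D_def using permutes_in_image[OF perm]
        by (intro arg_cong[where f = Determinant.det] eq_matI) (auto simp: r_def)
      also have "\<dots> = signof \<sigma> * D f"
        unfolding D_def using \<sigma> 
        by (subst Determinant.det_permute_rows) (simp_all add: Pm_def)
      finally show ?thesis .
    qed
    have "Determinant.det G = (\<Sum>f\<in>F. (\<Prod>i<n. h (r \<sigma> f i)) * (\<Prod>i<n. \<phi> i (r \<sigma> f i)) * D (r \<sigma> f))"
      unfolding G1 by (rule sum.reindex_bij_betw[OF bij, symmetric])
    also have "\<dots> = (\<Sum>f\<in>F. (\<Prod>i<n. h (f (\<sigma> i))) * (\<Prod>i<n. \<phi> i (f (\<sigma> i))) * (signof \<sigma> * D f))"
      unfolding Dr by (intro sum.cong refl arg_cong2[where f="(*)"] prod.cong) (auto simp: r_def)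
    also have "\<dots> = (\<Sum>f\<in>F. (\<Prod>i<n. h (f i)) * (\<Prod>i<n. \<phi> i (f (\<sigma> i))) * (signof \<sigma> * D f))"
      by (intro sum.cong refl arg_cong2[where f="(*)"] prod.reindex_bij_betw permutes_imp_bij perm)
    finally show ?thesis .
  qed
  have "fact n * Determinant.det G = (\<Sum>\<sigma>\<in>Pm. Determinant.det G)"
    using cardPm by simp
  also have "\<dots> = (\<Sum>\<sigma>\<in>Pm. \<Sum>f\<in>F. (\<Prod>i<n. h (f i)) * (\<Prod>i<n. \<phi> i (f (\<sigma> i))) * (signof \<sigma> * D f))"
    by (intro sum.cong refl G2)
  also have "\<dots> = (\<Sum>f\<in>F. (\<Prod>i<n. h (f i)) * D f * (\<Sum>\<sigma>\<in>Pm. signof \<sigma> * (\<Prod>i<n. \<phi> i (f (\<sigma> i)))))"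
    by (subst sum.swap) (simp add: sum_distrib_left mult_ac)
  also have "\<dots> = (\<Sum>f\<in>F. (\<Prod>i<n. h (f i)) * (D f)\<^sup>2)"
    by (simp flip: D2 add: power2_eq_square mult.assoc)
  finally show ?thesis unfolding F_def D_def G_def .
qed

lemma sum_injective_functions_by_image:
  fixes G :: "'b set \<Rightarrow> real"
  assumes S: "finite S"
  shows "(\<Sum>f\<in>{f \<in> PiE {..<n} (\<lambda>_. S). inj_on f {..<n}}. G (f ` {..<n}))
       = fact n * (\<Sum>Y\<in>{Y. Y \<subseteq> S \<and> card Y = n}. G Y)"
proof -
  define F where "F = {f \<in> PiE {..<n} (\<lambda>_. S). inj_on f {..<n}}"
  define Ys where "Ys = {Y. Y \<subseteq> S \<and> card Y = n}"
  have finF: "finite F" unfolding F_def using S by (auto intro!: finite_PiE)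
  have finY: "finite Ys" unfolding Ys_def using S by auto
  have img: "(\<lambda>f. f ` {..<n}) ` F \<subseteq> Ys"
    by (auto simp: F_def Ys_def card_image PiE_iff)
  have cardF: "card {f \<in> F. f ` {..<n} = Y} = fact n" if Y: "Y \<in> Ys" for Y
  proof -
    have finY: "finite Y" and cardY: "card Y = n"
      using Y S by (auto simp: Ys_def intro: finite_subset)
    have "{f \<in> F. f ` {..<n} = Y} = {f \<in> {..<n} \<rightarrow>\<^sub>E Y. inj_on f {..<n}}"
    proof (intro Set.set_eqI iffI)
      fix f assume "f \<in> {f \<in> {..<n} \<rightarrow>\<^sub>E Y. inj_on f {..<n}}"
      then have f: "f \<in> {..<n} \<rightarrow>\<^sub>E Y" "inj_on f {..<n}" by auto
      have "f ` {..<n} = Y"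
        by (rule card_subset_eq) (use f finY cardY in \<open>auto simp: card_image\<close>)
      with f Y show "f \<in> {f \<in> F. f ` {..<n} = Y}"
        by (auto simp: F_def Ys_def PiE_iff)
    qed (use Y in \<open>auto simp: F_def PiE_iff\<close>)
    moreover have "card {f \<in> {..<n} \<rightarrow>\<^sub>E Y. inj_on f {..<n}} = fact n"
      using card_inj_on_subset_funcset[of "{..<n}" Y "{..<n}"] finY cardY
      by (simp add: fact_prod_rev)
    ultimately show ?thesis by simp
  qed
  have "(\<Sum>f\<in>F. G (f ` {..<n})) = (\<Sum>Y\<in>Ys. \<Sum>f\<in>{f \<in> F. f ` {..<n} = Y}. G (f ` {..<n}))"
    by (rule sum.group[OF finF finY img, symmetric])
  also have "\<dots> = (\<Sum>Y\<in>Ys. fact n * G Y)"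
    by (intro sum.cong refl) (simp add: cardF)
  finally show ?thesis by (simp add: F_def Ys_def sum_distrib_left)
qed

text \<open>The square of the Vandermonde product, written over ordered pairs so that no enumeration
  of \<open>Y\<close> has to be chosen.\<close>

definition discriminant :: "nat set \<Rightarrow> real" where
  "discriminant Y = (\<Prod>p\<in>Y. \<Prod>q\<in>Y - {p}. \<bar>real p - real q\<bar>)"

lemma prod_off_diagonal_symmetric:
  fixes g :: "nat \<Rightarrow> nat \<Rightarrow> 'a :: comm_monoid_mult"
  assumes "\<And>i j. g i j = g j i"
  shows "(\<Prod>j<n. \<Prod>l\<in>{..<n} - {j}. g j l) = (\<Prod>j<n. \<Prod>l<j. g j l) * (\<Prod>j<n. \<Prod>l<j. g j l)"
proof (induction n)
  case (Suc n)
  have 1: "(\<Prod>l\<in>{..<Suc n} - {j}. g j l) = (\<Prod>l\<in>{..<n} - {j}. g j l) * g n j" if "j < n" for j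
  proof -
    have "{..<Suc n} - {j} = insert n ({..<n} - {j})" using that by auto
    then show ?thesis using that assms[of n j] by (simp add: mult.commute)
  qed
  have 2: "{..<Suc n} - {n} = {..<n}" by auto
  have "(\<Prod>j<Suc n. \<Prod>l\<in>{..<Suc n} - {j}. g j l)
      = (\<Prod>j<n. (\<Prod>l\<in>{..<n} - {j}. g j l) * g n j) * (\<Prod>l<n. g n l)"
    by (simp add: 1 2)
  also have "\<dots> = (\<Prod>j<n. \<Prod>l\<in>{..<n} - {j}. g j l) * (\<Prod>l<n. g n l) * (\<Prod>l<n. g n l)"
    by (simp add: prod.distrib)
  finally show ?case by (simp add: Suc mult_ac)
qed simp

lemma discriminant_image:
  fixes f :: "nat \<Rightarrow> nat"
  assumes "inj_on f {..<n}"
  shows "discriminant (f ` {..<n}) = (\<Prod>j<n. \<Prod>l<j. real (f j) - real (f l))\<^sup>2"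
proof -
  have "discriminant (f ` {..<n}) = (\<Prod>j<n. \<Prod>l\<in>{..<n} - {j}. \<bar>real (f j) - real (f l)\<bar>)"
  proof -
    have "f ` {..<n} - {f j} = f ` ({..<n} - {j})" if "j < n" for j
      using assms that by (auto simp: inj_on_def)
    then show ?thesis unfolding discriminant_def
      using assms
      by (simp add: prod.reindex inj_on_diff)
  qed
  also have "\<dots> = (\<Prod>j<n. \<Prod>l<j. \<bar>real (f j) - real (f l)\<bar>)\<^sup>2"
    unfolding power2_eq_square by (rule prod_off_diagonal_symmetric[where g = "\<lambda>j l. \<bar>real (f j) - real (f l)\<bar>"]) (rule abs_minus_commute)
  also have "\<dots> = (\<Prod>j<n. \<Prod>l<j. real (f j) - real (f l))\<^sup>2"
    by (simp flip: abs_prod)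
  finally show ?thesis .
qed

lemma vandermonde_eq_0:
  fixes f :: "nat \<Rightarrow> nat"
  assumes "\<not> inj_on f {..<n}"
  shows "(\<Prod>j<n. \<Prod>l<j. real (f j) - real (f l)) = 0"
proof -
  obtain a b where ab: "a < n" "b < n" "a \<noteq> b" "f a = f b" using assms by (auto simp: inj_on_def)
  have "\<exists>j<n. \<exists>l<j. f j = f l"
  proof (cases "a < b")
    case True then show ?thesis using ab by (intro exI[of _ b]) auto
  next
    case False
    then have "b < a" using ab by auto
    then show ?thesis using ab by (intro exI[of _ a]) (auto intro!: exI[of _ b])
  qed
  then obtain j l where "j < n" "l < j" "f j = f l" by auto
  then have "(\<Prod>l<j. real (f j) - real (f l)) = 0" by (auto intro!: prod_zero bexI[of _ l])
  then show ?thesis using \<open>j < n\<close> by (intro prod_zero) auto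
qed

text \<open>The factor \<open>g\<close> is a free test function multiplying the weight. Monic
  polynomials may replace the powers in the Vandermonde determinant, the normalization by
  \<open>sqrt (h i)\<close> is compensated by the product of the \<open>h i\<close>, and functions
  that are not injective contribute 0.\<close>

lemma orthogonal_ensemble_sum:
  fixes w g h :: "nat \<Rightarrow> real" and Q :: "nat \<Rightarrow> real poly"
  assumes deg: "\<And>i. i < n \<Longrightarrow> degree (Q i) \<le> i" and monic: "\<And>i. i < n \<Longrightarrow> coeff (Q i) i = 1"
    and h: "\<And>i. i < n \<Longrightarrow> 0 < h i"
  shows "(\<Sum>Y\<in>{Y. Y \<subseteq> {..<N} \<and> card Y = n}. discriminant Y * (\<Prod>s\<in>Y. w s * g s))
    = (\<Prod>i<n. h i) * mdet (Matrix.mat n n (\<lambda>(i,j).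
        \<Sum>s<N. w s * g s * (poly (Q i) (real s) / sqrt (h i)) * (poly (Q j) (real s) / sqrt (h j))))"
proof -
  define P where "P i = smult (1 / sqrt (h i)) (Q i)" for i
  define W where "W Y = (\<Prod>s\<in>Y. w s * g s)" for Y
  define F where "F = PiE {..<n} (\<lambda>_. {..<N})"
  have finF: "finite F" by (auto simp: F_def intro!: finite_PiE)
  have PQ: "poly (P i) x = poly (Q i) x / sqrt (h i)" for i x by (simp add: P_def)
  define V where "V f = (\<Prod>j<n. \<Prod>l<j. real (f j) - real (f l))" for f :: "nat \<Rightarrow> nat"
  define D where "D f = mdet (Matrix.mat n n (\<lambda>(i,j). poly (P j) (real (f i))))" for f
  have hp: "(\<Prod>j<n. h j) > 0" using h by (intro prod_pos) auto
  then have hp0: "(\<Prod>j<n. h j) \<noteq> 0" by linarith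
  have D: "(D f)\<^sup>2 = (V f)\<^sup>2 / (\<Prod>j<n. h j)" for f
  proof -
    have "D f = (\<Prod>j<n. 1 / sqrt (h j)) * V f"
      unfolding D_def V_def using deg monic
      by (subst det_poly_eval) (auto simp: P_def det_vandermonde)
    moreover have "(\<Prod>j<n. 1 / sqrt (h j))\<^sup>2 = 1 / (\<Prod>j<n. h j)"
      unfolding prod_power_distrib using h by (simp add: prod_dividef power_divide less_imp_le)
    ultimately show ?thesis by (simp add: power_mult_distrib)
  qed
  have gen: "X * H = S" if "f \<noteq> 0" "H \<noteq> 0" "f * X = f * S / H" for X S H f :: real
    using that by (simp add: field_simps)
  have "fact n * mdet (Matrix.mat n n (\<lambda>(i,j). \<Sum>s<N. w s * g s * poly (P i) (real s) * poly (P j) (real s)))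
      = (\<Sum>f\<in>F. (\<Prod>i<n. w (f i) * g (f i)) * (D f)\<^sup>2)"
    unfolding F_def D_def
    using andreief_functions[of "{..<N}" n "\<lambda>s. w s * g s" "\<lambda>i s. poly (P i) (real s)"] by simp
  also have "\<dots> = (\<Sum>f\<in>F. (\<Prod>i<n. w (f i) * g (f i)) * (V f)\<^sup>2) / (\<Prod>j<n. h j)"
    by (simp add: D sum_divide_distrib)
  also have "(\<Sum>f\<in>F. (\<Prod>i<n. w (f i) * g (f i)) * (V f)\<^sup>2)
      = (\<Sum>f\<in>{f\<in>F. inj_on f {..<n}}. (\<Prod>i<n. w (f i) * g (f i)) * (V f)\<^sup>2)"
    by (rule sum.mono_neutral_right) (use finF in \<open>auto simp: V_def vandermonde_eq_0\<close>)
  also have "\<dots> = (\<Sum>f\<in>{f\<in>F. inj_on f {..<n}}. W (f ` {..<n}) * discriminant (f ` {..<n}))"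
    by (intro sum.cong refl) (auto simp: W_def V_def discriminant_image prod.reindex)
  also have "\<dots> = fact n * (\<Sum>Y\<in>{Y. Y \<subseteq> {..<N} \<and> card Y = n}. W Y * discriminant Y)"
    unfolding F_def by (rule sum_injective_functions_by_image) auto
  finally have "fact n * mdet (Matrix.mat n n (\<lambda>(i,j). \<Sum>s<N. w s * g s * poly (P i) (real s) * poly (P j) (real s)))
     = fact n * (\<Sum>Y\<in>{Y. Y \<subseteq> {..<N} \<and> card Y = n}. W Y * discriminant Y) / (\<Prod>j<n. h j)" .
  then have "mdet (Matrix.mat n n (\<lambda>(i,j). \<Sum>s<N. w s * g s * poly (P i) (real s) * poly (P j) (real s)))
     * (\<Prod>j<n. h j) = (\<Sum>Y\<in>{Y. Y \<subseteq> {..<N} \<and> card Y = n}. W Y * discriminant Y)"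
    by (rule gen[OF fact_nonzero hp0])
  then show ?thesis by (simp add: W_def PQ mult.commute)
qed

text \<open>
  Summation over the particle configurations of the ensemble turns into a determinant of size \<open>n\<close>;
  the commutation rule for determinants brings it down to the size \<open>r\<close> of the observed window.
\<close>

lemma orthogonal_ensemble_window:
  fixes w h :: "nat \<Rightarrow> real" and Q :: "nat \<Rightarrow> real poly" and b :: "nat \<Rightarrow> nat"
  assumes deg: "\<And>i. i < n \<Longrightarrow> degree (Q i) \<le> i" and monic: "\<And>i. i < n \<Longrightarrow> coeff (Q i) i = 1"
    and h: "\<And>i. i < n \<Longrightarrow> 0 < h i" and w: "\<And>s. s < N \<Longrightarrow> 0 < w s"
    and orth: "\<And>i j. i < n \<Longrightarrow> j < n \<Longrightarrow>
      (\<Sum>s<N. w s * poly (Q i) (real s) * poly (Q j) (real s)) = (if i = j then h i else 0)"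
    and b: "inj_on b {..<r}" "b ` {..<r} \<subseteq> {..<N}"
    and \<psi>: "\<And>i s. \<psi> i s = sqrt (w s) * poly (Q i) (real s) / sqrt (h i)"
  shows "(\<Sum>Y\<in>{Y. Y \<subseteq> {..<N} \<and> card Y = n}. discriminant Y * (\<Prod>s\<in>Y. w s) *
            (\<Prod>u<r. if b u \<in> Y then 1 + \<tau> else 1))
    = (\<Prod>i<n. h i) * mdet (1\<^sub>m r + \<tau> \<cdot>\<^sub>m Matrix.mat r r (\<lambda>(u,v). \<Sum>i<n. \<psi> i (b u) * \<psi> i (b v)))"
proof -
  \<comment> \<open>With this \<open>g\<close> the Gram matrix is the identity, by orthonormality,
    plus a perturbation supported on the window, which factors through dimension \<open>r\<close> as
    \<open>A * C\<close>.\<close>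
  define g where "g s = (if s \<in> b ` {..<r} then 1 + \<tau> else 1)" for s
  define A where "A = Matrix.mat n r (\<lambda>(i,u). \<tau> * \<psi> i (b u))"
  define C where "C = Matrix.mat r n (\<lambda>(u,i). \<psi> i (b u))"
  have A: "A \<in> carrier_mat n r" and C: "C \<in> carrier_mat r n" by (auto simp: A_def C_def)
  have prodg: "(\<Prod>u<r. if b u \<in> Y then 1 + \<tau> else 1) = (\<Prod>s\<in>Y. g s)" if "Y \<subseteq> {..<N}" for Y
  proof -
    have fin: "finite Y" using that by (rule finite_subset) auto
    have "(\<Prod>u<r. if b u \<in> Y then 1 + \<tau> else 1) = (\<Prod>s\<in>b ` {..<r}. if s \<in> Y then 1 + \<tau> else 1)"
      using b by (simp add: prod.reindex)
    also have "\<dots> = (\<Prod>s\<in>b ` {..<r} \<inter> Y. 1 + \<tau>)" by (subst prod.inter_restrict) auto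
    also have "\<dots> = (\<Prod>s\<in>Y. g s)"
      unfolding g_def using fin prod.inter_restrict[of Y "\<lambda>_. 1 + \<tau>" "b ` {..<r}"]
      by (simp add: Int_commute)
    finally show ?thesis .
  qed
  have entry: "(\<Sum>s<N. w s * g s * (poly (Q i) (real s) / sqrt (h i)) * (poly (Q j) (real s) / sqrt (h j)))
      = (if i = j then 1 else 0) + (\<Sum>u<r. \<tau> * \<psi> i (b u) * \<psi> j (b u))" if ij: "i < n" "j < n" for i j
  proof -
    have psi: "w s * (poly (Q i) (real s) / sqrt (h i)) * (poly (Q j) (real s) / sqrt (h j)) = \<psi> i s * \<psi> j s"
      if "s < N" for s
      using w[OF that] by (simp add: \<psi> field_simps)
    have "(\<Sum>s<N. w s * g s * (poly (Q i) (real s) / sqrt (h i)) * (poly (Q j) (real s) / sqrt (h j)))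
       = (\<Sum>s<N. \<psi> i s * \<psi> j s + (if s \<in> b ` {..<r} then \<tau> * (\<psi> i s * \<psi> j s) else 0))"
      by (intro sum.cong refl) (simp add: psi[symmetric] g_def algebra_simps add_divide_distrib)
    also have "\<dots> = (\<Sum>s<N. \<psi> i s * \<psi> j s) + (\<Sum>s\<in>b ` {..<r}. \<tau> * (\<psi> i s * \<psi> j s))"
      using b(2) by (simp add: sum.distrib sum.inter_restrict[symmetric] Int_absorb1)
    also have "(\<Sum>s\<in>b ` {..<r}. \<tau> * (\<psi> i s * \<psi> j s)) = (\<Sum>u<r. \<tau> * \<psi> i (b u) * \<psi> j (b u))"
      using b(1) by (simp add: sum.reindex mult.assoc)
    also have "(\<Sum>s<N. \<psi> i s * \<psi> j s) = (\<Sum>s<N. w s * poly (Q i) (real s) * poly (Q j) (real s)) / (sqrt (h i) * sqrt (h j))"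
      unfolding sum_divide_distrib by (intro sum.cong refl) (simp add: psi[symmetric])
    also have "\<dots> = (if i = j then 1 else 0)"
      using orth[OF ij] h[of i] ij by auto
    finally show ?thesis .
  qed
  have mats: "Matrix.mat n n (\<lambda>(i,j). \<Sum>s<N. w s * g s * (poly (Q i) (real s) / sqrt (h i)) *
      (poly (Q j) (real s) / sqrt (h j))) = 1\<^sub>m n + A * C" (is "?G = _")
  proof (rule eq_matI)
    fix i j assume "i < dim_row (1\<^sub>m n + A * C)" "j < dim_col (1\<^sub>m n + A * C)"
    then have ij: "i < n" "j < n" using A C by auto
    have "?G $$ (i,j) = (if i = j then 1 else 0) + (\<Sum>u<r. \<tau> * \<psi> i (b u) * \<psi> j (b u))"
      using ij by (simp only: index_mat(1) prod.case entry)
    also have "\<dots> = (1\<^sub>m n + A * C) $$ (i,j)"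
      using ij by (simp add: A_def C_def scalar_prod_def atLeast0LessThan)
    finally show "?G $$ (i,j) = (1\<^sub>m n + A * C) $$ (i,j)" .
  qed (use A C in auto)
  have "(\<Sum>Y\<in>{Y. Y \<subseteq> {..<N} \<and> card Y = n}. discriminant Y * (\<Prod>s\<in>Y. w s) *
            (\<Prod>u<r. if b u \<in> Y then 1 + \<tau> else 1))
     = (\<Sum>Y\<in>{Y. Y \<subseteq> {..<N} \<and> card Y = n}. discriminant Y * (\<Prod>s\<in>Y. w s * g s))"
    by (intro sum.cong refl) (simp add: prodg prod.distrib)
  also have "\<dots> = (\<Prod>i<n. h i) * mdet (1\<^sub>m n + A * C)"
    by (simp only: orthogonal_ensemble_sum[where Q = Q and h = h and n = n, OF deg monic h] mats)
  also have "mdet (1\<^sub>m n + A * C) = mdet (1\<^sub>m r + C * A)"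
    by (rule det_one_plus_mult_commute[OF A C])
  also have "1\<^sub>m r + C * A = 1\<^sub>m r + \<tau> \<cdot>\<^sub>m Matrix.mat r r (\<lambda>(u,v). \<Sum>i<n. \<psi> i (b u) * \<psi> i (b v))"
    by (intro eq_matI)
       (auto simp: A_def C_def scalar_prod_def atLeast0LessThan sum_distrib_left mult_ac)
  finally show ?thesis .
qed

section \<open>Determinants as generating functions of hole counts\<close>

lemma tendsto_det:
  fixes A :: "'k \<Rightarrow> nat \<Rightarrow> nat \<Rightarrow> real"
  assumes "\<And>i j. i < n \<Longrightarrow> j < n \<Longrightarrow> ((\<lambda>k. A k i j) \<longlongrightarrow> L i j) F"
  shows "((\<lambda>k. mdet (Matrix.mat n n (\<lambda>(i,j). A k i j)))
           \<longlongrightarrow> mdet (Matrix.mat n n (\<lambda>(i,j). L i j))) F"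
proof -
  have "mdet (Matrix.mat n n (\<lambda>(i,j). M i j))
      = (\<Sum>\<pi> | \<pi> permutes {0..<n}. signof \<pi> * (\<Prod>i = 0..<n. M i (\<pi> i)))" for M :: "nat \<Rightarrow> nat \<Rightarrow> real"
    by (subst det_def'[of _ n]) (auto intro!: sum.cong prod.cong simp: permutes_nat_less)
  then show ?thesis
    by (auto intro!: tendsto_sum tendsto_mult tendsto_prod assms simp: permutes_nat_less)
qed

text \<open>Conjugation by a diagonal matrix of signs: in each Leibniz term every sign occurs twice,
  once for its row and once for its column.\<close>

lemma det_sign_conjugate:
  fixes A :: "nat \<Rightarrow> nat \<Rightarrow> real"
  assumes \<epsilon>: "\<And>i. i < n \<Longrightarrow> \<epsilon> i * \<epsilon> i = 1"
  shows "mdet (Matrix.mat n n (\<lambda>(i,j). \<epsilon> i * \<epsilon> j * A i j)) = mdet (Matrix.mat n n (\<lambda>(i,j). A i j))"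
proof -
  have L: "mdet (Matrix.mat n n (\<lambda>(i,j). M i j))
      = (\<Sum>\<pi> | \<pi> permutes {0..<n}. signof \<pi> * (\<Prod>i = 0..<n. M i (\<pi> i)))" for M :: "nat \<Rightarrow> nat \<Rightarrow> real"
    by (subst det_def'[of _ n]) (auto intro!: sum.cong prod.cong simp: permutes_nat_less)
  have "(\<Prod>i = 0..<n. \<epsilon> i * \<epsilon> (\<pi> i) * A i (\<pi> i)) = (\<Prod>i = 0..<n. A i (\<pi> i))"
    if "\<pi> permutes {0..<n}" for \<pi>
  proof -
    have "(\<Prod>i = 0..<n. \<epsilon> (\<pi> i)) = (\<Prod>i = 0..<n. \<epsilon> i)"
      using that by (intro prod.reindex_bij_betw permutes_imp_bij)
    then have "(\<Prod>i = 0..<n. \<epsilon> i * \<epsilon> (\<pi> i)) = (\<Prod>i = 0..<n. \<epsilon> i * \<epsilon> i)"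
      by (simp add: prod.distrib)
    also have "\<dots> = 1" using \<epsilon> by simp
    finally show ?thesis by (simp add: prod.distrib)
  qed
  then show ?thesis unfolding L by (auto intro!: sum.cong)
qed

text \<open>The window formula marks particles by 1 + \<tau>, whereas holes are to be marked by 1 -
  t. The choice \<tau> = t / (1 - t) gives (1 - t) (1 + \<tau>) = 1, so a factor 1 - t for each of
  the \<open>r\<close> sites exchanges the roles; this is where t = 1 is excluded.\<close>

lemma orthogonal_ensemble_gaps:
  fixes w h :: "nat \<Rightarrow> real" and Q :: "nat \<Rightarrow> real poly" and b :: "nat \<Rightarrow> nat" and N n :: nat
  assumes deg: "\<And>i. i < n \<Longrightarrow> degree (Q i) \<le> i" and monic: "\<And>i. i < n \<Longrightarrow> coeff (Q i) i = 1"
    and h: "\<And>i. i < n \<Longrightarrow> 0 < h i" and w: "\<And>s. s < N \<Longrightarrow> 0 < w s"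
    and orth: "\<And>i j. i < n \<Longrightarrow> j < n \<Longrightarrow>
      (\<Sum>s<N. w s * poly (Q i) (real s) * poly (Q j) (real s)) = (if i = j then h i else 0)"
    and b: "inj_on b {..<r}" "b ` {..<r} \<subseteq> {..<N}"
    and \<psi>: "\<And>i s. \<psi> i s = sqrt (w s) * poly (Q i) (real s) / sqrt (h i)"
    and t: "t \<noteq> 1"
  defines "W \<equiv> \<lambda>Y. discriminant Y * (\<Prod>s\<in>Y. w s)" and "Ys \<equiv> {Y. Y \<subseteq> {..<N} \<and> card Y = n}"
  shows "(\<Sum>p\<le>r. (\<Sum>Y\<in>{Y\<in>Ys. card {u. u < r \<and> b u \<notin> Y} = p}. W Y) / (\<Sum>Y\<in>Ys. W Y) * (1 - t) ^ p)
    = mdet (Matrix.mat r r (\<lambda>(u,v). (if u = v then 1 else 0)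
         - t * ((if u = v then 1 else 0) - (\<Sum>i<n. \<psi> i (b u) * \<psi> i (b v)))))"
proof -
  define K where "K = Matrix.mat r r (\<lambda>(u,v). \<Sum>i<n. \<psi> i (b u) * \<psi> i (b v))"
  define \<tau> where "\<tau> = t / (1 - t)"
  note window = orthogonal_ensemble_window[where w = w and Q = Q and b = b and r = r and \<psi> = \<psi> and h = h
      and n = n and N = N, OF deg monic h w orth b \<psi>]
  \<comment> \<open>At \<tau> = 0 the window formula yields the partition function.\<close>
  have Z: "(\<Sum>Y\<in>Ys. W Y) = (\<Prod>i<n. h i)"
  proof -
    have "1\<^sub>m r + 0 \<cdot>\<^sub>m K = 1\<^sub>m r" by (intro eq_matI) (auto simp: K_def)
    then show ?thesis using window[of 0] by (simp add: W_def Ys_def K_def cong: if_cong)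
  qed
  have Zpos: "(\<Prod>i<n. h i) > 0" using h by (intro prod_pos) auto
  have finYs: "finite Ys" by (auto simp: Ys_def)
  have fac: "(1 - t) ^ card {u. u < r \<and> b u \<notin> Y} = (1 - t) ^ r * (\<Prod>u<r. if b u \<in> Y then 1 + \<tau> else 1)" for Y
  proof -
    have "(1 - t) ^ r * (\<Prod>u<r. if b u \<in> Y then 1 + \<tau> else 1) = (\<Prod>u<r. (1 - t) * (if b u \<in> Y then 1 + \<tau> else 1))"
      by (simp add: prod.distrib)
    also have "\<dots> = (\<Prod>u<r. if u \<in> {u. u < r \<and> b u \<notin> Y} then 1 - t else 1)"
      using t by (intro prod.cong) (auto simp: \<tau>_def field_simps)
    also have "\<dots> = (\<Prod>u\<in>{..<r} \<inter> {u. u < r \<and> b u \<notin> Y}. 1 - t)" by (subst prod.inter_restrict) auto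
    also have "{..<r} \<inter> {u. u < r \<and> b u \<notin> Y} = {u. u < r \<and> b u \<notin> Y}" by auto
    finally show ?thesis by simp
  qed
  have "(\<Sum>p\<le>r. (\<Sum>Y\<in>{Y\<in>Ys. card {u. u < r \<and> b u \<notin> Y} = p}. W Y) * (1 - t) ^ p)
      = (\<Sum>p\<le>r. \<Sum>Y\<in>{Y\<in>Ys. card {u. u < r \<and> b u \<notin> Y} = p}. W Y * (1 - t) ^ card {u. u < r \<and> b u \<notin> Y})"
    by (simp add: sum_distrib_right)
  also have "\<dots> = (\<Sum>Y\<in>Ys. W Y * (1 - t) ^ card {u. u < r \<and> b u \<notin> Y})"
  proof (rule sum.group[OF finYs])
    have "card {u. u < r \<and> b u \<notin> Y} \<le> r" for Y
      using card_mono[of "{..<r}" "{u. u < r \<and> b u \<notin> Y}"] by auto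
    then show "(\<lambda>Y. card {u. u < r \<and> b u \<notin> Y}) ` Ys \<subseteq> {..r}" by auto
  qed auto
  also have "\<dots> = (1 - t) ^ r * (\<Sum>Y\<in>Ys. W Y * (\<Prod>u<r. if b u \<in> Y then 1 + \<tau> else 1))"
    by (simp add: fac sum_distrib_left mult_ac)
  also have "\<dots> = (\<Prod>i<n. h i) * ((1 - t) ^ r * mdet (1\<^sub>m r + \<tau> \<cdot>\<^sub>m K))"
    using window[of \<tau>] by (simp add: W_def Ys_def K_def)
  also have "(1 - t) ^ r * mdet (1\<^sub>m r + \<tau> \<cdot>\<^sub>m K) = mdet ((1 - t) \<cdot>\<^sub>m (1\<^sub>m r + \<tau> \<cdot>\<^sub>m K))"
    by (simp add: K_def)
  also have "(1 - t) \<cdot>\<^sub>m (1\<^sub>m r + \<tau> \<cdot>\<^sub>m K) = Matrix.mat r r (\<lambda>(u,v). (if u = v then 1 else 0)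
         - t * ((if u = v then 1 else 0) - (\<Sum>i<n. \<psi> i (b u) * \<psi> i (b v))))"
    using t by (intro eq_matI) (auto simp: K_def \<tau>_def field_simps)
  finally have E: "(\<Sum>p\<le>r. (\<Sum>Y\<in>{Y\<in>Ys. card {u. u < r \<and> b u \<notin> Y} = p}. W Y) * (1 - t) ^ p)
    = (\<Prod>i<n. h i) * mdet (Matrix.mat r r (\<lambda>(u,v). (if u = v then 1 else 0)
         - t * ((if u = v then 1 else 0) - (\<Sum>i<n. \<psi> i (b u) * \<psi> i (b v)))))" .
  have "(\<Sum>p\<le>r. (\<Sum>Y\<in>{Y\<in>Ys. card {u. u < r \<and> b u \<notin> Y} = p}. W Y) / (\<Prod>i<n. h i) * (1 - t) ^ p)
     = (\<Sum>p\<le>r. (\<Sum>Y\<in>{Y\<in>Ys. card {u. u < r \<and> b u \<notin> Y} = p}. W Y) * (1 - t) ^ p) / (\<Prod>i<n. h i)"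
    by (simp only: sum_divide_distrib[of _ "{..r}"] times_divide_eq_left)
  then show ?thesis unfolding Z E
    using nonzero_mult_div_cancel_left[OF less_imp_neq[OF Zpos, symmetric]] by simp
qed

lemma higher_deriv_poly_reflected:
  fixes q :: "real poly"
  shows "(deriv ^^ p) (\<lambda>t. poly q (1 - t)) = (\<lambda>t. (-1) ^ p * poly ((pderiv ^^ p) q) (1 - t))"
proof (induction p)
  case (Suc p)
  have "deriv (\<lambda>t. (-1) ^ p * poly r (1 - t)) t = (-1) ^ Suc p * poly (pderiv r) (1 - t)" for r :: "real poly" and t
    by (rule DERIV_imp_deriv) (auto intro!: derivative_eq_intros)
  then show ?case by (simp add: Suc)
qed simp

lemma poly_higher_pderiv_0:
  fixes q :: "real poly"
  shows "poly ((pderiv ^^ p) q) 0 = fact p * coeff q p"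
proof -
  have "coeff ((pderiv ^^ p) q) i = pochhammer (of_nat (Suc i)) p * coeff q (i + p)" for i
  proof (induction p arbitrary: i)
    case (Suc p)
    show ?case by (simp add: coeff_pderiv Suc pochhammer_rec algebra_simps)
  qed simp
  from this[of 0] show ?thesis by (simp add: poly_0_coeff_0 pochhammer_fact)
qed

text \<open>The sums are polynomials of degree at most \<open>r\<close> in 1 - t, so their
  coefficients are fixed linear combinations of \<open>r + 1\<close> values and converge with them.
  The limit agrees with a polynomial off t = 1, and continuity closes the gap at the very point
  where the derivatives are taken.\<close>

lemma coefficients_converge:
  fixes P :: "nat \<Rightarrow> nat \<Rightarrow> real" and f :: "real \<Rightarrow> real"
  assumes lim: "\<And>t. t \<noteq> 1 \<Longrightarrow> (\<lambda>k. \<Sum>p\<le>r. P k p * (1 - t) ^ p) \<longlonglongrightarrow> f t"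
    and cont: "isCont f 1" and zero: "\<And>k p. p > r \<Longrightarrow> P k p = 0"
  shows "(\<lambda>k. P k p) \<longlonglongrightarrow> 1 / fact p * ((-1) ^ p * (deriv ^^ p) f 1)"
proof -
  \<comment> \<open>The nodes 1, ..., r + 1 for 1 - t keep away from 0, the value that belongs to
    the excluded t = 1.\<close>
  define x where "x l = real (Suc l)" for l :: nat
  define Lag where "Lag l = (\<Prod>m\<in>{..r} - {l}. smult (1 / (x l - x m)) [:- x m, 1:])" for l
  define q where "q k = (\<Sum>p\<le>r. monom (P k p) p)" for k
  have xinj: "x l = x m \<longleftrightarrow> l = m" for l m by (simp add: x_def)
  have degq: "degree (q k) \<le> r" for k
    unfolding q_def by (intro degree_sum_le) (auto intro: order.trans[OF degree_monom_le])
  have coeffq: "coeff (q k) p = P k p" for k p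
    using zero[of p k] by (cases "p \<le> r") (simp_all add: q_def coeff_sum)
  have polyq: "poly (q k) z = (\<Sum>p\<le>r. P k p * z ^ p)" for k z
    by (simp add: q_def poly_sum poly_monom)
  have lagdeg: "degree (Lag l) \<le> r" if "l \<le> r" for l
  proof -
    have "degree (Lag l) \<le> sum (degree \<circ> (\<lambda>m. smult (1 / (x l - x m)) [:- x m, 1:])) ({..r} - {l})"
      unfolding Lag_def by (rule degree_prod_sum_le) auto
    also have "\<dots> \<le> sum (\<lambda>_. 1) ({..r} - {l})"
      by (intro sum_mono) (auto simp: degree_smult_eq)
    also have "\<dots> = r" using that by simp
    finally show ?thesis .
  qed
  have lagval: "poly (Lag l) (x m) = (if l = m then 1 else 0)" if "l \<le> r" "m \<le> r" for l m
  proof (cases "l = m")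
    case True
    then show ?thesis by (auto simp: Lag_def poly_prod xinj diff_divide_distrib[symmetric] intro!: prod.neutral)
  next
    case False
    then show ?thesis using that by (auto simp: Lag_def poly_prod intro!: prod_zero bexI[of _ m])
  qed
  have interp: "q k = (\<Sum>l\<le>r. smult (poly (q k) (x l)) (Lag l))" (is "_ = ?R") for k
  proof (rule poly_eqI_degree[where A = "x ` {..r}"])
    have card: "card (x ` {..r}) = Suc r" by (subst card_image) (auto simp: inj_on_def xinj)
    show "poly (q k) y = poly ?R y" if y: "y \<in> x ` {..r}" for y
    proof -
      obtain m where m: "m \<le> r" "y = x m" using y by auto
      have "poly ?R y = (\<Sum>l\<le>r. poly (q k) (x l) * (if l = m then 1 else 0))"
        using m by (simp add: poly_sum lagval)
      also have "\<dots> = poly (q k) y" using m by (simp add: if_distrib sum.delta cong: if_cong)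
      finally show ?thesis by simp
    qed
    show "card (x ` {..r}) > degree (q k)" using degq[of k] card by simp
    have "degree ?R \<le> r"
      by (intro degree_sum_le) (auto intro: order.trans[OF degree_smult_le] lagdeg)
    then show "card (x ` {..r}) > degree ?R" using card by simp
  qed
  define R where "R = (\<Sum>l\<le>r. smult (f (1 - x l)) (Lag l))"
  have valconv: "(\<lambda>k. poly (q k) (x l)) \<longlonglongrightarrow> f (1 - x l)" for l
    using lim[of "1 - x l"] by (simp add: polyq x_def)
  have coeffconv: "(\<lambda>k. P k p) \<longlonglongrightarrow> coeff R p" for p
  proof -
    have "P k p = (\<Sum>l\<le>r. poly (q k) (x l) * coeff (Lag l) p)" for k
      unfolding coeffq[symmetric] by (subst interp) (simp add: coeff_sum)
    then show ?thesis by (auto simp: R_def coeff_sum intro!: tendsto_intros valconv)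
  qed
  have f_off: "f t = poly R (1 - t)" if "t \<noteq> 1" for t
  proof -
    have "degree R \<le> r"
      unfolding R_def by (intro degree_sum_le) (auto intro: order.trans[OF degree_smult_le] lagdeg)
    have "(\<lambda>k. poly (q k) (1 - t)) \<longlonglongrightarrow> poly R (1 - t)"
    proof -
      have "poly (q k) (1 - t) = (\<Sum>l\<le>r. poly (q k) (x l) * poly (Lag l) (1 - t))" for k
        by (subst interp) (simp add: poly_sum)
      then show ?thesis by (auto simp: R_def poly_sum intro!: tendsto_intros valconv)
    qed
    moreover have "(\<lambda>k. poly (q k) (1 - t)) \<longlonglongrightarrow> f t" using lim[OF that] by (simp add: polyq)
    ultimately show ?thesis using LIMSEQ_unique by blast
  qed
  have "f = (\<lambda>t. poly R (1 - t))"
  proof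
    fix t show "f t = poly R (1 - t)"
    proof (cases "t = 1")
      case True
      have "f \<midarrow>1\<rightarrow> f 1" using cont by (simp add: isCont_def)
      moreover have "f \<midarrow>1\<rightarrow> poly R (1 - 1)"
      proof (rule Lim_transform_eventually)
        show "(\<lambda>t. poly R (1 - t)) \<midarrow>1\<rightarrow> poly R (1 - 1)"
          by (intro tendsto_intros)
        show "\<forall>\<^sub>F t in at 1. poly R (1 - t) = f t"
          by (auto simp: eventually_at f_off intro: exI[of _ 1])
      qed
      ultimately have "f 1 = poly R (1 - 1)" by (rule LIM_unique)
      then show ?thesis using True by simp
    qed (simp add: f_off)
  qed
  then have "(deriv ^^ p) f = (deriv ^^ p) (\<lambda>t. poly R (1 - t))" by (rule arg_cong)
  then have d1: "(deriv ^^ p) f 1 = (-1) ^ p * (fact p * coeff R p)"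
    by (simp add: higher_deriv_poly_reflected poly_higher_pderiv_0)
  have cancel: "1 / F * (s * (s * (F * a))) = a" if "F \<noteq> 0" "s * s = 1" for F s a :: real
    using that by (metis mult.assoc mult.left_commute mult_1 nonzero_eq_divide_eq times_divide_eq_left)
  have "((-1) ^ p * (-1) ^ p :: real) = 1" by (metis left_minus_one_mult_self mult.right_neutral)
  from cancel[OF fact_nonzero this] have "1 / fact p * ((-1) ^ p * (deriv ^^ p) f 1) = coeff R p"
    unfolding d1 .
  then show ?thesis using coeffconv[of p] by metis
qed

section \<open>The Hahn ensemble\<close>

context
  fixes N a b :: nat
begin

text \<open>The particle weight is dual to the hole weight: it is the inverse of the hole weight,
  divided by the square of \<open>fact s * fact (N - 1 - s)\<close>, the product of the distances
  from \<open>s\<close> to the other sites.\<close>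

definition hahn_weight :: "nat \<Rightarrow> real" where
  "hahn_weight s = 1 / (fact s * fact (s + b) * fact (N - 1 - s) * fact (N - 1 - s + a))"

text \<open>Birth and death rates of a chain for which \<open>hahn_weight\<close> is reversible;
  \<open>hahn_op\<close> is its generator. The birth rate vanishes at the last site and the death
  rate at 0, so the chain stays on \<open>{..<N}\<close>.\<close>

definition birth :: "real \<Rightarrow> real" where
  "birth x = (real N - 1 - x) * (real N - 1 - x + real a)"

definition death :: "real \<Rightarrow> real" where
  "death x = x * (x + real b)"

definition hahn_op :: "(real \<Rightarrow> real) \<Rightarrow> real \<Rightarrow> real" where
  "hahn_op f x = birth x * (f (x + 1) - f x) + death x * (f (x - 1) - f x)"

text \<open>In the basis of falling factorials the operator is bidiagonal, with diagonal entries
  \<open>- hahn_ev j\<close> and entries \<open>hahn_sub j\<close> linking degree \<open>j\<close>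
  to degree \<open>j - 1\<close>.\<close>

definition hahn_ev :: "nat \<Rightarrow> real" where
  "hahn_ev j = real j * (2 * real N + real a + real b - 1 - real j)"

definition hahn_sub :: "nat \<Rightarrow> real" where
  "hahn_sub j = real j * (real j - real N) * (real j - real N - real a)"

definition falling :: "nat \<Rightarrow> real poly" where
  "falling j = (\<Prod>l<j. [:- real l, 1:])"

text \<open>Solution of the bidiagonal eigenvector equation, computed downwards from the top
  coefficient 1, which is the empty product at i = j. For \<open>j < N\<close> the denominators are
  nonzero by \<open>hahn_ev_less\<close>.\<close>

definition hahn_coeff :: "nat \<Rightarrow> nat \<Rightarrow> real" where
  "hahn_coeff j i = (\<Prod>l\<in>{i..<j}. hahn_sub (Suc l) / (hahn_ev l - hahn_ev j))"

definition hahn_poly :: "nat \<Rightarrow> real poly" where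
  "hahn_poly j = (\<Sum>i\<le>j. smult (hahn_coeff j i) (falling i))"

definition hahn_norm :: "nat \<Rightarrow> real" where
  "hahn_norm j = (\<Sum>s<N. hahn_weight s * poly (hahn_poly j) (real s) * poly (hahn_poly j) (real s))"

definition hahn_fun :: "nat \<Rightarrow> nat \<Rightarrow> real" where
  "hahn_fun j s = sqrt (hahn_weight s) * poly (hahn_poly j) (real s) / sqrt (hahn_norm j)"

lemma hahn_weight_pos: "0 < hahn_weight s"
  by (simp add: hahn_weight_def)

lemma poly_falling: "poly (falling j) x = (\<Prod>l<j. x - real l)"
  by (simp add: falling_def poly_prod)

lemma degree_falling: "degree (falling j) = j"
  unfolding falling_def by (subst degree_prod_sum_eq) auto

lemma coeff_falling_top: "coeff (falling j) j = 1"
proof -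
  have "lead_coeff (falling j) = 1" unfolding falling_def by (simp add: lead_coeff_prod)
  then show ?thesis by (simp add: degree_falling)
qed

lemma falling_shift: "poly (falling (Suc j)) x = x * poly (falling j) (x - 1)"
  unfolding poly_falling prod.lessThan_Suc_shift by (simp add: algebra_simps)

text \<open>The forward shift and, after multiplication by the factor x of \<open>death\<close>, the
  backward shift are controlled by \<open>falling_shift\<close>; all values become multiples of one
  falling factorial \<open>E\<close> of degree j - 1, and polynomials in x are compared.\<close>

lemma hahn_op_falling:
  "hahn_op (poly (falling j)) x = - hahn_ev j * poly (falling j) x + hahn_sub j * poly (falling (j - 1)) x"
proof (cases j)
  case 0
  then show ?thesis by (simp add: hahn_op_def hahn_ev_def hahn_sub_def falling_def)
next
  case (Suc i)
  define E where "E = poly (falling i) x"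
  have 1: "poly (falling (Suc i)) x = E * (x - real i)"
    by (simp add: E_def poly_falling)
  have 2: "poly (falling (Suc i)) (x + 1) = (x + 1) * E"
    using falling_shift[of i "x + 1"] by (simp add: E_def)
  have 3: "x * poly (falling (Suc i)) (x - 1) = E * (x - real i) * (x - real (Suc i))"
    unfolding falling_shift[symmetric] by (simp add: E_def poly_falling)
  have "death x * (poly (falling (Suc i)) (x - 1) - poly (falling (Suc i)) x)
      = (x + real b) * (x * poly (falling (Suc i)) (x - 1) - x * poly (falling (Suc i)) x)"
    by (simp add: death_def algebra_simps)
  then show ?thesis
    unfolding hahn_op_def Suc 1 2 3 diff_Suc_1 E_def[symmetric]
    by (simp add: birth_def hahn_ev_def hahn_sub_def algebra_simps)
qed

text \<open>The quadratic \<open>hahn_ev\<close> peaks beyond the range of degrees, because i + j <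
  2 N - 1 there. Eigenvalues are thus ordered by degree, which makes the span of the first
  eigenfunctions a spectral subspace.\<close>

lemma hahn_ev_less: assumes "i < j" "j < N" shows "hahn_ev i < hahn_ev j"
proof -
  have "hahn_ev j - hahn_ev i = (real j - real i) * (2 * real N + real a + real b - 1 - real i - real j)"
    by (simp add: hahn_ev_def algebra_simps)
  moreover have "(real j - real i) * (2 * real N + real a + real b - 1 - real i - real j) > 0"
    using assms by (intro mult_pos_pos) linarith+
  ultimately show ?thesis by linarith
qed

lemma hahn_ev_mono: assumes "i \<le> j" "j < N" shows "hahn_ev i \<le> hahn_ev j"
  using hahn_ev_less[of i j] assms by (cases "i = j") auto

lemma hahn_ev_eq_iff: assumes "i < N" "j < N" shows "hahn_ev i = hahn_ev j \<longleftrightarrow> i = j"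
  using hahn_ev_less[of i j] hahn_ev_less[of j i] assms by (cases i j rule: linorder_cases) auto

lemma hahn_coeff_step:
  assumes "i < j" "j < N"
  shows "hahn_coeff j i * (hahn_ev i - hahn_ev j) = hahn_sub (Suc i) * hahn_coeff j (Suc i)"
proof -
  have "{i..<j} = insert i {Suc i..<j}" using assms by auto
  then have "hahn_coeff j i = hahn_sub (Suc i) / (hahn_ev i - hahn_ev j) * hahn_coeff j (Suc i)"
    by (simp add: hahn_coeff_def)
  then show ?thesis using hahn_ev_less[OF assms] by simp
qed

lemma degree_hahn_poly: "degree (hahn_poly j) \<le> j"
  unfolding hahn_poly_def
  by (intro degree_sum_le) (auto intro: order.trans[OF degree_smult_le] simp: degree_falling)

lemma coeff_hahn_poly_top: "coeff (hahn_poly j) j = 1"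
proof -
  have "coeff (falling i) j = 0" if "i < j" for i
    using that by (intro coeff_eq_0) (simp add: degree_falling)
  then have "coeff (hahn_poly j) j = (\<Sum>i\<le>j. if i = j then 1 else 0)"
    unfolding hahn_poly_def coeff_sum
    by (intro sum.cong refl) (auto simp: coeff_falling_top hahn_coeff_def)
  then show ?thesis by simp
qed

lemma hahn_op_poly:
  assumes j: "j < N"
  shows "hahn_op (poly (hahn_poly j)) x = - hahn_ev j * poly (hahn_poly j) x"
proof -
  define q where "q = hahn_coeff j"
  define e where "e i = poly (falling i) x" for i
  have "hahn_op (poly (hahn_poly j)) x = (\<Sum>i\<le>j. q i * hahn_op (poly (falling i)) x)"
    unfolding hahn_op_def hahn_poly_def q_def
    by (simp add: poly_sum sum_distrib_left sum_subtractf[symmetric] sum.distrib[symmetric] algebra_simps)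
  also have "\<dots> = (\<Sum>i\<le>j. - hahn_ev i * q i * e i) + (\<Sum>i\<le>j. q i * hahn_sub i * e (i - 1))"
    unfolding hahn_op_falling e_def sum.distrib[symmetric]
    by (intro sum.cong refl) (simp add: algebra_simps)
  also have "(\<Sum>i\<le>j. q i * hahn_sub i * e (i - 1)) = (\<Sum>i<j. q (Suc i) * hahn_sub (Suc i) * e i)"
    unfolding lessThan_Suc_atMost[symmetric] sum.lessThan_Suc_shift by (simp add: hahn_sub_def)
  also have "\<dots> = (\<Sum>i<j. q i * (hahn_ev i - hahn_ev j) * e i)"
    using hahn_coeff_step j by (intro sum.cong refl) (simp add: q_def mult.commute)
  also have "\<dots> = (\<Sum>i\<le>j. q i * (hahn_ev i - hahn_ev j) * e i)"
    unfolding lessThan_Suc_atMost[symmetric] by simp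
  also have "(\<Sum>i\<le>j. - hahn_ev i * q i * e i) + (\<Sum>i\<le>j. q i * (hahn_ev i - hahn_ev j) * e i)
      = - hahn_ev j * (\<Sum>i\<le>j. q i * e i)"
    by (simp add: sum_distrib_left sum.distrib[symmetric] sum_negf[symmetric] algebra_simps)
  also have "(\<Sum>i\<le>j. q i * e i) = poly (hahn_poly j) x"
    by (simp add: hahn_poly_def poly_sum q_def e_def)
  finally show ?thesis .
qed

lemma detailed_balance:
  assumes "Suc s < N"
  shows "hahn_weight s * birth (real s) = hahn_weight (Suc s) * death (real (Suc s))"
proof -
  obtain d where d: "N = Suc (Suc (s + d))"
    using less_imp_Suc_add[OF assms] by auto
  have f: "fact (Suc d + a) = (real d + 1 + real a) * (fact (d + a) :: real)" by (simp add: algebra_simps)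
  have g: "fact (Suc s + b) = (real s + 1 + real b) * (fact (s + b) :: real)" by (simp add: algebra_simps)
  have nz: "real d + 1 + real a \<noteq> 0" "real s + 1 + real b \<noteq> 0" by linarith+
  have e: "real N - 1 - real s = real d + 1" "N - 1 - s = Suc d" "N - 1 - Suc s = d" using d by auto
  have nz2: "real d + 1 \<noteq> 0" "real s + 1 \<noteq> 0" by linarith+
  have "hahn_weight s * birth (real s) = 1 / (fact s * fact (s + b) * fact d * fact (d + a))"
    unfolding hahn_weight_def birth_def e f using nz nz2
    by (simp add: divide_simps)
  moreover have "hahn_weight (Suc s) * death (real (Suc s)) = 1 / (fact s * fact (s + b) * fact d * fact (d + a))"
    unfolding hahn_weight_def death_def e g using nz nz2
    by (simp add: divide_simps)
  ultimately show ?thesis by simp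
qed

text \<open>Summation by parts with detailed balance brings the left side to a symmetric Dirichlet
  form; the boundary terms vanish with the birth rate at the last site and the death rate at
  0.\<close>

lemma hahn_op_symmetric:
  fixes f g :: "real \<Rightarrow> real"
  shows "(\<Sum>s<N. hahn_weight s * hahn_op f (real s) * g (real s))
       = (\<Sum>s<N. hahn_weight s * f (real s) * hahn_op g (real s))"
proof (cases N)
  case (Suc m)
  define c where "c s = hahn_weight s * birth (real s)" for s
  have Nm: "{..<N} = {..<Suc m}" using Suc by simp
  have b0: "birth (real m) = 0" unfolding birth_def using Suc by simp
  have db: "hahn_weight (Suc s) * death (real (Suc s)) = c s" if "s < m" for s
    using detailed_balance[of s] that Suc unfolding c_def by simp
  have D: "(\<Sum>s<N. hahn_weight s * hahn_op f (real s) * g (real s))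
      = - (\<Sum>s<m. c s * (f (real (Suc s)) - f (real s)) * (g (real (Suc s)) - g (real s)))" for f g
  proof -
    have "(\<Sum>s<N. hahn_weight s * hahn_op f (real s) * g (real s))
       = (\<Sum>s<Suc m. c s * (f (real s + 1) - f (real s)) * g (real s))
         + (\<Sum>s<Suc m. hahn_weight s * death (real s) * (f (real s - 1) - f (real s)) * g (real s))"
      unfolding Nm sum.distrib[symmetric]
      by (intro sum.cong refl) (simp add: hahn_op_def c_def algebra_simps)
    also have "(\<Sum>s<Suc m. c s * (f (real s + 1) - f (real s)) * g (real s))
       = (\<Sum>s<m. c s * (f (real (Suc s)) - f (real s)) * g (real s))"
      by (simp add: c_def b0 add.commute)
    also have "(\<Sum>s<Suc m. hahn_weight s * death (real s) * (f (real s - 1) - f (real s)) * g (real s))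
       = (\<Sum>s<m. c s * (f (real s) - f (real (Suc s))) * g (real (Suc s)))"
    proof -
      have "(\<Sum>s<Suc m. hahn_weight s * death (real s) * (f (real s - 1) - f (real s)) * g (real s))
         = (\<Sum>s<m. hahn_weight (Suc s) * death (real (Suc s)) * (f (real (Suc s) - 1) - f (real (Suc s))) * g (real (Suc s)))"
        unfolding sum.lessThan_Suc_shift by (simp add: death_def)
      also have "\<dots> = (\<Sum>s<m. c s * (f (real s) - f (real (Suc s))) * g (real (Suc s)))"
        by (intro sum.cong refl) (simp only: db lessThan_iff, simp)
      finally show ?thesis .
    qed
    finally show ?thesis
      unfolding sum_negf[symmetric] by (simp add: sum.distrib[symmetric] algebra_simps)
  qed
  have "(\<Sum>s<N. hahn_weight s * f (real s) * hahn_op g (real s))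
      = (\<Sum>s<N. hahn_weight s * hahn_op g (real s) * f (real s))"
    by (simp add: mult_ac)
  then show ?thesis unfolding D by (simp add: mult_ac)
qed simp

lemma hahn_poly_orthogonal:
  assumes "i < N" "j < N"
  shows "(\<Sum>s<N. hahn_weight s * poly (hahn_poly i) (real s) * poly (hahn_poly j) (real s))
       = (if i = j then hahn_norm i else 0)"
proof (cases "i = j")
  case False
  define S where "S = (\<Sum>s<N. hahn_weight s * poly (hahn_poly i) (real s) * poly (hahn_poly j) (real s))"
  have "- hahn_ev i * S = - hahn_ev j * S"
    using hahn_op_symmetric[of "poly (hahn_poly i)" "poly (hahn_poly j)"] assms
    by (simp add: hahn_op_poly S_def sum_distrib_left mult_ac sum_negf)
  then show ?thesis using hahn_ev_eq_iff[OF assms] False by (simp add: S_def)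
qed (simp add: hahn_norm_def)

lemma hahn_norm_pos:
  assumes "j < N"
  shows "0 < hahn_norm j"
proof -
  have nz: "hahn_poly j \<noteq> 0" using coeff_hahn_poly_top[of j] by auto
  have "\<exists>s<N. poly (hahn_poly j) (real s) \<noteq> 0"
  proof (rule ccontr)
    assume "\<not> ?thesis"
    then have "real ` {..<N} \<subseteq> {x. poly (hahn_poly j) x = 0}" by auto
    then have "card (real ` {..<N}) \<le> card {x. poly (hahn_poly j) x = 0}"
      by (intro card_mono poly_roots_finite nz)
    also have "\<dots> \<le> degree (hahn_poly j)" by (rule card_poly_roots_bound[OF nz])
    finally show False using degree_hahn_poly[of j] assms by (simp add: card_image)
  qed
  then obtain s where s: "s < N" "poly (hahn_poly j) (real s) \<noteq> 0" by auto
  have "0 < hahn_weight s * poly (hahn_poly j) (real s) * poly (hahn_poly j) (real s)"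
    using s hahn_weight_pos[of s] by (auto simp: mult.assoc zero_less_mult_iff neq_iff)
  moreover have "0 \<le> hahn_weight s * poly (hahn_poly j) (real s) * poly (hahn_poly j) (real s)" for s
    using hahn_weight_pos[of s] by (simp add: mult.assoc less_imp_le)
  ultimately show ?thesis unfolding hahn_norm_def using s(1)
    by (intro sum_pos2[of _ s]) auto
qed

lemma hahn_fun_orthonormal:
  assumes "i < N" "j < N"
  shows "(\<Sum>s<N. hahn_fun i s * hahn_fun j s) = (if i = j then 1 else 0)"
proof -
  have "hahn_fun i s * hahn_fun j s = hahn_weight s * poly (hahn_poly i) (real s) * poly (hahn_poly j) (real s)
     / (sqrt (hahn_norm i) * sqrt (hahn_norm j))" for s
    using hahn_weight_pos[of s] by (simp add: hahn_fun_def field_simps)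
  then have "(\<Sum>s<N. hahn_fun i s * hahn_fun j s) = (\<Sum>s<N. hahn_weight s * poly (hahn_poly i) (real s) * poly (hahn_poly j) (real s))
     / (sqrt (hahn_norm i) * sqrt (hahn_norm j))"
    by (simp add: sum_divide_distrib)
  then show ?thesis using hahn_norm_pos[OF assms(1)]
    unfolding hahn_poly_orthogonal[OF assms] by auto
qed

text \<open>Orthonormal rows of a square matrix have orthonormal columns. This is the zeroth moment
  of the spectral measures attached to the sites.\<close>

lemma hahn_fun_complete:
  assumes "s < N" "t < N"
  shows "(\<Sum>j<N. hahn_fun j s * hahn_fun j t) = (if s = t then 1 else 0)"
proof -
  define A where "A = Matrix.mat N N (\<lambda>(j,s). hahn_fun j s)"
  define C where "C = Matrix.mat N N (\<lambda>(s,j). hahn_fun j s)"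
  have AC: "A \<in> carrier_mat N N" "C \<in> carrier_mat N N" by (auto simp: A_def C_def)
  have "A * C = 1\<^sub>m N"
    by (intro eq_matI) (auto simp: A_def C_def scalar_prod_def atLeast0LessThan hahn_fun_orthonormal)
  then have "C * A = 1\<^sub>m N" by (rule mat_mult_left_right_inverse[OF AC])
  then have "(C * A) $$ (s,t) = 1\<^sub>m N $$ (s,t)" by simp
  then show ?thesis using assms by (simp add: A_def C_def scalar_prod_def atLeast0LessThan)
qed

text \<open>The eigenvalue equation read in the site \<open>s\<close> at fixed degree.
  Multiplication by the square root of the weight makes the operator symmetric: by detailed balance
  the off-diagonal entries become geometric means of opposite rates.\<close>

lemma hahn_fun_recurrence:
  assumes j: "j < N" and s: "0 < s" "Suc s < N"
  shows "hahn_ev j * hahn_fun j s = (birth (real s) + death (real s)) * hahn_fun j s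
    - sqrt (birth (real s) * death (real (Suc s))) * hahn_fun j (Suc s)
    - sqrt (birth (real (s - 1)) * death (real s)) * hahn_fun j (s - 1)"
proof -
  define q where "q = poly (hahn_poly j)"
  define c where "c = 1 / sqrt (hahn_norm j)"
  have sN: "real s + 1 < real N" "0 < real s" using s by linarith+
  have rs: "real (s - 1) = real s - 1" "real (Suc s) = real s + 1" using s by (auto simp: of_nat_diff)
  have pos: "0 \<le> birth (real s)" "0 \<le> death (real s)"
    unfolding birth_def death_def using sN by (auto intro!: mult_nonneg_nonneg)
  have db1: "sqrt (hahn_weight s) * birth (real s) = sqrt (hahn_weight (Suc s)) * sqrt (birth (real s) * death (real (Suc s)))"
  proof -
    have "sqrt (hahn_weight s) * birth (real s) = sqrt (hahn_weight s * birth (real s)) * sqrt (birth (real s))"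
      using pos(1) by (simp add: real_sqrt_mult mult.assoc)
    then show ?thesis unfolding detailed_balance[OF s(2)] by (simp add: real_sqrt_mult mult_ac)
  qed
  have s1: "Suc (s - 1) = s" using s by simp
  have db2: "sqrt (hahn_weight s) * death (real s) = sqrt (hahn_weight (s - 1)) * sqrt (birth (real (s - 1)) * death (real s))"
  proof -
    have "sqrt (hahn_weight s) * death (real s) = sqrt (hahn_weight s * death (real s)) * sqrt (death (real s))"
      using pos(2) by (simp add: real_sqrt_mult mult.assoc)
    also have "hahn_weight s * death (real s) = hahn_weight (s - 1) * birth (real (s - 1))"
      using detailed_balance[of "s - 1"] s s1 by simp
    finally show ?thesis by (simp add: real_sqrt_mult mult_ac)
  qed
  have f: "hahn_fun j t = c * sqrt (hahn_weight t) * q (real t)" for t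
    by (simp add: hahn_fun_def c_def q_def)
  have gen: "e * u = (b + d) * u - b * p - d * r" if "b * (p - u) + d * (r - u) = - e * u"
    for b d e u p r :: real using that by (simp add: algebra_simps)
  have "birth (real s) * (q (real (Suc s)) - q (real s)) + death (real s) * (q (real (s - 1)) - q (real s))
      = - hahn_ev j * q (real s)"
    using hahn_op_poly[OF j, of "real s"] unfolding rs hahn_op_def q_def .
  then have ev: "hahn_ev j * q (real s) = (birth (real s) + death (real s)) * q (real s)
      - birth (real s) * q (real (Suc s)) - death (real s) * q (real (s - 1))"
    by (rule gen)
  have "hahn_ev j * hahn_fun j s = c * sqrt (hahn_weight s) * (hahn_ev j * q (real s))"
    by (simp add: f)
  also have "\<dots> = (birth (real s) + death (real s)) * (c * sqrt (hahn_weight s) * q (real s))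
     - c * q (real (Suc s)) * (sqrt (hahn_weight s) * birth (real s))
     - c * q (real (s - 1)) * (sqrt (hahn_weight s) * death (real s))"
    unfolding ev by (simp only: ring_distribs mult_ac)
  finally show ?thesis unfolding db1 db2 f by (simp only: mult_ac)
qed

end

section \<open>Spectral measures and projections from moments\<close>

lemma weak_convergence_by_moments:
  fixes y c :: "nat \<Rightarrow> nat \<Rightarrow> real" and N :: "nat \<Rightarrow> nat" and U :: "'a measure" and \<phi> \<xi> :: "'a \<Rightarrow> real"
  assumes "finite_measure U" and [measurable]: "\<phi> \<in> borel_measurable U" "\<xi> \<in> borel_measurable U"
    and \<xi>: "\<And>th. \<bar>\<xi> th\<bar> \<le> C" and \<phi>: "\<And>th. 0 \<le> \<phi> th \<and> \<phi> th \<le> R"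
    and y: "\<And>k j. j < N k \<Longrightarrow> 0 \<le> y k j \<and> y k j \<le> R"
    and c: "\<forall>\<^sub>F k in sequentially. (\<Sum>j<N k. \<bar>c k j\<bar>) \<le> 1"
    and moments: "\<And>m. (\<lambda>k. \<Sum>j<N k. y k j ^ m * c k j) \<longlonglongrightarrow> (LINT th|U. \<phi> th ^ m * \<xi> th)"
    and f: "continuous_on UNIV f"
  shows "(\<lambda>k. \<Sum>j<N k. f (y k j) * c k j) \<longlonglongrightarrow> (LINT th|U. f (\<phi> th) * \<xi> th)"
proof -
  interpret finite_measure U by fact
  have [measurable]: "f \<in> borel_measurable borel" using f by (rule borel_measurable_continuous_onI)
  have C0: "0 \<le> C" using \<xi>[of undefined] by linarith
  have bdd: "\<exists>K. \<forall>x\<in>{0..R}. \<bar>g x\<bar> \<le> K" if "continuous_on {0..R} g" for g :: "real \<Rightarrow> real"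
  proof -
    have "compact (g ` {0..R})" using that by (intro compact_continuous_image) auto
    then show ?thesis using compact_imp_bounded bounded_iff by (metis imageI real_norm_def)
  qed
  have int: "integrable U (\<lambda>th. g (\<phi> th) * \<xi> th)" if "continuous_on UNIV g" for g :: "real \<Rightarrow> real"
  proof -
    have [measurable]: "g \<in> borel_measurable borel" using that by (rule borel_measurable_continuous_onI)
    obtain K where K: "\<forall>x\<in>{0..R}. \<bar>g x\<bar> \<le> K" using bdd[of g] \<open>continuous_on UNIV g\<close> continuous_on_subset by blast
    show ?thesis
    proof (rule integrable_const_bound[where B = "K * C"])
      show "AE th in U. norm (g (\<phi> th) * \<xi> th) \<le> K * C"
      proof (rule AE_I2)
        fix th
        have "\<bar>g (\<phi> th)\<bar> \<le> K" using K \<phi>[of th] by auto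
        then show "norm (g (\<phi> th) * \<xi> th) \<le> K * C"
          using \<xi>[of th] unfolding real_norm_def abs_mult by (intro mult_mono) auto
      qed
    qed measurable
  qed
  define \<Lambda> where "\<Lambda> g k = (\<Sum>j<N k. g (y k j) * c k j)" for g :: "real \<Rightarrow> real" and k
  define I where "I g = (LINT th|U. g (\<phi> th) * \<xi> th)" for g :: "real \<Rightarrow> real"
  have poly: "\<Lambda> g \<longlonglongrightarrow> I g" if "real_polynomial_function g" for g
  proof -
    obtain a n where g: "g = (\<lambda>x. \<Sum>i\<le>n. a i * x ^ i)"
      using \<open>real_polynomial_function g\<close> unfolding real_polynomial_function_iff_sum by blast
    have L: "\<Lambda> g = (\<lambda>k. \<Sum>i\<le>n. a i * (\<Sum>j<N k. y k j ^ i * c k j))"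
      unfolding \<Lambda>_def g sum_distrib_left sum_distrib_right
      by (subst sum.swap) (simp add: mult.assoc)
    have int_pow: "integrable U (\<lambda>th. \<phi> th ^ i * \<xi> th)" for i
      by (rule int) (intro continuous_intros)
    have "I g = (\<Sum>i\<le>n. a i * (LINT th|U. \<phi> th ^ i * \<xi> th))"
    proof -
      have "I g = (LINT th|U. (\<Sum>i\<le>n. a i * (\<phi> th ^ i * \<xi> th)))"
        unfolding I_def g by (simp add: sum_distrib_right mult.assoc)
      also have "\<dots> = (\<Sum>i\<le>n. a i * (LINT th|U. \<phi> th ^ i * \<xi> th))"
        using int_pow by (subst Bochner_Integration.integral_sum) auto
      finally show ?thesis .
    qed
    then show ?thesis unfolding L by (auto intro!: tendsto_intros moments)
  qed
  have "\<Lambda> f \<longlonglongrightarrow> I f"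
  proof (rule LIMSEQ_I)
    fix e :: real assume e: "0 < e"
    define Mu where "Mu = measure U (space U)"
    define d where "d = e / (2 + C * Mu + 1)"
    have Mu: "0 \<le> Mu" by (simp add: Mu_def)
    have CM: "0 \<le> C * Mu" using C0 Mu by simp
    have d: "0 < d" using e CM by (simp add: d_def)
    \<comment> \<open>Weierstrass approximation of \<open>f\<close> on [0, R]. The error is at most
      \<open>d\<close> in the sums, whose coefficients have total variation at most 1, and at most
      \<open>d * C * Mu\<close> in the integral; a third error \<open>d\<close> is spent on the
      convergence for the polynomial.\<close>
    obtain g where g: "real_polynomial_function g" "\<And>x. x \<in> {0..R} \<Longrightarrow> \<bar>f x - g x\<bar> < d"
      using Stone_Weierstrass_real_polynomial_function[of "{0..R}" f d] f d continuous_on_subset[OF f] by auto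
    have contg: "continuous_on UNIV g"
      using g(1) by (simp add: continuous_at_imp_continuous_on continuous_real_polymonial_function)
    have 1: "\<forall>\<^sub>F k in sequentially. \<bar>\<Lambda> f k - \<Lambda> g k\<bar> \<le> d"
      using c
    proof eventually_elim
      case (elim k)
      have "\<bar>\<Lambda> f k - \<Lambda> g k\<bar> = \<bar>\<Sum>j<N k. (f (y k j) - g (y k j)) * c k j\<bar>"
        by (simp add: \<Lambda>_def sum_subtractf algebra_simps)
      also have "\<dots> \<le> (\<Sum>j<N k. \<bar>(f (y k j) - g (y k j)) * c k j\<bar>)" by (rule sum_abs)
      also have "\<dots> \<le> (\<Sum>j<N k. d * \<bar>c k j\<bar>)"
        using y less_imp_le[OF g(2)] by (intro sum_mono) (auto simp: abs_mult intro!: mult_right_mono)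
      also have "\<dots> \<le> d * 1" unfolding sum_distrib_left[symmetric] using elim d by (intro mult_left_mono) auto
      finally show ?case by simp
    qed
    have 2: "\<forall>\<^sub>F k in sequentially. \<bar>\<Lambda> g k - I g\<bar> < d"
      using tendstoD[OF poly[OF g(1)] d] by (simp add: dist_real_def)
    have 3: "\<bar>I g - I f\<bar> \<le> d * C * Mu"
    proof -
      have "I g - I f = (LINT th|U. g (\<phi> th) * \<xi> th - f (\<phi> th) * \<xi> th)"
        unfolding I_def using int[OF contg] int[OF f] by simp
      also have "\<bar>\<dots>\<bar> \<le> (LINT th|U. \<bar>g (\<phi> th) * \<xi> th - f (\<phi> th) * \<xi> th\<bar>)"
        by (rule integral_abs_bound)
      also have "\<dots> \<le> (LINT th|U. d * C)"
      proof (rule integral_mono)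
        show "integrable U (\<lambda>th. \<bar>g (\<phi> th) * \<xi> th - f (\<phi> th) * \<xi> th\<bar>)"
          using int[OF contg] int[OF f] by (intro integrable_abs Bochner_Integration.integrable_diff)
        fix th
        have "\<bar>g (\<phi> th) * \<xi> th - f (\<phi> th) * \<xi> th\<bar> = \<bar>f (\<phi> th) - g (\<phi> th)\<bar> * \<bar>\<xi> th\<bar>"
          by (simp add: abs_mult[symmetric] left_diff_distrib[symmetric]) (simp add: abs_mult abs_minus_commute)
        also have "\<dots> \<le> d * C"
          using g(2)[of "\<phi> th"] \<phi>[of th] \<xi>[of th] d by (intro mult_mono) auto
        finally show "\<bar>g (\<phi> th) * \<xi> th - f (\<phi> th) * \<xi> th\<bar> \<le> d * C" .
      qed simp
      finally show ?thesis by (simp add: Mu_def mult_ac)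
    qed
    have "\<forall>\<^sub>F k in sequentially. norm (\<Lambda> f k - I f) < e"
      using 1 2
    proof eventually_elim
      case (elim k)
      have "\<bar>\<Lambda> f k - I f\<bar> < d + d + d * C * Mu" using elim 3 by linarith
      also have "\<dots> \<le> d * (2 + C * Mu + 1)" using d by (simp add: algebra_simps)
      also have "\<dots> = e" using CM by (simp add: d_def)
      finally show ?case by simp
    qed
    then show "\<exists>no. \<forall>n\<ge>no. norm (\<Lambda> f n - I f) < e" by (simp add: eventually_sequentially)
  qed
  then show ?thesis by (simp add: \<Lambda>_def[abs_def] I_def)
qed

lemma abs_mult_le_mean: "\<bar>x * y\<bar> \<le> (x * x + y * y) / 2" for x y :: real
proof -
  have "0 \<le> (\<bar>x\<bar> - \<bar>y\<bar>) * (\<bar>x\<bar> - \<bar>y\<bar>)" by simp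
  also have "\<dots> = x * x + y * y - 2 * \<bar>x * y\<bar>" by (simp add: left_diff_distrib right_diff_distrib abs_mult)
  finally show ?thesis by simp
qed

text \<open>
  Matrix elements of spectral projections converge as soon as the moments do, because the limiting
  spectral measure does not charge the threshold; the diagonal elements control the error made
  in smoothing the indicator function of the half line.
\<close>

lemma spectral_projection_limit:
  fixes y u v :: "nat \<Rightarrow> nat \<Rightarrow> real" and N n :: "nat \<Rightarrow> nat" and U :: "'a measure" and \<phi> \<xi> :: "'a \<Rightarrow> real"
  assumes fin: "finite_measure U" and [measurable]: "\<phi> \<in> borel_measurable U" "\<xi> \<in> borel_measurable U"
    and \<xi>: "\<And>th. \<bar>\<xi> th\<bar> \<le> C" and \<phi>: "\<And>th. 0 \<le> \<phi> th \<and> \<phi> th \<le> R"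
    and y: "\<And>k j. j < N k \<Longrightarrow> 0 \<le> y k j \<and> y k j \<le> R"
    and u: "\<forall>\<^sub>F k in sequentially. (\<Sum>j<N k. u k j * u k j) \<le> 1"
    and v: "\<forall>\<^sub>F k in sequentially. (\<Sum>j<N k. v k j * v k j) \<le> 1"
    and muv: "\<And>m. (\<lambda>k. \<Sum>j<N k. y k j ^ m * (u k j * v k j)) \<longlonglongrightarrow> (LINT th|U. \<phi> th ^ m * \<xi> th)"
    and muu: "\<And>m. (\<lambda>k. \<Sum>j<N k. y k j ^ m * (u k j * u k j)) \<longlonglongrightarrow> (LINT th|U. \<phi> th ^ m * C)"
    and mvv: "\<And>m. (\<lambda>k. \<Sum>j<N k. y k j ^ m * (v k j * v k j)) \<longlonglongrightarrow> (LINT th|U. \<phi> th ^ m * C)"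
    and n: "\<And>k. n k \<le> N k"
    and below: "\<forall>\<^sub>F k in sequentially. \<forall>j<n k. y k j \<le> lk k"
    and above: "\<forall>\<^sub>F k in sequentially. \<forall>j<N k. n k \<le> j \<longrightarrow> lk k \<le> y k j"
    and lk: "lk \<longlonglongrightarrow> l"
    and null: "AE th in U. \<phi> th \<noteq> l"
  shows "(\<lambda>k. \<Sum>j<n k. u k j * v k j) \<longlonglongrightarrow> (LINT th|U. (if \<phi> th < l then \<xi> th else 0))"
proof (rule LIMSEQ_I)
  fix e :: real assume e: "0 < e"
  interpret finite_measure U by fact
  have C0: "0 \<le> C" using \<xi>[of undefined] by linarith
  \<comment> \<open>\<open>g d\<close> is a bump equal to 1 within distance d of the threshold and 0
    beyond 2 d; \<open>h d\<close> is a ramp falling from 1 to 0 between l - d and l + d. The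
    indicator of the half line differs from \<open>h d\<close> by at most
    \<open>g d\<close>.\<close>
  define g where "g d z = max 0 (min 1 (2 - \<bar>z - l\<bar> / d))" for d z :: real
  define h where "h d z = max 0 (min 1 ((l + d - z) / (2 * d)))" for d z :: real
  have contg: "continuous_on UNIV (g d)" if "d > 0" for d unfolding g_def
    using \<open>d > 0\<close> by (intro continuous_intros) auto
  have conth: "continuous_on UNIV (h d)" if "d > 0" for d unfolding h_def
    using \<open>d > 0\<close> by (intro continuous_intros) auto
  have gm: "g d \<in> borel_measurable borel" "h d \<in> borel_measurable borel" for d
    unfolding g_def h_def by measurable
  note [measurable] = gm
  have g01: "0 \<le> g d z" "g d z \<le> 1" "0 \<le> h d z" "h d z \<le> 1" for d z
    by (auto simp: g_def h_def)
  have near: "g d z = 1" if "\<bar>z - l\<bar> \<le> d" "d > 0" for d z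
    using that by (simp add: g_def field_simps)
  have hlow: "h d z = 1" if "z \<le> l - d" "d > 0" for d z
    using that by (simp add: h_def field_simps)
  have hhigh: "h d z = 0" if "l + d \<le> z" "d > 0" for d z
    using that by (simp add: h_def field_simps)
  \<comment> \<open>Shrinking bumps lose all their mass because \<phi> takes the threshold value on
    a null set only.\<close>
  have "(\<lambda>m. LINT th|U. g (1 / real (Suc m)) (\<phi> th) * C) \<longlonglongrightarrow> (LINT th|U. 0)"
  proof (rule integral_dominated_convergence[where w = "\<lambda>_. C"])
    show "AE th in U. (\<lambda>m. g (1 / real (Suc m)) (\<phi> th) * C) \<longlonglongrightarrow> 0"
      using null
    proof eventually_elim
      case (elim th)
      define p where "p = \<bar>\<phi> th - l\<bar>"
      have p: "0 < p" using elim by (simp add: p_def)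
      obtain m0 where m0: "2 / p < real m0" using reals_Archimedean2 by blast
      have "g (1 / real (Suc m)) (\<phi> th) = 0" if "m \<ge> m0" for m
      proof -
        have "2 / p \<le> real (Suc m)" using m0 \<open>m \<ge> m0\<close> by linarith
        then have "2 \<le> p * real (Suc m)" using p by (simp add: field_simps)
        then show ?thesis by (simp add: g_def p_def)
      qed
      then show ?case by (intro tendsto_eventually) (auto simp: eventually_sequentially)
    qed
    show "AE th in U. norm (g (1 / real (Suc m)) (\<phi> th) * C) \<le> C" for m
      using g01 C0 by (intro AE_I2) (auto simp: abs_mult mult_left_le_one_le)
  qed (auto simp del: of_nat_Suc)
  then have "\<forall>\<^sub>F m in sequentially. \<bar>\<integral>th. g (1 / real (Suc m)) (\<phi> th) * C \<partial>U\<bar> < e / 4"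
    using tendstoD[of _ _ _ "e / 4"] e by (fastforce simp: dist_real_def)
  then obtain m where m: "\<bar>\<integral>th. g (1 / real (Suc m)) (\<phi> th) * C \<partial>U\<bar> < e / 4"
    by (auto simp: eventually_sequentially)
  define d where "d = 1 / real (Suc m)"
  have d: "0 < d" by (simp add: d_def)
  define G where "G = (LINT th|U. g d (\<phi> th) * C)"
  have G: "G < e / 4" using m by (simp add: G_def d_def)
  define J where "J = (LINT th|U. (if \<phi> th < l then \<xi> th else 0))"
  define H where "H = (LINT th|U. h d (\<phi> th) * \<xi> th)"
  have ev_uv: "\<forall>\<^sub>F k in sequentially. (\<Sum>j<N k. \<bar>u k j * v k j\<bar>) \<le> 1"
    using u v
  proof eventually_elim
    case (elim k)
    have "(\<Sum>j<N k. \<bar>u k j * v k j\<bar>) \<le> (\<Sum>j<N k. (u k j * u k j + v k j * v k j) / 2)"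
    proof (rule sum_mono)
      fix j
      show "\<bar>u k j * v k j\<bar> \<le> (u k j * u k j + v k j * v k j) / 2" by (rule abs_mult_le_mean)
    qed
    also have "\<dots> \<le> 1" using elim by (simp add: sum.distrib sum_divide_distrib[symmetric])
    finally show ?case .
  qed
  have "(\<lambda>k. \<Sum>j<N k. h d (y k j) * (u k j * v k j)) \<longlonglongrightarrow> H"
    unfolding H_def by (rule weak_convergence_by_moments[OF fin _ _ \<xi> \<phi> y ev_uv muv conth[OF d]]) auto
  then have 1: "\<forall>\<^sub>F k in sequentially. \<bar>(\<Sum>j<N k. h d (y k j) * (u k j * v k j)) - H\<bar> < e / 4"
    using tendstoD[of _ H _ "e / 4"] e by (simp add: dist_real_def)
  have "(\<lambda>k. \<Sum>j<N k. g d (y k j) * (u k j * u k j)) \<longlonglongrightarrow> G"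
    unfolding G_def
    by (rule weak_convergence_by_moments[OF fin _ _ _ \<phi> y _ muu contg[OF d], where C = C]) (use C0 u in auto)
  then have 2: "\<forall>\<^sub>F k in sequentially. (\<Sum>j<N k. g d (y k j) * (u k j * u k j)) < e / 4"
    using G by (rule order_tendstoD)
  have "(\<lambda>k. \<Sum>j<N k. g d (y k j) * (v k j * v k j)) \<longlonglongrightarrow> G"
    unfolding G_def
    by (rule weak_convergence_by_moments[OF fin _ _ _ \<phi> y _ mvv contg[OF d], where C = C]) (use C0 v in auto)
  then have 3: "\<forall>\<^sub>F k in sequentially. (\<Sum>j<N k. g d (y k j) * (v k j * v k j)) < e / 4"
    using G by (rule order_tendstoD)
  have 4: "\<forall>\<^sub>F k in sequentially. \<bar>lk k - l\<bar> < d"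
    using tendstoD[OF lk d] by (simp add: dist_real_def)
  have JH: "\<bar>J - H\<bar> \<le> G"
  proof -
    have i1: "integrable U (\<lambda>th. if \<phi> th < l then \<xi> th else 0)"
      by (rule integrable_const_bound[where B = C]) (use \<xi> C0 in auto)
    have i2: "integrable U (\<lambda>th. h d (\<phi> th) * \<xi> th)"
    proof (rule integrable_const_bound[where B = C])
      have "\<bar>h d (\<phi> th) * \<xi> th\<bar> \<le> 1 * C" for th
        unfolding abs_mult using g01[of d "\<phi> th"] \<xi>[of th] by (intro mult_mono) auto
      then show "AE th in U. norm (h d (\<phi> th) * \<xi> th) \<le> C" by simp
    qed measurable
    have i3: "integrable U (\<lambda>th. g d (\<phi> th) * C)"
      by (rule integrable_const_bound[where B = C])
         (use g01 C0 in \<open>auto simp: abs_mult mult_left_le_one_le\<close>)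
    have "J - H = (LINT th|U. (if \<phi> th < l then \<xi> th else 0) - h d (\<phi> th) * \<xi> th)"
      unfolding J_def H_def using i1 i2 by simp
    also have "\<bar>\<dots>\<bar> \<le> (LINT th|U. \<bar>(if \<phi> th < l then \<xi> th else 0) - h d (\<phi> th) * \<xi> th\<bar>)"
      by (rule integral_abs_bound)
    also have "\<dots> \<le> G" unfolding G_def
    proof (rule integral_mono[OF _ i3])
      show "integrable U (\<lambda>th. \<bar>(if \<phi> th < l then \<xi> th else 0) - h d (\<phi> th) * \<xi> th\<bar>)"
        using i1 i2 by (intro integrable_abs Bochner_Integration.integrable_diff)
      fix th
      define z where "z = \<phi> th"
      have "\<bar>(if z < l then \<xi> th else 0) - h d z * \<xi> th\<bar> = \<bar>(if z < l then 1 else 0) - h d z\<bar> * \<bar>\<xi> th\<bar>"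
        by (simp add: abs_mult[symmetric] left_diff_distrib)
      also have "\<dots> \<le> g d z * C"
      proof (rule mult_mono)
        show "\<bar>(if z < l then 1 else 0) - h d z\<bar> \<le> g d z"
        proof (cases "\<bar>z - l\<bar> \<le> d")
          case True
          then show ?thesis using near[OF True d] g01[of d z] by auto
        next
          case False
          then consider "z \<le> l - d" "z < l" | "l + d \<le> z" "\<not> z < l" using d by linarith
          then show ?thesis using hlow[of z d] hhigh[of d z] d g01(1)[of d z] by cases auto
        qed
      qed (use \<xi> g01 in auto)
      finally show "\<bar>(if \<phi> th < l then \<xi> th else 0) - h d (\<phi> th) * \<xi> th\<bar> \<le> g d (\<phi> th) * C"
        by (simp add: z_def)
    qed
    finally show ?thesis .
  qed
  have halves: "p < e / 4" if "p \<le> (q + r) / 2" "q < e / 4" "r < e / 4" for p q r :: real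
    using that by (simp add: field_simps)
  have "\<forall>\<^sub>F k in sequentially. norm ((\<Sum>j<n k. u k j * v k j) - J) < e"
    using 1 2 3 4 below above
  proof eventually_elim
    case (elim k)
    have split: "(\<Sum>j<n k. u k j * v k j) = (\<Sum>j<N k. (if j < n k then 1 else 0) * (u k j * v k j))"
    proof -
      have "(\<Sum>j<n k. u k j * v k j) = (\<Sum>j<n k. (if j < n k then 1 else 0) * (u k j * v k j))"
        by (intro sum.cong) auto
      also have "\<dots> = (\<Sum>j<N k. (if j < n k then 1 else 0) * (u k j * v k j))"
        using n[of k] by (intro sum.mono_neutral_left) auto
      finally show ?thesis .
    qed
    \<comment> \<open>Outside the bump, the position of \<open>y k j\<close> relative to l decides
      whether j < n k, because \<open>lk k\<close> is within d of l.\<close>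
    have cut: "\<bar>(if j < n k then 1 else 0) - h d (y k j)\<bar> \<le> g d (y k j)" if j: "j < N k" for j
    proof (cases "\<bar>y k j - l\<bar> \<le> d")
      case True
      then show ?thesis using near[OF True d] g01[of d "y k j"] by auto
    next
      case False
      then consider "y k j < l - d" | "l + d < y k j" using d by linarith
      then show ?thesis
      proof cases
        case 1
        then have "j < n k" using elim j by (metis (no_types, lifting) abs_diff_less_iff leI less_trans not_less)
        then show ?thesis using hlow[of "y k j" d] d g01(1)[of d "y k j"] 1 by auto
      next
        case 2
        have "\<not> j < n k"
        proof
          assume "j < n k"
          then have "y k j \<le> lk k" using elim by auto
          then show False using 2 elim(4) by linarith
        qed
        then show ?thesis using hhigh[of d "y k j"] d g01(1)[of d "y k j"] 2 by auto
      qed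
    qed
    have "\<bar>(\<Sum>j<n k. u k j * v k j) - (\<Sum>j<N k. h d (y k j) * (u k j * v k j))\<bar>
       = \<bar>\<Sum>j<N k. ((if j < n k then 1 else 0) - h d (y k j)) * (u k j * v k j)\<bar>"
      unfolding split sum_subtractf[symmetric] left_diff_distrib ..
    also have "\<dots> \<le> (\<Sum>j<N k. \<bar>((if j < n k then 1 else 0) - h d (y k j)) * (u k j * v k j)\<bar>)"
      by (rule sum_abs)
    also have "\<dots> \<le> (\<Sum>j<N k. g d (y k j) * ((u k j * u k j + v k j * v k j) / 2))"
    proof (rule sum_mono)
      fix j assume "j \<in> {..<N k}"
      then have c: "\<bar>(if j < n k then 1 else 0) - h d (y k j)\<bar> \<le> g d (y k j)" using cut by auto
      show "\<bar>((if j < n k then 1 else 0) - h d (y k j)) * (u k j * v k j)\<bar>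
          \<le> g d (y k j) * ((u k j * u k j + v k j * v k j) / 2)"
        unfolding abs_mult[of "_ - _"] by (intro mult_mono[OF c abs_mult_le_mean]) (use g01 in auto)
    qed
    also have "\<dots> = ((\<Sum>j<N k. g d (y k j) * (u k j * u k j)) + (\<Sum>j<N k. g d (y k j) * (v k j * v k j))) / 2"
      by (simp add: sum.distrib[symmetric] sum_divide_distrib algebra_simps add_divide_distrib)
    finally have "\<bar>(\<Sum>j<n k. u k j * v k j) - (\<Sum>j<N k. h d (y k j) * (u k j * v k j))\<bar> < e / 4"
      by (rule halves[OF _ elim(2,3)])
    then have "\<bar>(\<Sum>j<n k. u k j * v k j) - J\<bar> < e" using elim(1) JH G e by linarith
    then show ?case by simp
  qed
  then show "\<exists>no. \<forall>k\<ge>no. norm ((\<Sum>j<n k. u k j * v k j) - (LINT th|U. (if \<phi> th < l then \<xi> th else 0))) < e"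
    by (simp add: eventually_sequentially J_def)
qed

section \<open>Local limit of the Hahn kernel\<close>

definition site :: "nat \<Rightarrow> int \<Rightarrow> nat" where
  "site s i = nat (int s + i)"

text \<open>Fourier side of the limiting operator on the integers: for an even symbol the matrix
  element at distance d is the integral of the symbol against cos (d th) / pi over [0, pi].\<close>

definition half_circle :: "real measure" where
  "half_circle = restrict_space lborel {0..pi}"

lemma finite_measure_half_circle: "finite_measure half_circle"
  unfolding half_circle_def
  by (rule finite_measureI) (simp add: emeasure_restrict_space space_restrict_space)

lemma borel_measurable_half_circle:
  "f \<in> borel_measurable borel \<Longrightarrow> f \<in> borel_measurable half_circle"
  unfolding half_circle_def by (intro measurable_restrict_space1) simp

lemma integral_cos_half_circle:
  "(LINT th|half_circle. cos (of_int d * th) / pi) = (if d = 0 then 1 else 0)"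
proof -
  have E: "(LINT th|half_circle. cos (of_int d * th) / pi) = (LINT th|lborel. cos (of_int d * th) / pi * indicator {0..pi} th)"
    unfolding half_circle_def by (subst integral_restrict_space) (auto simp: mult.commute)
  show ?thesis
  proof (cases "d = 0")
    case False
    have hb: "has_bochner_integral lborel (\<lambda>th. cos (of_int d * th) / pi * indicator {0..pi} th)
      (sin (of_int d * pi) / (of_int d * pi) - sin (of_int d * 0) / (of_int d * pi))"
      using False
      by (intro has_bochner_integral_FTC_Icc_real) (auto intro!: derivative_eq_intros continuous_intros)
    have "sin (of_int d * pi) = 0" by (simp add: sin_zero_iff_int2)
    then show ?thesis unfolding E has_bochner_integral_integral_eq[OF hb] using False by simp
  next
    case True
    have hb: "has_bochner_integral lborel (\<lambda>th. 1 / pi * indicator {0..pi} th) (pi / pi - 0 / pi)"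
      by (intro has_bochner_integral_FTC_Icc_real) (auto intro!: derivative_eq_intros continuous_intros)
    from has_bochner_integral_integral_eq[OF hb] show ?thesis unfolding E using True by simp
  qed
qed

lemma integrable_half_circle_cos:
  "integrable half_circle (\<lambda>th. (p - q * cos th) ^ m * (cos (of_int d * th) / pi))"
proof -
  interpret finite_measure half_circle by (rule finite_measure_half_circle)
  show ?thesis
  proof (rule integrable_const_bound[where B = "(\<bar>p\<bar> + \<bar>q\<bar>) ^ m * (1 / pi)"])
    have "\<bar>(p - q * cos th) ^ m * (cos (of_int d * th) / pi)\<bar> \<le> (\<bar>p\<bar> + \<bar>q\<bar>) ^ m * (1 / pi)" for th
    proof -
      have "\<bar>q * cos th\<bar> \<le> \<bar>q\<bar> * 1" unfolding abs_mult by (intro mult_left_mono) auto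
      then have "\<bar>p - q * cos th\<bar> \<le> \<bar>p\<bar> + \<bar>q\<bar>" by linarith
      then show ?thesis unfolding abs_mult power_abs
        by (intro mult_mono power_mono) (auto simp: divide_right_mono)
    qed
    then show "AE th in half_circle. norm ((p - q * cos th) ^ m * (cos (of_int d * th) / pi)) \<le> (\<bar>p\<bar> + \<bar>q\<bar>) ^ m * (1 / pi)"
      by simp
  qed (intro borel_measurable_half_circle, measurable)
qed

text \<open>From 2 cos th cos (d th) = cos ((d + 1) th) + cos ((d - 1) th). The moments of the Hahn
  matrix obey the same three-term relation in the limit.\<close>

lemma half_circle_moment_Suc:
  "(LINT th|half_circle. (p - 2 * q * cos th) ^ Suc m * (cos (of_int d * th) / pi))
    = p * (LINT th|half_circle. (p - 2 * q * cos th) ^ m * (cos (of_int d * th) / pi))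
      - q * (LINT th|half_circle. (p - 2 * q * cos th) ^ m * (cos (of_int (d + 1) * th) / pi))
      - q * (LINT th|half_circle. (p - 2 * q * cos th) ^ m * (cos (of_int (d - 1) * th) / pi))"
proof -
  define F where "F d th = (p - 2 * q * cos th) ^ m * (cos (of_int d * th) / pi)" for d :: int and th
  have int: "integrable half_circle (F d)" for d
    unfolding F_def by (rule integrable_half_circle_cos)
  have "(p - 2 * q * cos th) ^ Suc m * (cos (of_int d * th) / pi)
     = p * F d th - q * F (d + 1) th - q * F (d - 1) th" for th
  proof -
    define c where "c = cos (of_int d * th)"
    define c1 where "c1 = cos (of_int (d + 1) * th)"
    define c2 where "c2 = cos (of_int (d - 1) * th)"
    define W where "W = (p - 2 * q * cos th) ^ m"
    have trig: "2 * cos th * c = c1 + c2"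
      by (simp add: distrib_right left_diff_distrib cos_add cos_diff c_def c1_def c2_def)
    have "(p - 2 * q * cos th) * c = p * c - q * (2 * cos th * c)" by (simp add: algebra_simps)
    also have "\<dots> = p * c - q * c1 - q * c2" by (simp add: trig distrib_left)
    finally have e: "(p - 2 * q * cos th) * c = p * c - q * c1 - q * c2" .
    have "(p - 2 * q * cos th) ^ Suc m * (c / pi) = W * ((p - 2 * q * cos th) * c) / pi"
      by (simp add: W_def)
    also have "\<dots> = p * (W * (c / pi)) - q * (W * (c1 / pi)) - q * (W * (c2 / pi))"
      unfolding e by (simp add: right_diff_distrib diff_divide_distrib mult.left_commute)
    finally show ?thesis by (simp only: F_def c_def c1_def c2_def W_def)
  qed
  then have "(LINT th|half_circle. (p - 2 * q * cos th) ^ Suc m * (cos (of_int d * th) / pi))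
      = (LINT th|half_circle. p * F d th - q * F (d + 1) th - q * F (d - 1) th)"
    by simp
  also have "\<dots> = p * (LINT th|half_circle. F d th) - q * (LINT th|half_circle. F (d + 1) th) - q * (LINT th|half_circle. F (d - 1) th)"
    using int by simp
  finally show ?thesis by (simp only: F_def)
qed

text \<open>Divided by N^2, the rates at sites near x N tend to \<open>P\<close> and
  \<open>D\<close>, so the matrix looks locally like the constant one with diagonal P + D and
  off-diagonal entries - sqrt (P D); \<open>l\<close> is the limit of the rescaled eigenvalue at the
  cutoff degree.\<close>

theorem hahn_kernel_limit:
  fixes N a b n s :: "nat \<Rightarrow> nat" and A B t x :: real and i i' :: int
  assumes N: "filterlim N at_top sequentially" and N0: "\<And>k. 0 < N k"
    and a: "\<And>k. real (a k) = A * real (N k)" and b: "\<And>k. real (b k) = B * real (N k)"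
    and AB: "0 < A" "0 < B" and n: "\<And>k. real (n k) = t * real (N k)" and t: "0 < t" "t < 1"
    and s: "(\<lambda>k. real (s k) / real (N k)) \<longlonglongrightarrow> x" and x: "0 < x" "x < 1"
  defines "P \<equiv> (1 - x) * (1 - x + A)" and "D \<equiv> x * (x + B)" and "l \<equiv> t * (2 + A + B - t)"
  shows "(\<lambda>k. \<Sum>j<n k. hahn_fun (N k) (a k) (b k) j (site (s k) i) * hahn_fun (N k) (a k) (b k) j (site (s k) i'))
    \<longlonglongrightarrow> (LINT th|half_circle. (if P + D - 2 * sqrt (P * D) * cos th < l then cos (of_int (i - i') * th) / pi else 0))"
proof -
  define \<psi> where "\<psi> k j r = hahn_fun (N k) (a k) (b k) j (site (s k) r)" for k j r
  define y where "y k j = hahn_ev (N k) (a k) (b k) j / (real (N k))\<^sup>2" for k j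
  define p where "p = P + D"
  define q where "q = sqrt (P * D)"
  define Mom where "Mom m d = (LINT th|half_circle. (p - 2 * q * cos th) ^ m * (cos (of_int d * th) / pi))" for m and d :: int
  have PD: "0 < P" "0 < D" using x AB by (auto simp: P_def D_def)
  have Ninf: "filterlim (\<lambda>k. real (N k)) at_top sequentially"
    by (rule filterlim_compose[OF filterlim_real_sequentially N])
  have Nr: "0 < real (N k)" for k using N0[of k] by simp
  have inv: "(\<lambda>k. r / real (N k)) \<longlonglongrightarrow> 0" for r :: real
    by (rule tendsto_divide_0[OF tendsto_const filterlim_at_top_imp_at_infinity[OF Ninf]])
  \<comment> \<open>A fixed offset, possibly negative, stays inside the line for large k; from then
    on the truncation by \<open>nat\<close> in \<open>site\<close> is harmless and the recurrence
    applies.\<close>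
  have interior: "\<forall>\<^sub>F k in sequentially. 0 < int (s k) + r \<and> int (s k) + r + 1 < int (N k)" for r :: int
  proof -
    have "(\<lambda>k. real (s k) / real (N k) + real_of_int r / real (N k)) \<longlonglongrightarrow> x + 0"
      by (intro tendsto_add s inv)
    then have "\<forall>\<^sub>F k in sequentially. 0 < real (s k) / real (N k) + real_of_int r / real (N k)"
      using x(1) by (intro order_tendstoD) auto
    moreover have "(\<lambda>k. real (s k) / real (N k) + real_of_int (r + 1) / real (N k)) \<longlonglongrightarrow> x + 0"
      by (intro tendsto_add s inv)
    then have "\<forall>\<^sub>F k in sequentially. real (s k) / real (N k) + real_of_int (r + 1) / real (N k) < 1"
      using x(2) by (intro order_tendstoD) auto
    ultimately show ?thesis
    proof eventually_elim
      case (elim k)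
      have "0 < (real (s k) + real_of_int r) / real (N k)" using elim(1) by (simp add: add_divide_distrib)
      then have "0 < real (s k) + real_of_int r" using Nr[of k] by (simp add: zero_less_divide_iff)
      moreover have "(real (s k) + real_of_int (r + 1)) / real (N k) < 1" using elim(2) by (simp add: add_divide_distrib)
      then have "real (s k) + real_of_int (r + 1) < real (N k)" using Nr[of k] by (simp add: divide_less_eq)
      ultimately show ?case by linarith
    qed
  qed
  have site: "real (site (s k) r) = real (s k) + of_int r" "site (s k) (r + 1) = Suc (site (s k) r)"
      "site (s k) (r - 1) = site (s k) r - 1" "0 < site (s k) r" "Suc (site (s k) r) < N k"
    if "0 < int (s k) + r \<and> int (s k) + r + 1 < int (N k)" for k r
    using that by (auto simp: site_def nat_add_distrib nat_diff_distrib)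
  have ratio: "(\<lambda>k. real (site (s k) r) / real (N k)) \<longlonglongrightarrow> x" for r
  proof -
    have "(\<lambda>k. real (s k) / real (N k) + real_of_int r / real (N k)) \<longlonglongrightarrow> x"
      using tendsto_add[OF s inv[of "real_of_int r"]] by simp
    moreover have "\<forall>\<^sub>F k in sequentially. real (s k) / real (N k) + real_of_int r / real (N k) = real (site (s k) r) / real (N k)"
      using interior[of r] by eventually_elim (simp add: site add_divide_distrib)
    ultimately show ?thesis by (rule Lim_transform_eventually)
  qed
  have birth_lim: "(\<lambda>k. birth (N k) (a k) (real (site (s k) r)) / (real (N k))\<^sup>2) \<longlonglongrightarrow> P" for r
  proof -
    have "(\<lambda>k. (1 - 1 / real (N k) - real (site (s k) r) / real (N k)) * (1 - 1 / real (N k) - real (site (s k) r) / real (N k) + A))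
       \<longlonglongrightarrow> (1 - 0 - x) * (1 - 0 - x + A)"
      by (intro tendsto_intros inv ratio)
    moreover have "birth (N k) (a k) (real (site (s k) r)) / (real (N k))\<^sup>2
       = (1 - 1 / real (N k) - real (site (s k) r) / real (N k)) * (1 - 1 / real (N k) - real (site (s k) r) / real (N k) + A)" for k
      unfolding birth_def a using Nr[of k] by (simp add: field_simps power2_eq_square)
    ultimately show ?thesis by (simp add: P_def)
  qed
  have death_lim: "(\<lambda>k. death (b k) (real (site (s k) r)) / (real (N k))\<^sup>2) \<longlonglongrightarrow> D" for r
  proof -
    have "(\<lambda>k. (real (site (s k) r) / real (N k)) * (real (site (s k) r) / real (N k) + B)) \<longlonglongrightarrow> x * (x + B)"
      by (intro tendsto_intros inv ratio)
    moreover have "death (b k) (real (site (s k) r)) / (real (N k))\<^sup>2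
       = (real (site (s k) r) / real (N k)) * (real (site (s k) r) / real (N k) + B)" for k
      unfolding death_def b using Nr[of k] by (simp add: field_simps power2_eq_square)
    ultimately show ?thesis by (simp add: D_def)
  qed
  define diag where "diag k r = (birth (N k) (a k) (real (site (s k) r)) + death (b k) (real (site (s k) r))) / (real (N k))\<^sup>2" for k r
  define off where "off k r = sqrt (birth (N k) (a k) (real (site (s k) r)) * death (b k) (real (site (s k) (r + 1)))) / (real (N k))\<^sup>2" for k r
  have diag_lim: "(\<lambda>k. diag k r) \<longlonglongrightarrow> p" for r
    unfolding diag_def add_divide_distrib p_def by (intro tendsto_add birth_lim death_lim)
  have off_lim: "(\<lambda>k. off k r) \<longlonglongrightarrow> q" for r
  proof -
    have "off k r = sqrt (birth (N k) (a k) (real (site (s k) r)) / (real (N k))\<^sup>2 * (death (b k) (real (site (s k) (r + 1))) / (real (N k))\<^sup>2))" for k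
    proof -
      define X where "X = birth (N k) (a k) (real (site (s k) r))"
      define Y where "Y = death (b k) (real (site (s k) (r + 1)))"
      have "X / (real (N k))\<^sup>2 * (Y / (real (N k))\<^sup>2) = (X * Y) / ((real (N k))\<^sup>2)\<^sup>2"
        by (simp add: power2_eq_square)
      then have "sqrt (X / (real (N k))\<^sup>2 * (Y / (real (N k))\<^sup>2)) = sqrt (X * Y) / (real (N k))\<^sup>2"
        by (simp only: real_sqrt_divide real_sqrt_abs) simp
      then show ?thesis by (simp only: off_def X_def Y_def)
    qed
    then have "(\<lambda>k. off k r) = (\<lambda>k. sqrt (birth (N k) (a k) (real (site (s k) r)) / (real (N k))\<^sup>2 * (death (b k) (real (site (s k) (r + 1))) / (real (N k))\<^sup>2)))"
      by (rule HOL.ext)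
    then show ?thesis unfolding q_def by (simp only:) (intro tendsto_intros birth_lim death_lim)
  qed
  have three_term: "y k j * \<psi> k j r = diag k r * \<psi> k j r - off k r * \<psi> k j (r + 1) - off k (r - 1) * \<psi> k j (r - 1)"
    if j: "j < N k" and int: "0 < int (s k) + r \<and> int (s k) + r + 1 < int (N k)" for k j r
  proof -
    have "y k j * \<psi> k j r = (hahn_ev (N k) (a k) (b k) j * hahn_fun (N k) (a k) (b k) j (site (s k) r)) / (real (N k))\<^sup>2"
      by (simp add: y_def \<psi>_def)
    also have "\<dots> = diag k r * \<psi> k j r - off k r * \<psi> k j (r + 1) - off k (r - 1) * \<psi> k j (r - 1)"
      unfolding hahn_fun_recurrence[OF j site(4)[OF int] site(5)[OF int]]
      unfolding diag_def off_def \<psi>_def diff_add_cancel site(2,3)[OF int]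
      by (simp add: diff_divide_distrib)
    finally show ?thesis .
  qed
  \<comment> \<open>Each factor y is spent on moving the index \<open>r\<close> by one through the
    three-term relation; the base case is completeness of the eigenfunctions.\<close>
  have moments: "(\<lambda>k. \<Sum>j<N k. y k j ^ m * (\<psi> k j r * \<psi> k j r')) \<longlonglongrightarrow> Mom m (r - r')" for m r r'
  proof (induction m arbitrary: r)
    case 0
    have "\<forall>\<^sub>F k in sequentially. (\<Sum>j<N k. \<psi> k j r * \<psi> k j r') = (if r - r' = 0 then 1 else 0)"
      using interior[of r] interior[of r']
    proof eventually_elim
      case (elim k)
      have "(\<Sum>j<N k. \<psi> k j r * \<psi> k j r') = (if site (s k) r = site (s k) r' then 1 else 0)"
        unfolding \<psi>_def using site(5)[OF elim(1)] site(5)[OF elim(2)] by (intro hahn_fun_complete) auto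
      also have "site (s k) r = site (s k) r' \<longleftrightarrow> r - r' = 0"
        using elim by (auto simp: site_def)
      finally show ?case .
    qed
    then have "(\<lambda>k. \<Sum>j<N k. \<psi> k j r * \<psi> k j r') \<longlonglongrightarrow> (if r - r' = 0 then 1 else 0)"
      by (rule tendsto_eventually)
    then show ?case by (simp add: Mom_def integral_cos_half_circle[of "r - r'", simplified])
  next
    case (Suc m)
    define S where "S k r = (\<Sum>j<N k. y k j ^ m * (\<psi> k j r * \<psi> k j r'))" for k r
    have "(\<lambda>k. diag k r * S k r - off k r * S k (r + 1) - off k (r - 1) * S k (r - 1))
       \<longlonglongrightarrow> p * Mom m (r - r') - q * Mom m (r + 1 - r') - q * Mom m (r - 1 - r')"
      unfolding S_def by (intro tendsto_intros diag_lim off_lim Suc.IH)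
    moreover have "p * Mom m (r - r') - q * Mom m (r + 1 - r') - q * Mom m (r - 1 - r') = Mom (Suc m) (r - r')"
      unfolding Mom_def half_circle_moment_Suc by (simp add: algebra_simps)
    moreover have "\<forall>\<^sub>F k in sequentially. diag k r * S k r - off k r * S k (r + 1) - off k (r - 1) * S k (r - 1)
        = (\<Sum>j<N k. y k j ^ Suc m * (\<psi> k j r * \<psi> k j r'))"
      using interior[of r]
    proof eventually_elim
      case (elim k)
      have "(\<Sum>j<N k. y k j ^ Suc m * (\<psi> k j r * \<psi> k j r')) = (\<Sum>j<N k. y k j ^ m * ((y k j * \<psi> k j r) * \<psi> k j r'))"
        by (simp add: mult_ac)
      also have "\<dots> = (\<Sum>j<N k. y k j ^ m * ((diag k r * \<psi> k j r - off k r * \<psi> k j (r + 1) - off k (r - 1) * \<psi> k j (r - 1)) * \<psi> k j r'))"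
        using three_term[OF _ elim] by (intro sum.cong refl) auto
      also have "\<dots> = diag k r * S k r - off k r * S k (r + 1) - off k (r - 1) * S k (r - 1)"
        unfolding S_def sum_distrib_left sum_subtractf[symmetric]
        by (intro sum.cong refl) (simp add: algebra_simps)
      finally show ?case by simp
    qed
    ultimately show ?case by (simp only:) (rule Lim_transform_eventually)
  qed
  \<comment> \<open>One bound for both the rescaled eigenvalues, at most 2 + A + B, and the symbol,
    at most p + 2 q.\<close>
  define R where "R = 2 + A + B + (P + D) + 2 * q"
  have q0: "0 \<le> q" using PD by (simp add: q_def)
  have pq: "2 * q \<le> p"
  proof -
    have "0 \<le> (sqrt P - sqrt D)\<^sup>2" by simp
    also have "\<dots> = p - 2 * q"
      using PD by (simp add: power2_diff p_def q_def real_sqrt_mult)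
    finally show ?thesis by simp
  qed
  have \<phi>: "0 \<le> p - 2 * q * cos th \<and> p - 2 * q * cos th \<le> R" for th
  proof -
    have "\<bar>2 * q * cos th\<bar> \<le> 2 * q * 1" unfolding abs_mult using q0 by (intro mult_mono) auto
    then show ?thesis using pq AB PD by (auto simp: R_def p_def)
  qed
  have yR: "0 \<le> y k j \<and> y k j \<le> R" if "j < N k" for k j
  proof -
    have jN: "real j + 1 \<le> real (N k)" using that by linarith
    have ev: "0 \<le> hahn_ev (N k) (a k) (b k) j"
      unfolding hahn_ev_def using jN by (intro mult_nonneg_nonneg) auto
    have "hahn_ev (N k) (a k) (b k) j \<le> real (N k) * (2 * real (N k) + real (a k) + real (b k))"
      unfolding hahn_ev_def using jN by (intro mult_mono) auto
    also have "\<dots> = (2 + A + B) * (real (N k))\<^sup>2" unfolding a b by (simp add: algebra_simps power2_eq_square)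
    finally have "y k j \<le> 2 + A + B" using Nr[of k] by (simp add: y_def divide_le_eq)
    then show ?thesis using ev PD q0 by (auto simp: y_def R_def)
  qed
  \<comment> \<open>The rescaled eigenvalue of the first omitted degree serves as threshold.\<close>
  define lk where "lk k = y k (n k)" for k
  have nN: "n k < N k" for k
  proof -
    have "real (n k) < real (N k)" unfolding n using t Nr[of k] by simp
    then show ?thesis by simp
  qed
  have mono: "y k j \<le> y k j'" if "j \<le> j'" "j' < N k" for k j j'
    unfolding y_def using hahn_ev_mono[OF that] by (intro divide_right_mono) auto
  have lk: "lk \<longlonglongrightarrow> l"
  proof -
    have lk: "lk k = t * (2 + A + B - 1 / real (N k) - t)" for k
      unfolding lk_def y_def hahn_ev_def n a b using Nr[of k] by (simp add: field_simps power2_eq_square)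
    moreover have "(\<lambda>k. t * (2 + A + B - 1 / real (N k) - t)) \<longlonglongrightarrow> t * (2 + A + B - 0 - t)"
      by (intro tendsto_intros inv)
    ultimately show ?thesis by (simp add: l_def fun_eq_iff[THEN iffD2, rule_format, OF lk])
  qed
  \<comment> \<open>The cosine is injective on [0, pi], so the symbol takes the threshold value at
    most once.\<close>
  have null: "AE th in half_circle. p - 2 * q * cos th \<noteq> l"
  proof -
    define Z where "Z = {th. 0 \<le> th \<and> th \<le> pi \<and> p - 2 * q * cos th = l}"
    have q1: "q > 0" using PD by (simp add: q_def)
    have "th = arccos ((p - l) / (2 * q))" if "th \<in> Z" for th
    proof -
      have "cos th = (p - l) / (2 * q)" using that q1 by (auto simp: Z_def field_simps)
      then show ?thesis using that arccos_cos[of th] by (auto simp: Z_def)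
    qed
    then have "Z \<subseteq> {arccos ((p - l) / (2 * q))}" by auto
    then have "finite Z" using finite_subset by blast
    then have "Z \<in> null_sets lborel" by (rule finite_imp_null_set_lborel)
    then have "AE th in lborel. th \<in> {0..pi} \<longrightarrow> p - 2 * q * cos th \<noteq> l"
      by (rule AE_I') (auto simp: Z_def)
    then show ?thesis unfolding half_circle_def by (subst AE_restrict_space_iff) auto
  qed
  have one: "\<forall>\<^sub>F k in sequentially. (\<Sum>j<N k. \<psi> k j r * \<psi> k j r) \<le> 1" for r
    using interior[of r]
  proof eventually_elim
    case (elim k)
    then show ?case unfolding \<psi>_def using site(5)[OF elim] by (subst hahn_fun_complete) auto
  qed
  have "(\<lambda>k. \<Sum>j<n k. \<psi> k j i * \<psi> k j i') \<longlonglongrightarrow>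
      (LINT th|half_circle. (if p - 2 * q * cos th < l then cos (of_int (i - i') * th) / pi else 0))"
  proof (rule spectral_projection_limit[where C = "1 / pi" and R = R and y = y and N = N and lk = lk])
    show "(\<lambda>th. p - 2 * q * cos th) \<in> borel_measurable half_circle"
      "(\<lambda>th. cos (real_of_int (i - i') * th) / pi) \<in> borel_measurable half_circle"
      by (intro borel_measurable_half_circle, measurable)+
    show "(\<lambda>k. \<Sum>j<N k. y k j ^ m * (\<psi> k j i * \<psi> k j i')) \<longlonglongrightarrow>
        (LINT th|half_circle. (p - 2 * q * cos th) ^ m * (cos (real_of_int (i - i') * th) / pi))" for m
      using moments[of m i i'] by (simp add: Mom_def)
    show "(\<lambda>k. \<Sum>j<N k. y k j ^ m * (\<psi> k j i * \<psi> k j i)) \<longlonglongrightarrow>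
        (LINT th|half_circle. (p - 2 * q * cos th) ^ m * (1 / pi))" for m
      using moments[of m i i] by (simp add: Mom_def)
    show "(\<lambda>k. \<Sum>j<N k. y k j ^ m * (\<psi> k j i' * \<psi> k j i')) \<longlonglongrightarrow>
        (LINT th|half_circle. (p - 2 * q * cos th) ^ m * (1 / pi))" for m
      using moments[of m i' i'] by (simp add: Mom_def)
  qed (use \<phi> yR one nN lk null mono in \<open>auto simp: finite_measure_half_circle divide_right_mono lk_def less_imp_le\<close>)
  then show ?thesis by (simp add: \<psi>_def p_def q_def)
qed

definition hahn_density :: "real \<Rightarrow> real \<Rightarrow> real \<Rightarrow> real \<Rightarrow> real" where
  "hahn_density A B t x = arccos (max (-1) (min 1
     (((1 - x) * (1 - x + A) + x * (x + B) - t * (2 + A + B - t)) / (2 * sqrt ((1 - x) * (1 - x + A) * (x * (x + B))))))) / pi"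

lemma hahn_density_bounds: "0 \<le> hahn_density A B t x" "hahn_density A B t x \<le> 1"
proof -
  have "0 \<le> arccos (max (-1) (min 1 y)) \<and> arccos (max (-1) (min 1 y)) \<le> pi" for y
    by (auto intro!: arccos_lbound arccos_ubound)
  then show "0 \<le> hahn_density A B t x" "hahn_density A B t x \<le> 1"
    unfolding hahn_density_def by simp_all
qed

text \<open>The symbol increases on [0, pi], so the region below the threshold is an initial arc
  ending at \<open>th\<^sub>0\<close>, over which the cosines integrate to a sine kernel.\<close>

lemma spectral_cutoff_integral:
  fixes p q l :: real and d :: int
  assumes q: "0 < q"
  defines "th\<^sub>0 \<equiv> arccos (max (-1) (min 1 ((p - l) / (2 * q))))"
  shows "(LINT th|half_circle. (if p - 2 * q * cos th < l then cos (of_int d * th) / pi else 0))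
    = (if d = 0 then th\<^sub>0 / pi else sin (of_int d * th\<^sub>0) / (pi * of_int d))"
proof -
  define \<kappa> where "\<kappa> = (p - l) / (2 * q)"
  define \<kappa>' where "\<kappa>' = max (-1) (min 1 \<kappa>)"
  have th0: "th\<^sub>0 = arccos \<kappa>'" by (simp add: th\<^sub>0_def \<kappa>'_def \<kappa>_def)
  have \<kappa>': "-1 \<le> \<kappa>'" "\<kappa>' \<le> 1" by (auto simp: \<kappa>'_def)
  have bd: "0 \<le> th\<^sub>0" "th\<^sub>0 \<le> pi" unfolding th0 using \<kappa>' by (auto intro: arccos_lbound arccos_ubound)
  have cos0: "cos th\<^sub>0 = \<kappa>'" unfolding th0 using \<kappa>' by simp
  have cut: "p - 2 * q * cos th < l \<longleftrightarrow> \<kappa> < cos th" for th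
    unfolding \<kappa>_def using q by (simp add: field_simps)
  have below: "\<kappa> < cos th" if "0 \<le> th" "th < th\<^sub>0" for th
  proof -
    have "\<kappa> \<le> 1"
    proof (rule ccontr)
      assume "\<not> \<kappa> \<le> 1"
      then have "\<kappa>' = 1" by (simp add: \<kappa>'_def)
      then show False using that th0 by simp
    qed
    then have "\<kappa> \<le> \<kappa>'" by (simp add: \<kappa>'_def)
    moreover have "cos th\<^sub>0 < cos th" using that bd by (intro cos_monotone_0_pi) auto
    ultimately show ?thesis using cos0 by linarith
  qed
  have above: "\<not> \<kappa> < cos th" if "th\<^sub>0 < th" "th \<le> pi" for th
  proof -
    have "-1 \<le> \<kappa>"
    proof (rule ccontr)
      assume "\<not> -1 \<le> \<kappa>"
      then have "\<kappa>' = -1" by (simp add: \<kappa>'_def)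
      then show False using that th0 by simp
    qed
    then have "\<kappa>' \<le> \<kappa>" by (simp add: \<kappa>'_def)
    moreover have "cos th < cos th\<^sub>0" using that bd by (intro cos_monotone_0_pi) auto
    ultimately show ?thesis using cos0 by linarith
  qed
  have "(LINT th|half_circle. (if p - 2 * q * cos th < l then cos (of_int d * th) / pi else 0))
     = (LINT th|lborel. (if p - 2 * q * cos th < l then cos (of_int d * th) / pi else 0) * indicator {0..pi} th)"
    unfolding half_circle_def by (subst integral_restrict_space) (auto simp: mult.commute)
  also have "\<dots> = (LINT th|lborel. cos (of_int d * th) / pi * indicator {0..th\<^sub>0} th)"
  proof (rule integral_cong_AE)
    have "AE th in lborel. th \<noteq> th\<^sub>0" by (rule AE_lborel_singleton)
    then show "AE th in lborel. (if p - 2 * q * cos th < l then cos (of_int d * th) / pi else 0) * indicator {0..pi} th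
      = cos (of_int d * th) / pi * indicator {0..th\<^sub>0} th"
    proof eventually_elim
      case (elim th)
      consider "th < 0" | "0 \<le> th" "th < th\<^sub>0" | "th\<^sub>0 < th" "th \<le> pi" | "pi < th" using elim by linarith
      then show ?case
        using below[of th] above[of th] bd by cases (auto simp: cut indicator_def)
    qed
  qed measurable
  also have "\<dots> = (if d = 0 then th\<^sub>0 / pi else sin (of_int d * th\<^sub>0) / (pi * of_int d))"
  proof (cases "d = 0")
    case False
    have hb: "has_bochner_integral lborel (\<lambda>th. cos (of_int d * th) / pi * indicator {0..th\<^sub>0} th)
      (sin (of_int d * th\<^sub>0) / (pi * of_int d) - sin (of_int d * 0) / (pi * of_int d))"
      using False bd
      by (intro has_bochner_integral_FTC_Icc_real) (auto intro!: derivative_eq_intros continuous_intros)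
    then show ?thesis unfolding has_bochner_integral_integral_eq[OF hb] using False by simp
  next
    case True
    have hb: "has_bochner_integral lborel (\<lambda>th. 1 / pi * indicator {0..th\<^sub>0} th) (th\<^sub>0 / pi - 0 / pi)"
      using bd by (intro has_bochner_integral_FTC_Icc_real) (auto intro!: derivative_eq_intros continuous_intros)
    from has_bochner_integral_integral_eq[OF hb] show ?thesis using True by simp
  qed
  finally show ?thesis .
qed

lemma hahn_kernel_limit_sine:
  fixes N a b n s :: "nat \<Rightarrow> nat" and A B t x :: real and i i' :: int
  assumes N: "filterlim N at_top sequentially" and N0: "\<And>k. 0 < N k"
    and a: "\<And>k. real (a k) = A * real (N k)" and b: "\<And>k. real (b k) = B * real (N k)"
    and AB: "0 < A" "0 < B" and n: "\<And>k. real (n k) = t * real (N k)" and t: "0 < t" "t < 1"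
    and s: "(\<lambda>k. real (s k) / real (N k)) \<longlonglongrightarrow> x" and x: "0 < x" "x < 1"
  shows "(\<lambda>k. \<Sum>j<n k. hahn_fun (N k) (a k) (b k) j (site (s k) i) * hahn_fun (N k) (a k) (b k) j (site (s k) i'))
    \<longlonglongrightarrow> sine_kernel (hahn_density A B t x) i i'"
proof -
  define q where "q = sqrt ((1 - x) * (1 - x + A) * (x * (x + B)))"
  have q: "0 < q" using x AB by (simp add: q_def)
  have "(\<integral>th. (if (1 - x) * (1 - x + A) + x * (x + B) - 2 * q * cos th < t * (2 + A + B - t)
      then cos (of_int (i - i') * th) / pi else 0) \<partial>half_circle) = sine_kernel (hahn_density A B t x) i i'"
    unfolding spectral_cutoff_integral[OF q]
    by (auto simp: sine_kernel_def hahn_density_def q_def mult_ac)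
  then show ?thesis
    using hahn_kernel_limit[OF N N0 a b AB n t s x, of i i'] unfolding q_def by simp
qed

text \<open>At an integer d one has sin (pi d) = 0 and cos (pi d) = (-1)^d, so the kernel of the
  complementary projection is a sine kernel of density 1 - \<rho> up to sign.\<close>

lemma sine_kernel_complement:
  "(if i = j then 1 else 0) - sine_kernel \<rho> i j = (-1) ^ nat \<bar>i - j\<bar> * sine_kernel (1 - \<rho>) i j"
proof (cases "i = j")
  case False
  define d where "d = i - j"
  have d: "d \<noteq> 0" using False by (simp add: d_def)
  have c: "cos (pi * of_int d) = (-1) ^ nat \<bar>d\<bar>"
  proof -
    have "cos (pi * of_int d) = cos (real (nat \<bar>d\<bar>) * pi)"
    proof (cases "d \<ge> 0")
      case False
      then have "real (nat \<bar>d\<bar>) * pi = - (pi * of_int d)" by simp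
      then show ?thesis by (simp only: cos_minus)
    qed (simp add: mult.commute)
    then show ?thesis by (simp only: cos_npi)
  qed
  have s: "sin (pi * of_int d) = 0" by (rule sin_npi_int[of d, unfolded mult.commute[of "real_of_int d"]])
  have "sin (pi * (1 - \<rho>) * of_int d) = sin (pi * of_int d - pi * \<rho> * of_int d)" by (simp add: algebra_simps)
  also have "\<dots> = - ((-1) ^ nat \<bar>d\<bar> * sin (pi * \<rho> * of_int d))"
    unfolding sin_diff s c by simp
  finally have "(-1) ^ nat \<bar>d\<bar> * sin (pi * (1 - \<rho>) * of_int d) = - sin (pi * \<rho> * of_int d)"
    by simp
  then show ?thesis using False by (simp add: sine_kernel_def d_def)
qed (simp add: sine_kernel_def)

theorem hahn_ensemble_gap_probability:
  fixes N a b n s j :: "nat \<Rightarrow> nat" and A B t x :: real and M p :: nat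
  assumes N: "filterlim N at_top sequentially" and N0: "\<And>k. 0 < N k"
    and a: "\<And>k. real (a k) = A * real (N k)" and b: "\<And>k. real (b k) = B * real (N k)"
    and AB: "0 < A" "0 < B" and n: "\<And>k. real (n k) = t * real (N k)" and t: "0 < t" "t < 1"
    and s: "(\<lambda>k. real (s k) / real (N k)) \<longlonglongrightarrow> x" and x: "0 < x" "x < 1"
    and j: "inj_on j {..M}"
  defines "W \<equiv> \<lambda>k Y. discriminant Y * (\<Prod>r\<in>Y. hahn_weight (N k) (a k) (b k) r)"
    and "Ys \<equiv> \<lambda>k. {Y. Y \<subseteq> {..<N k} \<and> card Y = n k}"
  shows "(\<lambda>k. (\<Sum>Y\<in>{Y\<in>Ys k. card {u. u < Suc M \<and> s k + j u \<notin> Y} = p}. W k Y) / (\<Sum>Y\<in>Ys k. W k Y))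
     \<longlonglongrightarrow> 1 / fact p * ((-1) ^ p * (deriv ^^ p) (\<lambda>z. Determinant.det
            (1\<^sub>m (Suc M) - z \<cdot>\<^sub>m sine_matrix (1 - hahn_density A B t x) M j)) 1)"
proof (rule coefficients_converge[where r = "Suc M"])
  define r where "r = Suc M"
  define \<rho> where "\<rho> = hahn_density A B t x"
  define f where "f z = mdet (1\<^sub>m r - z \<cdot>\<^sub>m sine_matrix (1 - \<rho>) M j)" for z
  have f: "f z = mdet (Matrix.mat r r (\<lambda>(u,v). (if u = v then 1 else 0) - z * sine_kernel (1 - \<rho>) (int (j u)) (int (j v))))" for z
    unfolding f_def sine_matrix_def by (intro arg_cong[where f = Determinant.det] eq_matI) (auto simp: r_def)
  show "isCont (\<lambda>z. mdet (1\<^sub>m (Suc M) - z \<cdot>\<^sub>m sine_matrix (1 - hahn_density A B t x) M j)) 1"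
    unfolding \<rho>_def[symmetric] r_def[symmetric] f_def[symmetric] isCont_def f
    by (intro tendsto_det tendsto_intros)
  show "(\<Sum>Y\<in>{Y\<in>Ys k. card {u. u < Suc M \<and> s k + j u \<notin> Y} = q}. W k Y) / (\<Sum>Y\<in>Ys k. W k Y) = 0"
    if "q > Suc M" for k q
  proof -
    have "card {u. u < Suc M \<and> s k + j u \<notin> Y} \<le> Suc M" for Y
      using card_mono[of "{..<Suc M}" "{u. u < Suc M \<and> s k + j u \<notin> Y}"] by auto
    then have "{Y\<in>Ys k. card {u. u < Suc M \<and> s k + j u \<notin> Y} = q} = {}"
      using that by (metis (mono_tags, lifting) Collect_empty_eq not_less)
    then show ?thesis by (simp only: sum.empty div_0)
  qed
  fix z :: real assume z: "z \<noteq> 1"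
  define K where "K k u v = (\<Sum>i<n k. hahn_fun (N k) (a k) (b k) i (s k + j u) * hahn_fun (N k) (a k) (b k) i (s k + j v))" for k u v
  have Nr: "0 < real (N k)" for k using N0[of k] by simp
  have nN: "n k < N k" for k
  proof -
    have "real (n k) < real (N k)" unfolding n using t Nr[of k] by simp
    then show ?thesis by simp
  qed
  have inN: "\<forall>\<^sub>F k in sequentially. (\<lambda>u. s k + j u) ` {..<r} \<subseteq> {..<N k}"
  proof -
    have "\<forall>\<^sub>F k in sequentially. \<forall>u\<in>{..<r}. s k + j u < N k"
    proof (rule eventually_ball_finite)
      show "\<forall>u\<in>{..<r}. \<forall>\<^sub>F k in sequentially. s k + j u < N k"
      proof
        fix u
        have "(\<lambda>k. real (j u) / real (N k)) \<longlonglongrightarrow> 0"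
          by (rule tendsto_divide_0[OF tendsto_const filterlim_at_top_imp_at_infinity[OF filterlim_compose[OF filterlim_real_sequentially N]]])
        from tendsto_add[OF s this] have "(\<lambda>k. real (s k) / real (N k) + real (j u) / real (N k)) \<longlonglongrightarrow> x" by simp
        then have "\<forall>\<^sub>F k in sequentially. real (s k) / real (N k) + real (j u) / real (N k) < 1"
          using x by (intro order_tendstoD) auto
        then show "\<forall>\<^sub>F k in sequentially. s k + j u < N k"
        proof eventually_elim
          case (elim k)
          then have "(real (s k) + real (j u)) / real (N k) < 1" by (simp add: add_divide_distrib)
          then show ?case using Nr[of k] by (simp add: divide_less_eq)
        qed
      qed
    qed simp
    then show ?thesis by eventually_elim auto
  qed
  have Klim: "(\<lambda>k. K k u v) \<longlonglongrightarrow> sine_kernel \<rho> (int (j u)) (int (j v))" for u v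
  proof -
    have "site (s k) (int (j u)) = s k + j u" for k u by (simp add: site_def nat_add_distrib)
    then show ?thesis
      using hahn_kernel_limit_sine[OF N N0 a b AB n t s x, of "int (j u)" "int (j v)"] by (simp add: K_def \<rho>_def)
  qed
  \<comment> \<open>The parity of |j u - j v| splits into the parities of j u and j v, which
    exhibits the sign as a diagonal conjugation.\<close>
  define er :: "nat \<Rightarrow> real" where "er u = (-1) ^ j u" for u
  have eps: "(-1) ^ nat \<bar>int (j u) - int (j v)\<bar> = er u * er v" for u v
  proof -
    have "even (nat \<bar>int (j u) - int (j v)\<bar>) \<longleftrightarrow> (even (j u) \<longleftrightarrow> even (j v))"
      by (cases "j u \<ge> j v") (auto simp: even_nat_iff)
    then show ?thesis by (auto simp: er_def minus_one_power_iff)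
  qed
  have "(\<lambda>k. mdet (Matrix.mat r r (\<lambda>(u,v). (if u = v then 1 else 0) - z * ((if u = v then 1 else 0) - K k u v))))
     \<longlonglongrightarrow> mdet (Matrix.mat r r (\<lambda>(u,v). (if u = v then 1 else 0) - z * ((if u = v then 1 else 0) - sine_kernel \<rho> (int (j u)) (int (j v)))))"
    by (intro tendsto_det tendsto_intros Klim)
  also have "mdet (Matrix.mat r r (\<lambda>(u,v). (if u = v then 1 else 0) - z * ((if u = v then 1 else 0) - sine_kernel \<rho> (int (j u)) (int (j v)))))
     = mdet (Matrix.mat r r (\<lambda>(u,v). er u * er v * ((if u = v then 1 else 0) - z * sine_kernel (1 - \<rho>) (int (j u)) (int (j v)))))"
  proof (intro arg_cong[where f = Determinant.det] eq_matI, goal_cases)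
    case (1 u v)
    then have uv: "u < r" "v < r" by auto
    have "u = v \<longleftrightarrow> int (j u) = int (j v)" using j uv by (auto simp: inj_on_def r_def)
    then have comp: "(if u = v then 1 else 0) - sine_kernel \<rho> (int (j u)) (int (j v))
       = er u * er v * sine_kernel (1 - \<rho>) (int (j u)) (int (j v))"
      unfolding eps[symmetric] sine_kernel_complement[symmetric] by simp
    have "er u * er u = 1" by (simp add: er_def minus_one_power_iff)
    then have "(if u = v then 1 else 0) - z * ((if u = v then 1 else 0) - sine_kernel \<rho> (int (j u)) (int (j v)))
       = er u * er v * ((if u = v then 1 else 0) - z * sine_kernel (1 - \<rho>) (int (j u)) (int (j v)))"
      unfolding comp by (cases "u = v") simp_all
    then show ?case using uv by simp
  qed auto
  also have "\<dots> = f z"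
    unfolding f by (rule det_sign_conjugate) (simp add: er_def minus_one_power_iff)
  finally have lim: "(\<lambda>k. mdet (Matrix.mat r r (\<lambda>(u,v). (if u = v then 1 else 0) - z * ((if u = v then 1 else 0) - K k u v)))) \<longlonglongrightarrow> f z" .
  have inj: "inj_on (\<lambda>u. s k + j u) {..<r}" for k
    using j by (auto simp: inj_on_def r_def less_Suc_eq_le)
  have "\<forall>\<^sub>F k in sequentially. mdet (Matrix.mat r r (\<lambda>(u,v). (if u = v then 1 else 0) - z * ((if u = v then 1 else 0) - K k u v)))
     = (\<Sum>q\<le>r. (\<Sum>Y\<in>{Y\<in>Ys k. card {u. u < r \<and> s k + j u \<notin> Y} = q}. W k Y) / (\<Sum>Y\<in>Ys k. W k Y) * (1 - z) ^ q)"
    using inN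
  proof eventually_elim
    case (elim k)
    show ?case unfolding W_def Ys_def K_def
      by (rule orthogonal_ensemble_gaps[where Q = "hahn_poly (N k) (a k) (b k)" and h = "hahn_norm (N k) (a k) (b k)"
           and b = "\<lambda>u. s k + j u" and \<psi> = "hahn_fun (N k) (a k) (b k)", symmetric])
         (use nN[of k] elim inj[of k] z in \<open>auto simp: degree_hahn_poly coeff_hahn_poly_top hahn_norm_pos hahn_weight_pos
             hahn_poly_orthogonal hahn_fun_def\<close>)
  qed
  from Lim_transform_eventually[OF lim this]
  show "(\<lambda>k. \<Sum>q\<le>Suc M. (\<Sum>Y\<in>{Y\<in>Ys k. card {u. u < Suc M \<and> s k + j u \<notin> Y} = q}. W k Y) / (\<Sum>Y\<in>Ys k. W k Y) * (1 - z) ^ q)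
     \<longlonglongrightarrow> mdet (1\<^sub>m (Suc M) - z \<cdot>\<^sub>m sine_matrix (1 - hahn_density A B t x) M j)"
    by (simp only: f_def r_def \<rho>_def)
qed

section \<open>The equilibrium measure\<close>

text \<open>Measures of bounded density are represented by their densities with respect to this
  probability measure; energies become integrals of bounded functions against an integrable
  kernel.\<close>

definition unif :: "real measure" where
  "unif = restrict_space lborel {0..1}"

abbreviation "unif2 \<equiv> unif \<Otimes>\<^sub>M unif"

definition logker :: "real \<Rightarrow> real" where
  "logker w = - ln \<bar>w\<bar>"

definition log_energy :: "(real \<Rightarrow> real) \<Rightarrow> (real \<Rightarrow> real) \<Rightarrow> real" where
  "log_energy f g = (LINT z|unif2. logker (fst z - snd z) * (f (fst z) * g (snd z)))"

definition bddm :: "(real \<Rightarrow> real) \<Rightarrow> bool" where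
  "bddm f \<longleftrightarrow> f \<in> borel_measurable borel \<and> (\<exists>K. \<forall>x. \<bar>f x\<bar> \<le> K)"

lemma space_unif: "space unif = {0..1}" by (simp add: unif_def space_restrict_space)

lemma prob_space_unif: "prob_space unif"
  by (rule prob_spaceI) (simp add: unif_def emeasure_restrict_space space_restrict_space)

interpretation unif: prob_space unif by (rule prob_space_unif)
interpretation unif2: pair_prob_space unif unif ..

lemma borel_measurable_unif [measurable (raw)]: "f \<in> borel_measurable borel \<Longrightarrow> f \<in> borel_measurable unif"
  unfolding unif_def by (intro measurable_restrict_space1) simp

lemma measurable_ident_unif: "(\<lambda>x. x) \<in> unif \<rightarrow>\<^sub>M borel"
  by (rule borel_measurable_unif) simp

lemma measurable_fst_unif2 [measurable]: "fst \<in> unif2 \<rightarrow>\<^sub>M borel"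
  by (rule measurable_compose[OF measurable_fst measurable_ident_unif])

lemma measurable_snd_unif2 [measurable]: "snd \<in> unif2 \<rightarrow>\<^sub>M borel"
  by (rule measurable_compose[OF measurable_snd measurable_ident_unif])

lemma measurable_logker [measurable]: "logker \<in> borel_measurable borel"
  unfolding logker_def by measurable

lemma bddm_measurable: "bddm f \<Longrightarrow> f \<in> borel_measurable borel" by (simp add: bddm_def)

lemma bddmI: "f \<in> borel_measurable borel \<Longrightarrow> (\<And>x. \<bar>f x\<bar> \<le> K) \<Longrightarrow> bddm f"
  by (auto simp: bddm_def)

lemma bddm_lin: assumes "bddm f" "bddm g" shows "bddm (\<lambda>x. a * f x + b * g x)"
proof -
  obtain K L where KL: "\<And>x. \<bar>f x\<bar> \<le> K" "\<And>x. \<bar>g x\<bar> \<le> L" using assms by (auto simp: bddm_def)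
  have [measurable]: "f \<in> borel_measurable borel" "g \<in> borel_measurable borel" using assms by (auto simp: bddm_def)
  show ?thesis
  proof (rule bddmI[where K = "\<bar>a\<bar> * K + \<bar>b\<bar> * L"])
    fix x
    have "\<bar>a * f x + b * g x\<bar> \<le> \<bar>a * f x\<bar> + \<bar>b * g x\<bar>" by (rule abs_triangle_ineq)
    also have "\<dots> \<le> \<bar>a\<bar> * K + \<bar>b\<bar> * L" unfolding abs_mult using KL by (intro add_mono mult_left_mono) auto
    finally show "\<bar>a * f x + b * g x\<bar> \<le> \<bar>a\<bar> * K + \<bar>b\<bar> * L" .
  qed measurable
qed

lemma bddm_diff: "bddm f \<Longrightarrow> bddm g \<Longrightarrow> bddm (\<lambda>x. f x - g x)"
  using bddm_lin[of f g 1 "-1"] by simp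

lemma integral_unif: "(LINT u|unif. f u) = (LINT u|lborel. indicator {0..1} u * f u)" for f :: "real \<Rightarrow> real"
  unfolding unif_def by (subst integral_restrict_space) auto

lemma integrable_unif: "integrable unif f \<longleftrightarrow> integrable lborel (\<lambda>u. indicator {0..1} u * f u)" for f :: "real \<Rightarrow> real"
  unfolding unif_def by (subst integrable_restrict_space) auto

lemma AE_unif_neq: "AE v in unif. v \<noteq> u"
  unfolding unif_def by (subst AE_restrict_space_iff) (auto intro: AE_mp[OF AE_lborel_singleton[of u]])

lemma integrable_unif_bddm: assumes "bddm f" shows "integrable unif f"
proof -
  obtain K where K: "\<And>x. \<bar>f x\<bar> \<le> K" using assms by (auto simp: bddm_def)
  show ?thesis
    by (rule unif.integrable_const_bound[where B = K]) (use K bddm_measurable[OF assms] in auto)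
qed

text \<open>Apply ln y \<le> y to an inverse square root. The bound gives continuity of z ln |z| at
  0, where the value is 0.\<close>

lemma abs_xlnx_le: "\<bar>z * ln \<bar>z\<bar>\<bar> \<le> 2 * sqrt \<bar>z\<bar>" if "\<bar>z\<bar> \<le> 1" for z :: real
proof (cases "z = 0")
  case False
  define y where "y = \<bar>z\<bar>"
  have y: "0 < y" "y \<le> 1" using that False by (auto simp: y_def)
  have "ln (1 / sqrt y) \<le> 1 / sqrt y" using y ln_bound[of "1 / sqrt y"] by simp
  then have "- ln y \<le> 2 / sqrt y" using y by (simp add: ln_div ln_sqrt)
  then have "y * (- ln y) \<le> y * (2 / sqrt y)" using y by (intro mult_left_mono) auto
  also have "\<dots> = 2 * (y / sqrt y)" by simp
  also have "\<dots> = 2 * sqrt y" using y by (simp only: real_div_sqrt less_imp_le)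
  finally have "y * (- ln y) \<le> 2 * sqrt y" .
  moreover have "\<bar>z * ln \<bar>z\<bar>\<bar> = y * (- ln y)" using y by (simp add: abs_mult y_def ln_le_zero_iff abs_of_nonpos)
  ultimately show ?thesis by (simp add: y_def)
qed simp

lemma continuous_xlnx: "continuous_on UNIV (\<lambda>z::real. z * ln \<bar>z\<bar>)"
  unfolding continuous_on_eq_continuous_at[OF open_UNIV]
proof
  fix z :: real
  show "isCont (\<lambda>z. z * ln \<bar>z\<bar>) z"
  proof (cases "z = 0")
    case True
    have "((\<lambda>z::real. 2 * sqrt \<bar>z\<bar>) \<longlongrightarrow> 2 * sqrt \<bar>0\<bar>) (at 0)" by (intro tendsto_intros)
    then have "((\<lambda>z::real. z * ln \<bar>z\<bar>) \<longlongrightarrow> 0) (at 0)"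
    proof (rule Lim_null_comparison[rotated, OF tendsto_eq_rhs])
      show "\<forall>\<^sub>F z in at 0. norm (z * ln \<bar>z\<bar>) \<le> 2 * sqrt \<bar>z :: real\<bar>"
        unfolding eventually_at by (rule exI[of _ 1]) (auto simp: dist_real_def simp del: abs_mult intro!: abs_xlnx_le)
    qed simp
    then show ?thesis using True by (simp add: isCont_def)
  qed (auto intro!: continuous_intros)
qed

lemma xlnx_ge: "-1 \<le> z * ln z" if "0 \<le> z" for z :: real
proof (cases "z = 0")
  case False
  then have z: "0 < z" using that by simp
  have "ln (1 / z) \<le> 1 / z - 1" using z by (intro ln_le_minus_one) simp
  then have "1 - 1 / z \<le> ln z" using z by (simp add: ln_div)
  then have "z * (1 - 1 / z) \<le> z * ln z" using z by (intro mult_left_mono) auto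
  then show ?thesis using z by (simp add: right_diff_distrib)
qed simp

lemma logker_nonneg: "u \<in> {0..1} \<Longrightarrow> v \<in> {0..1} \<Longrightarrow> 0 \<le> logker (u - v)"
  by (cases "u = v") (auto simp: logker_def)

text \<open>The antiderivative (v - u) - (v - u) ln |v - u| is continuous across the singularity, so
  the fundamental theorem of calculus applies with v = u as exceptional point.\<close>

lemma logker_integral:
  assumes u: "u \<in> {0..1}"
  shows "integrable unif (\<lambda>v. logker (u - v))"
    "(LINT v|unif. logker (u - v)) = 1 - u * ln u - (1 - u) * ln (1 - u)"
proof -
  define F where "F v = (v - u) - (v - u) * ln \<bar>v - u\<bar>" for v
  have "((\<lambda>v. logker (u - v)) has_integral (F 1 - F 0)) {0..1}"
  proof (rule fundamental_theorem_of_calculus_interior_strong[where S = "{u}"])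
    fix v assume v: "v \<in> {0<..<1} - {u}"
    have "((\<lambda>v. (v - u) - (v - u) * ln \<bar>v - u\<bar>) has_real_derivative - ln \<bar>v - u\<bar>) (at v)"
    proof (cases "v > u")
      case True
      have "((\<lambda>v. (v - u) - (v - u) * ln (v - u)) has_real_derivative - ln (v - u)) (at v)"
        using True by (auto intro!: derivative_eq_intros)
      then show ?thesis
        by (rule DERIV_cong_ev[THEN iffD1, rotated -1])
           (use True eventually_nhds_in_open[of "{u<..}" v] in \<open>auto elim!: eventually_mono\<close>)
    next
      case False
      have "((\<lambda>v. (v - u) - (v - u) * ln (u - v)) has_real_derivative - ln (u - v)) (at v)"
        using False v by (auto intro!: derivative_eq_intros simp: divide_simps)
      then show ?thesis
        by (rule DERIV_cong_ev[THEN iffD1, rotated -1])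
           (use False v eventually_nhds_in_open[of "{..<u}" v] in \<open>auto elim!: eventually_mono\<close>)
    qed
    then show "(F has_vector_derivative logker (u - v)) (at v)"
      by (simp add: F_def[abs_def] logker_def abs_minus_commute has_real_derivative_iff_has_vector_derivative)
  next
    have "continuous_on UNIV (\<lambda>v. (v - u) * ln \<bar>v - u\<bar>)"
      by (rule continuous_on_compose2[OF continuous_xlnx]) (auto intro!: continuous_intros)
    then have "continuous_on {0..1} (\<lambda>v. (v - u) * ln \<bar>v - u\<bar>)" by (rule continuous_on_subset) simp
    then show "continuous_on {0..1} F" unfolding F_def
      by (intro continuous_on_diff continuous_on_id continuous_on_const)
  qed auto
  moreover have "F 1 - F 0 = 1 - u * ln u - (1 - u) * ln (1 - u)"
    using u by (simp add: F_def)
  ultimately have hi: "((\<lambda>v. logker (u - v)) has_integral (1 - u * ln u - (1 - u) * ln (1 - u))) {0..1}" by simp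
  have nn: "integral\<^sup>N lborel (\<lambda>v. ennreal (indicator {0..1} v * logker (u - v))) = 1 - u * ln u - (1 - u) * ln (1 - u)"
    by (rule nn_integral_has_integral_lebesgue[OF _ hi]) (use u logker_nonneg in auto)
  have pos: "0 \<le> indicator {0..1} v * logker (u - v)" for v
    using u logker_nonneg[of u v] by (auto simp: indicator_def)
  have "has_bochner_integral lborel (\<lambda>v. indicator {0..1} v * logker (u - v)) (1 - u * ln u - (1 - u) * ln (1 - u))"
    by (rule has_bochner_integral_nn_integral[OF _ _ _ nn])
       (use pos has_integral_nonneg[OF hi] u logker_nonneg in auto)
  then show "integrable unif (\<lambda>v. logker (u - v))"
    "(LINT v|unif. logker (u - v)) = 1 - u * ln u - (1 - u) * ln (1 - u)"
    unfolding integrable_unif integral_unif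
    by (auto simp: has_bochner_integral_iff)
qed

lemma logker_integral_le:
  assumes "u \<in> {0..1}" shows "(LINT v|unif. logker (u - v)) \<le> 3"
  unfolding logker_integral(2)[OF assms] using xlnx_ge[of u] xlnx_ge[of "1 - u"] assms by auto

lemma integrable_logker: "integrable unif2 (\<lambda>z. logker (fst z - snd z))"
proof (rule unif2.Fubini_integrable)
  show "integrable unif (\<lambda>x. LINT y|unif. norm (logker (fst (x, y) - snd (x, y))))"
  proof (rule unif.integrable_const_bound[where B = 3])
    show "AE x in unif. norm (LINT y|unif. norm (logker (fst (x, y) - snd (x, y)))) \<le> 3"
    proof (rule AE_I2)
      fix x assume "x \<in> space unif"
      then have x: "x \<in> {0..1}" by (simp add: space_unif)
      have "(LINT y|unif. norm (logker (x - y))) = (LINT y|unif. logker (x - y))"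
        by (intro bochner_cong refl) (use x logker_nonneg in \<open>auto simp: space_unif\<close>)
      moreover have "0 \<le> (LINT y|unif. norm (logker (x - y)))" by simp
      ultimately show "norm (LINT y|unif. norm (logker (fst (x, y) - snd (x, y)))) \<le> 3"
        using logker_integral_le[OF x] by simp
    qed
  qed measurable
  show "AE x in unif. integrable unif (\<lambda>y. logker (fst (x, y) - snd (x, y)))"
    by (rule AE_I2) (simp add: space_unif logker_integral(1))
qed measurable

lemma integrable_logker_bddm:
  assumes "bddm f" "bddm g"
  shows "integrable unif2 (\<lambda>z. logker (fst z - snd z) * (f (fst z) * g (snd z)))"
proof -
  obtain K L where KL: "\<And>x. \<bar>f x\<bar> \<le> K" "\<And>x. \<bar>g x\<bar> \<le> L" using assms by (auto simp: bddm_def)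
  have [measurable]: "f \<in> borel_measurable borel" "g \<in> borel_measurable borel" using assms by (auto simp: bddm_def)
  show ?thesis
  proof (rule Bochner_Integration.integrable_bound[where f = "\<lambda>z. K * L * logker (fst z - snd z)"])
    have "\<bar>logker (fst z - snd z) * (f (fst z) * g (snd z))\<bar> \<le> \<bar>K * L * logker (fst z - snd z)\<bar>" for z
    proof -
      have "\<bar>f (fst z) * g (snd z)\<bar> \<le> K * L" unfolding abs_mult using KL by (intro mult_mono) (auto intro: order.trans[OF abs_ge_zero])
      then have "\<bar>f (fst z) * g (snd z)\<bar> \<le> \<bar>K * L\<bar>" by linarith
      then show ?thesis unfolding abs_mult[of _ "logker _"] abs_mult[of "logker _"]
        by (subst mult.commute) (intro mult_right_mono, auto)
    qed
    then show "AE z in unif2. norm (logker (fst z - snd z) * (f (fst z) * g (snd z))) \<le> norm (K * L * logker (fst z - snd z))"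
      by simp
  qed (use integrable_logker in \<open>auto\<close>)
qed

lemma log_energy_lin_left:
  assumes "bddm f" "bddm g" "bddm h"
  shows "log_energy (\<lambda>x. a * f x + b * g x) h = a * log_energy f h + b * log_energy g h"
proof -
  have "log_energy (\<lambda>x. a * f x + b * g x) h = (\<integral>z. a * (logker (fst z - snd z) * (f (fst z) * h (snd z)))
      + b * (logker (fst z - snd z) * (g (fst z) * h (snd z))) \<partial>unif2)"
    unfolding log_energy_def by (intro bochner_cong refl) (simp add: algebra_simps)
  also have "\<dots> = a * log_energy f h + b * log_energy g h"
    unfolding log_energy_def using integrable_logker_bddm[OF assms(1,3)] integrable_logker_bddm[OF assms(2,3)] by simp
  finally show ?thesis .
qed

lemma log_energy_commute: assumes "bddm f" "bddm g" shows "log_energy f g = log_energy g f"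
proof -
  have "log_energy f g = (\<integral>(x,y). logker (x - y) * (f x * g y) \<partial>unif2)"
    by (simp add: log_energy_def case_prod_unfold)
  also have "\<dots> = (\<integral>(x,y). logker (y - x) * (f y * g x) \<partial>unif2)"
    using integrable_logker_bddm[OF assms]
    by (subst unif2.integral_product_swap[symmetric]) (auto simp: case_prod_unfold)
  also have "\<dots> = log_energy g f"
    by (simp add: log_energy_def case_prod_unfold logker_def abs_minus_commute mult_ac)
  finally show ?thesis .
qed

lemma log_energy_lin_right:
  assumes "bddm f" "bddm g" "bddm h"
  shows "log_energy h (\<lambda>x. a * f x + b * g x) = a * log_energy h f + b * log_energy h g"
  using assms bddm_lin[OF assms(1,2)] by (simp add: log_energy_commute[of h] log_energy_lin_left)

lemma log_energy_square:
  assumes "bddm f" "bddm g"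
  shows "log_energy (\<lambda>x. a * f x + b * g x) (\<lambda>x. a * f x + b * g x)
    = a\<^sup>2 * log_energy f f + 2 * a * b * log_energy f g + b\<^sup>2 * log_energy g g"
  using assms bddm_lin[OF assms]
  by (simp add: log_energy_lin_left log_energy_lin_right log_energy_commute[of g f] power2_eq_square algebra_simps)

lemma log_energy_iterated:
  assumes "bddm f" "bddm g"
  shows "log_energy f g = (LINT x|unif. f x * (LINT y|unif. logker (x - y) * g y))"
proof -
  have "log_energy f g = (LINT x|unif. (LINT y|unif. logker (x - y) * (f x * g y)))"
    unfolding log_energy_def using unif2.integral_fst'[OF integrable_logker_bddm[OF assms]] by simp
  also have "\<dots> = (LINT x|unif. f x * (LINT y|unif. logker (x - y) * g y))"
    by (intro bochner_cong refl) (simp add: mult.left_commute)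
  finally show ?thesis .
qed

subsection \<open>Positivity\<close>

text \<open>A superposition of rank-one kernels has nonnegative energy: by Fubini the double
  integral becomes an integral of squares.\<close>

lemma gram_kernel_integral:
  fixes h :: "'p \<Rightarrow> real \<Rightarrow> real"
  assumes P: "finite_measure P" and h [measurable]: "case_prod h \<in> borel_measurable (P \<Otimes>\<^sub>M borel)"
    and C: "\<And>p u. \<bar>h p u\<bar> \<le> C" and f: "bddm f"
  shows "integrable unif2 (\<lambda>z. (LINT p|P. h p (fst z) * h p (snd z)) * (f (fst z) * f (snd z)))"
    "(LINT z|unif2. (LINT p|P. h p (fst z) * h p (snd z)) * (f (fst z) * f (snd z)))
      = (LINT p|P. (LINT u|unif. h p u * f u)\<^sup>2)"
proof -
  interpret P: finite_measure P by fact
  interpret PU: pair_sigma_finite P unif2 ..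
  interpret PUf: finite_measure "P \<Otimes>\<^sub>M unif2"
    by (intro finite_measure_pair_measure P unif2.P.finite_measure_axioms)
  obtain K where K: "\<And>x. \<bar>f x\<bar> \<le> K" using f by (auto simp: bddm_def)
  have [measurable]: "f \<in> borel_measurable borel" using f by (auto simp: bddm_def)
  have C0: "0 \<le> C" using C[of undefined undefined] by linarith
  have K0: "0 \<le> K" using K[of 0] by linarith
  have hm [measurable]: "h p \<in> borel_measurable borel" if "p \<in> space P" for p
    using measurable_Pair2[OF h that] by simp
  have hf: "\<bar>h p u * f u\<bar> \<le> C * K" for p u
    unfolding abs_mult using C K C0 by (intro mult_mono) auto
  have inth: "integrable unif (\<lambda>u. h p u * f u)" if "p \<in> space P" for p
    by (rule unif.integrable_const_bound[where B = "C * K"]) (use hf that in auto)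
  have int: "integrable (P \<Otimes>\<^sub>M unif2) (\<lambda>(p, z). (h p (fst z) * f (fst z)) * (h p (snd z) * f (snd z)))"
  proof (rule PUf.integrable_const_bound[where B = "(C * K) * (C * K)"])
    have "\<bar>(h p u * f u) * (h p v * f v)\<bar> \<le> (C * K) * (C * K)" for p u v
      unfolding abs_mult[of "h p u * f u"] using hf C0 K0 by (intro mult_mono) auto
    then show "AE x in P \<Otimes>\<^sub>M unif2. norm (case x of (p, z) \<Rightarrow> (h p (fst z) * f (fst z)) * (h p (snd z) * f (snd z))) \<le> (C * K) * (C * K)"
      by (auto simp: case_prod_unfold)
    have m: "(\<lambda>x. (fst x, fst (snd x))) \<in> P \<Otimes>\<^sub>M unif2 \<rightarrow>\<^sub>M P \<Otimes>\<^sub>M borel"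
      "(\<lambda>x. (fst x, snd (snd x))) \<in> P \<Otimes>\<^sub>M unif2 \<rightarrow>\<^sub>M P \<Otimes>\<^sub>M borel" by measurable
    have [measurable]: "(\<lambda>x. h (fst x) (fst (snd x))) \<in> borel_measurable (P \<Otimes>\<^sub>M unif2)"
      "(\<lambda>x. h (fst x) (snd (snd x))) \<in> borel_measurable (P \<Otimes>\<^sub>M unif2)"
      using measurable_compose[OF m(1) h] measurable_compose[OF m(2) h] by simp_all
    show "(\<lambda>(p, z). (h p (fst z) * f (fst z)) * (h p (snd z) * f (snd z))) \<in> borel_measurable (P \<Otimes>\<^sub>M unif2)"
      unfolding case_prod_unfold by measurable
  qed
  have k: "(LINT p|P. h p (fst z) * h p (snd z)) * (f (fst z) * f (snd z))
      = (LINT p|P. (h p (fst z) * f (fst z)) * (h p (snd z) * f (snd z)))" for z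
  proof -
    have "(LINT p|P. (h p (fst z) * f (fst z)) * (h p (snd z) * f (snd z)))
       = (LINT p|P. (h p (fst z) * h p (snd z)) * (f (fst z) * f (snd z)))"
      by (intro bochner_cong refl) (simp add: mult_ac)
    then show ?thesis by simp
  qed
  show "integrable unif2 (\<lambda>z. (LINT p|P. h p (fst z) * h p (snd z)) * (f (fst z) * f (snd z)))"
    unfolding k using PU.integrable_snd[OF int] by simp
  have "(LINT z|unif2. (LINT p|P. h p (fst z) * h p (snd z)) * (f (fst z) * f (snd z)))
     = (LINT p|P. (LINT z|unif2. (h p (fst z) * f (fst z)) * (h p (snd z) * f (snd z))))"
    unfolding k using PU.Fubini_integral[OF int] by simp
  also have "\<dots> = (LINT p|P. (LINT u|unif. h p u * f u)\<^sup>2)"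
  proof (rule bochner_cong[OF refl])
    fix p assume p: "p \<in> space P"
    note [measurable] = hm[OF p]
    have i2: "integrable unif2 (\<lambda>z. (h p (fst z) * f (fst z)) * (h p (snd z) * f (snd z)))"
    proof (rule unif2.P.integrable_const_bound[where B = "(C * K) * (C * K)"])
      have "\<bar>(h p u * f u) * (h p v * f v)\<bar> \<le> (C * K) * (C * K)" for u v
        unfolding abs_mult[of "h p u * f u"] using hf C0 K0 by (intro mult_mono) auto
      then show "AE z in unif2. norm ((h p (fst z) * f (fst z)) * (h p (snd z) * f (snd z))) \<le> (C * K) * (C * K)" by auto
    qed measurable
    have "(LINT z|unif2. (h p (fst z) * f (fst z)) * (h p (snd z) * f (snd z)))
      = (LINT u|unif. (LINT v|unif. (h p u * f u) * (h p v * f v)))"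
      using unif2.integral_fst'[OF i2] by simp
    also have "\<dots> = (LINT u|unif. h p u * f u)\<^sup>2"
      by (simp add: power2_eq_square)
    finally show "(LINT z|unif2. (h p (fst z) * f (fst z)) * (h p (snd z) * f (snd z))) = (LINT u|unif. h p u * f u)\<^sup>2" .
  qed
  finally show "(LINT z|unif2. (LINT p|P. h p (fst z) * h p (snd z)) * (f (fst z) * f (snd z)))
      = (LINT p|P. (LINT u|unif. h p u * f u)\<^sup>2)" .
qed

text \<open>Parameters (r, z) of a window of length r with right end z. Right ends up to 2 reach
  every window of length at most 1 that meets [0, 1]; the cutoff \<open>er\<close> keeps 1 / r
  bounded.\<close>

definition strip :: "real \<Rightarrow> (real \<times> real) measure" where
  "strip er = restrict_space lborel {er..1} \<Otimes>\<^sub>M restrict_space lborel {0..2}"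

text \<open>The indicator of the window [z - r, z] scaled by 1 / r. On \<open>strip er\<close> the
  maximum equals r; it makes the bound 1 / er hold for every p.\<close>

definition windowed :: "real \<Rightarrow> real \<times> real \<Rightarrow> real \<Rightarrow> real" where
  "windowed er p u = (if snd p - fst p \<le> u \<and> u \<le> snd p then 1 / max er (fst p) else 0)"

definition truncker :: "real \<Rightarrow> real \<Rightarrow> real \<Rightarrow> real" where
  "truncker er u v = (\<integral>p. windowed er p u * windowed er p v \<partial>strip er)"

lemma measurable_ident_restrict: "(\<lambda>x. x) \<in> restrict_space lborel S \<rightarrow>\<^sub>M (borel :: real measure)"
  by (intro measurable_restrict_space1) simp

lemma finite_measure_restrict_Icc: "finite_measure (restrict_space lborel {a..b::real})"
  by (rule finite_measureI) (simp add: emeasure_restrict_space space_restrict_space emeasure_lborel_Icc_eq)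

lemma finite_measure_strip: "finite_measure (strip er)"
  unfolding strip_def by (intro finite_measure_pair_measure finite_measure_restrict_Icc)

lemma windowed_measurable: "case_prod (windowed er) \<in> borel_measurable (strip er \<Otimes>\<^sub>M borel)"
proof -
  have f: "fst \<in> strip er \<rightarrow>\<^sub>M (borel :: real measure)" "snd \<in> strip er \<rightarrow>\<^sub>M (borel :: real measure)"
    unfolding strip_def
    by (rule measurable_compose[OF measurable_fst measurable_ident_restrict]
             measurable_compose[OF measurable_snd measurable_ident_restrict])+
  note [measurable] = measurable_compose[OF measurable_fst f(1)] measurable_compose[OF measurable_fst f(2)]
  show ?thesis unfolding case_prod_unfold windowed_def by measurable
qed

lemma windowed_bound: "0 < er \<Longrightarrow> \<bar>windowed er p u\<bar> \<le> 1 / er"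
  unfolding windowed_def by (auto intro!: divide_left_mono)

lemma truncker_nonneg: "0 \<le> truncker er u v" if "0 < er"
  unfolding truncker_def windowed_def using that by (intro integral_nonneg_AE AE_I2) auto

text \<open>The integrand vanishes below w and has the antiderivative ln r + w / r above it. The
  case w = 0 is set apart because \<open>ln 0 = 0\<close> would make the bound false.\<close>

lemma hat_integral:
  fixes w er :: real
  assumes "0 \<le> w" "w \<le> 1" "0 < er"
  shows "(LINT r|lborel. indicator {er..1} r * (max 0 (r - w) / r\<^sup>2)) \<le> w - 1 - ln w \<or> w = 0"
    "er \<le> w \<Longrightarrow> (LINT r|lborel. indicator {er..1} r * (max 0 (r - w) / r\<^sup>2)) = w - 1 - ln w"
proof -
  have hb: "has_bochner_integral lborel (\<lambda>r. (1 / r - w / r\<^sup>2) * indicator {w..1} r) ((ln 1 + w / 1) - (ln w + w / w))"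
    if "0 < w" using that assms
    by (intro has_bochner_integral_FTC_Icc_real)
       (auto intro!: derivative_eq_intros continuous_intros simp: field_simps power2_eq_square)
  have eq: "(1 / r - w / r\<^sup>2) * indicator {w..1} r = indicator {w..1} r * (max 0 (r - w) / r\<^sup>2)" if "0 < w" for r
    using that by (auto simp: indicator_def max_def field_simps power2_eq_square)
  have full: "has_bochner_integral lborel (\<lambda>r. indicator {w..1} r * (max 0 (r - w) / r\<^sup>2)) (w - 1 - ln w)" if "0 < w"
  proof -
    have "(ln 1 + w / 1) - (ln w + w / w) = w - 1 - ln w" using that by simp
    then show ?thesis using hb[OF that] unfolding eq[OF that] by (simp only:)
  qed
  show "er \<le> w \<Longrightarrow> (LINT r|lborel. indicator {er..1} r * (max 0 (r - w) / r\<^sup>2)) = w - 1 - ln w"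
  proof -
    assume e: "er \<le> w"
    have eq2: "indicator {er..1} r * (max 0 (r - w) / r\<^sup>2) = indicator {w..1} r * (max 0 (r - w) / r\<^sup>2)" for r :: real
      using e by (auto simp: indicator_def)
    show ?thesis unfolding eq2 using has_bochner_integral_integral_eq[OF full] e assms by linarith
  qed
  show "(LINT r|lborel. indicator {er..1} r * (max 0 (r - w) / r\<^sup>2)) \<le> w - 1 - ln w \<or> w = 0"
  proof (cases "w = 0")
    case False
    then have w: "0 < w" using assms by simp
    have "(LINT r|lborel. indicator {er..1} r * (max 0 (r - w) / r\<^sup>2)) \<le> (LINT r|lborel. indicator {w..1} r * (max 0 (r - w) / r\<^sup>2))"
    proof (rule integral_mono')
      show "integrable lborel (\<lambda>r. indicator {w..1} r * (max 0 (r - w) / r\<^sup>2))"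
        using full[OF w] by (auto simp: has_bochner_integral_iff)
      show "indicator {er..1} r * (max 0 (r - w) / r\<^sup>2) \<le> indicator {w..1} r * (max 0 (r - w) / r\<^sup>2)" for r :: real
        by (auto simp: indicator_def)
      show "0 \<le> indicator {w..1} r * (max 0 (r - w) / r\<^sup>2)" for r :: real by simp
    qed
    then show ?thesis using has_bochner_integral_integral_eq[OF full[OF w]] by simp
  qed simp
qed

text \<open>At fixed length r, the windows containing both u and v have their right ends in an
  interval of length max 0 (r - |u - v|).\<close>

lemma truncker_eq:
  assumes u: "u \<in> {0..1}" and v: "v \<in> {0..1}" and er: "0 < er"
  shows "truncker er u v = (LINT r|lborel. indicator {er..1} r * (max 0 (r - \<bar>u - v\<bar>) / r\<^sup>2))"
proof -
  interpret S: finite_measure "strip er" by (rule finite_measure_strip)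
  interpret A: finite_measure "restrict_space lborel {er..1::real}" by (rule finite_measure_restrict_Icc)
  interpret B: finite_measure "restrict_space lborel {0..2::real}" by (rule finite_measure_restrict_Icc)
  interpret AB: pair_sigma_finite "restrict_space lborel {er..1::real}" "restrict_space lborel {0..2::real}" ..
  have m: "(\<lambda>p. windowed er p u) \<in> borel_measurable (strip er)" for u
  proof -
    have "(\<lambda>p. (p, u)) \<in> strip er \<rightarrow>\<^sub>M strip er \<Otimes>\<^sub>M borel" by measurable
    from measurable_compose[OF this windowed_measurable] show ?thesis by simp
  qed
  have int: "integrable (strip er) (\<lambda>p. windowed er p u * windowed er p v)"
  proof (rule S.integrable_const_bound[where B = "(1 / er) * (1 / er)"])
    have "\<bar>windowed er p u * windowed er p v\<bar> \<le> (1 / er) * (1 / er)" for p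
      unfolding abs_mult using er windowed_bound by (intro mult_mono) auto
    then show "AE p in strip er. norm (windowed er p u * windowed er p v) \<le> (1 / er) * (1 / er)" by simp
  qed (use m in measurable)
  have "truncker er u v = (\<integral>r. (\<integral>z. windowed er (r, z) u * windowed er (r, z) v \<partial>restrict_space lborel {0..2}) \<partial>restrict_space lborel {er..1})"
    unfolding truncker_def strip_def using AB.integral_fst'[OF int[unfolded strip_def]] by simp
  also have "\<dots> = (\<integral>r. max 0 (r - \<bar>u - v\<bar>) / r\<^sup>2 \<partial>restrict_space lborel {er..1})"
  proof (rule bochner_cong[OF refl])
    fix r assume "r \<in> space (restrict_space lborel {er..1})"
    then have r: "er \<le> r" "r \<le> 1" by (auto simp: space_restrict_space)
    have "(\<integral>z. windowed er (r, z) u * windowed er (r, z) v \<partial>restrict_space lborel {0..2})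
      = (LINT z|lborel. indicator {0..2} z * (windowed er (r, z) u * windowed er (r, z) v))"
      by (subst integral_restrict_space) auto
    also have "\<dots> = (LINT z|lborel. 1 / r\<^sup>2 * indicator {max u v..min u v + r} z)"
      using r u v er by (intro bochner_cong refl)
        (auto simp: windowed_def indicator_def power2_eq_square max_def min_def split: if_splits)
    also have "\<dots> = max 0 (r - \<bar>u - v\<bar>) / r\<^sup>2"
      by (simp add: measure_def emeasure_lborel_Icc_eq max_def min_def abs_if)
    finally show "(\<integral>z. windowed er (r, z) u * windowed er (r, z) v \<partial>restrict_space lborel {0..2}) = max 0 (r - \<bar>u - v\<bar>) / r\<^sup>2" .
  qed
  also have "\<dots> = (LINT r|lborel. indicator {er..1} r * (max 0 (r - \<bar>u - v\<bar>) / r\<^sup>2))"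
    by (subst integral_restrict_space) auto
  finally show ?thesis .
qed

lemma truncker_le:
  assumes "u \<in> {0..1}" "v \<in> {0..1}" "0 < er" "u \<noteq> v"
  shows "(1 - \<bar>u - v\<bar>) + truncker er u v \<le> logker (u - v)"
    "er \<le> \<bar>u - v\<bar> \<Longrightarrow> (1 - \<bar>u - v\<bar>) + truncker er u v = logker (u - v)"
  using hat_integral[of "\<bar>u - v\<bar>" er] assms unfolding truncker_eq[OF assms(1-3)]
  by (auto simp: logker_def abs_le_iff)

text \<open>
  The decomposition \<open>- ln w = (1 - w) + (\<integral>r = 0..1. (r - w)\<^sup>+ / r\<^sup>2)\<close> for \<open>0 < w \<le> 1\<close> exhibits the logarithmic
  kernel as a superposition of Gram kernels; the first summand alone already dominates the square
  norm of the distribution function.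
\<close>

theorem log_energy_ge:
  assumes f: "bddm f"
  shows "(LINT z|unif. (LINT u|unif. (if u \<le> z then 1 else 0) * f u)\<^sup>2) \<le> log_energy f f"
proof -
  obtain K where K: "\<And>x. \<bar>f x\<bar> \<le> K" using f by (auto simp: bddm_def)
  have [measurable]: "f \<in> borel_measurable borel" using f by (auto simp: bddm_def)
  define lo where "lo z u = (if u \<le> z then 1 else 0 :: real)" for z u :: real
  define hi where "hi z u = (if z < u then 1 else 0 :: real)" for z u :: real
  have fstm: "(\<lambda>x. fst x) \<in> unif \<Otimes>\<^sub>M borel \<rightarrow>\<^sub>M (borel :: real measure)"
    by (rule measurable_compose[OF measurable_fst measurable_ident_unif])
  note [measurable] = fstm
  have m: "case_prod lo \<in> borel_measurable (unif \<Otimes>\<^sub>M borel)" "case_prod hi \<in> borel_measurable (unif \<Otimes>\<^sub>M borel)"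
    unfolding case_prod_unfold lo_def hi_def by measurable
  have b: "\<bar>lo z u\<bar> \<le> 1" "\<bar>hi z u\<bar> \<le> 1" for z u by (auto simp: lo_def hi_def)
  note g1 = gram_kernel_integral[OF unif.finite_measure_axioms m(1) b(1) f]
  note g2 = gram_kernel_integral[OF unif.finite_measure_axioms m(2) b(2) f]
  define Kl where "Kl z = (LINT p|unif. lo p (fst z) * lo p (snd z))" for z
  define Kh where "Kh z = (LINT p|unif. hi p (fst z) * hi p (snd z))" for z
  define ff where "ff z = f (fst z) * f (snd z)" for z
  \<comment> \<open>The levels p above both points have length 1 - max, those below both have length
    min; hence 1 - |u - v| is a sum of two Gram kernels, and the one from \<open>lo\<close> produces
    the distribution function.\<close>
  have hat: "Kl z + Kh z = 1 - \<bar>fst z - snd z\<bar>" if "z \<in> space unif2" for z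
  proof -
    have uv: "fst z \<in> {0..1}" "snd z \<in> {0..1}" using that by (auto simp: space_pair_measure space_unif)
    have "Kl z = (LINT p|lborel. indicator {0..1} p * (lo p (fst z) * lo p (snd z)))" unfolding Kl_def integral_unif ..
    also have "\<dots> = (LINT p|lborel. indicator {max (fst z) (snd z)..1} p)"
      using uv by (intro bochner_cong refl) (auto simp: lo_def indicator_def)
    finally have l: "Kl z = 1 - max (fst z) (snd z)" using uv by simp
    have "Kh z = (LINT p|lborel. indicator {0..1} p * (hi p (fst z) * hi p (snd z)))" unfolding Kh_def integral_unif ..
    also have "\<dots> = (LINT p|lborel. indicator {0..<min (fst z) (snd z)} p)"
      using uv by (intro bochner_cong refl) (auto simp: hi_def indicator_def)
    finally have h: "Kh z = min (fst z) (snd z)" using uv by simp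
    show ?thesis unfolding l h by (simp add: max_def min_def abs_if)
  qed
  define eps where "eps m = 1 / real (m + 2)" for m :: nat
  have eps: "0 < eps m" for m by (simp add: eps_def)
  define T where "T m z = truncker (eps m) (fst z) (snd z)" for m z
  note g3 = gram_kernel_integral[OF finite_measure_strip windowed_measurable windowed_bound[OF eps] f]
  have i1: "integrable unif2 (\<lambda>z. Kl z * ff z)" using g1(1) by (simp add: Kl_def ff_def)
  have i2: "integrable unif2 (\<lambda>z. Kh z * ff z)" using g2(1) by (simp add: Kh_def ff_def)
  have i3: "integrable unif2 (\<lambda>z. T m z * ff z)" for m using g3(1)[of m] by (simp add: T_def truncker_def ff_def)
  have e3: "0 \<le> (LINT z|unif2. T m z * ff z)" for m
    using g3(2)[of m] by (simp add: T_def truncker_def ff_def)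
  have e2: "0 \<le> (LINT z|unif2. Kh z * ff z)" using g2(2) by (simp add: Kh_def ff_def)
  have e1: "(LINT z|unif2. Kl z * ff z) = (LINT z|unif. (LINT u|unif. (if u \<le> z then 1 else 0) * f u)\<^sup>2)"
    using g1(2) by (simp add: Kl_def ff_def lo_def)
  \<comment> \<open>Off the diagonal the truncated kernels eventually equal the logarithmic kernel,
    which also dominates them. The energies of \<open>Kh\<close> and of \<open>T m\<close> are
    nonnegative and are dropped afterwards.\<close>
  have "(\<lambda>m. LINT z|unif2. Kl z * ff z + Kh z * ff z + T m z * ff z) \<longlonglongrightarrow> (LINT z|unif2. logker (fst z - snd z) * ff z)"
  proof (rule integral_dominated_convergence[where w = "\<lambda>z. logker (fst z - snd z) * K\<^sup>2"])
    have "AE z in unif2. fst z \<noteq> snd z"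
    proof (rule unif2.AE_pair_measure)
      show "{z \<in> space unif2. fst z \<noteq> snd z} \<in> sets unif2" by measurable
      show "AE x in unif. AE y in unif. fst (x, y) \<noteq> snd (x, y)"
      proof (rule AE_I2)
        fix x show "AE y in unif. fst (x, y) \<noteq> snd (x, y)" using AE_unif_neq[of x] by eventually_elim auto
      qed
    qed
    then have ae: "AE z in unif2. z \<in> space unif2 \<and> fst z \<noteq> snd z"
      using AE_space by eventually_elim auto
    show "AE z in unif2. (\<lambda>m. Kl z * ff z + Kh z * ff z + T m z * ff z) \<longlonglongrightarrow> logker (fst z - snd z) * ff z"
      using ae
    proof eventually_elim
      case (elim z)
      have uv: "fst z \<in> {0..1}" "snd z \<in> {0..1}" using elim by (auto simp: space_pair_measure space_unif)
      obtain m0 where m0: "1 / \<bar>fst z - snd z\<bar> < real m0" using reals_Archimedean2 by blast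
      have "Kl z * ff z + Kh z * ff z + T m z * ff z = logker (fst z - snd z) * ff z" if "m \<ge> m0" for m
      proof -
        have "1 / \<bar>fst z - snd z\<bar> \<le> real (m + 2)" using m0 \<open>m \<ge> m0\<close> by simp
        then have "eps m \<le> \<bar>fst z - snd z\<bar>" using elim by (simp add: eps_def field_simps)
        then have "logker (fst z - snd z) = Kl z + Kh z + T m z"
          using truncker_le(2)[OF uv eps] elim hat[of z] by (simp add: T_def)
        then show ?thesis by (simp add: distrib_right)
      qed
      then show ?case by (intro tendsto_eventually) (auto simp: eventually_sequentially)
    qed
    show "AE z in unif2. norm (Kl z * ff z + Kh z * ff z + T m z * ff z) \<le> logker (fst z - snd z) * K\<^sup>2" for m
      using ae
    proof eventually_elim
      case (elim z)
      have uv: "fst z \<in> {0..1}" "snd z \<in> {0..1}" using elim by (auto simp: space_pair_measure space_unif)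
      have ffb: "\<bar>ff z\<bar> \<le> K\<^sup>2"
        unfolding ff_def abs_mult power2_eq_square using K by (intro mult_mono) (auto intro: order.trans[OF abs_ge_zero])
      have le: "Kl z + Kh z + T m z \<le> logker (fst z - snd z)"
        using truncker_le(1)[OF uv eps] elim hat[of z] by (simp add: T_def)
      have "0 \<le> 1 - \<bar>fst z - snd z\<bar>" using uv by auto
      then have nn: "0 \<le> Kl z + Kh z + T m z"
        using truncker_nonneg[OF eps, of m "fst z" "snd z"] hat[of z] elim by (simp add: T_def)
      have "norm (Kl z * ff z + Kh z * ff z + T m z * ff z) = (Kl z + Kh z + T m z) * \<bar>ff z\<bar>"
        using nn by (simp add: distrib_right[symmetric] abs_mult)
      also have "\<dots> \<le> logker (fst z - snd z) * K\<^sup>2"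
        using le ffb nn by (intro mult_mono) auto
      finally show ?case .
    qed
    show "(\<lambda>z. Kl z * ff z + Kh z * ff z + T m z * ff z) \<in> borel_measurable unif2" for m
      using i1 i2 i3[of m] by (intro borel_measurable_add borel_measurable_integrable)
  qed (use integrable_logker in \<open>auto simp: ff_def\<close>)
  moreover have "(LINT z|unif2. Kl z * ff z) \<le> (LINT z|unif2. Kl z * ff z + Kh z * ff z + T m z * ff z)" for m
    using i1 i2 i3[of m] e2 e3[of m] by simp
  ultimately have "(LINT z|unif2. Kl z * ff z) \<le> (LINT z|unif2. logker (fst z - snd z) * ff z)"
    by (intro LIMSEQ_le_const) auto
  then show ?thesis unfolding e1[symmetric] by (simp add: log_energy_def ff_def)
qed

lemma log_energy_nonneg: "bddm f \<Longrightarrow> 0 \<le> log_energy f f"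
  using log_energy_ge[of f] by (rule order.trans[rotated]) (auto intro!: integral_nonneg_AE)

section \<open>Energies of lattice configurations\<close>

definition xlnx :: "real \<Rightarrow> real" where
  "xlnx z = z * ln \<bar>z\<bar>"

text \<open>The limit of - ln (weight) / N by Stirling's formula, one term for each of the four
  factorials, up to the constant removed in \<open>cellfield\<close>.\<close>

definition hahn_field :: "real \<Rightarrow> real \<Rightarrow> real \<Rightarrow> real" where
  "hahn_field A B x = xlnx x + xlnx (x + B) + xlnx (1 - x) + xlnx (1 - x + A)"

text \<open>The coefficient of N^2 in - ln of the weight of a configuration, as a functional of its
  particle density.\<close>

definition hahn_energy :: "real \<Rightarrow> real \<Rightarrow> (real \<Rightarrow> real) \<Rightarrow> real" where
  "hahn_energy A B f = log_energy f f + (LINT u|unif. hahn_field A B u * f u)"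

text \<open>Site s stands for the interval from s / N to (s + 1) / N, so that a configuration
  becomes the 0-1 valued density \<open>occ\<close>.\<close>

definition cell :: "nat \<Rightarrow> real \<Rightarrow> nat" where
  "cell N u = nat \<lfloor>real N * u\<rfloor>"

definition occ :: "nat \<Rightarrow> nat set \<Rightarrow> real \<Rightarrow> real" where
  "occ N Y u = (if cell N u \<in> Y then 1 else 0)"

lemma isCont_xlnx: "isCont xlnx z"
  using continuous_xlnx unfolding xlnx_def[abs_def] by (simp add: continuous_on_eq_continuous_at)

lemma tendsto_xlnx: "(f \<longlongrightarrow> l) F \<Longrightarrow> ((\<lambda>x. xlnx (f x)) \<longlongrightarrow> xlnx l) F"
  by (rule isCont_tendsto_compose[OF isCont_xlnx])

lemma measurable_xlnx [measurable]: "xlnx \<in> borel_measurable borel"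
  unfolding xlnx_def by measurable

lemma measurable_hahn_field [measurable]: "hahn_field A B \<in> borel_measurable borel"
  unfolding hahn_field_def by measurable

lemma xlnx_bounded: "\<exists>K. \<forall>z\<in>{0..R}. \<bar>xlnx z\<bar> \<le> K"
proof -
  have "compact (xlnx ` {0..R})"
    by (intro compact_continuous_image) (auto intro!: continuous_at_imp_continuous_on isCont_xlnx)
  then show ?thesis using compact_imp_bounded bounded_iff by (metis imageI real_norm_def)
qed

lemma hahn_field_bounded:
  assumes "0 \<le> A" "0 \<le> B"
  obtains K where "\<And>u. u \<in> {0..1} \<Longrightarrow> \<bar>hahn_field A B u\<bar> \<le> K"
proof -
  obtain K where K: "\<forall>z\<in>{0..1 + A + B}. \<bar>xlnx z\<bar> \<le> K" using xlnx_bounded by blast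
  have "\<bar>hahn_field A B u\<bar> \<le> 4 * K" if u: "u \<in> {0..1}" for u
  proof -
    have "\<bar>xlnx u\<bar> \<le> K" "\<bar>xlnx (u + B)\<bar> \<le> K" "\<bar>xlnx (1 - u)\<bar> \<le> K" "\<bar>xlnx (1 - u + A)\<bar> \<le> K"
      using K u assms by auto
    then show ?thesis unfolding hahn_field_def by linarith
  qed
  then show ?thesis by (rule that)
qed

lemma measurable_cell [measurable]: "cell N \<in> borel \<rightarrow>\<^sub>M count_space UNIV"
proof -
  have "(\<lambda>u. \<lfloor>real N * u\<rfloor>) \<in> borel \<rightarrow>\<^sub>M count_space UNIV" by measurable
  then have "(\<lambda>u. nat \<lfloor>real N * u\<rfloor>) \<in> borel \<rightarrow>\<^sub>M count_space UNIV"
    by (rule measurable_compose) simp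
  then show ?thesis unfolding cell_def[abs_def] .
qed

lemma measurable_cell_fun [measurable]: "(\<lambda>u. g (cell N u)) \<in> borel_measurable borel" for g :: "nat \<Rightarrow> real"
  by (rule measurable_compose[OF measurable_cell]) simp

lemma bddm_occ: "bddm (occ N Y)"
proof (rule bddmI[where K = 1])
  show "occ N Y \<in> borel_measurable borel"
    unfolding occ_def by (rule measurable_cell_fun[of "\<lambda>s. if s \<in> Y then 1 else 0"])
qed (auto simp: occ_def)

lemma cell_less: "u \<in> {0..<1} \<Longrightarrow> 0 < N \<Longrightarrow> cell N u < N"
proof -
  assume u: "u \<in> {0..<1}" "0 < N"
  then have "real N * u < real N" by simp
  then have "\<lfloor>real N * u\<rfloor> < int N" by (simp add: floor_less_iff)
  then show ?thesis using u(2) unfolding cell_def by linarith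
qed

lemma cell_bounds:
  assumes "0 \<le> u"
  shows "real (cell N u) \<le> real N * u" "real N * u < real (cell N u) + 1"
proof -
  have "0 \<le> \<lfloor>real N * u\<rfloor>" using assms by simp
  then have "real (cell N u) = of_int \<lfloor>real N * u\<rfloor>" unfolding cell_def by simp
  then show "real (cell N u) \<le> real N * u" "real N * u < real (cell N u) + 1" by linarith+
qed

lemma cell_ratio:
  assumes N: "filterlim N at_top sequentially" and N0: "\<And>k. 0 < N k" and u: "0 \<le> u"
  shows "(\<lambda>k. real (cell (N k) u) / real (N k)) \<longlonglongrightarrow> u"
proof (rule tendsto_sandwich[of "\<lambda>k. u - 1 / real (N k)" _ _ "\<lambda>k. u"])
  have "(\<lambda>k. 1 / real (N k)) \<longlonglongrightarrow> 0"
    by (rule tendsto_divide_0[OF tendsto_const filterlim_at_top_imp_at_infinity[OF filterlim_compose[OF filterlim_real_sequentially N]]])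
  from tendsto_diff[OF tendsto_const this, of u] show "(\<lambda>k. u - 1 / real (N k)) \<longlonglongrightarrow> u" by simp
  have "u - 1 / real (N k) \<le> real (cell (N k) u) / real (N k)" "real (cell (N k) u) / real (N k) \<le> u" for k
  proof -
    have Nr: "0 < real (N k)" using N0[of k] by simp
    have "u - 1 / real (N k) = (real (N k) * u - 1) / real (N k)" using Nr by (simp add: field_simps)
    also have "\<dots> \<le> real (cell (N k) u) / real (N k)" using cell_bounds[OF u, of "N k"] by (intro divide_right_mono) auto
    finally show "u - 1 / real (N k) \<le> real (cell (N k) u) / real (N k)" .
    show "real (cell (N k) u) / real (N k) \<le> u" using cell_bounds[OF u, of "N k"] Nr by (simp add: divide_le_eq mult.commute)
  qed
  then show "\<forall>\<^sub>F k in sequentially. u - 1 / real (N k) \<le> real (cell (N k) u) / real (N k)"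
    "\<forall>\<^sub>F k in sequentially. real (cell (N k) u) / real (N k) \<le> u" by auto
qed simp

lemma AE_unif_lt_1: "AE u in unif. u \<in> {0..<1}"
  using AE_unif_neq[of 1] AE_space
  by eventually_elim (auto simp: space_unif)

lemma integral_cell:
  fixes g :: "nat \<Rightarrow> real"
  assumes N: "0 < N"
  shows "(LINT u|unif. g (cell N u)) = (\<Sum>s<N. g s) / real N"
proof -
  have Nr: "0 < real N" using N by simp
  have "(LINT u|unif. g (cell N u)) = (LINT u|unif. (\<Sum>s<N. g s * indicator {real s / real N..<(real s + 1) / real N} u))"
  proof (rule integral_cong_AE)
    show "AE u in unif. g (cell N u) = (\<Sum>s<N. g s * indicator {real s / real N..<(real s + 1) / real N} u)"
      using AE_unif_lt_1
    proof eventually_elim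
      case (elim u)
      have c: "cell N u < N" using cell_less[OF elim N] .
      have "u \<in> {real s / real N..<(real s + 1) / real N} \<longleftrightarrow> s = cell N u" for s
      proof -
        have "u \<in> {real s / real N..<(real s + 1) / real N} \<longleftrightarrow> real s \<le> real N * u \<and> real N * u < real s + 1"
          using Nr by (auto simp: field_simps)
        also have "\<dots> \<longleftrightarrow> s = cell N u" using cell_bounds[of u N] elim by auto
        finally show ?thesis .
      qed
      then have "(\<Sum>s<N. g s * indicator {real s / real N..<(real s + 1) / real N} u) = (\<Sum>s<N. if s = cell N u then g s else 0)"
        by (intro sum.cong refl) (auto simp: indicator_def)
      then show ?case using c by simp
    qed
  qed measurable
  also have "\<dots> = (\<Sum>s<N. g s * (LINT u|unif. indicator {real s / real N..<(real s + 1) / real N} u))"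
  proof (subst Bochner_Integration.integral_sum)
    show "integrable unif (\<lambda>u. g s * indicator {real s / real N..<(real s + 1) / real N} u)" for s
      by (rule unif.integrable_const_bound[where B = "\<bar>g s\<bar>"]) (auto simp: abs_mult indicator_def)
  qed simp
  also have "\<dots> = (\<Sum>s<N. g s * (1 / real N))"
  proof (intro sum.cong refl arg_cong2[where f = "(*)"])
    fix s assume "s \<in> {..<N}"
    then have s: "(real s + 1) / real N \<le> 1" using Nr by (simp add: divide_le_eq)
    have ind: "indicator {0..1} u * indicator {real s / real N..<(real s + 1) / real N} u
        = (indicator {real s / real N..<(real s + 1) / real N} u :: real)" for u
    proof -
      have "0 \<le> u \<and> u \<le> 1" if a: "real s / real N \<le> u" and b: "u < (real s + 1) / real N"
      proof
        show "0 \<le> u" by (rule order.trans[OF _ a]) simp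
        show "u \<le> 1" by (rule order.trans[OF less_imp_le[OF b] s])
      qed
      then show ?thesis by (auto simp: indicator_def)
    qed
    show "(LINT u|unif. indicator {real s / real N..<(real s + 1) / real N} u) = 1 / real N"
      unfolding integral_unif ind
      using Nr by (simp add: divide_right_mono add_divide_distrib)
  qed
  finally show ?thesis by (simp add: sum_divide_distrib)
qed

lemma AE_unif2_lt_1: "AE z in unif2. fst z \<in> {0..<1} \<and> snd z \<in> {0..<1} \<and> fst z \<noteq> snd z"
proof (rule unif2.AE_pair_measure)
  show "{z \<in> space unif2. fst z \<in> {0..<1} \<and> snd z \<in> {0..<1} \<and> fst z \<noteq> snd z} \<in> sets unif2" by measurable
  show "AE x in unif. AE y in unif. fst (x, y) \<in> {0..<1} \<and> snd (x, y) \<in> {0..<1} \<and> fst (x, y) \<noteq> snd (x, y)"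
    using AE_unif_lt_1
  proof eventually_elim
    case (elim x)
    show ?case using AE_unif_lt_1 AE_unif_neq[of x] by eventually_elim (use elim in auto)
  qed
qed

lemma measurable_cell_pair [measurable]: "(\<lambda>z. G (cell N (fst z)) (cell N (snd z))) \<in> borel_measurable unif2" for G :: "nat \<Rightarrow> nat \<Rightarrow> real"
proof -
  have "(\<lambda>z. (cell N (fst z), cell N (snd z))) \<in> unif2 \<rightarrow>\<^sub>M count_space UNIV \<Otimes>\<^sub>M count_space UNIV" by measurable
  then have "(\<lambda>z. (cell N (fst z), cell N (snd z))) \<in> unif2 \<rightarrow>\<^sub>M count_space UNIV"
    by (simp add: pair_measure_countable)
  from measurable_compose[OF this, of "\<lambda>p. G (fst p) (snd p)" borel] show ?thesis by simp
qed

lemma integral_cell_pair: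
  fixes G :: "nat \<Rightarrow> nat \<Rightarrow> real"
  assumes N: "0 < N"
  shows "(LINT z|unif2. G (cell N (fst z)) (cell N (snd z))) = (\<Sum>s<N. \<Sum>t<N. G s t) / (real N)\<^sup>2"
    "integrable unif2 (\<lambda>z. G (cell N (fst z)) (cell N (snd z)))"
proof -
  define C where "C = (\<Sum>s<N. \<Sum>t<N. \<bar>G s t\<bar>)"
  have C: "\<bar>G s t\<bar> \<le> C" if "s < N" "t < N" for s t
  proof -
    have "\<bar>G s t\<bar> \<le> (\<Sum>t<N. \<bar>G s t\<bar>)" using that by (intro member_le_sum) auto
    also have "\<dots> \<le> C" unfolding C_def using that by (intro member_le_sum[of s _ "\<lambda>s. \<Sum>t<N. \<bar>G s t\<bar>"]) (auto intro: sum_nonneg)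
    finally show ?thesis .
  qed
  show int: "integrable unif2 (\<lambda>z. G (cell N (fst z)) (cell N (snd z)))"
  proof (rule unif2.P.integrable_const_bound[where B = C])
    show "AE z in unif2. norm (G (cell N (fst z)) (cell N (snd z))) \<le> C"
      using AE_unif2_lt_1 by eventually_elim (auto intro!: C cell_less N)
  qed measurable
  have "(LINT z|unif2. G (cell N (fst z)) (cell N (snd z))) = (LINT x|unif. (LINT y|unif. G (cell N x) (cell N y)))"
    using unif2.integral_fst'[OF int] by simp
  also have "\<dots> = (LINT x|unif. (\<Sum>t<N. G (cell N x) t) / real N)"
    by (simp add: integral_cell[OF N])
  also have "\<dots> = (\<Sum>s<N. \<Sum>t<N. G s t) / (real N)\<^sup>2"
    using integral_cell[OF N, of "\<lambda>s. (\<Sum>t<N. G s t) / real N"]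
    by (simp add: sum_divide_distrib[symmetric] power2_eq_square)
  finally show "(LINT z|unif2. G (cell N (fst z)) (cell N (snd z))) = (\<Sum>s<N. \<Sum>t<N. G s t) / (real N)\<^sup>2" .
qed

text \<open>Stirling's formula with a crude error, which vanishes after division by N. The induction
  gives the sharper bound 1 + ln m for m > 0; the square root covers m = 0 as well.\<close>

lemma ln_fact_bounds:
  obtains d where "ln (fact m :: real) = xlnx (real m) - real m + d" "0 \<le> d" "d \<le> 1 + 2 * sqrt (real m)"
proof -
  have "0 \<le> ln (fact m :: real) - (real m * ln (real m) - real m) \<and>
      ln (fact m :: real) - (real m * ln (real m) - real m) \<le> 1 + ln (real m)" if "m > 0"
    using that
  proof (induction m)
    case (Suc m)
    show ?case
    proof (cases "m = 0")
      case False
      define x where "x = real m"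
      have x: "0 < x" using False by (simp add: x_def)
      have f: "ln (fact (Suc m) :: real) = ln (x + 1) + ln (fact m)"
        by (simp add: x_def ln_mult add.commute)
      define q where "q = ln (x + 1) - ln x"
      have q: "q = ln (1 + 1 / x)"
      proof -
        have "ln ((x + 1) / x) = ln (x + 1) - ln x" using x by (simp add: ln_div)
        moreover have "(x + 1) / x = 1 + 1 / x" using x by (simp add: field_simps)
        ultimately show ?thesis by (simp add: q_def)
      qed
      have q1: "q \<le> 1 / x" unfolding q using x by (intro ln_add_one_self_le_self) simp
      have q2: "1 / (x + 1) \<le> q"
      proof -
        have "ln (x / (x + 1)) \<le> x / (x + 1) - 1" using x by (intro ln_le_minus_one) simp
        also have "\<dots> = - (1 / (x + 1))" using x by (simp add: field_simps)
        finally show ?thesis using x by (simp add: q_def ln_div)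
      qed
      have step: "ln (fact (Suc m) :: real) - ((x + 1) * ln (x + 1) - (x + 1))
          = (ln (fact m) - (x * ln x - x)) + (1 - x * q)"
        unfolding f q_def by (simp add: algebra_simps)
      have "x * q \<le> 1" using q1 x by (simp add: field_simps)
      moreover have "1 - x * q \<le> q"
      proof -
        have "1 \<le> (x + 1) * q" using q2 x by (simp add: field_simps)
        then show ?thesis by (simp add: algebra_simps)
      qed
      ultimately show ?thesis
        using Suc.IH False step unfolding x_def[symmetric] by (auto simp: q_def x_def add.commute)
    qed simp
  qed simp
  moreover have "ln (real m) \<le> 2 * sqrt (real m)" if "m > 0"
  proof -
    have "ln (sqrt (real m)) \<le> sqrt (real m)" using that by (intro ln_bound) simp
    then show ?thesis using that by (simp add: ln_sqrt)
  qed
  ultimately show ?thesis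
    by (intro that[of "ln (fact m) - (xlnx (real m) - real m)"]) (cases "m > 0"; fastforce simp: xlnx_def)+
qed

text \<open>On diagonal cells \<open>ln 0 = 0\<close> gives the value 0, in accordance with the
  discriminant: a particle does not interact with itself.\<close>

definition cellker :: "nat \<Rightarrow> real \<times> real \<Rightarrow> real" where
  "cellker N z = logker ((real (cell N (fst z)) - real (cell N (snd z))) / real N)"

text \<open>The four factorial arguments in \<open>hahn_weight\<close> add up to 2 (N - 1) + a + b
  at every site, so the terms of Stirling's formula that are linear in them contribute a constant,
  which is subtracted here.\<close>

definition cellfield :: "nat \<Rightarrow> nat \<Rightarrow> nat \<Rightarrow> nat \<Rightarrow> real" where
  "cellfield N a b s = (- ln (hahn_weight N a b s) - (2 * (real N - 1) + real a + real b) * (ln (real N) - 1)) / real N"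

lemma integrable_cellker: "0 < N \<Longrightarrow> integrable unif2 (cellker N)"
  unfolding cellker_def[abs_def]
  by (rule integral_cell_pair(2)[of N "\<lambda>s t. logker ((real s - real t) / real N)"])

text \<open>Domination uniform in N: for different cells at index distance d one has N |u - v| \<le>
  d + 1 \<le> 2 d, which costs ln 2; equal cells contribute 0.\<close>

lemma cellker_bounds:
  assumes N: "0 < N" and z: "fst z \<in> {0..<1}" "snd z \<in> {0..<1}" "fst z \<noteq> snd z"
  shows "0 \<le> cellker N z" "cellker N z \<le> logker (fst z - snd z) + ln 2"
proof -
  define s t where "s = cell N (fst z)" and "t = cell N (snd z)"
  define w where "w = \<bar>fst z - snd z\<bar>"
  have w: "0 < w" "w \<le> 1" using z by (auto simp: w_def)
  have Nr: "0 < real N" using N by simp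
  have st: "s < N" "t < N" using cell_less[OF z(1) N] cell_less[OF z(2) N] by (auto simp: s_def t_def)
  have cb: "real s \<le> real N * fst z" "real N * fst z < real s + 1" "real t \<le> real N * snd z" "real N * snd z < real t + 1"
    using cell_bounds[of "fst z" N] cell_bounds[of "snd z" N] z by (auto simp: s_def t_def)
  have lw: "ln w \<le> 0" using w by simp
  have l2: "0 \<le> ln (2::real)" by simp
  have "0 \<le> cellker N z \<and> cellker N z \<le> - ln w + ln 2"
  proof (cases "s = t")
    case True
    then show ?thesis using order.trans[OF lw l2] by (simp add: cellker_def s_def[symmetric] t_def[symmetric] logker_def)
  next
    case False
    define d where "d = \<bar>real s - real t\<bar>"
    have d1: "1 \<le> d" using False by (auto simp: d_def abs_if)
    have dN: "d \<le> real N" using st by (auto simp: d_def abs_if)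
    have "real N * w = \<bar>real N * fst z - real N * snd z\<bar>"
      using Nr by (simp add: w_def abs_mult right_diff_distrib[symmetric])
    also have "\<dots> \<le> d + 1" using cb by (auto simp: d_def abs_if)
    finally have wd: "real N * w \<le> 2 * d" using d1 by linarith
    have ck: "cellker N z = - ln (d / real N)"
      using Nr by (simp add: cellker_def s_def[symmetric] t_def[symmetric] logker_def d_def abs_divide)
    have "d / real N \<le> 1" using dN Nr by simp
    then have 1: "0 \<le> - ln (d / real N)" using d1 Nr by (simp add: ln_le_zero_iff)
    have "w / 2 \<le> d / real N" using wd Nr by (simp add: field_simps)
    then have "ln (w / 2) \<le> ln (d / real N)" using w d1 Nr by (subst ln_le_cancel_iff) auto
    then have "- ln (d / real N) \<le> - ln w + ln 2" using w by (simp add: ln_div)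
    then show ?thesis using 1 ck by simp
  qed
  then show "0 \<le> cellker N z" "cellker N z \<le> logker (fst z - snd z) + ln 2"
    by (auto simp: logker_def w_def)
qed

lemma cellker_L1:
  assumes N: "filterlim N at_top sequentially" and N0: "\<And>k. 0 < N k"
  shows "(\<lambda>k. LINT z|unif2. \<bar>cellker (N k) z - logker (fst z - snd z)\<bar>) \<longlonglongrightarrow> 0"
proof -
  have "(\<lambda>k. LINT z|unif2. \<bar>cellker (N k) z - logker (fst z - snd z)\<bar>) \<longlonglongrightarrow> (LINT z|unif2. 0)"
  proof (rule integral_dominated_convergence[where w = "\<lambda>z. 2 * logker (fst z - snd z) + ln 2"])
    show "AE z in unif2. (\<lambda>k. \<bar>cellker (N k) z - logker (fst z - snd z)\<bar>) \<longlonglongrightarrow> 0"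
      using AE_unif2_lt_1
    proof eventually_elim
      case (elim z)
      have "(\<lambda>k. real (cell (N k) (fst z)) / real (N k) - real (cell (N k) (snd z)) / real (N k)) \<longlonglongrightarrow> fst z - snd z"
        using elim by (intro tendsto_diff cell_ratio[OF N N0]) auto
      then have "(\<lambda>k. - ln \<bar>real (cell (N k) (fst z)) / real (N k) - real (cell (N k) (snd z)) / real (N k)\<bar>) \<longlonglongrightarrow> - ln \<bar>fst z - snd z\<bar>"
        using elim by (intro tendsto_minus tendsto_ln tendsto_rabs) auto
      then have "(\<lambda>k. cellker (N k) z) \<longlonglongrightarrow> logker (fst z - snd z)"
        by (simp add: cellker_def logker_def diff_divide_distrib)
      then have "(\<lambda>k. \<bar>cellker (N k) z - logker (fst z - snd z)\<bar>) \<longlonglongrightarrow> \<bar>logker (fst z - snd z) - logker (fst z - snd z)\<bar>"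
        by (intro tendsto_intros)
      then show ?case by simp
    qed
    show "AE z in unif2. norm \<bar>cellker (N k) z - logker (fst z - snd z)\<bar> \<le> 2 * logker (fst z - snd z) + ln 2" for k
      using AE_unif2_lt_1
    proof eventually_elim
      case (elim z)
      have "0 \<le> logker (fst z - snd z)" using elim by (intro logker_nonneg) auto
      then show ?case using cellker_bounds[OF N0, of z k] elim by auto
    qed
    show "integrable unif2 (\<lambda>z. 2 * logker (fst z - snd z) + ln 2)" using integrable_logker by simp
    show "(\<lambda>z. \<bar>cellker (N k) z - logker (fst z - snd z)\<bar>) \<in> borel_measurable unif2" for k
      using borel_measurable_integrable[OF integrable_cellker[OF N0, of k]] by measurable
  qed simp
  then show ?thesis by simp
qed

lemma cellfield_L1:
  assumes N: "filterlim N at_top sequentially" and N0: "\<And>k. 0 < N k"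
    and a: "\<And>k. real (a k) = A * real (N k)" and b: "\<And>k. real (b k) = B * real (N k)"
    and AB: "0 < A" "0 < B"
  shows "(\<lambda>k. LINT u|unif. \<bar>cellfield (N k) (a k) (b k) (cell (N k) u) - hahn_field A B u\<bar>) \<longlonglongrightarrow> 0"
proof -
  define R where "R = 2 + A + B"
  \<comment> \<open>The field at s / N, except that N - 1 - s leaves a shift by 1 / N in the last
    two terms.\<close>
  define X where "X k s = xlnx (real s / real (N k)) + xlnx (real s / real (N k) + B)
     + xlnx (1 - 1 / real (N k) - real s / real (N k)) + xlnx (1 - 1 / real (N k) - real s / real (N k) + A)" for k s
  define E where "E k = 4 * (1 / real (N k) + 2 * sqrt R * (1 / sqrt (real (N k))))" for k
  have Nr: "1 \<le> real (N k)" for k using N0[of k] by simp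
  have near: "\<bar>cellfield (N k) (a k) (b k) s - X k s\<bar> \<le> E k" if s: "s < N k" for k s
  proof -
    define n where "n = real (N k)"
    have n1: "1 \<le> n" using Nr by (simp add: n_def)
    define m1 m2 m3 m4 where "m1 = s" "m2 = s + b k" "m3 = N k - 1 - s" "m4 = N k - 1 - s + a k"
    note mdef = m1_m2_m3_m4_def
    have mr: "real m1 = real s" "real m2 = real s + B * n" "real m3 = n - 1 - real s" "real m4 = n - 1 - real s + A * n"
      using s by (auto simp: mdef n_def a b of_nat_diff)
    have mR: "real m1 \<le> R * n" "real m2 \<le> R * n" "real m3 \<le> R * n" "real m4 \<le> R * n"
    proof -
      have "real s \<le> n" using s by (simp add: n_def)
      moreover have "0 \<le> A * n" "0 \<le> B * n" using AB n1 by auto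
      ultimately show "real m1 \<le> R * n" "real m2 \<le> R * n" "real m3 \<le> R * n" "real m4 \<le> R * n"
        unfolding mr R_def distrib_right using n1 by linarith+
    qed
    obtain d1 where d1: "ln (fact m1 :: real) = xlnx (real m1) - real m1 + d1" "0 \<le> d1" "d1 \<le> 1 + 2 * sqrt (real m1)" by (rule ln_fact_bounds)
    obtain d2 where d2: "ln (fact m2 :: real) = xlnx (real m2) - real m2 + d2" "0 \<le> d2" "d2 \<le> 1 + 2 * sqrt (real m2)" by (rule ln_fact_bounds)
    obtain d3 where d3: "ln (fact m3 :: real) = xlnx (real m3) - real m3 + d3" "0 \<le> d3" "d3 \<le> 1 + 2 * sqrt (real m3)" by (rule ln_fact_bounds)
    obtain d4 where d4: "ln (fact m4 :: real) = xlnx (real m4) - real m4 + d4" "0 \<le> d4" "d4 \<le> 1 + 2 * sqrt (real m4)" by (rule ln_fact_bounds)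
    have sc: "xlnx (real m) = n * xlnx (real m / n) + real m * ln n" for m
    proof (cases "m = 0")
      case False
      then have "ln (real m) = ln (real m / n) + ln n" using n1 by (simp add: ln_div)
      then have "xlnx (real m) = real m * (ln (real m / n) + ln n)" by (simp add: xlnx_def)
      then show ?thesis using n1 by (simp add: xlnx_def distrib_left)
    qed (simp add: xlnx_def)
    have "- ln (hahn_weight (N k) (a k) (b k) s) = ln (fact m1) + ln (fact m2) + ln (fact m3) + ln (fact m4)"
      by (simp add: hahn_weight_def mdef ln_div ln_mult)
    also have "\<dots> = n * (xlnx (real m1 / n) + xlnx (real m2 / n) + xlnx (real m3 / n) + xlnx (real m4 / n))
       + (real m1 + real m2 + real m3 + real m4) * (ln n - 1) + (d1 + d2 + d3 + d4)"
      unfolding d1 d2 d3 d4 sc by (simp add: algebra_simps)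
    also have "real m1 + real m2 + real m3 + real m4 = 2 * (n - 1) + real (a k) + real (b k)"
      unfolding mr a b n_def by simp
    also have "xlnx (real m1 / n) + xlnx (real m2 / n) + xlnx (real m3 / n) + xlnx (real m4 / n) = X k s"
    proof -
      have "real m1 / n = real s / n" "real m2 / n = real s / n + B" "real m3 / n = 1 - 1 / n - real s / n"
        "real m4 / n = 1 - 1 / n - real s / n + A"
        unfolding mr using n1 by (auto simp: field_simps)
      then show ?thesis by (simp only: X_def n_def)
    qed
    finally have e: "cellfield (N k) (a k) (b k) s - X k s = (d1 + d2 + d3 + d4) / n"
      using n1 unfolding cellfield_def n_def[symmetric] by (simp add: field_simps)
    have sq: "sqrt (real m) \<le> sqrt R * sqrt n" if "real m \<le> R * n" for m
      using that by (metis real_sqrt_le_iff real_sqrt_mult)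
    define S where "S = sqrt R * sqrt n"
    have "d1 \<le> 1 + 2 * S" "d2 \<le> 1 + 2 * S" "d3 \<le> 1 + 2 * S" "d4 \<le> 1 + 2 * S"
      using d1(3) d2(3) d3(3) d4(3) sq[OF mR(1)] sq[OF mR(2)] sq[OF mR(3)] sq[OF mR(4)]
      unfolding S_def[symmetric] by linarith+
    then have "d1 + d2 + d3 + d4 \<le> (1 + 2 * S) + (1 + 2 * S) + (1 + 2 * S) + (1 + 2 * S)" by (intro add_mono)
    then have "d1 + d2 + d3 + d4 \<le> 4 * (1 + 2 * (sqrt R * sqrt n))" by (simp add: S_def)
    then have "(d1 + d2 + d3 + d4) / n \<le> 4 * (1 + 2 * (sqrt R * sqrt n)) / n"
      using n1 by (intro divide_right_mono) auto
    also have "\<dots> = 4 * (1 / n + 2 * sqrt R * (sqrt n / n))" by (simp add: add_divide_distrib)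
    also have "sqrt n / n = 1 / sqrt n" using n1 by (metis real_sqrt_ge_zero sqrt_divide_self_eq inverse_eq_divide order.trans zero_le_one)
    finally have "(d1 + d2 + d3 + d4) / n \<le> E k" by (simp add: E_def n_def)
    moreover have "0 \<le> (d1 + d2 + d3 + d4) / n" using d1(2) d2(2) d3(2) d4(2) n1 by simp
    ultimately show ?thesis unfolding e by simp
  qed
  have E0: "E \<longlonglongrightarrow> 0"
  proof -
    have Ninf: "filterlim (\<lambda>k. real (N k)) at_top sequentially"
      by (rule filterlim_compose[OF filterlim_real_sequentially N])
    have i: "(\<lambda>k. 1 / real (N k)) \<longlonglongrightarrow> 0"
      by (rule tendsto_divide_0[OF tendsto_const filterlim_at_top_imp_at_infinity[OF Ninf]])
    have "(\<lambda>k. sqrt (1 / real (N k))) \<longlonglongrightarrow> sqrt 0" by (intro tendsto_real_sqrt i)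
    then have "(\<lambda>k. 1 / sqrt (real (N k))) \<longlonglongrightarrow> 0" by (simp add: real_sqrt_divide)
    then have "(\<lambda>k. 4 * (1 / real (N k) + 2 * sqrt R * (1 / sqrt (real (N k))))) \<longlonglongrightarrow> 4 * (0 + 2 * sqrt R * 0)"
      by (intro tendsto_intros i)
    then show ?thesis by (simp add: E_def[abs_def])
  qed
  obtain K0 where K0: "\<forall>z\<in>{0..R}. \<bar>xlnx z\<bar> \<le> K0" using xlnx_bounded by blast
  have XK: "\<bar>X k s\<bar> \<le> 4 * K0" if s: "s < N k" for k s
  proof -
    have "real s + 1 \<le> real (N k)" using s by linarith
    then have "(real s + 1) / real (N k) \<le> 1" using Nr[of k] by (simp add: divide_le_eq)
    then have pq: "real s / real (N k) + 1 / real (N k) \<le> 1" by (simp add: add_divide_distrib)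
    define p q where "p = real s / real (N k)" and "q = 1 / real (N k)"
    have "0 \<le> p" "0 \<le> q" "p + q \<le> 1" using pq by (auto simp: p_def q_def)
    then have "p \<in> {0..R}" "p + B \<in> {0..R}" "1 - q - p \<in> {0..R}" "1 - q - p + A \<in> {0..R}"
      using AB by (auto simp: R_def)
    then have "\<bar>xlnx p\<bar> \<le> K0" "\<bar>xlnx (p + B)\<bar> \<le> K0" "\<bar>xlnx (1 - q - p)\<bar> \<le> K0" "\<bar>xlnx (1 - q - p + A)\<bar> \<le> K0"
      using K0 by auto
    then have "\<bar>xlnx p + xlnx (p + B) + xlnx (1 - q - p) + xlnx (1 - q - p + A)\<bar> \<le> 4 * K0" by linarith
    then show ?thesis unfolding X_def p_def q_def .
  qed
  obtain K1 where K1: "\<And>u. u \<in> {0..1} \<Longrightarrow> \<bar>hahn_field A B u\<bar> \<le> K1"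
    using hahn_field_bounded[of A B] AB by (metis less_imp_le)
  obtain K2 where K2: "\<And>k. \<bar>E k\<bar> \<le> K2"
    using convergent_imp_Bseq[of E] E0 unfolding Bseq_def convergent_def by (metis real_norm_def)
  have "(\<lambda>k. LINT u|unif. \<bar>cellfield (N k) (a k) (b k) (cell (N k) u) - hahn_field A B u\<bar>) \<longlonglongrightarrow> (LINT u|unif. 0)"
  proof (rule integral_dominated_convergence[where w = "\<lambda>u. K2 + 4 * K0 + K1"])
    show "AE u in unif. (\<lambda>k. \<bar>cellfield (N k) (a k) (b k) (cell (N k) u) - hahn_field A B u\<bar>) \<longlonglongrightarrow> 0"
      using AE_unif_lt_1
    proof eventually_elim
      case (elim u)
      have r: "(\<lambda>k. real (cell (N k) u) / real (N k)) \<longlonglongrightarrow> u" using elim by (intro cell_ratio[OF N N0]) auto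
      have i: "(\<lambda>k. 1 / real (N k)) \<longlonglongrightarrow> 0"
        by (rule tendsto_divide_0[OF tendsto_const filterlim_at_top_imp_at_infinity[OF filterlim_compose[OF filterlim_real_sequentially N]]])
      have "(\<lambda>k. X k (cell (N k) u)) \<longlonglongrightarrow> xlnx u + xlnx (u + B) + xlnx (1 - 0 - u) + xlnx (1 - 0 - u + A)"
        unfolding X_def by (intro tendsto_intros tendsto_xlnx r i)
      then have Xl: "(\<lambda>k. X k (cell (N k) u)) \<longlonglongrightarrow> hahn_field A B u" by (simp add: hahn_field_def)
      show ?case
      proof (rule tendsto_sandwich[of "\<lambda>_. 0" _ _ "\<lambda>k. E k + \<bar>X k (cell (N k) u) - hahn_field A B u\<bar>"])
        have "(\<lambda>k. E k + \<bar>X k (cell (N k) u) - hahn_field A B u\<bar>) \<longlonglongrightarrow> 0 + \<bar>hahn_field A B u - hahn_field A B u\<bar>"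
          by (intro tendsto_intros E0 Xl)
        then show "(\<lambda>k. E k + \<bar>X k (cell (N k) u) - hahn_field A B u\<bar>) \<longlonglongrightarrow> 0" by simp
        have "\<bar>cellfield (N k) (a k) (b k) (cell (N k) u) - hahn_field A B u\<bar> \<le> E k + \<bar>X k (cell (N k) u) - hahn_field A B u\<bar>" for k
          using near[OF cell_less[OF elim N0], of k] by linarith
        then show "\<forall>\<^sub>F k in sequentially. \<bar>cellfield (N k) (a k) (b k) (cell (N k) u) - hahn_field A B u\<bar> \<le> E k + \<bar>X k (cell (N k) u) - hahn_field A B u\<bar>"
          by simp
      qed auto
    qed
    show "AE u in unif. norm \<bar>cellfield (N k) (a k) (b k) (cell (N k) u) - hahn_field A B u\<bar> \<le> K2 + 4 * K0 + K1" for k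
      using AE_unif_lt_1
    proof eventually_elim
      case (elim u)
      have "\<bar>hahn_field A B u\<bar> \<le> K1" using K1[of u] elim by auto
      then show ?case
        using near[OF cell_less[OF elim N0], of k] XK[OF cell_less[OF elim N0], of k] K2[of k] by auto
    qed
  qed (auto intro!: borel_measurable_unif)
  then show ?thesis by simp
qed

text \<open>Scaling distances by N costs ln N for each of the n (n - 1) ordered pairs. Everything
  outside the N^2 term depends only on n, N, a and b, hence cancels when configurations are
  compared.\<close>

lemma discriminant_energy:
  assumes N: "0 < N" and Y: "Y \<subseteq> {..<N}" and n: "card Y = n"
  shows "- ln (discriminant Y * (\<Prod>s\<in>Y. hahn_weight N a b s))
    = (real N)\<^sup>2 * ((LINT z|unif2. cellker N z * (occ N Y (fst z) * occ N Y (snd z)))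
        + (LINT u|unif. cellfield N a b (cell N u) * occ N Y u))
      + (real n * (2 * (real N - 1) + real a + real b) * (ln (real N) - 1) - real n * (real n - 1) * ln (real N))"
proof -
  have fin: "finite Y" using Y finite_subset by blast
  have Nr: "0 < real N" using N by simp
  define I where "I s = (if s \<in> Y then 1 else 0 :: real)" for s
  have sumI: "(\<Sum>s<N. g s * I s) = (\<Sum>s\<in>Y. g s)" for g :: "nat \<Rightarrow> real"
  proof -
    have "(\<Sum>s<N. g s * I s) = (\<Sum>s<N. if s \<in> Y then g s else 0)" by (intro sum.cong) (auto simp: I_def)
    also have "\<dots> = (\<Sum>s\<in>{..<N} \<inter> Y. g s)" by (simp add: sum.inter_restrict)
    also have "{..<N} \<inter> Y = Y" using Y by auto
    finally show ?thesis .
  qed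
  have occI: "occ N Y u = I (cell N u)" for u by (simp add: occ_def I_def)
  have D: "(real N)\<^sup>2 * (LINT z|unif2. cellker N z * (occ N Y (fst z) * occ N Y (snd z))) = (\<Sum>s\<in>Y. \<Sum>t\<in>Y. logker ((real s - real t) / real N))"
  proof -
    have "(LINT z|unif2. cellker N z * (occ N Y (fst z) * occ N Y (snd z)))
      = (\<Sum>s<N. \<Sum>t<N. logker ((real s - real t) / real N) * (I s * I t)) / (real N)\<^sup>2"
      unfolding cellker_def occI
      by (rule integral_cell_pair(1)[OF N, of "\<lambda>s t. logker ((real s - real t) / real N) * (I s * I t)"])
    also have "(\<Sum>s<N. \<Sum>t<N. logker ((real s - real t) / real N) * (I s * I t))
       = (\<Sum>s<N. (\<Sum>t<N. logker ((real s - real t) / real N) * I t) * I s)"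
      by (intro sum.cong refl) (simp add: sum_distrib_left sum_distrib_right mult_ac)
    finally show ?thesis using Nr by (simp add: sumI)
  qed
  have Fi: "(real N)\<^sup>2 * (LINT u|unif. cellfield N a b (cell N u) * occ N Y u) = real N * (\<Sum>s\<in>Y. cellfield N a b s)"
  proof -
    have "(LINT u|unif. cellfield N a b (cell N u) * occ N Y u) = (\<Sum>s<N. cellfield N a b s * I s) / real N"
      unfolding occI by (rule integral_cell[OF N, of "\<lambda>s. cellfield N a b s * I s"])
    then show ?thesis using Nr by (simp add: sumI power2_eq_square)
  qed
  have "ln (discriminant Y) = (\<Sum>p\<in>Y. \<Sum>q\<in>Y - {p}. ln \<bar>real p - real q\<bar>)"
  proof -
    have "ln (discriminant Y) = (\<Sum>p\<in>Y. ln (\<Prod>q\<in>Y - {p}. \<bar>real p - real q\<bar>))"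
      unfolding discriminant_def using fin by (subst ln_prod) (auto intro!: prod_pos)
    also have "\<dots> = (\<Sum>p\<in>Y. \<Sum>q\<in>Y - {p}. ln \<bar>real p - real q\<bar>)"
      using fin by (intro sum.cong refl ln_prod) auto
    finally show ?thesis .
  qed
  also have "\<dots> = (\<Sum>p\<in>Y. \<Sum>q\<in>Y - {p}. ln (real N) - logker ((real p - real q) / real N))"
    using Nr by (intro sum.cong refl) (auto simp: logker_def abs_divide ln_div)
  also have "\<dots> = (\<Sum>p\<in>Y. (real n - 1) * ln (real N) - (\<Sum>q\<in>Y. logker ((real p - real q) / real N)))"
  proof (intro sum.cong refl)
    fix p assume p: "p \<in> Y"
    have "(\<Sum>q\<in>Y. logker ((real p - real q) / real N)) = (\<Sum>q\<in>Y - {p}. logker ((real p - real q) / real N))"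
      using p fin by (subst sum.remove[of _ p]) (auto simp: logker_def)
    moreover have "card (Y - {p}) = n - 1" "1 \<le> n" using p fin n by (auto simp: Suc_le_eq card_gt_0_iff)
    ultimately show "(\<Sum>q\<in>Y - {p}. ln (real N) - logker ((real p - real q) / real N))
      = (real n - 1) * ln (real N) - (\<Sum>q\<in>Y. logker ((real p - real q) / real N))"
      by (simp add: sum_subtractf of_nat_diff)
  qed
  finally have lnD: "ln (discriminant Y) = real n * (real n - 1) * ln (real N) - (\<Sum>p\<in>Y. \<Sum>q\<in>Y. logker ((real p - real q) / real N))"
    using n by (simp add: sum_subtractf)
  have lnW: "ln (\<Prod>s\<in>Y. hahn_weight N a b s) = (\<Sum>s\<in>Y. ln (hahn_weight N a b s))"
    using fin by (intro ln_prod) (auto simp: less_imp_neq[OF hahn_weight_pos, symmetric])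
  also have "\<dots> = (\<Sum>s\<in>Y. - (real N * cellfield N a b s) - (2 * (real N - 1) + real a + real b) * (ln (real N) - 1))"
    using Nr by (intro sum.cong refl) (simp add: cellfield_def)
  also have "\<dots> = - (real N * (\<Sum>s\<in>Y. cellfield N a b s)) - real n * (2 * (real N - 1) + real a + real b) * (ln (real N) - 1)"
    using n by (simp add: sum_subtractf sum_negf sum_distrib_left mult.assoc)
  finally have lnW: "ln (\<Prod>s\<in>Y. hahn_weight N a b s) = - (real N * (\<Sum>s\<in>Y. cellfield N a b s)) - real n * (2 * (real N - 1) + real a + real b) * (ln (real N) - 1)" .
  have dpos: "0 < discriminant Y" unfolding discriminant_def using fin by (auto intro!: prod_pos)
  have wpos: "0 < (\<Prod>s\<in>Y. hahn_weight N a b s)" by (intro prod_pos) (auto simp: hahn_weight_pos)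
  have "- ln (discriminant Y * (\<Prod>s\<in>Y. hahn_weight N a b s)) = - ln (discriminant Y) - ln (\<Prod>s\<in>Y. hahn_weight N a b s)"
    using dpos wpos by (simp add: ln_mult)
  then show ?thesis unfolding lnD lnW distrib_left D Fi by simp
qed

text \<open>The bound is uniform over configurations: \<open>occ\<close> takes values in [0, 1], so
  only the L1 distances of the kernels and of the fields remain.\<close>

lemma discretized_energy_error:
  assumes N: "0 < N" and Y: "Y \<subseteq> {..<N}" and AB: "0 < A" "0 < B"
  shows "\<bar>((LINT z|unif2. cellker N z * (occ N Y (fst z) * occ N Y (snd z)))
        + (LINT u|unif. cellfield N a b (cell N u) * occ N Y u)) - hahn_energy A B (occ N Y)\<bar>
    \<le> (LINT z|unif2. \<bar>cellker N z - logker (fst z - snd z)\<bar>) + (LINT u|unif. \<bar>cellfield N a b (cell N u) - hahn_field A B u\<bar>)"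
proof -
  have [measurable]: "occ N Y \<in> borel_measurable borel" using bddm_occ by (rule bddm_measurable)
  have o: "0 \<le> occ N Y u" "occ N Y u \<le> 1" for u by (auto simp: occ_def)
  define pp where "pp z = occ N Y (fst z) * occ N Y (snd z)" for z
  have pp: "\<bar>pp z\<bar> \<le> 1" for z by (auto simp: pp_def occ_def)
  have [measurable]: "pp \<in> borel_measurable unif2" unfolding pp_def by measurable
  note ck = integrable_cellker[OF N]
  have [measurable]: "cellker N \<in> borel_measurable unif2" using ck by (rule borel_measurable_integrable)
  have i1: "integrable unif2 (\<lambda>z. cellker N z * pp z)"
  proof (rule Bochner_Integration.integrable_bound[OF ck])
    show "AE z in unif2. norm (cellker N z * pp z) \<le> norm (cellker N z)"
      using pp by (intro AE_I2) (auto simp: abs_mult mult_left_le)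
  qed measurable
  have i2: "integrable unif2 (\<lambda>z. logker (fst z - snd z) * pp z)"
    unfolding pp_def by (rule integrable_logker_bddm[OF bddm_occ bddm_occ])
  obtain K where K: "\<And>u. u \<in> {0..1} \<Longrightarrow> \<bar>hahn_field A B u\<bar> \<le> K"
    using hahn_field_bounded[of A B] AB by (metis less_imp_le)
  have i3: "integrable unif (\<lambda>u. hahn_field A B u * occ N Y u)"
  proof (rule unif.integrable_const_bound[where B = K])
    show "AE u in unif. norm (hahn_field A B u * occ N Y u) \<le> K"
    proof (rule AE_I2)
      fix u assume "u \<in> space unif"
      then have "\<bar>hahn_field A B u\<bar> \<le> K" using K by (simp add: space_unif)
      then show "norm (hahn_field A B u * occ N Y u) \<le> K" by (auto simp: occ_def)
    qed
  qed (auto intro!: borel_measurable_unif)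
  define C where "C = (\<Sum>s<N. \<bar>cellfield N a b s\<bar>)"
  have C: "\<bar>cellfield N a b s\<bar> \<le> C" if "s < N" for s
    unfolding C_def using that by (intro member_le_sum) auto
  have i5: "integrable unif (\<lambda>u. cellfield N a b (cell N u))"
  proof (rule unif.integrable_const_bound[where B = C])
    show "AE u in unif. norm (cellfield N a b (cell N u)) \<le> C"
      using AE_unif_lt_1 by eventually_elim (use C cell_less[OF _ N] in auto)
  qed (auto intro!: borel_measurable_unif)
  have i4: "integrable unif (\<lambda>u. cellfield N a b (cell N u) * occ N Y u)"
  proof (rule Bochner_Integration.integrable_bound[OF i5])
    show "AE u in unif. norm (cellfield N a b (cell N u) * occ N Y u) \<le> norm (cellfield N a b (cell N u))"
      by (intro AE_I2) (auto simp: occ_def)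
  qed (auto intro!: borel_measurable_unif)
  have i6: "integrable unif (hahn_field A B)"
  proof (rule unif.integrable_const_bound[where B = K])
    show "AE u in unif. norm (hahn_field A B u) \<le> K" using K by (auto intro!: AE_I2 simp: space_unif)
  qed (auto intro!: borel_measurable_unif)
  have 1: "\<bar>(LINT z|unif2. cellker N z * pp z) - log_energy (occ N Y) (occ N Y)\<bar> \<le> (LINT z|unif2. \<bar>cellker N z - logker (fst z - snd z)\<bar>)"
  proof -
    have "(LINT z|unif2. cellker N z * pp z) - log_energy (occ N Y) (occ N Y) = (LINT z|unif2. cellker N z * pp z - logker (fst z - snd z) * pp z)"
      unfolding log_energy_def pp_def[symmetric] using i1 i2 by simp
    also have "\<bar>\<dots>\<bar> \<le> (LINT z|unif2. \<bar>cellker N z * pp z - logker (fst z - snd z) * pp z\<bar>)" by (rule integral_abs_bound)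
    also have "\<dots> \<le> (LINT z|unif2. \<bar>cellker N z - logker (fst z - snd z)\<bar>)"
    proof (rule integral_mono)
      show "integrable unif2 (\<lambda>z. \<bar>cellker N z * pp z - logker (fst z - snd z) * pp z\<bar>)" using i1 i2 by simp
      show "integrable unif2 (\<lambda>z. \<bar>cellker N z - logker (fst z - snd z)\<bar>)" using ck integrable_logker by simp
      show "\<bar>cellker N z * pp z - logker (fst z - snd z) * pp z\<bar> \<le> \<bar>cellker N z - logker (fst z - snd z)\<bar>" for z
        unfolding left_diff_distrib[symmetric] abs_mult using pp[of z] by (intro mult_left_le) auto
    qed
    finally show ?thesis .
  qed
  have 2: "\<bar>(LINT u|unif. cellfield N a b (cell N u) * occ N Y u) - (LINT u|unif. hahn_field A B u * occ N Y u)\<bar>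
     \<le> (LINT u|unif. \<bar>cellfield N a b (cell N u) - hahn_field A B u\<bar>)"
  proof -
    have "(LINT u|unif. cellfield N a b (cell N u) * occ N Y u) - (LINT u|unif. hahn_field A B u * occ N Y u)
       = (LINT u|unif. cellfield N a b (cell N u) * occ N Y u - hahn_field A B u * occ N Y u)"
      using i3 i4 by simp
    also have "\<bar>\<dots>\<bar> \<le> (LINT u|unif. \<bar>cellfield N a b (cell N u) * occ N Y u - hahn_field A B u * occ N Y u\<bar>)" by (rule integral_abs_bound)
    also have "\<dots> \<le> (LINT u|unif. \<bar>cellfield N a b (cell N u) - hahn_field A B u\<bar>)"
    proof (rule integral_mono)
      show "integrable unif (\<lambda>u. \<bar>cellfield N a b (cell N u) * occ N Y u - hahn_field A B u * occ N Y u\<bar>)" using i3 i4 by simp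
      show "integrable unif (\<lambda>u. \<bar>cellfield N a b (cell N u) - hahn_field A B u\<bar>)" using i5 i6 by simp
    qed (auto simp: occ_def)
    finally show ?thesis .
  qed
  show ?thesis using 1 2 unfolding hahn_energy_def pp_def by linarith
qed

text \<open>The mean of - ln W under the Gibbs weights is the entropy minus ln Z. The entropy is at
  most ln (card S), by ln y \<le> y - 1 with y = 1 / (c p), and Z is at least
  \<open>W Y0\<close>.\<close>

lemma gibbs_variational:
  fixes W :: "'a \<Rightarrow> real"
  assumes fin: "finite S" and W: "\<And>Y. Y \<in> S \<Longrightarrow> 0 < W Y" and Y0: "Y0 \<in> S"
  shows "(\<Sum>Y\<in>S. W Y / sum W S * (- ln (W Y))) \<le> ln (real (card S)) - ln (W Y0)"
proof -
  define Z where "Z = sum W S"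
  define c where "c = real (card S)"
  have c: "0 < c" using fin Y0 by (auto simp: c_def card_gt_0_iff)
  have WZ: "W Y0 \<le> Z" unfolding Z_def using fin Y0 W by (intro member_le_sum) (auto intro: less_imp_le)
  have Z: "0 < Z" using WZ W[OF Y0] by linarith
  have "W Y / Z * (- ln (W Y)) \<le> 1 / c - W Y / Z + W Y / Z * (ln c - ln Z)" if Y: "Y \<in> S" for Y
  proof -
    define p where "p = W Y / Z"
    have p: "0 < p" using W[OF Y] Z by (simp add: p_def)
    have "ln (1 / (c * p)) \<le> 1 / (c * p) - 1" using c p by (intro ln_le_minus_one) simp
    moreover have "ln (1 / (c * p)) = - ln c - (ln (W Y) - ln Z)"
      using c p W[OF Y] Z by (simp add: ln_div ln_mult p_def)
    ultimately have "p * (- ln c - (ln (W Y) - ln Z)) \<le> p * (1 / (c * p) - 1)"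
      using p by (intro mult_left_mono) auto
    also have "\<dots> = 1 / c - p" using p c by (simp add: right_diff_distrib)
    finally show ?thesis unfolding p_def[symmetric] by (simp add: algebra_simps)
  qed
  then have "(\<Sum>Y\<in>S. W Y / Z * (- ln (W Y))) \<le> (\<Sum>Y\<in>S. 1 / c - W Y / Z + W Y / Z * (ln c - ln Z))"
    by (rule sum_mono)
  also have "\<dots> = ln c - ln Z"
    using Z c unfolding sum.distrib sum_subtractf sum_distrib_right[symmetric] sum_divide_distrib[symmetric]
    by (simp add: Z_def[symmetric] c_def[symmetric])
  also have "\<dots> \<le> ln c - ln (W Y0)" using WZ W[OF Y0] by simp
  finally show ?thesis by (simp add: Z_def c_def)
qed

section \<open>Convexity and pointwise continuity of the energy\<close>

lemma bddm_sum: "finite I \<Longrightarrow> (\<And>i. i \<in> I \<Longrightarrow> bddm (f i)) \<Longrightarrow> bddm (\<lambda>x. \<Sum>i\<in>I. p i * f i x)"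
proof (induction I rule: finite_induct)
  case (insert i I)
  then show ?case using bddm_lin[of "f i" "\<lambda>x. \<Sum>i\<in>I. p i * f i x" "p i" 1] by simp
qed (auto intro: bddmI[where K = 0])

lemma log_energy_sum_left:
  "finite I \<Longrightarrow> (\<And>i. i \<in> I \<Longrightarrow> bddm (f i)) \<Longrightarrow> bddm h \<Longrightarrow>
    log_energy (\<lambda>x. \<Sum>i\<in>I. p i * f i x) h = (\<Sum>i\<in>I. p i * log_energy (f i) h)"
proof (induction I rule: finite_induct)
  case empty
  then show ?case by (simp add: log_energy_def)
next
  case (insert i I)
  then show ?case using log_energy_lin_left[of "f i" "\<lambda>x. \<Sum>i\<in>I. p i * f i x" h "p i" 1] bddm_sum[of I f p]
    by simp
qed

lemma integrable_hahn_field: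
  assumes AB: "0 < A" "0 < B" and f: "bddm f"
  shows "integrable unif (\<lambda>u. hahn_field A B u * f u)"
proof -
  obtain K where K: "\<And>u. u \<in> {0..1} \<Longrightarrow> \<bar>hahn_field A B u\<bar> \<le> K"
    using hahn_field_bounded[of A B] AB by (metis less_imp_le)
  obtain L where L: "\<And>u. \<bar>f u\<bar> \<le> L" using f by (auto simp: bddm_def)
  have [measurable]: "f \<in> borel_measurable borel" using f by (rule bddm_measurable)
  show ?thesis
  proof (rule unif.integrable_const_bound[where B = "K * L"])
    show "AE u in unif. norm (hahn_field A B u * f u) \<le> K * L"
    proof (rule AE_I2)
      fix u assume "u \<in> space unif"
      then have "\<bar>hahn_field A B u\<bar> \<le> K" using K by (simp add: space_unif)
      then show "norm (hahn_field A B u * f u) \<le> K * L"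
        using L[of u] unfolding real_norm_def abs_mult by (intro mult_mono) auto
    qed
  qed (auto intro!: borel_measurable_unif)
qed

text \<open>The energies of \<open>f i - g\<close>, averaged with the weights \<open>p i\<close>,
  are exactly the convexity gap of the quadratic part, and they are nonnegative; the field part is
  linear.\<close>

lemma hahn_energy_convex:
  assumes AB: "0 < A" "0 < B" and I: "finite I" "\<And>i. i \<in> I \<Longrightarrow> bddm (f i)"
    and p: "\<And>i. i \<in> I \<Longrightarrow> 0 \<le> p i" "(\<Sum>i\<in>I. p i) = 1"
  shows "hahn_energy A B (\<lambda>x. \<Sum>i\<in>I. p i * f i x) \<le> (\<Sum>i\<in>I. p i * hahn_energy A B (f i))"
proof -
  define g where "g x = (\<Sum>i\<in>I. p i * f i x)" for x
  have g: "bddm g" unfolding g_def by (rule bddm_sum[OF I])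
  have lg: "log_energy g g = (\<Sum>i\<in>I. p i * log_energy (f i) g)"
    unfolding g_def[abs_def] using log_energy_sum_left[OF I g] by (simp add: g_def[abs_def])
  have "0 \<le> (\<Sum>i\<in>I. p i * log_energy (\<lambda>x. f i x - g x) (\<lambda>x. f i x - g x))"
    using p I g by (intro sum_nonneg mult_nonneg_nonneg log_energy_nonneg bddm_diff) auto
  also have "\<dots> = (\<Sum>i\<in>I. p i * (log_energy (f i) (f i) - 2 * log_energy (f i) g + log_energy g g))"
    using log_energy_square[of _ g 1 "-1"] I g by (intro sum.cong refl) simp
  also have "\<dots> = (\<Sum>i\<in>I. p i * log_energy (f i) (f i)) - 2 * (\<Sum>i\<in>I. p i * log_energy (f i) g) + (\<Sum>i\<in>I. p i) * log_energy g g"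
    by (simp add: algebra_simps sum.distrib sum_subtractf sum_distrib_left sum_distrib_right)
  finally have 1: "log_energy g g \<le> (\<Sum>i\<in>I. p i * log_energy (f i) (f i))"
    using p(2) lg by simp
  have "(LINT u|unif. hahn_field A B u * g u) = (LINT u|unif. (\<Sum>i\<in>I. p i * (hahn_field A B u * f i u)))"
    by (simp add: g_def sum_distrib_left mult_ac)
  also have "\<dots> = (\<Sum>i\<in>I. p i * (LINT u|unif. hahn_field A B u * f i u))"
    using integrable_hahn_field[OF AB I(2)] by (subst Bochner_Integration.integral_sum) auto
  finally show ?thesis using 1 unfolding hahn_energy_def g_def[symmetric]
    by (simp add: distrib_left sum.distrib)
qed

lemma AE_unif_interior: "AE u in unif. u \<in> {0<..<1}"
  using AE_unif_neq[of 1] AE_unif_neq[of 0] AE_space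
  by eventually_elim (auto simp: space_unif)

lemma AE_unif2_interior: "AE z in unif2. fst z \<in> {0<..<1} \<and> snd z \<in> {0<..<1}"
proof (rule unif2.AE_pair_measure)
  show "{z \<in> space unif2. fst z \<in> {0<..<1} \<and> snd z \<in> {0<..<1}} \<in> sets unif2" by measurable
  show "AE x in unif. AE y in unif. fst (x, y) \<in> {0<..<1} \<and> snd (x, y) \<in> {0<..<1}"
    using AE_unif_interior
  proof eventually_elim
    case (elim x)
    show ?case using AE_unif_interior by eventually_elim (use elim in auto)
  qed
qed

lemma hahn_energy_tendsto:
  assumes AB: "0 < A" "0 < B" and f: "\<And>k. bddm (f k)" and g: "bddm g"
    and b: "\<And>k u. \<bar>f k u\<bar> \<le> 1" and lim: "\<And>u. u \<in> {0<..<1} \<Longrightarrow> (\<lambda>k. f k u) \<longlonglongrightarrow> g u"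
  shows "(\<lambda>k. hahn_energy A B (f k)) \<longlonglongrightarrow> hahn_energy A B g"
proof -
  have [measurable]: "f k \<in> borel_measurable borel" "g \<in> borel_measurable borel" for k
    using f g by (auto intro: bddm_measurable)
  have "(\<lambda>k. log_energy (f k) (f k)) \<longlonglongrightarrow> log_energy g g"
    unfolding log_energy_def
  proof (rule integral_dominated_convergence[where w = "\<lambda>z. \<bar>logker (fst z - snd z)\<bar>"])
    show "AE z in unif2. (\<lambda>k. logker (fst z - snd z) * (f k (fst z) * f k (snd z))) \<longlonglongrightarrow> logker (fst z - snd z) * (g (fst z) * g (snd z))"
      using AE_unif2_interior by eventually_elim (auto intro!: tendsto_intros lim)
    show "AE z in unif2. norm (logker (fst z - snd z) * (f k (fst z) * f k (snd z))) \<le> \<bar>logker (fst z - snd z)\<bar>" for k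
    proof (rule AE_I2)
      fix z :: "real \<times> real"
      have "\<bar>f k (fst z)\<bar> * \<bar>f k (snd z)\<bar> \<le> 1 * 1" using b by (intro mult_mono) auto
      then show "norm (logker (fst z - snd z) * (f k (fst z) * f k (snd z))) \<le> \<bar>logker (fst z - snd z)\<bar>"
        unfolding real_norm_def abs_mult by (intro mult_left_le) auto
    qed
  qed (use integrable_logker in auto)
  moreover have "(\<lambda>k. LINT u|unif. hahn_field A B u * f k u) \<longlonglongrightarrow> (LINT u|unif. hahn_field A B u * g u)"
  proof (rule integral_dominated_convergence[where w = "\<lambda>u. \<bar>hahn_field A B u * 1\<bar>"])
    show "AE u in unif. (\<lambda>k. hahn_field A B u * f k u) \<longlonglongrightarrow> hahn_field A B u * g u"
      using AE_unif_interior by eventually_elim (auto intro!: tendsto_intros lim)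
    show "AE u in unif. norm (hahn_field A B u * f k u) \<le> \<bar>hahn_field A B u * 1\<bar>" for k
      using b by (intro AE_I2) (auto simp: abs_mult intro: mult_left_le)
    show "integrable unif (\<lambda>u. \<bar>hahn_field A B u * 1\<bar>)"
      by (intro integrable_abs integrable_hahn_field AB bddmI[where K = 1]) auto
  qed (auto intro!: borel_measurable_unif)
  ultimately show ?thesis unfolding hahn_energy_def by (rule tendsto_add)
qed

subsection \<open>Sampling a density by lattice configurations\<close>

definition dist_fun :: "(real \<Rightarrow> real) \<Rightarrow> real \<Rightarrow> real" where
  "dist_fun r x = (LINT u|unif. indicator {..x} u * r u)"

lemma dist_fun_increment:
  assumes r: "r \<in> borel_measurable borel" "\<And>u. 0 \<le> r u" "\<And>u. r u \<le> 1" and xy: "0 \<le> x" "x \<le> y" "y \<le> 1"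
  shows "0 \<le> dist_fun r y - dist_fun r x" "dist_fun r y - dist_fun r x \<le> y - x"
proof -
  note [measurable] = r(1)
  have br: "\<bar>r u\<bar> \<le> 1" for u using r(2,3)[of u] by simp
  have i: "integrable unif (\<lambda>u. indicator S u * r u)" if [measurable]: "S \<in> sets borel" for S
    by (rule unif.integrable_const_bound[where B = 1])
       (use br in \<open>auto simp: abs_mult indicator_def intro!: borel_measurable_unif\<close>)
  have "indicator {..y} u * r u - indicator {..x} u * r u = indicator {x<..y} u * r u" for u
    using xy by (auto simp: indicator_def)
  then have e: "dist_fun r y - dist_fun r x = (LINT u|unif. indicator {x<..y} u * r u)"
    unfolding dist_fun_def using i by (subst Bochner_Integration.integral_diff[symmetric]) auto
  show "0 \<le> dist_fun r y - dist_fun r x" unfolding e using r by (intro integral_nonneg_AE AE_I2) auto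
  have "(LINT u|unif. indicator {x<..y} u * r u) \<le> (LINT u|unif. indicator {x<..y} u)"
    using r i[of "{x<..y}"]
    by (intro integral_mono) (auto simp: indicator_def intro!: unif.integrable_const_bound[where B = 1] borel_measurable_unif)
  also have "\<dots> = (LINT u|lborel. indicator {x<..y} u)"
    unfolding integral_unif using xy by (intro bochner_cong refl) (auto simp: indicator_def)
  also have "\<dots> = y - x" using xy by simp
  finally show "dist_fun r y - dist_fun r x \<le> y - x" unfolding e .
qed

text \<open>Rounding the distribution function: a site is occupied when the integer part of N times
  the accumulated mass jumps across its cell. A density at most 1 makes every increment 0 or 1, and
  n = t N makes the final count exact.\<close>

lemma sampling_exists:
  assumes r: "r \<in> borel_measurable borel" "\<And>u. 0 \<le> r u" "\<And>u. r u \<le> 1"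
    and t: "(LINT u|unif. r u) = t" and n: "real n = t * real N" and N: "0 < N"
  obtains Y where "Y \<subseteq> {..<N}" "card Y = n" "\<And>x. x \<in> {0..1} \<Longrightarrow> \<bar>dist_fun (occ N Y) x - dist_fun r x\<bar> \<le> 3 / real N"
proof -
  have Nr: "0 < real N" using N by simp
  define R where "R m = real N * dist_fun r (real m / real N)" for m
  define fl where "fl m = nat \<lfloor>R m\<rfloor>" for m
  have d0: "dist_fun r 0 = 0"
  proof -
    have "AE u in unif. indicator {..0} u * r u = 0"
      using AE_unif_neq[of 0] AE_space by eventually_elim (auto simp: space_unif indicator_def)
    then show ?thesis unfolding dist_fun_def by (rule integral_eq_zero_AE)
  qed
  have d1: "dist_fun r 1 = t"
    unfolding dist_fun_def t[symmetric]
    by (intro bochner_cong refl) (auto simp: space_unif)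
  have R0: "R 0 = 0" by (simp add: R_def d0)
  have RN: "R N = real n" using Nr by (simp add: R_def d1 n)
  have Rstep: "R m \<le> R (Suc m)" "R (Suc m) \<le> R m + 1" if "m < N" for m
  proof -
    have xy: "0 \<le> real m / real N" "real m / real N \<le> real (Suc m) / real N" "real (Suc m) / real N \<le> 1"
      using that Nr by (auto simp: divide_right_mono)
    have inc: "0 \<le> dist_fun r (real (Suc m) / real N) - dist_fun r (real m / real N)"
      "dist_fun r (real (Suc m) / real N) - dist_fun r (real m / real N) \<le> real (Suc m) / real N - real m / real N"
      using dist_fun_increment[OF r xy] by auto
    have e: "real (Suc m) / real N - real m / real N = 1 / real N" by (simp add: diff_divide_distrib[symmetric])
    have "0 \<le> real N * (dist_fun r (real (Suc m) / real N) - dist_fun r (real m / real N))" using inc(1) Nr by simp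
    moreover have "real N * (dist_fun r (real (Suc m) / real N) - dist_fun r (real m / real N)) \<le> real N * (1 / real N)"
      using inc(2) e Nr by (intro mult_left_mono) auto
    ultimately show "R m \<le> R (Suc m)" "R (Suc m) \<le> R m + 1"
      using Nr unfolding R_def right_diff_distrib by auto
  qed
  have Rnn: "0 \<le> R m" if "m \<le> N" for m using that
  proof (induction m)
    case (Suc m)
    then show ?case using Rstep(1)[of m] by simp
  qed (simp add: R0)
  have flR: "real (fl m) \<le> R m" "R m < real (fl m) + 1" if "m \<le> N" for m
  proof -
    have "0 \<le> \<lfloor>R m\<rfloor>" using Rnn[OF that] by simp
    then have "real (fl m) = of_int \<lfloor>R m\<rfloor>" by (simp add: fl_def)
    then show "real (fl m) \<le> R m" "R m < real (fl m) + 1" by linarith+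
  qed
  have flstep: "fl (Suc m) = fl m \<or> fl (Suc m) = Suc (fl m)" if "m < N" for m
  proof -
    have "real (fl m) < real (fl (Suc m)) + 1" "real (fl (Suc m)) < real (fl m) + 2"
      using flR[of m] flR[of "Suc m"] Rstep[OF that] that by auto
    then show ?thesis by linarith
  qed
  define Y where "Y = {s. s < N \<and> fl (Suc s) \<noteq> fl s}"
  have Ysub: "Y \<subseteq> {..<N}" by (auto simp: Y_def)
  have count: "card (Y \<inter> {..<m}) = fl m" if "m \<le> N" for m using that
  proof (induction m)
    case 0
    then show ?case by (simp add: fl_def R0)
  next
    case (Suc m)
    have "Y \<inter> {..<Suc m} = (if m \<in> Y then insert m (Y \<inter> {..<m}) else Y \<inter> {..<m})"
      by (auto simp: less_Suc_eq)
    then have "card (Y \<inter> {..<Suc m}) = (if m \<in> Y then Suc (fl m) else fl m)"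
      using Suc by auto
    also have "\<dots> = fl (Suc m)" using flstep[of m] Suc by (auto simp: Y_def)
    finally show ?case .
  qed
  have cardY: "card Y = n"
  proof -
    have "Y \<inter> {..<N} = Y" using Ysub by auto
    then have "card Y = fl N" using count[of N] by simp
    then show ?thesis by (simp add: fl_def RN)
  qed
  have occb: "occ N Y \<in> borel_measurable borel" "\<And>u. 0 \<le> occ N Y u" "\<And>u. occ N Y u \<le> 1"
    using bddm_measurable[OF bddm_occ] by (auto simp: occ_def)
  have lattice: "dist_fun (occ N Y) (real m / real N) = real (fl m) / real N" if "m \<le> N" for m
  proof -
    have "dist_fun (occ N Y) (real m / real N) = (LINT u|unif. (if cell N u < m \<and> cell N u \<in> Y then 1 else 0))"
      unfolding dist_fun_def
    proof (rule integral_cong_AE)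
      show "AE u in unif. indicator {..real m / real N} u * occ N Y u = (if cell N u < m \<and> cell N u \<in> Y then 1 else 0)"
        using AE_unif_lt_1 AE_unif_neq[of "real m / real N"]
      proof eventually_elim
        case (elim u)
        have "u \<le> real m / real N \<longleftrightarrow> u < real m / real N" using elim(2) by linarith
        also have "\<dots> \<longleftrightarrow> real N * u < real m" using Nr by (simp only: less_divide_eq mult.commute[of u]) simp
        also have "\<dots> \<longleftrightarrow> cell N u < m" using cell_bounds[of u N] elim by auto
        finally show ?case by (auto simp: occ_def indicator_def)
      qed
      show "(\<lambda>u. indicator {..real m / real N} u * occ N Y u) \<in> borel_measurable unif"
        using occb(1) by (intro borel_measurable_unif) measurable
      show "(\<lambda>u. if cell N u < m \<and> cell N u \<in> Y then 1 else 0 :: real) \<in> borel_measurable unif"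
        by (intro borel_measurable_unif measurable_cell_fun[of "\<lambda>s. if s < m \<and> s \<in> Y then 1 else 0"])
    qed
    also have "\<dots> = (\<Sum>s<N. if s < m \<and> s \<in> Y then 1 else 0) / real N"
      by (rule integral_cell[OF N, of "\<lambda>s. if s < m \<and> s \<in> Y then 1 else 0"])
    also have "(\<Sum>s<N. if s < m \<and> s \<in> Y then 1 else 0 :: real) = real (card {s\<in>{..<N}. s < m \<and> s \<in> Y})"
      by (simp add: sum.If_cases Int_def)
    also have "{s\<in>{..<N}. s < m \<and> s \<in> Y} = Y \<inter> {..<m}" using that by auto
    finally show ?thesis using count[OF that] by simp
  qed
  have "\<bar>dist_fun (occ N Y) x - dist_fun r x\<bar> \<le> 3 / real N" if x: "x \<in> {0..1}" for x
  proof -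
    define m where "m = cell N x"
    have cb: "real m \<le> real N * x" "real N * x < real m + 1" using cell_bounds[of x N] x by (auto simp: m_def)
    have mN: "m \<le> N"
    proof -
      have "real N * x \<le> real N * 1" using x by (intro mult_left_mono) auto
      then show ?thesis using cb by simp
    qed
    have xm: "0 \<le> real m / real N" "real m / real N \<le> x" "x \<le> 1" "x - real m / real N \<le> 1 / real N"
    proof -
      have "x < (real m + 1) / real N" using cb Nr by (simp add: field_simps)
      then show "x - real m / real N \<le> 1 / real N" by (simp add: add_divide_distrib)
    qed (use cb Nr x in \<open>auto simp: divide_le_eq mult.commute\<close>)
    \<comment> \<open>Three errors of 1 / N: moving x to the grid in each of the two distribution
      functions, which are 1-Lipschitz, and the rounding at the grid point.\<close>
    define q where "q = 1 / real N"
    have 1: "\<bar>dist_fun (occ N Y) x - dist_fun (occ N Y) (real m / real N)\<bar> \<le> q"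
      using dist_fun_increment[OF occb xm(1-3)] xm(4) by (simp add: q_def)
    have 2: "\<bar>dist_fun r x - dist_fun r (real m / real N)\<bar> \<le> q"
      using dist_fun_increment[OF r xm(1-3)] xm(4) by (simp add: q_def)
    have 3: "\<bar>dist_fun (occ N Y) (real m / real N) - dist_fun r (real m / real N)\<bar> \<le> q"
    proof -
      have "dist_fun r (real m / real N) = R m / real N" using Nr by (simp add: R_def)
      then have "dist_fun (occ N Y) (real m / real N) - dist_fun r (real m / real N) = (real (fl m) - R m) / real N"
        using lattice[OF mN] by (simp add: diff_divide_distrib)
      moreover have "\<bar>real (fl m) - R m\<bar> \<le> 1" using flR[OF mN] by auto
      ultimately show ?thesis using Nr by (simp add: q_def abs_divide divide_right_mono)
    qed
    have "\<bar>dist_fun (occ N Y) x - dist_fun r x\<bar> \<le> 3 * q" using 1 2 3 by linarith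
    then show ?thesis by (simp add: q_def)
  qed
  from that[OF Ysub cardY this] show ?thesis .
qed

text \<open>Densities of mass t become probability measures on the real line, to which the theorems
  on weak convergence apply.\<close>

definition law :: "real \<Rightarrow> (real \<Rightarrow> real) \<Rightarrow> real measure" where
  "law t f = distr (density unif (\<lambda>u. ennreal (f u / t))) borel (\<lambda>u. u)"

lemma
  assumes f [measurable]: "f \<in> borel_measurable borel" and nn: "\<And>u. 0 \<le> f u" and le: "\<And>u. f u \<le> 1"
    and t: "0 < t" "(LINT u|unif. f u) = t"
  shows real_distribution_law: "real_distribution (law t f)"
    and integral_law: "\<And>g :: real \<Rightarrow> real. g \<in> borel_measurable borel \<Longrightarrow> (\<integral>u. g u \<partial>law t f) = (LINT u|unif. g u * f u) / t"
    and cdf_law: "cdf (law t f) x = dist_fun f x / t"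
proof -
  have int: "integrable unif f" using nn le by (intro integrable_unif_bddm bddmI[where K = 1]) auto
  have m: "(\<lambda>u. u) \<in> density unif (\<lambda>u. ennreal (f u / t)) \<rightarrow>\<^sub>M (borel :: real measure)"
    using measurable_ident_unif by simp
  have "prob_space (density unif (\<lambda>u. ennreal (f u / t)))"
  proof (rule prob_spaceI)
    have "emeasure (density unif (\<lambda>u. ennreal (f u / t))) (space (density unif (\<lambda>u. ennreal (f u / t))))
      = (\<integral>\<^sup>+u. ennreal (f u / t) * indicator (space unif) u \<partial>unif)"
      by (simp add: emeasure_density)
    also have "\<dots> = (\<integral>\<^sup>+u. ennreal (f u / t) \<partial>unif)" by (intro nn_integral_cong) auto
    also have "\<dots> = ennreal (LINT u|unif. f u / t)"
      using int nn t(1) by (intro nn_integral_eq_integral) (auto intro: AE_I2)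
    also have "\<dots> = 1" using t by simp
    finally show "emeasure (density unif (\<lambda>u. ennreal (f u / t))) (space (density unif (\<lambda>u. ennreal (f u / t)))) = 1" .
  qed
  then interpret P: prob_space "density unif (\<lambda>u. ennreal (f u / t))" .
  show rd: "real_distribution (law t f)" unfolding law_def by (rule P.real_distribution_distr[OF m])
  show int_law: "(\<integral>u. g u \<partial>law t f) = (LINT u|unif. g u * f u) / t"
    if g [measurable]: "g \<in> borel_measurable borel" for g :: "real \<Rightarrow> real"
  proof -
    have "(\<integral>u. g u \<partial>law t f) = (\<integral>u. g u \<partial>density unif (\<lambda>u. ennreal (f u / t)))"
      unfolding law_def using m by (subst integral_distr) auto
    also have "\<dots> = (LINT u|unif. f u / t * g u)"
      using nn t(1) by (subst integral_density) (auto intro: AE_I2)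
    also have "\<dots> = (LINT u|unif. g u * f u / t)" by (intro bochner_cong refl) simp
    finally show ?thesis by simp
  qed
  interpret R: real_distribution "law t f" by (rule rd)
  have "cdf (law t f) x = (\<integral>u. indicator {..x} u \<partial>law t f)" by (simp add: cdf_def)
  also have "\<dots> = dist_fun f x / t" by (subst int_law) (auto simp: dist_fun_def)
  finally show "cdf (law t f) x = dist_fun f x / t" .
qed

section \<open>Continuity of the energy under weak convergence\<close>

lemma dist_fun_outside:
  "x < 0 \<Longrightarrow> dist_fun f x = 0" "1 \<le> x \<Longrightarrow> dist_fun f x = (LINT u|unif. f u)"
proof -
  show "dist_fun f x = 0" if "x < 0"
  proof -
    have "dist_fun f x = (LINT u|unif. 0)"
      unfolding dist_fun_def using that by (intro bochner_cong refl) (auto simp: space_unif indicator_def)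
    then show ?thesis by simp
  qed
  show "dist_fun f x = (LINT u|unif. f u)" if "1 \<le> x"
    unfolding dist_fun_def using that by (intro bochner_cong refl) (auto simp: space_unif indicator_def)
qed

context
  fixes f :: "nat \<Rightarrow> real \<Rightarrow> real" and r :: "real \<Rightarrow> real" and t :: real
  assumes f: "\<And>k. f k \<in> borel_measurable borel" "\<And>k u. 0 \<le> f k u" "\<And>k u. f k u \<le> 1"
    and r: "r \<in> borel_measurable borel" "\<And>u. 0 \<le> r u" "\<And>u. r u \<le> 1"
    and t: "0 < t" "\<And>k. (LINT u|unif. f k u) = t" "(LINT u|unif. r u) = t"
    and conv: "\<And>x. x \<in> {0..1} \<Longrightarrow> (\<lambda>k. dist_fun (f k) x) \<longlonglongrightarrow> dist_fun r x"
begin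

lemma bddm_f: "bddm (f k)" and bddm_r: "bddm r"
  using f r by (auto intro!: bddmI[where K = 1] simp: abs_le_iff intro: order.trans[of _ 0])

text \<open>One discontinuity c is allowed because the limit law has a density and does not charge
  it. It is meant for the singularity of the logarithm, where \<open>ln 0 = 0\<close> makes even the
  truncated kernel discontinuous.\<close>

lemma weak_test:
  assumes g: "g \<in> borel_measurable borel" "\<And>x. \<bar>g x\<bar> \<le> K" "\<And>x. x \<noteq> c \<Longrightarrow> isCont g x"
  shows "(\<lambda>k. LINT u|unif. g u * f k u) \<longlonglongrightarrow> (LINT u|unif. g u * r u)"
proof -
  have rdf: "\<And>k. real_distribution (law t (f k))" and rdr: "real_distribution (law t r)"
    using real_distribution_law f r t by auto
  have "weak_conv_m (\<lambda>k. law t (f k)) (law t r)"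
    unfolding weak_conv_m_def weak_conv_def
  proof (intro allI impI)
    fix x
    have "(\<lambda>k. dist_fun (f k) x) \<longlonglongrightarrow> dist_fun r x"
    proof -
      consider "x < 0" | "x \<in> {0..1}" | "1 \<le> x" by fastforce
      then show ?thesis using conv dist_fun_outside t by cases auto
    qed
    then have "(\<lambda>k. dist_fun (f k) x / t) \<longlonglongrightarrow> dist_fun r x / t" using t(1) by (intro tendsto_intros) auto
    then show "(\<lambda>k. cdf (law t (f k)) x) \<longlonglongrightarrow> cdf (law t r) x"
      using cdf_law[OF f t(1,2)] cdf_law[OF r t(1,3)] by simp
  qed
  moreover have "emeasure (law t r) {x. \<not> isCont g x} = 0"
  proof -
    interpret R: real_distribution "law t r" by (rule rdr)
    have "measure (law t r) {c} = (\<integral>u. indicator {c} u \<partial>law t r)" by simp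
    also have "\<dots> = (LINT u|unif. indicator {c} u * r u) / t" by (rule integral_law[OF r t(1,3)]) simp
    also have "(LINT u|unif. indicator {c} u * r u) = 0"
    proof (rule integral_eq_zero_AE)
      show "AE u in unif. indicator {c} u * r u = 0" using AE_unif_neq[of c] by eventually_elim auto
    qed
    finally have "emeasure (law t r) {c} = 0" by (simp add: R.emeasure_eq_measure)
    moreover have "emeasure (law t r) {x. \<not> isCont g x} \<le> emeasure (law t r) {c}"
      using g(3) by (intro emeasure_mono) auto
    ultimately show ?thesis by simp
  qed
  ultimately have "(\<lambda>k. \<integral>u. g u \<partial>law t (f k)) \<longlonglongrightarrow> (\<integral>u. g u \<partial>law t r)"
    using weak_conv_imp_bdd_ae_continuous_conv[of "\<lambda>k. law t (f k)" "law t r" g K] rdf rdr g by simp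
  then have "(\<lambda>k. (LINT u|unif. g u * f k u) / t) \<longlonglongrightarrow> (LINT u|unif. g u * r u) / t"
    unfolding integral_law[OF f t(1,2) g(1)] integral_law[OF r t(1,3) g(1)] .
  then have "(\<lambda>k. (LINT u|unif. g u * f k u) / t * t) \<longlonglongrightarrow> (LINT u|unif. g u * r u) / t * t"
    by (rule tendsto_mult[OF _ tendsto_const])
  then show ?thesis using t(1) by simp
qed

text \<open>The kernel is cut off at height m. As all densities are at most 1, the discarded part is
  bounded by the integral of logker - g m, uniformly in k.\<close>

lemma potential_tendsto:
  assumes x: "x \<in> {0..1}"
  shows "(\<lambda>k. LINT v|unif. logker (x - v) * f k v) \<longlonglongrightarrow> (LINT v|unif. logker (x - v) * r v)"
proof (rule LIMSEQ_I)
  fix e :: real assume e: "0 < e"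
  define g where "g m v = max 0 (min (real m) (logker (x - v)))" for m :: nat and v
  have gm [measurable]: "g m \<in> borel_measurable borel" for m unfolding g_def by measurable
  have nn: "0 \<le> logker (x - v)" if "v \<in> {0..1}" for v using logker_nonneg[OF x that] .
  have il: "integrable unif (\<lambda>v. logker (x - v))" by (rule logker_integral(1)[OF x])
  have gl: "0 \<le> logker (x - v) - g m v" "logker (x - v) - g m v \<le> logker (x - v)" if "v \<in> {0..1}" for m v
    using nn[OF that] by (auto simp: g_def)
  have "(\<lambda>m. LINT v|unif. logker (x - v) - g m v) \<longlonglongrightarrow> (LINT v|unif. 0)"
  proof (rule integral_dominated_convergence[where w = "\<lambda>v. logker (x - v)"])
    show "AE v in unif. (\<lambda>m. logker (x - v) - g m v) \<longlonglongrightarrow> 0"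
    proof (rule AE_I2)
      fix v assume "v \<in> space unif"
      then have v: "v \<in> {0..1}" by (simp add: space_unif)
      obtain m0 where m0: "logker (x - v) \<le> real m0" using real_arch_simple by blast
      have "logker (x - v) - g m v = 0" if "m \<ge> m0" for m
      proof -
        have "logker (x - v) \<le> real m" using m0 \<open>m \<ge> m0\<close> by linarith
        then show ?thesis using nn[OF v] by (simp add: g_def)
      qed
      then show "(\<lambda>m. logker (x - v) - g m v) \<longlonglongrightarrow> 0" by (intro tendsto_eventually) (auto simp: eventually_sequentially)
    qed
    show "AE v in unif. norm (logker (x - v) - g m v) \<le> logker (x - v)" for m
      using gl by (intro AE_I2) (auto simp: space_unif)
  qed (use il in \<open>auto intro!: borel_measurable_unif\<close>)
  then have "(\<lambda>m. LINT v|unif. logker (x - v) - g m v) \<longlonglongrightarrow> 0" by simp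
  then have "\<forall>\<^sub>F m in sequentially. (LINT v|unif. logker (x - v) - g m v) < e / 3"
    using e by (intro order_tendstoD(2)) auto
  then obtain m where m: "(LINT v|unif. logker (x - v) - g m v) < e / 3" by (auto simp: eventually_sequentially)
  define e3 where "e3 = e / 3"
  have e3: "0 < e3" "e = 3 * e3" using e by (auto simp: e3_def)
  have gb: "\<bar>g m v\<bar> \<le> real m" for v by (auto simp: g_def)
  have close: "\<bar>(LINT v|unif. logker (x - v) * h v) - (LINT v|unif. g m v * h v)\<bar> < e3"
    if h [measurable]: "h \<in> borel_measurable borel" and h01: "\<And>u. 0 \<le> h u" "\<And>u. h u \<le> 1" for h
  proof -
    have i1: "integrable unif (\<lambda>v. logker (x - v) * h v)"
      by (rule Bochner_Integration.integrable_bound[OF il]) (use h01 in \<open>auto intro!: borel_measurable_unif AE_I2 simp: abs_mult mult_left_le\<close>)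
    have i2: "integrable unif (\<lambda>v. g m v * h v)"
    proof (rule unif.integrable_const_bound[where B = "real m"])
      have "\<bar>g m v\<bar> * \<bar>h v\<bar> \<le> real m * 1" for v using gb h01 by (intro mult_mono) auto
      then show "AE v in unif. norm (g m v * h v) \<le> real m" by (simp add: abs_mult)
    qed (auto intro!: borel_measurable_unif)
    have ig: "integrable unif (g m)" by (rule integrable_unif_bddm[OF bddmI[OF gm gb]])
    have "(LINT v|unif. logker (x - v) * h v) - (LINT v|unif. g m v * h v) = (LINT v|unif. logker (x - v) * h v - g m v * h v)"
      using i1 i2 by simp
    also have "\<bar>\<dots>\<bar> \<le> (LINT v|unif. \<bar>logker (x - v) * h v - g m v * h v\<bar>)" by (rule integral_abs_bound)
    also have "\<dots> \<le> (LINT v|unif. logker (x - v) - g m v)"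
    proof (rule integral_mono)
      show "integrable unif (\<lambda>v. \<bar>logker (x - v) * h v - g m v * h v\<bar>)" using i1 i2 by simp
      show "integrable unif (\<lambda>v. logker (x - v) - g m v)" using il ig by simp
      show "\<bar>logker (x - v) * h v - g m v * h v\<bar> \<le> logker (x - v) - g m v" if "v \<in> space unif" for v
      proof -
        have "0 \<le> logker (x - v) - g m v" using gl(1)[of v m] that by (simp add: space_unif)
        then show ?thesis unfolding left_diff_distrib[symmetric] abs_mult using h01[of v] by (simp add: mult_left_le)
      qed
    qed
    also have "\<dots> < e3" using m by (simp add: e3_def)
    finally show ?thesis .
  qed
  have "(\<lambda>k. LINT v|unif. g m v * f k v) \<longlonglongrightarrow> (LINT v|unif. g m v * r v)"
  proof (rule weak_test[OF gm gb, where c = x])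
    show "isCont (g m) v" if "v \<noteq> x" for v
      unfolding g_def logker_def using that by (auto intro!: continuous_intros)
  qed
  then have "\<forall>\<^sub>F k in sequentially. \<bar>(LINT v|unif. g m v * f k v) - (LINT v|unif. g m v * r v)\<bar> < e3"
    using tendstoD[OF _ e3(1)] by (fastforce simp: dist_real_def)
  then have "\<forall>\<^sub>F k in sequentially. norm ((LINT v|unif. logker (x - v) * f k v) - (LINT v|unif. logker (x - v) * r v)) < e"
  proof eventually_elim
    case (elim k)
    show ?case using elim close[OF f, of k] close[OF r] unfolding real_norm_def e3(2) by linarith
  qed
  then show "\<exists>no. \<forall>k\<ge>no. norm ((LINT v|unif. logker (x - v) * f k v) - (LINT v|unif. logker (x - v) * r v)) < e"
    by (simp add: eventually_sequentially)
qed

text \<open>By symmetry the difference of the logarithmic energies is the sum of the integrals of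
  \<open>f k\<close> and of \<open>r\<close> against the difference of the potentials. The
  potentials converge pointwise and are bounded by 3, so these integrals tend to 0 whatever factor
  with values in [0, 1] stands in front.\<close>

lemma hahn_energy_weak_tendsto:
  assumes AB: "0 < A" "0 < B"
  shows "(\<lambda>k. hahn_energy A B (f k)) \<longlonglongrightarrow> hahn_energy A B r"
proof -
  define V where "V h x = (LINT v|unif. logker (x - v) * h v)" for h x
  have Vb: "\<bar>V h x\<bar> \<le> 3" if x: "x \<in> {0..1}" and h: "\<And>u. 0 \<le> h u" "\<And>u. h u \<le> 1" and hm: "h \<in> borel_measurable borel" for h x
  proof -
    note [measurable] = hm
    have i1: "integrable unif (\<lambda>v. logker (x - v) * h v)"
      by (rule Bochner_Integration.integrable_bound[OF logker_integral(1)[OF x]])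
         (use h in \<open>auto intro!: borel_measurable_unif AE_I2 simp: abs_mult mult_left_le\<close>)
    have "0 \<le> V h x" unfolding V_def
      using logker_nonneg[OF x] h by (intro integral_nonneg_AE AE_I2) (auto simp: space_unif)
    moreover have "V h x \<le> (LINT v|unif. logker (x - v))" unfolding V_def
      using logker_nonneg[OF x] h by (intro integral_mono i1 logker_integral(1)[OF x]) (auto simp: space_unif mult_left_le)
    ultimately show ?thesis using logker_integral_le[OF x] by linarith
  qed
  have Vm: "(\<lambda>x. V h x) \<in> borel_measurable unif" if [measurable]: "h \<in> borel_measurable borel" for h
    unfolding V_def by measurable
  have key: "(\<lambda>k. LINT x|unif. q k x * (V (f k) x - V r x)) \<longlonglongrightarrow> 0"
    if q: "\<And>k. q k \<in> borel_measurable borel" "\<And>k u. 0 \<le> q k u" "\<And>k u. q k u \<le> 1" for q :: "nat \<Rightarrow> real \<Rightarrow> real"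
  proof -
    have "(\<lambda>k. LINT x|unif. q k x * (V (f k) x - V r x)) \<longlonglongrightarrow> (LINT x|unif. 0)"
    proof (rule integral_dominated_convergence[where w = "\<lambda>_. 6"])
      have le: "\<bar>q k x * (V (f k) x - V r x)\<bar> \<le> \<bar>V (f k) x - V r x\<bar>" for k x
        unfolding abs_mult using q(2,3)[of k x] by (simp add: mult_left_le_one_le)
      show "AE x in unif. (\<lambda>k. q k x * (V (f k) x - V r x)) \<longlonglongrightarrow> 0"
      proof (rule AE_I2)
        fix x assume "x \<in> space unif"
        then have "(\<lambda>k. V (f k) x) \<longlonglongrightarrow> V r x" unfolding V_def by (intro potential_tendsto) (simp add: space_unif)
        then have "(\<lambda>k. \<bar>V (f k) x - V r x\<bar>) \<longlonglongrightarrow> \<bar>V r x - V r x\<bar>" by (intro tendsto_intros)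
        then have l: "(\<lambda>k. \<bar>V (f k) x - V r x\<bar>) \<longlonglongrightarrow> 0" by simp
        show "(\<lambda>k. q k x * (V (f k) x - V r x)) \<longlonglongrightarrow> 0"
          by (rule Lim_null_comparison[OF _ l]) (use le in \<open>auto intro!: always_eventually\<close>)
      qed
      show "AE x in unif. norm (q k x * (V (f k) x - V r x)) \<le> 6" for k
      proof (rule AE_I2)
        fix x assume "x \<in> space unif"
        then have x: "x \<in> {0..1}" by (simp add: space_unif)
        show "norm (q k x * (V (f k) x - V r x)) \<le> 6"
          using le[of k x] Vb[OF x f(2,3,1), of k] Vb[OF x r(2,3,1)] by (simp only: real_norm_def)
      qed
      show "(\<lambda>x. q k x * (V (f k) x - V r x)) \<in> borel_measurable unif" for k
        using borel_measurable_unif[OF q(1)[of k]] Vm[OF f(1)[of k]] Vm[OF r(1)] by measurable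
    qed auto
    then show ?thesis by simp
  qed
  have iV: "integrable unif (\<lambda>x. q x * V h x)"
    if q: "q \<in> borel_measurable borel" "\<And>u. 0 \<le> q u" "\<And>u. q u \<le> 1" and h: "h \<in> borel_measurable borel" "\<And>u. 0 \<le> h u" "\<And>u. h u \<le> 1" for q h
  proof (rule unif.integrable_const_bound[where B = 3])
    show "AE x in unif. norm (q x * V h x) \<le> 3"
    proof (rule AE_I2)
      fix x assume "x \<in> space unif"
      then have "\<bar>V h x\<bar> \<le> 3" using h by (intro Vb) (auto simp: space_unif)
      moreover have "\<bar>q x\<bar> * \<bar>V h x\<bar> \<le> \<bar>V h x\<bar>" using q(2,3)[of x] by (simp add: mult_left_le_one_le)
      ultimately show "norm (q x * V h x) \<le> 3" by (simp add: abs_mult)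
    qed
    show "(\<lambda>x. q x * V h x) \<in> borel_measurable unif"
      using borel_measurable_unif[OF q(1)] Vm[OF h(1)] by measurable
  qed
  have "log_energy (f k) (f k) - log_energy r r
      = (LINT x|unif. f k x * (V (f k) x - V r x)) + (LINT x|unif. r x * (V (f k) x - V r x))" for k
  proof -
    have "log_energy (f k) (f k) - log_energy r r = (log_energy (f k) (f k) - log_energy (f k) r) + (log_energy r (f k) - log_energy r r)"
      using log_energy_commute[OF bddm_f bddm_r, of k] by simp
    also have "log_energy (f k) (f k) - log_energy (f k) r = (LINT x|unif. f k x * (V (f k) x - V r x))"
      unfolding log_energy_iterated[OF bddm_f bddm_f] log_energy_iterated[OF bddm_f bddm_r] V_def[symmetric] right_diff_distrib
      using iV[OF f f, of k k] iV[OF f r, of k] by simp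
    also have "log_energy r (f k) - log_energy r r = (LINT x|unif. r x * (V (f k) x - V r x))"
      unfolding log_energy_iterated[OF bddm_r bddm_f] log_energy_iterated[OF bddm_r bddm_r] V_def[symmetric] right_diff_distrib
      using iV[OF r f, of k] iV[OF r r] by simp
    finally show ?thesis .
  qed
  moreover have "(\<lambda>k. (LINT x|unif. f k x * (V (f k) x - V r x)) + (LINT x|unif. r x * (V (f k) x - V r x))) \<longlonglongrightarrow> 0 + 0"
    by (intro tendsto_add key f r)
  ultimately have "(\<lambda>k. log_energy (f k) (f k) - log_energy r r) \<longlonglongrightarrow> 0" by simp
  then have 1: "(\<lambda>k. log_energy (f k) (f k)) \<longlonglongrightarrow> log_energy r r" by (simp add: LIM_zero_iff)
  obtain K where K: "\<And>u. u \<in> {0..1} \<Longrightarrow> \<bar>hahn_field A B u\<bar> \<le> K"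
    using hahn_field_bounded[of A B] AB by (metis less_imp_le)
  have K0: "0 \<le> K" using K[of 0] by (auto intro: order.trans[OF abs_ge_zero])
  \<comment> \<open>Clipping leaves the field unchanged on [0, 1] and makes it a bounded continuous
    test function on the whole line.\<close>
  define g where "g u = max (-K) (min K (hahn_field A B u))" for u
  have gh: "hahn_field A B u = g u" if "u \<in> space unif" for u
    using K[of u] that by (auto simp: g_def space_unif)
  have gm: "g \<in> borel_measurable borel" unfolding g_def by measurable
  have "isCont g u" for u
    unfolding g_def hahn_field_def
    by (intro continuous_intros isCont_o2[OF _ isCont_xlnx])
  then have "(\<lambda>k. LINT u|unif. g u * f k u) \<longlonglongrightarrow> (LINT u|unif. g u * r u)"
    using K0 by (intro weak_test[OF gm, of K]) (auto simp: g_def)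
  moreover have "(LINT u|unif. hahn_field A B u * h u) = (LINT u|unif. g u * h u)" for h
    by (intro bochner_cong refl) (simp add: gh)
  ultimately have "(\<lambda>k. LINT u|unif. hahn_field A B u * f k u) \<longlonglongrightarrow> (LINT u|unif. hahn_field A B u * r u)" by simp
  from tendsto_add[OF 1 this] show ?thesis by (simp add: hahn_energy_def)
qed

end

section \<open>Mean density of the ensemble and its minimality\<close>

lemma hahn_occupation:
  fixes N a b n :: nat
  assumes n: "n \<le> N" and s: "s < N"
  defines "W \<equiv> \<lambda>Y. discriminant Y * (\<Prod>r\<in>Y. hahn_weight N a b r)" and "Ys \<equiv> {Y. Y \<subseteq> {..<N} \<and> card Y = n}"
  shows "(\<Sum>Y\<in>Ys. W Y / sum W Ys * (if s \<in> Y then 1 else 0)) = (\<Sum>j<n. hahn_fun N a b j s * hahn_fun N a b j s)"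
proof -
  define K where "K = (\<Sum>j<n. hahn_fun N a b j s * hahn_fun N a b j s)"
  define H where "H = (\<Prod>i<n. hahn_norm N a b i)"
  have H: "0 < H" unfolding H_def using n by (intro prod_pos) (auto intro!: hahn_norm_pos)
  have window: "(\<Sum>Y\<in>Ys. W Y * (if s \<in> Y then 1 + \<tau> else 1)) = H * (1 + \<tau> * K)" for \<tau>
  proof -
    have "inj_on (\<lambda>_. s) {..<Suc 0}" "(\<lambda>_. s) ` {..<Suc 0} \<subseteq> {..<N}" using s by (auto simp: inj_on_def)
    note w = orthogonal_ensemble_window[where Q = "hahn_poly N a b" and b = "\<lambda>_. s" and \<psi> = "hahn_fun N a b"
        and h = "hahn_norm N a b" and w = "hahn_weight N a b" and n = n and N = N and \<tau> = \<tau>, OF _ _ _ _ _ this]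
    have "(\<Sum>Y\<in>Ys. W Y * (\<Prod>u<Suc 0. if s \<in> Y then 1 + \<tau> else 1))
      = H * mdet (1\<^sub>m (Suc 0) + \<tau> \<cdot>\<^sub>m Matrix.mat (Suc 0) (Suc 0) (\<lambda>(u,v). \<Sum>i<n. hahn_fun N a b i s * hahn_fun N a b i s))"
      unfolding W_def Ys_def H_def
      by (rule w) (use n in \<open>auto simp: degree_hahn_poly coeff_hahn_poly_top hahn_norm_pos hahn_weight_pos hahn_poly_orthogonal hahn_fun_def\<close>)
    then show ?thesis by (simp add: det_single K_def)
  qed
  have Z: "sum W Ys = H" using window[of 0] by (simp cong: if_cong)
  \<comment> \<open>The window formula for a single site is affine in \<tau>; comparing \<tau> = 1
    with \<tau> = 0 isolates the occupation probability.\<close>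
  have "(\<Sum>Y\<in>Ys. W Y * (if s \<in> Y then 1 + 1 else 1)) = (\<Sum>Y\<in>Ys. W Y + W Y * (if s \<in> Y then 1 else 0))"
    by (intro sum.cong refl) auto
  then have "H * (1 + 1 * K) = H + (\<Sum>Y\<in>Ys. W Y * (if s \<in> Y then 1 else 0))"
    unfolding window sum.distrib Z .
  then have "(\<Sum>Y\<in>Ys. W Y * (if s \<in> Y then 1 else 0)) = H * K" by (simp add: distrib_left)
  moreover have "(\<Sum>Y\<in>Ys. W Y / sum W Ys * (if s \<in> Y then 1 else 0)) = (\<Sum>Y\<in>Ys. W Y * (if s \<in> Y then 1 else 0)) / H"
    unfolding Z sum_divide_distrib by (intro sum.cong refl) simp
  ultimately show ?thesis using H by (simp add: K_def)
qed

lemma measurable_hahn_density [measurable]: "hahn_density A B t \<in> borel_measurable borel"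
proof -
  have c: "continuous_on UNIV (\<lambda>y. arccos (max (-1) (min 1 y)))"
    by (intro continuous_intros) auto
  have [measurable]: "(\<lambda>y. arccos (max (-1) (min 1 y))) \<in> borel_measurable borel"
    by (rule borel_measurable_continuous_onI[OF c])
  show ?thesis unfolding hahn_density_def by measurable
qed

lemma bddm_hahn_density: "bddm (hahn_density A B t)"
  using hahn_density_bounds[of A B t] by (intro bddmI[where K = 1]) (auto simp: abs_le_iff intro: order.trans[of _ 0])

context
  fixes N a b n :: "nat \<Rightarrow> nat" and A B t :: real
  assumes N: "filterlim N at_top sequentially" and N0: "\<And>k. 0 < N k"
    and a: "\<And>k. real (a k) = A * real (N k)" and b: "\<And>k. real (b k) = B * real (N k)"
    and AB: "0 < A" "0 < B" and n: "\<And>k. real (n k) = t * real (N k)" and t: "0 < t" "t < 1"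
begin

definition confs :: "nat \<Rightarrow> nat set set" where
  "confs k = {Y. Y \<subseteq> {..<N k} \<and> card Y = n k}"

definition wt :: "nat \<Rightarrow> nat set \<Rightarrow> real" where
  "wt k Y = discriminant Y * (\<Prod>r\<in>Y. hahn_weight (N k) (a k) (b k) r)"

definition mean_density :: "nat \<Rightarrow> real \<Rightarrow> real" where
  "mean_density k u = (\<Sum>Y\<in>confs k. wt k Y / sum (wt k) (confs k) * occ (N k) Y u)"

lemma n_less: "n k < N k"
proof -
  have "real (n k) < real (N k)" unfolding n using t N0[of k] by simp
  then show ?thesis by simp
qed

lemma finite_confs: "finite (confs k)" by (simp add: confs_def)

lemma wt_pos: "Y \<in> confs k \<Longrightarrow> 0 < wt k Y"
  unfolding wt_def discriminant_def confs_def
  by (intro mult_pos_pos prod_pos) (auto simp: hahn_weight_pos intro!: prod_pos)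

lemma confs_nonempty: "confs k \<noteq> {}"
proof -
  have "{..<n k} \<in> confs k" using n_less[of k] by (auto simp: confs_def)
  then show ?thesis by auto
qed

lemma wt_sum_pos: "0 < sum (wt k) (confs k)"
  using finite_confs confs_nonempty wt_pos by (intro sum_pos) auto

lemma prob_sum: "(\<Sum>Y\<in>confs k. wt k Y / sum (wt k) (confs k)) = 1"
  using wt_sum_pos[of k] by (simp add: sum_divide_distrib[symmetric])

lemma prob_nonneg: "Y \<in> confs k \<Longrightarrow> 0 \<le> wt k Y / sum (wt k) (confs k)"
  using wt_sum_pos[of k] wt_pos[of Y k] by (simp add: less_imp_le)

lemma mean_density_bounds: "0 \<le> mean_density k u" "mean_density k u \<le> 1"
proof -
  show "0 \<le> mean_density k u" unfolding mean_density_def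
    using prob_nonneg by (intro sum_nonneg mult_nonneg_nonneg) (auto simp: occ_def)
  have "mean_density k u \<le> (\<Sum>Y\<in>confs k. wt k Y / sum (wt k) (confs k) * 1)" unfolding mean_density_def
    using prob_nonneg by (intro sum_mono mult_left_mono) (auto simp: occ_def)
  then show "mean_density k u \<le> 1" using prob_sum[of k] by simp
qed

lemma bddm_mean_density: "bddm (mean_density k)"
  unfolding mean_density_def[abs_def] by (rule bddm_sum[OF finite_confs bddm_occ])

lemma mean_density_tendsto:
  assumes u: "u \<in> {0<..<1}"
  shows "(\<lambda>k. mean_density k u) \<longlonglongrightarrow> hahn_density A B t u"
proof -
  have "mean_density k u = (\<Sum>j<n k. hahn_fun (N k) (a k) (b k) j (cell (N k) u) * hahn_fun (N k) (a k) (b k) j (cell (N k) u))" for k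
    using hahn_occupation[of "n k" "N k" "cell (N k) u" "a k" "b k"] n_less[of k] cell_less[of u "N k"] u N0[of k]
    unfolding mean_density_def wt_def confs_def occ_def by simp
  moreover have "(\<lambda>k. real (cell (N k) u) / real (N k)) \<longlonglongrightarrow> u" using u by (intro cell_ratio[OF N N0]) auto
  from hahn_kernel_limit_sine[OF N N0 a b AB n t this, of 0 0] u
  have "(\<lambda>k. \<Sum>j<n k. hahn_fun (N k) (a k) (b k) j (cell (N k) u) * hahn_fun (N k) (a k) (b k) j (cell (N k) u)) \<longlonglongrightarrow> hahn_density A B t u"
    by (simp add: site_def sine_kernel_def)
  ultimately show ?thesis by simp
qed

lemma integral_mean_density: "(LINT u|unif. mean_density k u) = t"
proof -
  have "(LINT u|unif. mean_density k u) = (\<Sum>Y\<in>confs k. wt k Y / sum (wt k) (confs k) * (LINT u|unif. occ (N k) Y u))"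
    unfolding mean_density_def using integrable_unif_bddm[OF bddm_occ]
    by (subst Bochner_Integration.integral_sum) auto
  also have "\<dots> = (\<Sum>Y\<in>confs k. wt k Y / sum (wt k) (confs k) * t)"
  proof (intro sum.cong refl arg_cong2[where f = "(*)"])
    fix Y assume Y: "Y \<in> confs k"
    have "(LINT u|unif. occ (N k) Y u) = (\<Sum>s<N k. if s \<in> Y then 1 else 0) / real (N k)"
      unfolding occ_def by (rule integral_cell[OF N0, of "\<lambda>s. if s \<in> Y then 1 else 0"])
    also have "(\<Sum>s<N k. if s \<in> Y then 1 else 0 :: real) = real (card ({..<N k} \<inter> Y))"
      by (simp add: sum.If_cases)
    also have "{..<N k} \<inter> Y = Y" using Y by (auto simp: confs_def)
    also have "real (card Y) / real (N k) = t" using Y n[of k] N0[of k] by (simp add: confs_def)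
    finally show "(LINT u|unif. occ (N k) Y u) = t" .
  qed
  also have "\<dots> = t" unfolding sum_distrib_right[symmetric] prob_sum by simp
  finally show ?thesis .
qed

text \<open>The mass is inherited by dominated convergence from the ensemble, where it is t for
  every k; the arccosine is not integrated explicitly.\<close>

lemma integral_hahn_density: "(LINT u|unif. hahn_density A B t u) = t"
proof -
  have "(\<lambda>k. LINT u|unif. mean_density k u) \<longlonglongrightarrow> (LINT u|unif. hahn_density A B t u)"
  proof (rule integral_dominated_convergence[where w = "\<lambda>_. 1"])
    show "AE u in unif. (\<lambda>k. mean_density k u) \<longlonglongrightarrow> hahn_density A B t u"
      using AE_unif_interior by eventually_elim (rule mean_density_tendsto)
    show "AE u in unif. norm (mean_density k u) \<le> 1" for k
      using mean_density_bounds[of k] by (intro AE_I2) (auto simp: abs_le_iff intro: order.trans[of _ 0])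
  qed (use bddm_measurable[OF bddm_mean_density] in \<open>auto intro!: borel_measurable_unif\<close>)
  then have "(\<lambda>k::nat. t) \<longlonglongrightarrow> (LINT u|unif. hahn_density A B t u)" by (simp add: integral_mean_density)
  then show ?thesis using LIMSEQ_unique tendsto_const by blast
qed

text \<open>
  The Gibbs variational principle bounds the mean energy of the ensemble by that of any configuration, up to
  the entropy, which is only linear in \<open>N\<close> whereas the energies are quadratic. Convexity passes from the mean
  energy to the energy of the mean density, whose limit is known from the spectral analysis.
\<close>

theorem hahn_density_minimizes:
  assumes r: "r \<in> borel_measurable borel" "\<And>u. 0 \<le> r u" "\<And>u. r u \<le> 1" and rt: "(LINT u|unif. r u) = t"
  shows "hahn_energy A B (hahn_density A B t) \<le> hahn_energy A B r"
proof -
  have "\<exists>Y. Y \<subseteq> {..<N k} \<and> card Y = n k \<and> (\<forall>x\<in>{0..1}. \<bar>dist_fun (occ (N k) Y) x - dist_fun r x\<bar> \<le> 3 / real (N k))" for k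
    using sampling_exists[OF r rt n N0, of k] by metis
  then obtain Y0 where Y0: "\<And>k. Y0 k \<subseteq> {..<N k}" "\<And>k. card (Y0 k) = n k"
    and Y0d: "\<And>k x. x \<in> {0..1} \<Longrightarrow> \<bar>dist_fun (occ (N k) (Y0 k)) x - dist_fun r x\<bar> \<le> 3 / real (N k)"
    by metis
  have Ninf: "filterlim (\<lambda>k. real (N k)) at_top sequentially"
    by (rule filterlim_compose[OF filterlim_real_sequentially N])
  have inv: "(\<lambda>k. c / real (N k)) \<longlonglongrightarrow> 0" for c
    by (rule tendsto_divide_0[OF tendsto_const filterlim_at_top_imp_at_infinity[OF Ninf]])
  define er where "er k = (LINT z|unif2. \<bar>cellker (N k) z - logker (fst z - snd z)\<bar>)
     + (LINT u|unif. \<bar>cellfield (N k) (a k) (b k) (cell (N k) u) - hahn_field A B u\<bar>)" for k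
  have er0: "er \<longlonglongrightarrow> 0"
    using tendsto_add[OF cellker_L1[OF N N0] cellfield_L1[OF N N0 a b AB]] by (simp add: er_def[abs_def])
  \<comment> \<open>One \<open>er\<close> compares the mean energy with its discrete version, the
    other does so for the sampled configuration. The entropy is at most N ln 2, hence ln 2 / N after
    division by N^2.\<close>
  have bound: "hahn_energy A B (mean_density k) \<le> hahn_energy A B (occ (N k) (Y0 k)) + 2 * er k + ln 2 / real (N k)" for k
  proof -
    define E where "E Y = (LINT z|unif2. cellker (N k) z * (occ (N k) Y (fst z) * occ (N k) Y (snd z)))
        + (LINT u|unif. cellfield (N k) (a k) (b k) (cell (N k) u) * occ (N k) Y u)" for Y
    define C where "C = real (n k) * (2 * (real (N k) - 1) + real (a k) + real (b k)) * (ln (real (N k)) - 1)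
       - real (n k) * (real (n k) - 1) * ln (real (N k))"
    define P where "P Y = wt k Y / sum (wt k) (confs k)" for Y
    have Nr: "0 < real (N k)" using N0[of k] by simp
    have lw: "- ln (wt k Y) = (real (N k))\<^sup>2 * E Y + C" if "Y \<in> confs k" for Y
      using that discriminant_energy[OF N0, of Y k "n k" "a k" "b k"] unfolding wt_def E_def C_def confs_def by simp
    have err: "\<bar>E Y - hahn_energy A B (occ (N k) Y)\<bar> \<le> er k" if "Y \<in> confs k" for Y
      using that discretized_energy_error[OF N0 _ AB, of Y k "a k" "b k"] unfolding E_def er_def confs_def by simp
    have Y0c: "Y0 k \<in> confs k" using Y0[of k] by (simp add: confs_def)
    have card: "ln (real (card (confs k))) \<le> real (N k) * ln 2"
    proof -
      have "card (confs k) \<le> card (Pow {..<N k})" by (intro card_mono) (auto simp: confs_def)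
      then have "real (card (confs k)) \<le> 2 ^ N k" by (simp add: card_Pow)
      moreover have "0 < real (card (confs k))" using finite_confs confs_nonempty by (simp add: card_gt_0_iff)
      ultimately have "ln (real (card (confs k))) \<le> ln (2 ^ N k)" by simp
      then show ?thesis by (simp add: ln_realpow)
    qed
    have "(\<Sum>Y\<in>confs k. P Y * ((real (N k))\<^sup>2 * E Y + C)) \<le> real (N k) * ln 2 + ((real (N k))\<^sup>2 * E (Y0 k) + C)"
    proof -
      have "(\<Sum>Y\<in>confs k. P Y * ((real (N k))\<^sup>2 * E Y + C)) = (\<Sum>Y\<in>confs k. P Y * (- ln (wt k Y)))"
        by (intro sum.cong refl) (simp add: lw)
      also have "\<dots> \<le> ln (real (card (confs k))) - ln (wt k (Y0 k))"
        unfolding P_def by (rule gibbs_variational[OF finite_confs wt_pos Y0c])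
      finally show ?thesis using card lw[OF Y0c] by linarith
    qed
    \<comment> \<open>The constant \<open>C\<close> is common to all configurations of
      \<open>n k\<close> particles and splits off because the probabilities add up to 1.\<close>
    moreover have "(\<Sum>Y\<in>confs k. P Y * ((real (N k))\<^sup>2 * E Y + C)) = (real (N k))\<^sup>2 * (\<Sum>Y\<in>confs k. P Y * E Y) + C"
    proof -
      have "(\<Sum>Y\<in>confs k. P Y * ((real (N k))\<^sup>2 * E Y + C)) = (real (N k))\<^sup>2 * (\<Sum>Y\<in>confs k. P Y * E Y) + C * (\<Sum>Y\<in>confs k. P Y)"
        by (simp add: distrib_left sum.distrib sum_distrib_left mult_ac)
      then show ?thesis using prob_sum[of k] unfolding P_def[symmetric] by simp
    qed
    ultimately have "(real (N k))\<^sup>2 * (\<Sum>Y\<in>confs k. P Y * E Y) \<le> real (N k) * ln 2 + (real (N k))\<^sup>2 * E (Y0 k)" by linarith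
    then have "(\<Sum>Y\<in>confs k. P Y * E Y) \<le> (real (N k) * ln 2 + (real (N k))\<^sup>2 * E (Y0 k)) / (real (N k))\<^sup>2"
      using Nr by (simp add: le_divide_eq mult.commute)
    also have "\<dots> = ln 2 / real (N k) + E (Y0 k)" using Nr by (simp add: add_divide_distrib power2_eq_square)
    finally have 1: "(\<Sum>Y\<in>confs k. P Y * E Y) \<le> ln 2 / real (N k) + E (Y0 k)" .
    have "hahn_energy A B (mean_density k) \<le> (\<Sum>Y\<in>confs k. P Y * hahn_energy A B (occ (N k) Y))"
      unfolding mean_density_def[abs_def] P_def[symmetric]
      by (rule hahn_energy_convex[OF AB finite_confs bddm_occ]) (use prob_nonneg prob_sum in \<open>auto simp: P_def\<close>)
    also have "\<dots> \<le> (\<Sum>Y\<in>confs k. P Y * (E Y + er k))"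
      using err prob_nonneg by (intro sum_mono mult_left_mono) (fastforce simp: P_def abs_le_iff)+
    also have "\<dots> = (\<Sum>Y\<in>confs k. P Y * E Y) + er k"
      using prob_sum[of k] unfolding P_def[symmetric] by (simp add: distrib_left sum.distrib sum_distrib_right[symmetric])
    finally have "hahn_energy A B (mean_density k) \<le> (\<Sum>Y\<in>confs k. P Y * E Y) + er k" .
    then show ?thesis using 1 err[OF Y0c] unfolding abs_le_iff by linarith
  qed
  have lim1: "(\<lambda>k. hahn_energy A B (mean_density k)) \<longlonglongrightarrow> hahn_energy A B (hahn_density A B t)"
  proof (rule hahn_energy_tendsto[OF AB bddm_mean_density bddm_hahn_density])
    show "\<bar>mean_density k u\<bar> \<le> 1" for k u using mean_density_bounds[of k u] by simp
  qed (rule mean_density_tendsto)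
  have occt: "(LINT u|unif. occ (N k) (Y0 k) u) = t" for k
  proof -
    have "(LINT u|unif. occ (N k) (Y0 k) u) = (\<Sum>s<N k. if s \<in> Y0 k then 1 else 0) / real (N k)"
      unfolding occ_def by (rule integral_cell[OF N0, of "\<lambda>s. if s \<in> Y0 k then 1 else 0"])
    also have "(\<Sum>s<N k. if s \<in> Y0 k then 1 else 0 :: real) = real (card ({..<N k} \<inter> Y0 k))"
      by (simp add: sum.If_cases)
    also have "{..<N k} \<inter> Y0 k = Y0 k" using Y0(1)[of k] by auto
    also have "real (card (Y0 k)) / real (N k) = t" using Y0(2)[of k] n[of k] N0[of k] by simp
    finally show ?thesis .
  qed
  have "(\<lambda>k. hahn_energy A B (occ (N k) (Y0 k))) \<longlonglongrightarrow> hahn_energy A B r"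
  proof (rule hahn_energy_weak_tendsto[where t = t])
    show "occ (N k) (Y0 k) \<in> borel_measurable borel" for k using bddm_occ by (rule bddm_measurable)
    show "0 \<le> occ (N k) (Y0 k) u" "occ (N k) (Y0 k) u \<le> 1" for k u by (auto simp: occ_def)
    show "(\<lambda>k. dist_fun (occ (N k) (Y0 k)) x) \<longlonglongrightarrow> dist_fun r x" if "x \<in> {0..1}" for x
    proof -
      have "(\<lambda>k. dist_fun (occ (N k) (Y0 k)) x - dist_fun r x) \<longlonglongrightarrow> 0"
        by (rule Lim_null_comparison[OF _ inv[of 3]]) (use Y0d[OF that] in auto)
      then show ?thesis by (simp add: LIM_zero_iff)
    qed
  qed (use r rt t occt AB in auto)
  then have "(\<lambda>k. hahn_energy A B (occ (N k) (Y0 k)) + 2 * er k + ln 2 / real (N k)) \<longlonglongrightarrow> hahn_energy A B r + 2 * 0 + 0"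
    by (intro tendsto_add tendsto_mult tendsto_const er0 inv)
  then have "(\<lambda>k. hahn_energy A B (occ (N k) (Y0 k)) + 2 * er k + ln 2 / real (N k)) \<longlonglongrightarrow> hahn_energy A B r" by simp
  from LIMSEQ_le[OF lim1 this] bound show ?thesis by auto
qed

end

section \<open>Identification of the equilibrium measure\<close>

lemma measurable_snd_unif [measurable]: "snd \<in> M \<Otimes>\<^sub>M unif \<rightarrow>\<^sub>M borel"
  by (rule measurable_compose[OF measurable_snd measurable_ident_unif])

text \<open>A Radon-Nikodym density obeys the constraint only almost everywhere; truncating it at 1
  / c and restricting it to [0, 1] gives pointwise bounds. Where the truncation acts, the constraint
  on \<mu> forces equality of the masses.\<close>

lemma admissible_density:
  assumes c: "0 < c" and adm: "admissible c \<mu>"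
  obtains g where "g \<in> borel_measurable borel" "\<And>x. 0 \<le> g x" "\<And>x. g x \<le> 1 / c" "\<And>x. x \<notin> {0..1} \<Longrightarrow> g x = 0"
    "\<mu> = density lborel (\<lambda>x. ennreal (g x))"
proof -
  have ps: "prob_space \<mu>" and s: "sets \<mu> = sets borel" and m01: "emeasure \<mu> {0..1} = 1"
    and le: "\<And>S. S \<in> sets borel \<Longrightarrow> emeasure \<mu> S \<le> ennreal (1 / c) * emeasure lborel S"
    using adm by (auto simp: admissible_def)
  interpret P: prob_space \<mu> by (rule ps)
  have ac: "absolutely_continuous lborel \<mu>"
    unfolding absolutely_continuous_def
  proof
    fix S assume "S \<in> null_sets (lborel :: real measure)"
    then have S: "S \<in> sets borel" "emeasure lborel S = 0" by auto
    then have "emeasure \<mu> S \<le> 0" using le[OF S(1)] by simp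
    then show "S \<in> null_sets \<mu>" using S s by (intro null_setsI) auto
  qed
  define h where "h = RN_deriv lborel \<mu>"
  have hm [measurable]: "h \<in> borel_measurable borel" unfolding h_def using borel_measurable_RN_deriv[of lborel \<mu>] by simp
  have hd: "density lborel h = \<mu>" unfolding h_def using ac s by (intro sigma_finite_measure.density_RN_deriv[OF sigma_finite_lborel]) auto
  define k where "k x = min (h x) (ennreal (1 / c)) * indicator {0..1} x" for x
  have km [measurable]: "k \<in> borel_measurable borel" unfolding k_def by measurable
  have kd: "density lborel k = \<mu>"
  proof (rule measure_eqI)
    fix S assume "S \<in> sets (density lborel k)"
    then have S [measurable]: "S \<in> sets borel" by simp
    define S1 where "S1 = (S \<inter> {0..1}) \<inter> {x. h x \<le> ennreal (1 / c)}"
    define S2 where "S2 = (S \<inter> {0..1}) \<inter> {x. \<not> h x \<le> ennreal (1 / c)}"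
    have [measurable]: "S1 \<in> sets borel" "S2 \<in> sets borel" unfolding S1_def S2_def by measurable
    have em: "emeasure (density lborel k) T = (\<integral>\<^sup>+x. k x * indicator T x \<partial>lborel)" if "T \<in> sets borel" for T
      using that by (subst emeasure_density) auto
    have emh: "emeasure \<mu> T = (\<integral>\<^sup>+x. h x * indicator T x \<partial>lborel)" if "T \<in> sets borel" for T
      unfolding hd[symmetric] using that by (subst emeasure_density) auto
    have 1: "emeasure (density lborel k) S1 = emeasure \<mu> S1"
      by (simp add: em emh) (intro nn_integral_cong, auto simp: k_def S1_def indicator_def min_def)
    have 2: "emeasure (density lborel k) S2 = emeasure \<mu> S2"
    proof (rule antisym)
      show "emeasure (density lborel k) S2 \<le> emeasure \<mu> S2"
        by (simp add: em emh) (intro nn_integral_mono, auto simp: k_def S2_def indicator_def min_def)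
      have "emeasure (density lborel k) S2 = (\<integral>\<^sup>+x. ennreal (1 / c) * indicator S2 x \<partial>lborel)"
        by (simp add: em) (intro nn_integral_cong, auto simp: k_def S2_def indicator_def min_def)
      also have "\<dots> = ennreal (1 / c) * emeasure lborel S2" by (simp add: nn_integral_cmult_indicator)
      finally show "emeasure \<mu> S2 \<le> emeasure (density lborel k) S2" using le[of S2] by simp
    qed
    have disj: "S1 \<inter> S2 = {}" "S1 \<union> S2 = S \<inter> {0..1}" by (auto simp: S1_def S2_def)
    have 3: "emeasure (density lborel k) (S \<inter> {0..1}) = emeasure \<mu> (S \<inter> {0..1})"
      unfolding disj(2)[symmetric] using 1 2 disj(1) s
      by (subst (1 2) plus_emeasure[symmetric]) auto
    have "emeasure (density lborel k) S = emeasure (density lborel k) (S \<inter> {0..1})"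
      by (simp add: em) (intro nn_integral_cong, auto simp: k_def indicator_def)
    also note 3
    also have "emeasure \<mu> (S \<inter> {0..1}) = emeasure \<mu> S"
    proof (rule emeasure_eq_AE)
      have "AE x in \<mu>. x \<in> {0..1}" using m01 s by (intro P.AE_prob_1) (simp add: measure_def)
      then show "AE x in \<mu>. (x \<in> S \<inter> {0..1}) = (x \<in> S)" by eventually_elim auto
    qed (use s in auto)
    finally show "emeasure (density lborel k) S = emeasure \<mu> S" .
  qed (use s in simp)
  have kle: "k x \<le> ennreal (1 / c)" for x by (auto simp: k_def indicator_def)
  define g where "g x = enn2real (k x)" for x
  have kg: "ennreal (g x) = k x" for x
    unfolding g_def by (intro ennreal_enn2real le_less_trans[OF kle]) simp
  show ?thesis
  proof (rule that)
    show "g \<in> borel_measurable borel" unfolding g_def by measurable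
    show "0 \<le> g x" for x by (simp add: g_def)
    show "g x \<le> 1 / c" for x using kle[of x] c unfolding kg[symmetric] by (simp add: ennreal_le_iff)
    show "g x = 0" if "x \<notin> {0..1}" for x using that by (simp add: g_def k_def)
    show "\<mu> = density lborel (\<lambda>x. ennreal (g x))" by (simp add: kg kd)
  qed
qed

lemma integral_density_unif:
  fixes h :: "real \<Rightarrow> real"
  assumes g: "g \<in> borel_measurable borel" "\<And>x. 0 \<le> g x" "\<And>x. x \<notin> {0..1} \<Longrightarrow> g x = 0" and h: "h \<in> borel_measurable borel"
  shows "(\<integral>x. h x \<partial>density lborel (\<lambda>x. ennreal (g x))) = (LINT x|unif. h x * g x)"
proof -
  have "(\<integral>x. h x \<partial>density lborel (\<lambda>x. ennreal (g x))) = (LINT x|lborel. g x * h x)"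
    using g h by (subst integral_density) auto
  also have "\<dots> = (LINT x|lborel. indicator {0..1} x * (h x * g x))"
    using g(3) by (intro bochner_cong refl) (auto simp: indicator_def)
  finally show ?thesis by (simp add: integral_unif)
qed

text \<open>The terms x ln x and (1 - x) ln (1 - x), part of \<open>hahn_field\<close> but not of
  \<open>potential\<close>, come from the explicit logarithmic potential of Lebesgue measure on
  [0, 1]; this is why that potential ends up with the factor 2.\<close>

lemma ext_field_eq:
  assumes x: "x \<in> {0..1}" and AB: "0 < A" "0 < B"
  shows "ext_field A B x = (B * ln B + (A + 1) * ln (A + 1) + 1) - hahn_field A B x - 2 * (LINT v|unif. logker (x - v))"
proof -
  have "(LBINT y:{0..1}. ln \<bar>x - y\<bar>) = - (LINT v|unif. logker (x - v))"
    unfolding integral_unif set_lebesgue_integral_def logker_def by simp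
  then show ?thesis
    unfolding ext_field_def potential_def logker_integral(2)[OF x] hahn_field_def xlnx_def
    using x AB by (simp add: abs_of_nonneg algebra_simps)
qed

text \<open>Particle-hole duality of the energies: when the quadratic form is expanded at 1 - c g,
  its cross term matches the doubled potential in \<open>ext_field_eq\<close>, and the rest does not
  depend on g.\<close>

lemma energy_eq:
  assumes c: "0 < c" and AB: "0 < A" "0 < B"
    and g: "g \<in> borel_measurable borel" "\<And>x. 0 \<le> g x" "\<And>x. g x \<le> 1 / c" "\<And>x. x \<notin> {0..1} \<Longrightarrow> g x = 0"
    and one: "(LINT x|unif. g x) = 1"
  shows "c * energy A B c (density lborel (\<lambda>x. ennreal (g x)))
    = hahn_energy A B (\<lambda>x. 1 - c * g x) - log_energy (\<lambda>_. 1) (\<lambda>_. 1) - (LINT u|unif. hahn_field A B u)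
      + c * (B * ln B + (A + 1) * ln (A + 1) + 1)"
proof -
  define \<mu> where "\<mu> = density lborel (\<lambda>x. ennreal (g x))"
  note [measurable] = g(1)
  have gb: "bddm g" using g by (intro bddmI[where K = "1 / c"]) (auto simp: abs_of_nonneg)
  have ob: "bddm (\<lambda>_. 1)" by (intro bddmI[where K = 1]) auto
  have lnk: "ln (1 / \<bar>w\<bar>) = logker w" for w :: real
    by (cases "w = 0") (simp_all add: logker_def ln_div)
  have int\<mu>: "(LINT x|\<mu>. h x) = (LINT x|unif. h x * g x)" if "h \<in> borel_measurable borel" for h :: "real \<Rightarrow> real"
    unfolding \<mu>_def by (rule integral_density_unif) (use g that in auto)
  have V: "(LINT y|\<mu>. ln (1 / \<bar>x - y\<bar>)) = (LINT y|unif. logker (x - y) * g y)" for x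
    unfolding lnk by (rule int\<mu>) measurable
  have Vm: "(\<lambda>x. LINT y|unif. logker (x - y) * g y) \<in> borel_measurable borel" by measurable
  have 1: "(LINT x|\<mu>. (LINT y|\<mu>. ln (1 / \<bar>x - y\<bar>))) = log_energy g g"
    unfolding V int\<mu>[OF Vm] log_energy_iterated[OF gb gb] by (simp add: mult.commute)
  define C where "C = B * ln B + (A + 1) * ln (A + 1) + 1"
  define L where "L x = (LINT v|unif. logker (x - v))" for x
  have Lm [measurable]: "L \<in> borel_measurable borel" unfolding L_def by measurable
  have extm: "ext_field A B \<in> borel_measurable borel"
    unfolding ext_field_def potential_def set_lebesgue_integral_def by measurable
  have i1: "integrable unif (\<lambda>x. C * g x)" using integrable_unif_bddm[OF gb] by simp
  have i2: "integrable unif (\<lambda>x. hahn_field A B x * g x)" by (rule integrable_hahn_field[OF AB gb])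
  have i3: "integrable unif (\<lambda>x. g x * L x)"
  proof (rule unif.integrable_const_bound[where B = "1 / c * 3"])
    show "AE x in unif. norm (g x * L x) \<le> 1 / c * 3"
    proof (rule AE_I2)
      fix x assume "x \<in> space unif"
      then have x: "x \<in> {0..1}" by (simp add: space_unif)
      have "0 \<le> L x" unfolding L_def using logker_nonneg[OF x] by (intro integral_nonneg_AE AE_I2) (auto simp: space_unif)
      then have "\<bar>L x\<bar> \<le> 3" using logker_integral_le[OF x] by (simp add: L_def)
      then show "norm (g x * L x) \<le> 1 / c * 3"
        unfolding real_norm_def abs_mult using g(2,3)[of x] c by (intro mult_mono) auto
    qed
  qed (auto intro!: borel_measurable_unif)
  have "(LINT x|\<mu>. ext_field A B x) = (LINT x|unif. ext_field A B x * g x)" by (rule int\<mu>[OF extm])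
  also have "\<dots> = (LINT x|unif. C * g x - hahn_field A B x * g x - 2 * (g x * L x))"
    by (intro bochner_cong refl)
       (simp add: ext_field_eq[OF _ AB] space_unif C_def L_def algebra_simps)
  also have "\<dots> = C - (LINT x|unif. hahn_field A B x * g x) - 2 * (LINT x|unif. g x * L x)"
    using i1 i2 i3 one by simp
  also have "(LINT x|unif. g x * L x) = log_energy g (\<lambda>_. 1)"
    unfolding log_energy_iterated[OF gb ob] by (simp add: L_def)
  finally have 2: "(LINT x|\<mu>. ext_field A B x) = C - (LINT x|unif. hahn_field A B x * g x) - 2 * log_energy g (\<lambda>_. 1)" .
  have le: "log_energy (\<lambda>x. 1 - c * g x) (\<lambda>x. 1 - c * g x) = log_energy (\<lambda>_. 1) (\<lambda>_. 1) - 2 * c * log_energy g (\<lambda>_. 1) + c\<^sup>2 * log_energy g g"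
    using log_energy_square[OF ob gb, of 1 "- c"] log_energy_commute[OF gb ob] by simp
  have i4: "integrable unif (hahn_field A B)" using integrable_hahn_field[OF AB ob] by simp
  have fe: "(LINT x|unif. hahn_field A B x * (1 - c * g x)) = (LINT x|unif. hahn_field A B x) - c * (LINT x|unif. hahn_field A B x * g x)"
    using i2 i4 by (simp add: right_diff_distrib mult.left_commute[of _ c])
  show ?thesis
    unfolding energy_def \<mu>_def[symmetric] 1 2 hahn_energy_def le fe C_def[symmetric]
    by (simp add: algebra_simps power2_eq_square)
qed

lemma AE_unif_dense:
  assumes ae: "AE z in unif. P z" and z0: "0 < z0" "z0 < 1" and e: "0 < e"
  obtains z where "\<bar>z - z0\<bar> < e" "z \<in> {0..1}" "P z"
proof -
  define l h where "l = max 0 (z0 - e)" and "h = min 1 (z0 + e)"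
  have lh: "l < h" "0 \<le> l" "h \<le> 1" using z0 e by (auto simp: l_def h_def)
  have "\<exists>z. z \<in> {l<..<h} \<and> P z"
  proof (rule ccontr)
    assume "\<nexists>z. z \<in> {l<..<h} \<and> P z"
    then have "AE z in unif. z \<notin> {l<..<h}" using ae by (auto elim!: eventually_mono)
    then have "AE z in lborel. z \<in> {0..1} \<longrightarrow> z \<notin> {l<..<h}"
      unfolding unif_def by (subst (asm) AE_restrict_space_iff) auto
    then have "AE z in lborel. z \<notin> {l<..<h}" by eventually_elim (use lh in auto)
    then have "emeasure lborel {l<..<h} = 0" using AE_iff_measurable[of "{l<..<h}" lborel "\<lambda>z. z \<notin> {l<..<h}"] by (simp add: set_eq_iff)
    then show False using lh by simp
  qed
  then obtain z where "z \<in> {l<..<h}" "P z" by auto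
  then show ?thesis using lh by (intro that[of z]) (auto simp: l_def h_def abs_if)
qed

lemma dist_fun_linear_approx:
  assumes r: "bddm r" and xy: "0 \<le> x" "x \<le> y" "y \<le> 1" and e: "\<And>u. x < u \<Longrightarrow> u \<le> y \<Longrightarrow> \<bar>r u - l\<bar> \<le> e"
  shows "\<bar>dist_fun r y - dist_fun r x - l * (y - x)\<bar> \<le> e * (y - x)"
proof -
  have rm [measurable]: "r \<in> borel_measurable borel" using r by (rule bddm_measurable)
  obtain K where K: "\<And>u. \<bar>r u\<bar> \<le> K" using r by (auto simp: bddm_def)
  have K0: "0 \<le> K" using K[of 0] by linarith
  have i: "integrable unif (\<lambda>u. indicator S u * r u)" if [measurable]: "S \<in> sets borel" for S
    by (rule unif.integrable_const_bound[where B = K])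
       (use K K0 in \<open>auto simp: abs_mult indicator_def intro!: borel_measurable_unif\<close>)
  have iI: "integrable unif (indicator {x<..y} :: real \<Rightarrow> real)"
    by (rule unif.integrable_const_bound[where B = 1]) (auto intro!: borel_measurable_unif)
  have len: "(LINT u|unif. indicator {x<..y} u) = y - x"
  proof -
    have "(LINT u|unif. indicator {x<..y} u) = (\<integral>u. indicator {x<..y} u \<partial>lborel :: real)"
      unfolding integral_unif using xy by (intro bochner_cong refl) (auto simp: indicator_def)
    then show ?thesis using xy by simp
  qed
  have "indicator {..y} u * r u - indicator {..x} u * r u = indicator {x<..y} u * r u" for u
    using xy by (auto simp: indicator_def)
  then have "dist_fun r y - dist_fun r x = (LINT u|unif. indicator {x<..y} u * r u)"
    unfolding dist_fun_def using i by (subst Bochner_Integration.integral_diff[symmetric]) auto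
  then have "dist_fun r y - dist_fun r x - l * (y - x) = (LINT u|unif. indicator {x<..y} u * r u - l * indicator {x<..y} u)"
    using i[of "{x<..y}"] iI len by simp
  also have "\<bar>\<dots>\<bar> \<le> (LINT u|unif. \<bar>indicator {x<..y} u * r u - l * indicator {x<..y} u\<bar>)" by (rule integral_abs_bound)
  also have "\<dots> \<le> (LINT u|unif. e * indicator {x<..y} u)"
  proof (rule integral_mono)
    show "integrable unif (\<lambda>u. \<bar>indicator {x<..y} u * r u - l * indicator {x<..y} u\<bar>)"
      using i[of "{x<..y}"] iI by (intro integrable_abs Bochner_Integration.integrable_diff integrable_mult_right) auto
    show "integrable unif (\<lambda>u. e * indicator {x<..y} u)" using iI by (intro integrable_mult_right)
    show "\<bar>indicator {x<..y} u * r u - l * indicator {x<..y} u\<bar> \<le> e * indicator {x<..y} u" for u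
      using e[of u] by (auto simp: indicator_def)
  qed
  also have "\<dots> = e * (y - x)" using len by simp
  finally show ?thesis .
qed

lemma dist_fun_has_derivative:
  assumes r: "bddm r" and x: "0 < x" "x < 1" and cont: "isCont r x"
  shows "(dist_fun r has_real_derivative r x) (at x)"
  unfolding has_field_derivative_def has_derivative_at_alt
proof (intro conjI allI impI)
  show "bounded_linear ((*) (r x))" by (rule bounded_linear_mult_right)
  fix e :: real assume e: "0 < e"
  obtain d where d0: "0 < d" "\<forall>u. dist u x < d \<longrightarrow> dist (r u) (r x) < e"
    using cont e unfolding continuous_at_eps_delta by blast
  have d: "0 < d" "\<And>u. \<bar>u - x\<bar> < d \<Longrightarrow> \<bar>r u - r x\<bar> < e" using d0 by (auto simp: dist_real_def)
  define d' where "d' = min d (min x (1 - x))"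
  have "norm (dist_fun r y - dist_fun r x - r x * (y - x)) \<le> e * norm (y - x)" if y: "norm (y - x) < d'" for y
  proof -
    have yd: "\<bar>y - x\<bar> < d" "0 \<le> y" "y \<le> 1" using y by (auto simp: d'_def)
    show ?thesis
    proof (cases "x \<le> y")
      case True
      have "\<bar>dist_fun r y - dist_fun r x - r x * (y - x)\<bar> \<le> e * (y - x)"
        using True x yd by (intro dist_fun_linear_approx[OF r]) (auto intro!: less_imp_le d(2))
      then show ?thesis using True by simp
    next
      case False
      have "\<bar>dist_fun r x - dist_fun r y - r x * (x - y)\<bar> \<le> e * (x - y)"
        using False x yd by (intro dist_fun_linear_approx[OF r]) (auto intro!: less_imp_le d(2))
      moreover have "dist_fun r y - dist_fun r x - r x * (y - x) = - (dist_fun r x - dist_fun r y - r x * (x - y))"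
        by (simp add: algebra_simps)
      ultimately show ?thesis using False by (simp only: real_norm_def abs_minus_cancel) auto
    qed
  qed
  moreover have "0 < d'" using d x by (simp add: d'_def)
  ultimately show "\<exists>d>0. \<forall>y. norm (y - x) < d \<longrightarrow> norm (dist_fun r y - dist_fun r x - r x * (y - x)) \<le> e * norm (y - x)" by blast
qed

lemma isCont_hahn_density:
  assumes x: "0 < x" "x < 1" and AB: "0 < A" "0 < B"
  shows "isCont (hahn_density A B t) x"
proof -
  have c: "isCont (\<lambda>y. arccos (max (-1) (min 1 y))) y" for y
  proof -
    have "continuous_on UNIV (\<lambda>y. arccos (max (-1) (min 1 y)))" by (intro continuous_intros) auto
    then show ?thesis by (simp add: continuous_on_eq_continuous_at)
  qed
  have "isCont (\<lambda>x. ((1 - x) * (1 - x + A) + x * (x + B) - t * (2 + A + B - t)) / (2 * sqrt ((1 - x) * (1 - x + A) * (x * (x + B))))) x"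
    using x AB by (intro continuous_intros) auto
  from isCont_o2[OF this c] show ?thesis
    unfolding hahn_density_def[abs_def] by (intro continuous_intros) auto
qed

text \<open>Both \<mu> and the measure with density (1 - \<rho>) / c are minimizers, one by
  hypothesis, the other through the ensemble. At their midpoint the parallelogram identity leaves an
  energy \<le> 0 for the difference, so the distribution functions agree; differentiating at a
  continuity point of \<rho> gives the claim.\<close>

theorem equilibrium_density:
  fixes N a b n :: "nat \<Rightarrow> nat" and A B c x :: real
  assumes N: "filterlim N at_top sequentially" and N0: "\<And>k. 0 < N k"
    and a: "\<And>k. real (a k) = A * real (N k)" and b: "\<And>k. real (b k) = B * real (N k)"
    and AB: "0 < A" "0 < B" and n: "\<And>k. real (n k) = (1 - c) * real (N k)" and c: "0 < c" "c < 1"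
    and eq: "is_equilibrium_measure A B c \<mu>" and x: "0 < x" "x < 1"
  shows "c * density_at \<mu> x = 1 - hahn_density A B (1 - c) x"
proof -
  define \<rho> where "\<rho> = hahn_density A B (1 - c)"
  have t: "0 < 1 - c" "1 - c < 1" using c by auto
  have \<rho>b: "bddm \<rho>" unfolding \<rho>_def by (rule bddm_hahn_density)
  have \<rho>01: "0 \<le> \<rho> u" "\<rho> u \<le> 1" for u using hahn_density_bounds by (auto simp: \<rho>_def)
  have [measurable]: "\<rho> \<in> borel_measurable borel" by (rule bddm_measurable[OF \<rho>b])
  have \<rho>int: "(LINT u|unif. \<rho> u) = 1 - c" unfolding \<rho>_def by (rule integral_hahn_density[OF N N0 a b AB n t])
  note minimal = hahn_density_minimizes[OF N N0 a b AB n t, folded \<rho>_def]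
  have adm: "admissible c \<mu>" and min: "\<And>\<nu>. admissible c \<nu> \<Longrightarrow> energy A B c \<mu> \<le> energy A B c \<nu>"
    using eq by (auto simp: is_equilibrium_measure_def)
  obtain g where g: "g \<in> borel_measurable borel" "\<And>x. 0 \<le> g x" "\<And>x. g x \<le> 1 / c" "\<And>x. x \<notin> {0..1} \<Longrightarrow> g x = 0"
    and \<mu>: "\<mu> = density lborel (\<lambda>x. ennreal (g x))" by (rule admissible_density[OF c(1) adm]) blast
  note [measurable] = g(1)
  have ps: "prob_space \<mu>" using adm by (simp add: admissible_def)
  interpret P: prob_space \<mu> by (rule ps)
  have int\<mu>: "(LINT x|\<mu>. h x) = (LINT x|unif. h x * g x)" if "h \<in> borel_measurable borel" for h :: "real \<Rightarrow> real"
    unfolding \<mu> by (rule integral_density_unif) (use g that in auto)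
  have gint: "(LINT u|unif. g u) = 1"
    using int\<mu>[of "\<lambda>_. 1"] by (simp add: P.prob_space)
  have gb: "bddm g" using g by (intro bddmI[where K = "1 / c"]) (auto simp: abs_of_nonneg)
  define r where "r u = 1 - c * g u" for u
  have r01: "0 \<le> r u" "r u \<le> 1" for u
    using g(2,3)[of u] c by (auto simp: r_def field_simps)
  have rm [measurable]: "r \<in> borel_measurable borel" unfolding r_def by measurable
  have rb: "bddm r" using r01 by (intro bddmI[where K = 1, OF rm]) (auto simp: abs_le_iff intro: order.trans[of _ 0])
  have rint: "(LINT u|unif. r u) = 1 - c"
    unfolding r_def using integrable_unif_bddm[OF gb] gint by (simp add: unif.prob_space)
  \<comment> \<open>Density of the competitor \<nu> for which 1 - c h is \<rho> on [0, 1]; an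
    admissible measure lives on [0, 1], hence the value 0 elsewhere.\<close>
  define h where "h u = (if u \<in> {0..1} then (1 - \<rho> u) / c else 0)" for u
  have hm [measurable]: "h \<in> borel_measurable borel" unfolding h_def by measurable
  have h: "0 \<le> h u" "h u \<le> 1 / c" "u \<notin> {0..1} \<Longrightarrow> h u = 0" for u
    using \<rho>01[of u] c by (auto simp: h_def divide_right_mono)
  have hint: "(LINT u|unif. h u) = 1"
  proof -
    have "(LINT u|unif. h u) = (LINT u|unif. (1 - \<rho> u) / c)"
      by (intro bochner_cong refl) (simp add: h_def space_unif)
    also have "\<dots> = 1" using integrable_unif_bddm[OF \<rho>b] \<rho>int c by (simp add: unif.prob_space)
    finally show ?thesis .
  qed
  have hb: "bddm h" using h by (intro bddmI[where K = "1 / c", OF hm]) (auto simp: abs_of_nonneg)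
  define \<nu> where "\<nu> = density lborel (\<lambda>x. ennreal (h x))"
  have hI: "integrable lborel h"
  proof -
    have e: "indicator {0..1} u * h u = h u" for u using h(3)[of u] by (auto simp: indicator_def)
    show ?thesis using integrable_unif_bddm[OF hb] unfolding integrable_unif e .
  qed
  have hI1: "(LINT u|lborel. h u) = 1"
  proof -
    have e: "indicator {0..1} u * h u = h u" for u using h(3)[of u] by (auto simp: indicator_def)
    show ?thesis using hint unfolding integral_unif e .
  qed
  have nn1: "(\<integral>\<^sup>+u. ennreal (h u) \<partial>lborel) = 1" using nn_integral_eq_integral[OF hI] h(1) hI1 by simp
  have adm\<nu>: "admissible c \<nu>"
    unfolding admissible_def
  proof (intro conjI ballI)
    show "prob_space \<nu>" unfolding \<nu>_def
      by (rule prob_spaceI) (simp add: emeasure_density nn1)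
    show "sets \<nu> = sets borel" by (simp add: \<nu>_def)
    have "emeasure \<nu> {0..1} = (\<integral>\<^sup>+u. ennreal (h u) * indicator {0..1} u \<partial>lborel)" unfolding \<nu>_def by (subst emeasure_density) auto
    also have "\<dots> = (\<integral>\<^sup>+u. ennreal (h u) \<partial>lborel)" using h(3) by (intro nn_integral_cong) (auto simp: indicator_def)
    finally show "emeasure \<nu> {0..1} = 1" by (simp add: nn1)
    fix S :: "real set" assume S [measurable]: "S \<in> sets borel"
    have "emeasure \<nu> S = (\<integral>\<^sup>+u. ennreal (h u) * indicator S u \<partial>lborel)" unfolding \<nu>_def by (subst emeasure_density) auto
    also have "\<dots> \<le> (\<integral>\<^sup>+u. ennreal (1 / c) * indicator S u \<partial>lborel)"
      using h(2) by (intro nn_integral_mono) (auto simp: indicator_def intro: ennreal_leI)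
    also have "\<dots> = ennreal (1 / c) * emeasure lborel S" by (simp add: nn_integral_cmult_indicator)
    finally show "emeasure \<nu> S \<le> ennreal (1 / c) * emeasure lborel S" .
  qed
  have "hahn_energy A B r \<le> hahn_energy A B (\<lambda>x. 1 - c * h x)"
  proof -
    define C where "C = log_energy (\<lambda>_. 1) (\<lambda>_. 1) + (LINT u|unif. hahn_field A B u) - c * (B * ln B + (A + 1) * ln (A + 1) + 1)"
    have e\<mu>: "c * energy A B c \<mu> = hahn_energy A B (\<lambda>x. 1 - c * g x) - C"
      unfolding \<mu> by (subst energy_eq) (use c AB g gint in \<open>auto simp: C_def\<close>)
    have e\<nu>: "c * energy A B c \<nu> = hahn_energy A B (\<lambda>x. 1 - c * h x) - C"
      unfolding \<nu>_def by (subst energy_eq) (use c AB hm h hint in \<open>auto simp: C_def\<close>)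
    have "c * energy A B c \<mu> \<le> c * energy A B c \<nu>" using min[OF adm\<nu>] c by simp
    then show ?thesis unfolding e\<mu> e\<nu> r_def[abs_def] by simp
  qed
  also have "hahn_energy A B (\<lambda>x. 1 - c * h x) = hahn_energy A B \<rho>"
  proof -
    have e: "1 - c * h u = \<rho> u" if "u \<in> {0..1}" for u using that c by (simp add: h_def)
    have "log_energy (\<lambda>x. 1 - c * h x) (\<lambda>x. 1 - c * h x) = log_energy \<rho> \<rho>"
      unfolding log_energy_def by (intro bochner_cong refl) (auto simp: e space_pair_measure space_unif)
    moreover have "(LINT u|unif. hahn_field A B u * (1 - c * h u)) = (LINT u|unif. hahn_field A B u * \<rho> u)"
      by (intro bochner_cong refl) (auto simp: e space_unif)
    ultimately show ?thesis by (simp add: hahn_energy_def)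
  qed
  finally have le1: "hahn_energy A B r \<le> hahn_energy A B \<rho>" .
  define m where "m u = 1 / 2 * r u + 1 / 2 * \<rho> u" for u
  have le2: "hahn_energy A B \<rho> \<le> hahn_energy A B m"
  proof (rule minimal)
    show "m \<in> borel_measurable borel" unfolding m_def by measurable
    show "0 \<le> m u" "m u \<le> 1" for u using r01[of u] \<rho>01[of u] by (auto simp: m_def)
    show "(LINT u|unif. m u) = 1 - c"
      unfolding m_def using integrable_unif_bddm[OF rb] integrable_unif_bddm[OF \<rho>b] rint \<rho>int by simp
  qed
  define \<sigma> where "\<sigma> u = r u - \<rho> u" for u
  have \<sigma>b: "bddm \<sigma>" unfolding \<sigma>_def by (rule bddm_diff[OF rb \<rho>b])
  have mid: "hahn_energy A B m = 1 / 2 * hahn_energy A B r + 1 / 2 * hahn_energy A B \<rho> - 1 / 4 * log_energy \<sigma> \<sigma>"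
  proof -
    have lm: "log_energy m m = 1 / 4 * log_energy r r + 1 / 2 * log_energy r \<rho> + 1 / 4 * log_energy \<rho> \<rho>"
      unfolding m_def[abs_def] using log_energy_square[OF rb \<rho>b, of "1/2" "1/2"] by (simp add: power2_eq_square)
    have ls: "log_energy \<sigma> \<sigma> = log_energy r r - 2 * log_energy r \<rho> + log_energy \<rho> \<rho>"
      unfolding \<sigma>_def[abs_def] using log_energy_square[OF rb \<rho>b, of 1 "-1"] by simp
    have fm: "(LINT u|unif. hahn_field A B u * m u) = 1 / 2 * (LINT u|unif. hahn_field A B u * r u) + 1 / 2 * (LINT u|unif. hahn_field A B u * \<rho> u)"
    proof -
      have "(LINT u|unif. hahn_field A B u * m u) = (LINT u|unif. 1 / 2 * (hahn_field A B u * r u) + 1 / 2 * (hahn_field A B u * \<rho> u))"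
        by (intro bochner_cong refl) (simp add: m_def algebra_simps)
      also have "\<dots> = 1 / 2 * (LINT u|unif. hahn_field A B u * r u) + 1 / 2 * (LINT u|unif. hahn_field A B u * \<rho> u)"
        using integrable_hahn_field[OF AB rb] integrable_hahn_field[OF AB \<rho>b] by simp
      finally show ?thesis .
    qed
    show ?thesis unfolding hahn_energy_def lm ls fm by (simp add: field_simps)
  qed
  have "log_energy \<sigma> \<sigma> \<le> 0" using le1 le2 mid by simp
  then have Sle: "(LINT z|unif. (LINT u|unif. (if u \<le> z then 1 else 0) * \<sigma> u)\<^sup>2) \<le> 0"
    using log_energy_ge[OF \<sigma>b] by linarith
  have Seq: "(LINT u|unif. (if u \<le> z then 1 else 0) * \<sigma> u) = dist_fun r z - dist_fun \<rho> z" for z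
  proof -
    have i: "integrable unif (\<lambda>u. indicator {..z} u * q u)" if q: "bddm q" for q
    proof (rule Bochner_Integration.integrable_bound[OF integrable_unif_bddm[OF q]])
      show "(\<lambda>u. indicator {..z} u * q u) \<in> borel_measurable unif"
        using bddm_measurable[OF q] by (intro borel_measurable_unif) measurable
    qed (auto simp: indicator_def)
    have "(LINT u|unif. (if u \<le> z then 1 else 0) * \<sigma> u) = (LINT u|unif. indicator {..z} u * r u - indicator {..z} u * \<rho> u)"
      by (intro bochner_cong refl) (auto simp: \<sigma>_def)
    also have "\<dots> = dist_fun r z - dist_fun \<rho> z" unfolding dist_fun_def using i[OF rb] i[OF \<rho>b] by simp
    finally show ?thesis .
  qed
  have lip: "\<bar>(dist_fun r z - dist_fun \<rho> z) - (dist_fun r y - dist_fun \<rho> y)\<bar> \<le> z - y" if "0 \<le> y" "y \<le> z" "z \<le> 1" for y z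
    using dist_fun_increment[of r y z] dist_fun_increment[of \<rho> y z] that r01 \<rho>01 by (simp add: abs_le_iff)
  have Sm: "(\<lambda>z. dist_fun r z - dist_fun \<rho> z) \<in> borel_measurable unif"
  proof -
    have [measurable]: "(\<lambda>x. fst x) \<in> unif \<Otimes>\<^sub>M unif \<rightarrow>\<^sub>M (borel :: real measure)" "(\<lambda>x. snd x) \<in> unif \<Otimes>\<^sub>M unif \<rightarrow>\<^sub>M (borel :: real measure)" by measurable
    have "case_prod (\<lambda>z u. (if u \<le> z then 1 else 0) * \<sigma> u) \<in> borel_measurable unif2"
      unfolding \<sigma>_def case_prod_unfold by measurable
    then have "(\<lambda>z. LINT u|unif. (if u \<le> z then 1 else 0) * \<sigma> u) \<in> borel_measurable unif"
      by (rule unif.borel_measurable_lebesgue_integral)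
    then show ?thesis unfolding Seq .
  qed
  have Szero: "AE z in unif. dist_fun r z - dist_fun \<rho> z = 0"
  proof -
    have int: "integrable unif (\<lambda>z. (dist_fun r z - dist_fun \<rho> z)\<^sup>2)"
    proof (rule unif.integrable_const_bound[where B = 1])
      show "AE z in unif. norm ((dist_fun r z - dist_fun \<rho> z)\<^sup>2) \<le> 1"
      proof (rule AE_I2)
        fix z assume "z \<in> space unif"
        then have z: "0 \<le> z" "z \<le> 1" by (auto simp: space_unif)
        have "dist_fun r 1 - dist_fun \<rho> 1 = 0" using dist_fun_outside(2)[of 1] rint \<rho>int by simp
        then have "\<bar>dist_fun r z - dist_fun \<rho> z\<bar> \<le> 1" using lip[of z 1] z by simp
        then show "norm ((dist_fun r z - dist_fun \<rho> z)\<^sup>2) \<le> 1" by (simp add: abs_square_le_1)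
      qed
    qed (use Sm in measurable)
    have "(LINT z|unif. (dist_fun r z - dist_fun \<rho> z)\<^sup>2) = 0"
      using Sle unfolding Seq by (intro antisym) auto
    then show ?thesis using integral_nonneg_eq_0_iff_AE[OF int] by auto
  qed
  \<comment> \<open>Almost everywhere equality extends to every point because the difference is
    1-Lipschitz: a gap d at z keeps it nonzero within distance d.\<close>
  have dist_eq: "dist_fun r z = dist_fun \<rho> z" if z: "0 < z" "z < 1" for z
  proof (rule ccontr)
    define d where "d = \<bar>dist_fun r z - dist_fun \<rho> z\<bar>"
    assume "dist_fun r z \<noteq> dist_fun \<rho> z"
    then have "0 < d" by (simp add: d_def)
    from AE_unif_dense[OF Szero z this]
    obtain y where y: "\<bar>y - z\<bar> < d" "y \<in> {0..1}" "dist_fun r y - dist_fun \<rho> y = 0" by blast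
    have "d \<le> \<bar>y - z\<bar>"
      using lip[of y z] lip[of z y] y z by (cases "y \<le> z") (auto simp: d_def)
    then show False using y by simp
  qed
  have cdf: "measure \<mu> {..z} = (z - dist_fun \<rho> z) / c" if z: "0 < z" "z < 1" for z
  proof -
    have "measure \<mu> {..z} = (LINT u|\<mu>. indicator {..z} u)" by (simp add: \<mu>)
    also have "\<dots> = (LINT u|unif. indicator {..z} u * g u)" by (rule int\<mu>) auto
    also have "\<dots> = (LINT u|unif. (indicator {..z} u - indicator {..z} u * r u) / c)"
      using c by (intro bochner_cong refl) (auto simp: r_def field_simps)
    also have "\<dots> = ((LINT u|unif. indicator {..z} u) - dist_fun r z) / c"
    proof -
      have "integrable unif (indicator {..z} :: real \<Rightarrow> real)"
        by (rule unif.integrable_const_bound[where B = 1]) (auto intro!: borel_measurable_unif)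
      moreover have "integrable unif (\<lambda>u. indicator {..z} u * r u)"
        by (rule unif.integrable_const_bound[where B = 1]) (use r01 in \<open>auto intro!: borel_measurable_unif simp: indicator_def\<close>)
      ultimately show ?thesis by (simp add: dist_fun_def)
    qed
    also have "(LINT u|unif. indicator {..z} u) = (\<integral>u. indicator {0..z} u \<partial>lborel :: real)"
      unfolding integral_unif using z by (intro bochner_cong refl) (auto simp: indicator_def)
    also have "\<dots> = z" using z by simp
    finally show ?thesis using dist_eq[OF z] by simp
  qed
  have "((\<lambda>z. (z - dist_fun \<rho> z) / c) has_real_derivative (1 - \<rho> x) / c) (at x)"
    using dist_fun_has_derivative[OF \<rho>b x] isCont_hahn_density[OF x AB] c
    by (auto intro!: derivative_eq_intros simp: \<rho>_def)
  then have "((\<lambda>z. measure \<mu> {..z}) has_real_derivative (1 - \<rho> x) / c) (at x)"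
  proof (rule DERIV_cong_ev[THEN iffD2, rotated -1])
    have "eventually (\<lambda>z. z \<in> {0<..<1}) (nhds x)" using x by (intro eventually_nhds_in_open) auto
    then show "eventually (\<lambda>z. measure \<mu> {..z} = (z - dist_fun \<rho> z) / c) (nhds x)"
      by eventually_elim (simp add: cdf)
  qed auto
  then have "density_at \<mu> x = (1 - \<rho> x) / c" unfolding density_at_def by (rule DERIV_imp_deriv)
  then show ?thesis using c by (simp add: \<rho>_def)
qed

section \<open>Counting families of paths\<close>

lemma prod_plus_expand:
  fixes f g :: "'b \<Rightarrow> 'a :: comm_semiring_1"
  assumes "finite A"
  shows "(\<Prod>i\<in>A. f i + g i) = (\<Sum>V\<in>Pow A. \<Prod>i\<in>A. if i \<in> V then f i else g i)"
  unfolding prod_add[OF assms]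
proof (intro sum.cong refl)
  fix V assume "V \<in> Pow A"
  then have "A \<inter> {i. i \<in> V} = V" "A \<inter> - {i. i \<in> V} = A - V" by auto
  then show "prod f V * prod g (A - V) = (\<Prod>i\<in>A. if i \<in> V then f i else g i)"
    using prod.If_cases[OF assms, of "\<lambda>i. i \<in> V" f g] by simp
qed

text \<open>Summing over V subjects each row of the Vandermonde determinant to f(y) -> y f(y - 1) +
  (L - y) f(y). This does not raise degrees and multiplies the top coefficient of x^j by L - j, so
  only a diagonal product comes out.\<close>

lemma vandermonde_shift_sum_indexed:
  fixes y :: "nat \<Rightarrow> real"
  shows "(\<Sum>V\<in>Pow {..<c}. (\<Prod>i<c. if i \<in> V then y i else L - y i) *
      (\<Prod>j<c. \<Prod>l<j. (if j \<in> V then y j - 1 else y j) - (if l \<in> V then y l - 1 else y l)))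
    = (\<Prod>j<c. L - real j) * (\<Prod>j<c. \<Prod>l<j. y j - y l)"
proof -
  \<comment> \<open>Written as x ((x - 1)^j - x^j) + L x^j, so that the two terms of degree j + 1
    cancel visibly.\<close>
  define P where "P j = pCons 0 ([:-1, 1:] ^ j - monom 1 j) + smult L (monom 1 j)" for j :: nat
  have P: "poly (P j) x = x * (x - 1) ^ j + (L - x) * x ^ j" for j x
    by (simp add: P_def poly_monom algebra_simps)
  have cP: "coeff (P j) (Suc i) = coeff ([:-1, 1:] ^ j) i - (if i = j then 1 else 0) + (if Suc i = j then L else 0)" for i j
    by (simp add: P_def)
  have deg1: "degree ([:-1, 1 :: real:] ^ j) = j" for j
    by (simp add: degree_power_eq)
  have deg: "degree (P j) \<le> j" for j
  proof (rule degree_le, intro allI impI)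
    fix k assume k: "j < k"
    then obtain i where i: "k = Suc i" by (cases k) auto
    show "coeff (P j) k = 0"
    proof (cases "i = j")
      case True
      then show ?thesis unfolding i cP by (simp add: coeff_linear_power)
    next
      case False
      then have "coeff ([:-1, 1 :: real:] ^ j) i = 0" using k i by (intro coeff_eq_0) (simp add: deg1)
      then show ?thesis unfolding i cP using False k i by simp
    qed
  qed
  have top: "coeff (P j) j = L - real j" for j
  proof (cases j)
    case 0
    then show ?thesis by (simp add: P_def)
  next
    case (Suc i)
    have "coeff ([:-1, 1 :: real:] ^ Suc i) i = - real (Suc i)"
      by (subst coeff_linear_poly_power) auto
    then show ?thesis unfolding Suc cP by simp
  qed
  define sh where "sh V i = (if i \<in> V then y i - 1 else y i)" for V and i :: nat
  define w where "w V i = (if i \<in> V then y i else L - y i)" for V and i :: nat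
  have L1: "mdet (Matrix.mat c c (\<lambda>(i,j). M i j))
      = (\<Sum>\<pi> | \<pi> permutes {0..<c}. signof \<pi> * (\<Prod>i<c. M i (\<pi> i)))" for M :: "nat \<Rightarrow> nat \<Rightarrow> real"
    by (subst det_def'[of _ c]) (auto intro!: sum.cong prod.cong simp: permutes_nat_less atLeast0LessThan)
  have "(\<Sum>V\<in>Pow {..<c}. (\<Prod>i<c. w V i) * (\<Prod>j<c. \<Prod>l<j. sh V j - sh V l))
     = (\<Sum>V\<in>Pow {..<c}. (\<Prod>i<c. w V i) * (\<Sum>\<pi> | \<pi> permutes {0..<c}. signof \<pi> * (\<Prod>i<c. sh V i ^ \<pi> i)))"
    unfolding det_vandermonde[symmetric] L1 ..
  also have "\<dots> = (\<Sum>\<pi> | \<pi> permutes {0..<c}. signof \<pi> * (\<Sum>V\<in>Pow {..<c}. \<Prod>i<c. w V i * sh V i ^ \<pi> i))"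
    unfolding sum_distrib_left prod.distrib
    by (subst sum.swap) (simp add: mult_ac)
  also have "\<dots> = (\<Sum>\<pi> | \<pi> permutes {0..<c}. signof \<pi> * (\<Prod>i<c. poly (P (\<pi> i)) (y i)))"
  proof (intro sum.cong refl arg_cong2[where f = "(*)"])
    fix \<pi>
    have "(\<Prod>i<c. poly (P (\<pi> i)) (y i)) = (\<Sum>V\<in>Pow {..<c}. \<Prod>i<c. if i \<in> V then y i * (y i - 1) ^ \<pi> i else (L - y i) * y i ^ \<pi> i)"
      unfolding P by (rule prod_plus_expand) simp
    also have "\<dots> = (\<Sum>V\<in>Pow {..<c}. \<Prod>i<c. w V i * sh V i ^ \<pi> i)"
      by (intro sum.cong prod.cong refl) (auto simp: w_def sh_def)
    finally show "(\<Sum>V\<in>Pow {..<c}. \<Prod>i<c. w V i * sh V i ^ \<pi> i) = (\<Prod>i<c. poly (P (\<pi> i)) (y i))" by simp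
  qed
  also have "\<dots> = (\<Prod>j<c. L - real j) * (\<Prod>j<c. \<Prod>l<j. y j - y l)"
    unfolding L1[symmetric, of "\<lambda>i j. poly (P j) (y i)"] using det_poly_eval[of c P y] deg by (simp add: top det_vandermonde)
  finally show ?thesis by (simp add: w_def sh_def)
qed

text \<open>Pairs are ordered by \<open>Z\<close> while differences are taken of \<phi>, so the same
  product serves for a set and for its shifted image, and it vanishes when \<phi> identifies two
  points.\<close>

definition lattice_vdm :: "int set \<Rightarrow> (int \<Rightarrow> int) \<Rightarrow> real" where
  "lattice_vdm Z \<phi> = (\<Prod>z\<in>Z. \<Prod>w\<in>{w\<in>Z. w < z}. of_int (\<phi> z) - of_int (\<phi> w))"

lemma lattice_vdm_indexed:
  fixes e :: "nat \<Rightarrow> int"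
  assumes e: "strict_mono_on {..<c} e" "e ` {..<c} = Z"
  shows "lattice_vdm Z \<phi> = (\<Prod>j<c. \<Prod>l<j. of_int (\<phi> (e j)) - of_int (\<phi> (e l)))"
proof -
  have inj: "inj_on e {..<c}" using e(1) by (rule strict_mono_on_imp_inj_on)
  have sub: "{w\<in>Z. w < e j} = e ` {..<j}" if j: "j < c" for j
  proof -
    have "e i < e j \<longleftrightarrow> i < j" if "i < c" for i
      using strict_mono_on_less[OF e(1)] that j by auto
    then show ?thesis using j unfolding e(2)[symmetric] by (auto simp: image_iff)
  qed
  have "lattice_vdm Z \<phi> = (\<Prod>j<c. \<Prod>w\<in>{w\<in>Z. w < e j}. of_int (\<phi> (e j)) - of_int (\<phi> w))"
    unfolding lattice_vdm_def e(2)[symmetric] using inj by (subst prod.reindex) auto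
  also have "\<dots> = (\<Prod>j<c. \<Prod>l<j. of_int (\<phi> (e j)) - of_int (\<phi> (e l)))"
  proof (intro prod.cong refl)
    fix j assume "j \<in> {..<c}"
    then have j: "j < c" by simp
    have "inj_on e {..<j}" by (rule inj_on_subset[OF inj]) (use j in auto)
    then show "(\<Prod>w\<in>{w\<in>Z. w < e j}. of_int (\<phi> (e j)) - of_int (\<phi> w)) = (\<Prod>l<j. of_int (\<phi> (e j)) - of_int (\<phi> (e l)))"
      unfolding sub[OF j] by (subst prod.reindex) auto
  qed
  finally show ?thesis .
qed

lemma ex_enumeration:
  fixes Z :: "int set"
  assumes "finite Z" "card Z = c"
  obtains e :: "nat \<Rightarrow> int" where "strict_mono_on {..<c} e" "e ` {..<c} = Z"
proof
  define xs where "xs = sorted_list_of_set Z"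
  have xs: "sorted_wrt (<) xs" "set xs = Z" "length xs = c" using assms by (auto simp: xs_def)
  show "strict_mono_on {..<c} (\<lambda>i. xs ! i)"
    using xs sorted_wrt_nth_less[OF xs(1)] by (intro strict_mono_onI) auto
  show "(\<lambda>i. xs ! i) ` {..<c} = Z" using xs by (auto simp: set_conv_nth)
qed

text \<open>One step of the paths read backwards: a path at z in \<open>U\<close> came up from z -
  1, the others kept their level.\<close>

definition shift_down :: "int set \<Rightarrow> int \<Rightarrow> int" where
  "shift_down U z = (if z \<in> U then z - 1 else z)"

lemma vandermonde_shift_sum:
  assumes Z: "finite Z" "card Z = c"
  shows "(\<Sum>U\<in>Pow Z. (\<Prod>z\<in>Z. if z \<in> U then of_int z else L - of_int z) * lattice_vdm Z (shift_down U))
    = (\<Prod>j<c. L - real j) * lattice_vdm Z (\<lambda>z. z)"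
proof -
  obtain e where e: "strict_mono_on {..<c} e" "e ` {..<c} = Z" using ex_enumeration[OF Z] .
  have inj: "inj_on e {..<c}" using e(1) by (rule strict_mono_on_imp_inj_on)
  have mem: "e i \<in> e ` V \<longleftrightarrow> i \<in> V" if "i < c" "V \<subseteq> {..<c}" for i V
    using inj that by (auto simp: inj_on_def)
  have bij: "bij_betw ((`) e) (Pow {..<c}) (Pow Z)"
    unfolding e(2)[symmetric] using inj by (rule bij_betw_Pow[OF inj_on_imp_bij_betw])
  have "(\<Sum>U\<in>Pow Z. (\<Prod>z\<in>Z. if z \<in> U then of_int z else L - of_int z) * lattice_vdm Z (shift_down U))
     = (\<Sum>V\<in>Pow {..<c}. (\<Prod>z\<in>Z. if z \<in> e ` V then of_int z else L - of_int z) * lattice_vdm Z (shift_down (e ` V)))"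
    by (rule sum.reindex_bij_betw[OF bij, symmetric])
  also have "\<dots> = (\<Sum>V\<in>Pow {..<c}. (\<Prod>i<c. if i \<in> V then of_int (e i) else L - of_int (e i)) *
      (\<Prod>j<c. \<Prod>l<j. (if j \<in> V then of_int (e j) - 1 else of_int (e j)) - (if l \<in> V then of_int (e l) - 1 else of_int (e l))))"
  proof (intro sum.cong refl arg_cong2[where f = "(*)"])
    fix V assume V: "V \<in> Pow {..<c}"
    show "(\<Prod>z\<in>Z. if z \<in> e ` V then of_int z else L - of_int z) = (\<Prod>i<c. if i \<in> V then of_int (e i) else L - of_int (e i))"
      unfolding e(2)[symmetric] prod.reindex[OF inj] comp_def using V mem by (intro prod.cong) auto
    show "lattice_vdm Z (shift_down (e ` V)) = (\<Prod>j<c. \<Prod>l<j. (if j \<in> V then of_int (e j) - 1 else of_int (e j)) - (if l \<in> V then of_int (e l) - 1 else of_int (e l)))"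
      unfolding lattice_vdm_indexed[OF e] shift_down_def using V mem by (intro prod.cong refl) auto
  qed
  also have "\<dots> = (\<Prod>j<c. L - real j) * (\<Prod>j<c. \<Prod>l<j. of_int (e j) - of_int (e l))"
    by (rule vandermonde_shift_sum_indexed)
  finally show ?thesis unfolding lattice_vdm_indexed[OF e] .
qed

text \<open>Colliding paths get weight 0, so the sum over all \<open>U\<close> equals the sum over
  the admissible steps.\<close>

lemma lattice_vdm_shift_eq_0:
  assumes "finite Z" "\<not> inj_on (shift_down U) Z"
  shows "lattice_vdm Z (shift_down U) = 0"
proof -
  obtain z w where zw: "z \<in> Z" "w \<in> Z" "z \<noteq> w" "shift_down U z = shift_down U w" using assms(2) by (auto simp: inj_on_def)
  have *: "lattice_vdm Z (shift_down U) = 0" if "z \<in> Z" "w \<in> Z" "w < z" "shift_down U z = shift_down U w" for z w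
  proof -
    have "(\<Prod>v\<in>{v\<in>Z. v < z}. of_int (shift_down U z) - of_int (shift_down U v) :: real) = 0"
      using that assms(1) by (intro prod_zero) auto
    then show ?thesis unfolding lattice_vdm_def using that assms(1) by (intro prod_zero) auto
  qed
  show ?thesis
  proof (cases "w < z")
    case True
    then show ?thesis using *[of z w] zw by auto
  next
    case False
    then show ?thesis using *[of w z] zw by auto
  qed
qed

lemma shift_down_strict_mono:
  assumes "inj_on (shift_down U) Z" "w \<in> Z" "z \<in> Z" "w < z"
  shows "shift_down U w < shift_down U z"
proof -
  have "shift_down U w \<le> shift_down U z" using assms(4) by (auto simp: shift_down_def)
  moreover have "shift_down U w \<noteq> shift_down U z" using assms by (auto simp: inj_on_def)
  ultimately show ?thesis by simp
qed

lemma lattice_vdm_shift_image: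
  assumes "finite Z" "inj_on (shift_down U) Z"
  shows "lattice_vdm (shift_down U ` Z) (\<lambda>z. z) = lattice_vdm Z (shift_down U)"
proof -
  define f where "f = shift_down U"
  have lt: "f w < f z \<longleftrightarrow> w < z" if "w \<in> Z" "z \<in> Z" for w z
    using shift_down_strict_mono[OF assms(2), of w z] shift_down_strict_mono[OF assms(2), of z w] that unfolding f_def
    by (cases w z rule: linorder_cases) auto
  have inj: "inj_on f Z" using assms(2) by (simp add: f_def)
  have "lattice_vdm (f ` Z) (\<lambda>z. z) = (\<Prod>z\<in>Z. \<Prod>w\<in>{w\<in>f ` Z. w < f z}. of_int (f z) - of_int w)"
    unfolding lattice_vdm_def using inj by (subst prod.reindex) auto
  also have "\<dots> = lattice_vdm Z f"
    unfolding lattice_vdm_def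
  proof (rule prod.cong[OF refl])
    fix z assume z: "z \<in> Z"
    have "{w\<in>f ` Z. w < f z} = f ` {w\<in>Z. w < z}" using lt z by auto
    moreover have "inj_on f {w\<in>Z. w < z}" by (rule inj_on_subset[OF inj]) auto
    ultimately show "(\<Prod>w\<in>{w\<in>f ` Z. w < f z}. of_int (f z) - of_int w) = (\<Prod>w\<in>{w\<in>Z. w < z}. of_int (f z) - of_int (f w) :: real)"
      by (simp add: prod.reindex)
  qed
  finally show ?thesis by (simp add: f_def)
qed

text \<open>The reciprocal Gamma function at i + 1: with the value 0 at negative integers,
  \<open>inv_fact_pred\<close> holds for all integers and products of such factors confine the paths
  to their range.\<close>

definition inv_fact :: "int \<Rightarrow> real" where
  "inv_fact i = (if i < 0 then 0 else 1 / fact (nat i))"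

lemma inv_fact_pred: "inv_fact (i - 1) = of_int i * inv_fact i"
proof -
  consider "i < 0" | "i = 0" | n where "i = int (Suc n)"
  proof (cases "0 < i")
    case True
    then obtain n where "i = int n" "0 < n" using zero_less_imp_eq_int by blast
    then show ?thesis using that(3)[of "n - 1"] by simp
  qed (use that in linarith)
  then show ?thesis
  proof cases
    case 3
    have nn: "inv_fact (int k) = 1 / fact k" for k by (simp add: inv_fact_def)
    have "i - 1 = int n" using 3 by simp
    then have "inv_fact (i - 1) = 1 / fact n" by (simp only: nn)
    also have "\<dots> = real (Suc n) * (1 / fact (Suc n))" by (simp del: of_nat_Suc)
    finally show ?thesis unfolding 3 nn by simp
  qed (auto simp: inv_fact_def)
qed

text \<open>The number of families of non-intersecting paths with \<open>k\<close> steps from the interval \<open>{0..<c}\<close> to \<open>Z\<close>.\<close>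

fun npaths :: "nat \<Rightarrow> nat \<Rightarrow> int set \<Rightarrow> nat" where
  "npaths c 0 Z = (if Z = {0..<int c} then 1 else 0)"
| "npaths c (Suc k) Z = (\<Sum>U\<in>{U\<in>Pow Z. inj_on (shift_down U) Z}. npaths c k (shift_down U ` Z))"

text \<open>Induction on the last step: a backward step multiplies the inverse factorials by z or by
  L - z with L = k + c, and these are the weights in \<open>vandermonde_shift_sum\<close>.\<close>

theorem npaths_formula:
  "\<exists>C>0. \<forall>Z. finite Z \<longrightarrow> card Z = c \<longrightarrow>
     real (npaths c k Z) = C * lattice_vdm Z (\<lambda>z. z) * (\<Prod>z\<in>Z. inv_fact z * inv_fact (int k + int c - 1 - z))"
proof (induction k)
  case 0
  define Z0 where "Z0 = {0..<int c}"
  define V where "V = lattice_vdm Z0 (\<lambda>z. z) * (\<Prod>z\<in>Z0. inv_fact z * inv_fact (int c - 1 - z))"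
  have V: "0 < V" unfolding V_def lattice_vdm_def Z0_def
    by (intro mult_pos_pos prod_pos ballI) (auto simp: inv_fact_def)
  have "real (npaths c 0 Z) = 1 / V * lattice_vdm Z (\<lambda>z. z) * (\<Prod>z\<in>Z. inv_fact z * inv_fact (int 0 + int c - 1 - z))"
    if Z: "finite Z" "card Z = c" for Z
  proof (cases "Z = Z0")
    case True
    then show ?thesis using V by (simp add: V_def[symmetric] Z0_def[symmetric] mult.assoc)
  next
    case False
    \<comment> \<open>Another set of c elements has a point outside \<open>{0..<c}\<close>, where
      one of the two inverse factorials vanishes.\<close>
    have "\<not> Z \<subseteq> Z0"
    proof
      assume "Z \<subseteq> Z0"
      then have "Z = Z0" using Z by (intro card_subset_eq) (auto simp: Z0_def)
      then show False using False by simp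
    qed
    then obtain z where z: "z \<in> Z" "z < 0 \<or> int c \<le> z" using not_le_imp_less unfolding subset_iff Z0_def by auto
    have "(\<Prod>z\<in>Z. inv_fact z * inv_fact (int 0 + int c - 1 - z)) = 0"
      using z Z(1) by (intro prod_zero) (auto intro!: bexI[of _ z] simp: inv_fact_def)
    then show ?thesis using False by (simp add: Z0_def)
  qed
  then show ?case using V by (intro exI[of _ "1 / V"] conjI allI impI) simp_all
next
  case (Suc k)
  then obtain C where C: "0 < C" and IH: "\<And>Z. finite Z \<Longrightarrow> card Z = c \<Longrightarrow>
     real (npaths c k Z) = C * lattice_vdm Z (\<lambda>z. z) * (\<Prod>z\<in>Z. inv_fact z * inv_fact (int k + int c - 1 - z))" by blast
  define L where "L = real k + real c"
  define D where "D = C * (\<Prod>j<c. L - real j)"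
  have D: "0 < D" unfolding D_def L_def using C by (intro mult_pos_pos prod_pos) auto
  define w where "w U z = (if z \<in> U then of_int z else L - of_int z)" for U z
  have "real (npaths c (Suc k) Z) = D * lattice_vdm Z (\<lambda>z. z) * (\<Prod>z\<in>Z. inv_fact z * inv_fact (int (Suc k) + int c - 1 - z))"
    if Z: "finite Z" "card Z = c" for Z
  proof -
    define F where "F = (\<Prod>z\<in>Z. inv_fact z * inv_fact (int (Suc k) + int c - 1 - z))"
    have fac: "inv_fact (shift_down U z) * inv_fact (int k + int c - 1 - shift_down U z)
        = w U z * (inv_fact z * inv_fact (int (Suc k) + int c - 1 - z))" for U z
    proof (cases "z \<in> U")
      case True
      have "int k + int c - 1 - (z - 1) = int (Suc k) + int c - 1 - z" by simp
      then show ?thesis using True by (simp only: shift_down_def w_def inv_fact_pred if_True mult.assoc)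
    next
      case False
      have "int k + int c - 1 - z = (int (Suc k) + int c - 1 - z) - 1" by simp
      then have "inv_fact (int k + int c - 1 - z) = (L - of_int z) * inv_fact (int (Suc k) + int c - 1 - z)"
        unfolding L_def by (simp only: inv_fact_pred) simp
      then show ?thesis using False by (simp add: shift_down_def w_def)
    qed
    have "real (npaths c (Suc k) Z) = (\<Sum>U\<in>{U\<in>Pow Z. inj_on (shift_down U) Z}. C * F * ((\<Prod>z\<in>Z. w U z) * lattice_vdm Z (shift_down U)))"
      unfolding npaths.simps of_nat_sum
    proof (intro sum.cong refl)
      fix U assume U: "U \<in> {U\<in>Pow Z. inj_on (shift_down U) Z}"
      then have inj: "inj_on (shift_down U) Z" by simp
      have "real (npaths c k (shift_down U ` Z)) = C * lattice_vdm (shift_down U ` Z) (\<lambda>z. z)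
          * (\<Prod>z\<in>shift_down U ` Z. inv_fact z * inv_fact (int k + int c - 1 - z))"
        using Z inj by (intro IH) (auto simp: card_image)
      also have "(\<Prod>z\<in>shift_down U ` Z. inv_fact z * inv_fact (int k + int c - 1 - z)) = (\<Prod>z\<in>Z. w U z) * F"
        unfolding prod.reindex[OF inj] comp_def fac F_def by (rule prod.distrib)
      finally show "real (npaths c k (shift_down U ` Z)) = C * F * ((\<Prod>z\<in>Z. w U z) * lattice_vdm Z (shift_down U))"
        by (simp add: lattice_vdm_shift_image[OF Z(1) inj])
    qed
    also have "\<dots> = (\<Sum>U\<in>Pow Z. C * F * ((\<Prod>z\<in>Z. w U z) * lattice_vdm Z (shift_down U)))"
      using Z(1) by (intro sum.mono_neutral_left) (auto simp: lattice_vdm_shift_eq_0)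
    also have "\<dots> = C * F * ((\<Prod>j<c. L - real j) * lattice_vdm Z (\<lambda>z. z))"
      unfolding sum_distrib_left[symmetric] w_def vandermonde_shift_sum[OF Z] ..
    finally show ?thesis unfolding F_def D_def by (simp add: mult_ac)
  qed
  then show ?case using D by (intro exI[of _ D] conjI allI impI)
qed

section \<open>Reversal and splitting of path families\<close>

definition path_step :: "int set \<Rightarrow> int set \<Rightarrow> bool" where
  "path_step Y Z \<longleftrightarrow> (\<exists>U\<subseteq>Z. inj_on (shift_down U) Z \<and> Y = shift_down U ` Z)"

lemma path_step_iff: "path_step Y Z \<longleftrightarrow> (\<exists>f. bij_betw f Z Y \<and> (\<forall>z\<in>Z. f z = z \<or> f z = z - 1))"
proof
  assume "path_step Y Z"
  then obtain U where "inj_on (shift_down U) Z" "Y = shift_down U ` Z" by (auto simp: path_step_def)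
  then show "\<exists>f. bij_betw f Z Y \<and> (\<forall>z\<in>Z. f z = z \<or> f z = z - 1)"
    by (intro exI[of _ "shift_down U"]) (auto simp: bij_betw_def shift_down_def)
next
  assume "\<exists>f. bij_betw f Z Y \<and> (\<forall>z\<in>Z. f z = z \<or> f z = z - 1)"
  then obtain f where f: "inj_on f Z" "f ` Z = Y" "\<And>z. z \<in> Z \<Longrightarrow> f z = z \<or> f z = z - 1" by (auto simp: bij_betw_def)
  define U where "U = {z\<in>Z. f z = z - 1}"
  have eq: "shift_down U z = f z" if "z \<in> Z" for z using f(3)[OF that] that by (auto simp: shift_down_def U_def)
  have "inj_on (shift_down U) Z" using f(1) eq by (auto simp: inj_on_def)
  moreover have "shift_down U ` Z = Y" unfolding f(2)[symmetric] using eq by (intro image_cong refl)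
  moreover have "U \<subseteq> Z" by (auto simp: U_def)
  ultimately show "path_step Y Z" unfolding path_step_def by (intro exI[of _ U] conjI) simp_all
qed

text \<open>Reversing time turns rises into descents, and reflecting the heights turns them back;
  the paths beyond the observed line can thus be counted by the same function.\<close>

lemma path_step_reflect:
  assumes "path_step Y Z"
  shows "path_step ((\<lambda>z. r - z) ` Z) ((\<lambda>z. r - z) ` Y)"
proof -
  obtain f where f: "bij_betw f Z Y" "\<And>z. z \<in> Z \<Longrightarrow> f z = z \<or> f z = z - 1" using assms unfolding path_step_iff by blast
  define g where "g = the_inv_into Z f"
  have g: "bij_betw g Y Z" unfolding g_def by (rule bij_betw_the_inv_into[OF f(1)])
  have fg: "f (g y) = y" if "y \<in> Y" for y
    using f_the_inv_into_f_bij_betw[OF f(1)] that by (simp add: g_def)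
  have gZ: "g y \<in> Z" if "y \<in> Y" for y using g that by (auto simp: bij_betw_def)
  have r: "bij_betw (\<lambda>z. r - z) X ((\<lambda>z. r - z) ` X)" for X :: "int set"
    by (rule inj_on_imp_bij_betw) (auto simp: inj_on_def)
  have r': "bij_betw (\<lambda>z. r - z) ((\<lambda>z. r - z) ` X) X" for X :: "int set"
    by (rule bij_betwI[where g = "\<lambda>z. r - z"]) auto
  have "bij_betw ((\<lambda>z. r - z) \<circ> (g \<circ> (\<lambda>z. r - z))) ((\<lambda>z. r - z) ` Y) ((\<lambda>z. r - z) ` Z)"
    by (rule bij_betw_trans[OF bij_betw_trans[OF r' g] r])
  moreover have "((\<lambda>z. r - z) \<circ> (g \<circ> (\<lambda>z. r - z))) z = z \<or> ((\<lambda>z. r - z) \<circ> (g \<circ> (\<lambda>z. r - z))) z = z - 1"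
    if "z \<in> (\<lambda>z. r - z) ` Y" for z
  proof -
    obtain y where y: "y \<in> Y" "z = r - y" using \<open>z \<in> _\<close> by auto
    then show ?thesis using f(2)[OF gZ[OF y(1)]] fg[OF y(1)] by auto
  qed
  ultimately show ?thesis unfolding path_step_iff by blast
qed

text \<open>Admissible shifts preserve the order, so a point and its image have the same rank, and
  the image set determines the shift of every point. Position sets therefore determine the
  paths.\<close>

lemma shift_down_image_unique:
  assumes Z: "finite Z" and U: "U \<subseteq> Z" "U' \<subseteq> Z"
    and inj: "inj_on (shift_down U) Z" "inj_on (shift_down U') Z"
    and eq: "shift_down U ` Z = shift_down U' ` Z"
  shows "U = U'"
proof -
  have rank: "card {w\<in>shift_down V ` Z. w < shift_down V z} = card {w\<in>Z. w < z}"
    if injV: "inj_on (shift_down V) Z" and z: "z \<in> Z" for V z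
  proof -
    have lt: "shift_down V w < shift_down V z \<longleftrightarrow> w < z" if "w \<in> Z" for w
      using shift_down_strict_mono[OF injV, of w z] shift_down_strict_mono[OF injV, of z w] that z
      by (cases w z rule: linorder_cases) auto
    have "{w\<in>shift_down V ` Z. w < shift_down V z} = shift_down V ` {w\<in>Z. w < z}" using lt by auto
    moreover have "inj_on (shift_down V) {w\<in>Z. w < z}" by (rule inj_on_subset[OF injV]) auto
    ultimately show ?thesis by (simp add: card_image)
  qed
  have same: "shift_down U z = shift_down U' z" if z: "z \<in> Z" for z
  proof -
    define W where "W = shift_down U ` Z"
    have fW: "finite W" using Z by (simp add: W_def)
    have mem: "shift_down U z \<in> W" "shift_down U' z \<in> W" using z eq by (auto simp: W_def)
    have c: "card {w\<in>W. w < shift_down U z} = card {w\<in>W. w < shift_down U' z}"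
      using rank[OF inj(1) z] rank[OF inj(2) z] eq by (simp add: W_def)
    have less: "card {w\<in>W. w < p} < card {w\<in>W. w < q}" if "p \<in> W" "p < q" for p q
      using fW that by (intro psubset_card_mono) auto
    show ?thesis using less[OF mem(1), of "shift_down U' z"] less[OF mem(2), of "shift_down U z"] c
      by (cases "shift_down U z" "shift_down U' z" rule: linorder_cases) auto
  qed
  show ?thesis
  proof (rule Set.set_eqI)
    fix z show "z \<in> U \<longleftrightarrow> z \<in> U'"
      using same[of z] U by (auto simp: shift_down_def split: if_splits)
  qed
qed

text \<open>The value beyond time n is fixed, so that families are equal as functions as soon as
  they agree up to time n.\<close>

definition path_families :: "nat \<Rightarrow> nat \<Rightarrow> int set \<Rightarrow> (nat \<Rightarrow> int set) set" where
  "path_families c n Z = {S. S 0 = {0..<int c} \<and> S n = Z \<and> (\<forall>k<n. path_step (S k) (S (Suc k))) \<and> (\<forall>k>n. S k = {})}"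

lemma card_path_families:
  "finite Z \<Longrightarrow> finite (path_families c n Z) \<and> card (path_families c n Z) = npaths c n Z"
proof (induction n arbitrary: Z)
  case 0
  have "path_families c 0 Z = (if Z = {0..<int c} then {\<lambda>k. if k = 0 then Z else {}} else {})"
    unfolding path_families_def by (auto simp: fun_eq_iff)
  then show ?case by simp
next
  case (Suc n)
  define V where "V = {U\<in>Pow Z. inj_on (shift_down U) Z}"
  define ext where "ext S = S(Suc n := Z)" for S :: "nat \<Rightarrow> int set"
  have V: "finite V" using Suc.prems by (simp add: V_def)
  have IH: "finite (path_families c n (shift_down U ` Z))" "card (path_families c n (shift_down U ` Z)) = npaths c n (shift_down U ` Z)" for U
    using Suc.IH[of "shift_down U ` Z"] Suc.prems by auto
  have inj: "inj_on ext (path_families c n W)" for W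
  proof (rule inj_onI)
    fix S T assume "S \<in> path_families c n W" "T \<in> path_families c n W" "ext S = ext T"
    then have S: "\<And>k. k > n \<Longrightarrow> S k = {}" "\<And>k. k > n \<Longrightarrow> T k = {}" and eq: "\<And>k. ext S k = ext T k" by (auto simp: path_families_def)
    show "S = T"
    proof
      fix k show "S k = T k" using S[of k] eq[of k] by (cases "k = Suc n") (auto simp: ext_def)
    qed
  qed
  have eq: "path_families c (Suc n) Z = (\<Union>U\<in>V. ext ` path_families c n (shift_down U ` Z))"
  proof (intro equalityI subsetI)
    fix S assume S: "S \<in> path_families c (Suc n) Z"
    then have "path_step (S n) Z" by (auto simp: path_families_def)
    then obtain U where U: "U \<in> V" "S n = shift_down U ` Z" by (auto simp: path_step_def V_def)
    have "S(Suc n := {}) \<in> path_families c n (shift_down U ` Z)"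
      using S U(2) by (auto simp: path_families_def)
    moreover have "S = ext (S(Suc n := {}))" using S by (auto simp: ext_def path_families_def)
    ultimately show "S \<in> (\<Union>U\<in>V. ext ` path_families c n (shift_down U ` Z))" using U(1) by blast
  next
    fix S assume "S \<in> (\<Union>U\<in>V. ext ` path_families c n (shift_down U ` Z))"
    then obtain U T where U: "U \<in> V" and T: "T \<in> path_families c n (shift_down U ` Z)" and S: "S = ext T" by blast
    have "path_step (T n) Z" using U T unfolding path_step_def by (auto simp: V_def path_families_def)
    then show "S \<in> path_families c (Suc n) Z"
      using T unfolding S ext_def path_families_def by (auto simp: less_Suc_eq)
  qed
  have disj: "ext ` path_families c n (shift_down U ` Z) \<inter> ext ` path_families c n (shift_down U' ` Z) = {}"
    if "U \<in> V" "U' \<in> V" "U \<noteq> U'" for U U'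
  proof -
    have ne: "shift_down U ` Z \<noteq> shift_down U' ` Z"
      using shift_down_image_unique[OF Suc.prems, of U U'] that by (auto simp: V_def)
    have "ext S n = W" if "S \<in> path_families c n W" for S W using that by (auto simp: ext_def path_families_def)
    then have at_n: "T n = W" if "T \<in> ext ` path_families c n W" for T W using that by blast
    show ?thesis
    proof (rule equals0I)
      fix T assume "T \<in> ext ` path_families c n (shift_down U ` Z) \<inter> ext ` path_families c n (shift_down U' ` Z)"
      then have "T n = shift_down U ` Z" "T n = shift_down U' ` Z" by (simp_all only: Int_iff at_n)
      then show False using ne by simp
    qed
  qed
  have "card (path_families c (Suc n) Z) = (\<Sum>U\<in>V. card (ext ` path_families c n (shift_down U ` Z)))"
    unfolding eq using V IH disj by (intro card_UN_disjoint) auto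
  also have "\<dots> = npaths c (Suc n) Z" using card_image[OF inj] IH by (simp add: V_def)
  finally show ?case unfolding eq using V IH by auto
qed

text \<open>Unit steps bound the positions forwards from the initial set and backwards from the
  final one; the two bounds are intersected.\<close>

lemma path_families_bounds:
  assumes "S \<in> path_families c (a + b) {int a..<int a + int c}" "k \<le> a + b"
  shows "S k \<subseteq> {max 0 (int k - int b)..<int (min a k) + int c}" "finite (S k)" "card (S k) = c"
proof -
  have S: "S 0 = {0..<int c}" "S (a + b) = {int a..<int a + int c}" "\<And>k. k < a + b \<Longrightarrow> path_step (S k) (S (Suc k))"
    using assms(1) by (auto simp: path_families_def)
  have st: "\<exists>f. bij_betw f (S (Suc k)) (S k) \<and> (\<forall>z\<in>S (Suc k). f z = z \<or> f z = z - 1)" if "k < a + b" for k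
    using S(3)[OF that] unfolding path_step_iff .
  have 1: "k \<le> a + b \<longrightarrow> S k \<subseteq> {0..<int k + int c} \<and> finite (S k) \<and> card (S k) = c" for k
  proof (induction k)
    case (Suc k)
    show ?case
    proof
      assume k: "Suc k \<le> a + b"
      then obtain f where f: "bij_betw f (S (Suc k)) (S k)" "\<forall>z\<in>S (Suc k). f z = z \<or> f z = z - 1" using st[of k] by auto
      have IH: "S k \<subseteq> {0..<int k + int c}" "finite (S k)" "card (S k) = c" using Suc k by auto
      have "z \<in> {0..<int (Suc k) + int c}" if "z \<in> S (Suc k)" for z
      proof -
        have "f z \<in> S k" using f(1) that by (auto simp: bij_betw_def)
        then have "0 \<le> f z" "f z < int k + int c" using IH(1) by auto
        then show ?thesis using bspec[OF f(2) that] by auto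
      qed
      then show "S (Suc k) \<subseteq> {0..<int (Suc k) + int c} \<and> finite (S (Suc k)) \<and> card (S (Suc k)) = c"
        using IH bij_betw_finite[OF f(1)] bij_betw_same_card[OF f(1)] by auto
    qed
  qed (simp add: S)
  have 2: "i \<le> a + b \<longrightarrow> S (a + b - i) \<subseteq> {int a - int i..<int a + int c}" for i
  proof (induction i)
    case (Suc i)
    show ?case
    proof
      assume i: "Suc i \<le> a + b"
      define l where "l = a + b - Suc i"
      have l: "l < a + b" "Suc l = a + b - i" using i by (auto simp: l_def)
      obtain f where f: "bij_betw f (S (Suc l)) (S l)" "\<forall>z\<in>S (Suc l). f z = z \<or> f z = z - 1" using st[OF l(1)] by auto
      have IH: "S (Suc l) \<subseteq> {int a - int i..<int a + int c}" using Suc i l(2) by auto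
      show "S (a + b - Suc i) \<subseteq> {int a - int (Suc i)..<int a + int c}"
        unfolding l_def[symmetric]
      proof
        fix y assume "y \<in> S l"
        then obtain z where z: "z \<in> S (Suc l)" "y = f z" using f(1) by (auto simp: bij_betw_def)
        have "int a - int i \<le> z" "z < int a + int c" using z(1) IH by auto
        then show "y \<in> {int a - int (Suc i)..<int a + int c}" using bspec[OF f(2) z(1)] z(2) by auto
      qed
    qed
  qed (simp add: S)
  have "S k \<subseteq> {int k - int b..<int a + int c}" using 2[of "a + b - k"] assms(2) by (simp add: of_nat_diff)
  moreover have "S k \<subseteq> {0..<int k + int c}" using 1 assms(2) by blast
  ultimately show "S k \<subseteq> {max 0 (int k - int b)..<int (min a k) + int c}" by fastforce
  show "finite (S k)" "card (S k) = c" using 1 assms(2) by auto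
qed

text \<open>The family is cut at time m; its second half, reversed and reflected by
  \<open>rf\<close>, starts at \<open>{0..<c}\<close> again.\<close>

lemma card_path_families_through:
  fixes a c m n :: nat
  assumes Z: "finite Z" and mn: "m \<le> n"
  defines "rf \<equiv> \<lambda>z :: int. int a + int c - 1 - z"
  shows "card {S\<in>path_families c n {int a..<int a + int c}. S m = Z} = npaths c m Z * npaths c (n - m) (rf ` Z)"
proof -
  have rr: "rf ` rf ` X = X" for X by (force simp: rf_def)
  have rE: "rf ` {int a..<int a + int c} = {0..<int c}"
  proof (intro equalityI subsetI)
    fix z assume "z \<in> {0..<int c}"
    then have "rf z \<in> {int a..<int a + int c}" "z = rf (rf z)" by (auto simp: rf_def)
    then show "z \<in> rf ` {int a..<int a + int c}" by blast
  qed (auto simp: rf_def)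
  have rE': "rf ` {0..<int c} = {int a..<int a + int c}" using rE rr by metis
  define f where "f S = ((\<lambda>k. if k \<le> m then S k else {}), (\<lambda>k. if k \<le> n - m then rf ` S (n - k) else {}))" for S :: "nat \<Rightarrow> int set"
  define g where "g = (\<lambda>(P, Q) k. if k \<le> m then P k else if k \<le> n then rf ` Q (n - k) else ({} :: int set))"
  have "bij_betw f {S\<in>path_families c n {int a..<int a + int c}. S m = Z} (path_families c m Z \<times> path_families c (n - m) (rf ` Z))"
  proof (rule bij_betw_byWitness[where f' = g])
    show "\<forall>S\<in>{S\<in>path_families c n {int a..<int a + int c}. S m = Z}. g (f S) = S"
    proof
      fix S assume S: "S \<in> {S\<in>path_families c n {int a..<int a + int c}. S m = Z}"
      show "g (f S) = S"
      proof
        fix k show "g (f S) k = S k"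
          using S mn by (auto simp: g_def f_def rr path_families_def)
      qed
    qed
    show "\<forall>PQ\<in>path_families c m Z \<times> path_families c (n - m) (rf ` Z). f (g PQ) = PQ"
    proof
      fix PQ assume "PQ \<in> path_families c m Z \<times> path_families c (n - m) (rf ` Z)"
      then obtain P Q where PQ: "PQ = (P, Q)" "P \<in> path_families c m Z" "Q \<in> path_families c (n - m) (rf ` Z)" by auto
      have "fst (f (g PQ)) k = P k" for k using PQ(2) by (auto simp: PQ(1) f_def g_def path_families_def)
      moreover have "snd (f (g PQ)) k = Q k" for k
      proof -
        consider "k < n - m" | "k = n - m" | "k > n - m" by linarith
        then show ?thesis
        proof cases
          case 2
          then show ?thesis using PQ(2,3) mn by (simp add: PQ(1) f_def g_def path_families_def)
        qed (use PQ(3) mn in \<open>auto simp: PQ(1) f_def g_def path_families_def rr\<close>)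
      qed
      ultimately show "f (g PQ) = PQ" unfolding PQ(1) by (intro prod_eqI ext) auto
    qed
    show "f ` {S\<in>path_families c n {int a..<int a + int c}. S m = Z} \<subseteq> path_families c m Z \<times> path_families c (n - m) (rf ` Z)"
    proof (rule image_subsetI)
      fix S assume "S \<in> {S\<in>path_families c n {int a..<int a + int c}. S m = Z}"
      then have S: "S 0 = {0..<int c}" "S n = {int a..<int a + int c}" "S m = Z" "\<And>k. k < n \<Longrightarrow> path_step (S k) (S (Suc k))" by (auto simp: path_families_def)
      have "path_step (rf ` S (n - k)) (rf ` S (n - Suc k))" if "k < n - m" for k
        using path_step_reflect[OF S(4)[of "n - Suc k"]] that mn unfolding rf_def by (simp add: Suc_diff_Suc)
      then show "f S \<in> path_families c m Z \<times> path_families c (n - m) (rf ` Z)"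
        using S mn rE by (auto simp: f_def path_families_def)
    qed
    show "g ` (path_families c m Z \<times> path_families c (n - m) (rf ` Z)) \<subseteq> {S\<in>path_families c n {int a..<int a + int c}. S m = Z}"
    proof (rule image_subsetI)
      fix PQ assume "PQ \<in> path_families c m Z \<times> path_families c (n - m) (rf ` Z)"
      then obtain P Q where PQ: "PQ = (P, Q)" and P: "P 0 = {0..<int c}" "P m = Z" "\<And>k. k < m \<Longrightarrow> path_step (P k) (P (Suc k))"
        and Q: "Q 0 = {0..<int c}" "Q (n - m) = rf ` Z" "\<And>k. k < n - m \<Longrightarrow> path_step (Q k) (Q (Suc k))" by (auto simp: path_families_def)
      define S where "S = g PQ"
      have Sl: "S k = P k" if "k \<le> m" for k using that by (simp add: S_def g_def PQ)
      have Sr: "S k = rf ` Q (n - k)" if "m \<le> k" "k \<le> n" for k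
        using that P(2) Q(2) by (cases "k = m") (auto simp: S_def g_def PQ rr)
      have So: "S k = {}" if "n < k" for k using that mn by (simp add: S_def g_def PQ)
      have "path_step (S k) (S (Suc k))" if "k < n" for k
      proof (cases "k < m")
        case True
        then show ?thesis using P(3) by (simp add: Sl)
      next
        case False
        have "Suc (n - Suc k) = n - k" using that by simp
        then have "path_step (Q (n - Suc k)) (Q (n - k))" using Q(3)[of "n - Suc k"] that False by simp
        from path_step_reflect[OF this, of "int a + int c - 1"]
        show ?thesis using False that by (simp add: Sr rf_def[abs_def])
      qed
      moreover have "S 0 = {0..<int c}" "S m = Z" using P by (simp_all add: Sl)
      moreover have "S n = {int a..<int a + int c}" using Sr[of n] mn Q(1) rE' by simp
      ultimately show "g PQ \<in> {S\<in>path_families c n {int a..<int a + int c}. S m = Z}"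
        unfolding S_def[symmetric] path_families_def using So by auto
    qed
  qed
  then have "card {S\<in>path_families c n {int a..<int a + int c}. S m = Z} = card (path_families c m Z \<times> path_families c (n - m) (rf ` Z))"
    by (rule bij_betw_same_card)
  then show ?thesis using card_path_families[of Z c m] card_path_families[of "rf ` Z" c "n - m"] Z by (simp add: card_cartesian_product)
qed

section \<open>Law of the paths on one line\<close>

lemma lattice_vdm_reflect:
  assumes "finite Z"
  shows "lattice_vdm ((\<lambda>z. r - z) ` Z) (\<lambda>z. z) = lattice_vdm Z (\<lambda>z. z)"
proof -
  have inj: "inj_on (\<lambda>z. r - z) X" for X :: "int set" by (auto simp: inj_on_def)
  have "lattice_vdm ((\<lambda>z. r - z) ` Z) (\<lambda>z. z) = (\<Prod>z\<in>Z. \<Prod>w\<in>{w\<in>Z. z < w}. of_int w - of_int z)"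
    unfolding lattice_vdm_def prod.reindex[OF inj] comp_def
  proof (rule prod.cong[OF refl])
    fix z
    have "{w \<in> (\<lambda>z. r - z) ` Z. w < r - z} = (\<lambda>z. r - z) ` {w\<in>Z. z < w}" by auto
    then show "(\<Prod>w\<in>{w \<in> (\<lambda>z. r - z) ` Z. w < r - z}. of_int (r - z) - of_int w) = (\<Prod>w\<in>{w\<in>Z. z < w}. of_int w - of_int z :: real)"
      by (simp add: prod.reindex[OF inj])
  qed
  also have "\<dots> = (\<Prod>w\<in>Z. \<Prod>z\<in>{z\<in>Z. z < w}. of_int w - of_int z)"
    by (rule prod.swap_restrict[OF assms assms])
  finally show ?thesis by (simp add: lattice_vdm_def)
qed

lemma lattice_vdm_square:
  assumes "finite Y"
  shows "(lattice_vdm ((\<lambda>s. p + int s) ` Y) (\<lambda>z. z))\<^sup>2 = discriminant Y"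
proof -
  define Z where "Z = (\<lambda>s. p + int s) ` Y"
  define d where "d w z = \<bar>of_int z - of_int w :: real\<bar>" for w z :: int
  have fin: "finite Z" using assms by (simp add: Z_def)
  have inj: "inj_on (\<lambda>s. p + int s) X" for X by (auto simp: inj_on_def)
  have vd: "lattice_vdm Z (\<lambda>z. z) = (\<Prod>z\<in>Z. \<Prod>w\<in>{w\<in>Z. w < z}. d w z)"
    unfolding lattice_vdm_def by (intro prod.cong refl) (auto simp: d_def)
  have "discriminant Y = (\<Prod>z\<in>Z. \<Prod>w\<in>Z - {z}. d w z)"
    unfolding discriminant_def Z_def prod.reindex[OF inj] comp_def
  proof (rule prod.cong[OF refl])
    fix s assume "s \<in> Y"
    have "(\<lambda>s. p + int s) ` Y - {p + int s} = (\<lambda>s. p + int s) ` (Y - {s})" by auto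
    then show "(\<Prod>q\<in>Y - {s}. \<bar>real s - real q\<bar>) = (\<Prod>w\<in>(\<lambda>s. p + int s) ` Y - {p + int s}. d w (p + int s))"
      by (simp add: prod.reindex[OF inj] d_def)
  qed
  also have "\<dots> = (\<Prod>z\<in>Z. (\<Prod>w\<in>{w\<in>Z. w < z}. d w z) * (\<Prod>w\<in>{w\<in>Z. z < w}. d w z))"
  proof (rule prod.cong[OF refl])
    fix z
    have "Z - {z} = {w\<in>Z. w < z} \<union> {w\<in>Z. z < w}" by auto
    moreover have "(\<Prod>w\<in>{w\<in>Z. w < z} \<union> {w\<in>Z. z < w}. d w z) = (\<Prod>w\<in>{w\<in>Z. w < z}. d w z) * (\<Prod>w\<in>{w\<in>Z. z < w}. d w z)"
      using fin by (intro prod.union_disjoint) auto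
    ultimately show "(\<Prod>w\<in>Z - {z}. d w z) = (\<Prod>w\<in>{w\<in>Z. w < z}. d w z) * (\<Prod>w\<in>{w\<in>Z. z < w}. d w z)" by (simp only:)
  qed
  also have "\<dots> = lattice_vdm Z (\<lambda>z. z) * (\<Prod>z\<in>Z. \<Prod>w\<in>{w\<in>Z. z < w}. d w z)"
    by (simp only: prod.distrib vd)
  also have "(\<Prod>z\<in>Z. \<Prod>w\<in>{w\<in>Z. z < w}. d w z) = (\<Prod>w\<in>Z. \<Prod>z\<in>{z\<in>Z. z < w}. d w z)"
    by (rule prod.swap_restrict[OF fin fin])
  also have "\<dots> = lattice_vdm Z (\<lambda>z. z)" unfolding vd by (intro prod.cong refl) (simp add: d_def abs_minus_commute)
  finally show ?thesis by (simp add: Z_def power2_eq_square)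
qed

text \<open>Both halves contribute the same Vandermonde product, hence its square, and four inverse
  factorials per particle; measured from the lowest site these are the factors of
  \<open>hahn_weight\<close>. Comparing m with a and b only decides which factorial is
  which.\<close>

theorem path_families_hahn_ensemble:
  assumes m: "m \<le> a + b" and p0: "p0 = max 0 (int m - int b)" and N: "int N = int (min a m) + int c - p0"
    and al: "al = nat \<bar>int m - int a\<bar>" and be: "be = nat \<bar>int m - int b\<bar>"
  shows "\<exists>K>0. \<forall>Y. Y \<subseteq> {..<N} \<longrightarrow> card Y = c \<longrightarrow>
    real (card {S\<in>path_families c (a + b) {int a..<int a + int c}. S m = (\<lambda>s. p0 + int s) ` Y})
      = K * (discriminant Y * (\<Prod>s\<in>Y. hahn_weight N al be s))"
proof -
  obtain C where C: "0 < C" "\<And>Z. finite Z \<Longrightarrow> card Z = c \<Longrightarrow>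
     real (npaths c m Z) = C * lattice_vdm Z (\<lambda>z. z) * (\<Prod>z\<in>Z. inv_fact z * inv_fact (int m + int c - 1 - z))"
    using npaths_formula[of c m] by blast
  obtain D where D: "0 < D" "\<And>Z. finite Z \<Longrightarrow> card Z = c \<Longrightarrow>
     real (npaths c (a + b - m) Z) = D * lattice_vdm Z (\<lambda>z. z) * (\<Prod>z\<in>Z. inv_fact z * inv_fact (int (a + b - m) + int c - 1 - z))"
    using npaths_formula[of c "a + b - m"] by blast
  have "real (card {S\<in>path_families c (a + b) {int a..<int a + int c}. S m = (\<lambda>s. p0 + int s) ` Y})
      = C * D * (discriminant Y * (\<Prod>s\<in>Y. hahn_weight N al be s))"
    if Y: "Y \<subseteq> {..<N}" "card Y = c" for Y
  proof -
    define Z where "Z = (\<lambda>s. p0 + int s) ` Y"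
    define r where "r = int a + int c - 1"
    have fY: "finite Y" using Y(1) by (rule finite_subset) simp
    have inj: "inj_on (\<lambda>s. p0 + int s) Y" by (auto simp: inj_on_def)
    have Z: "finite Z" "card Z = c" using fY Y(2) card_image[OF inj] by (auto simp: Z_def)
    have injr: "inj_on (\<lambda>z. r - z) Z" by (auto simp: inj_on_def)
    have rZ: "finite ((\<lambda>z. r - z) ` Z)" "card ((\<lambda>z. r - z) ` Z) = c" using Z card_image[OF injr] by auto
    have nf: "inv_fact (int k) = 1 / fact k" for k by (simp add: inv_fact_def)
    have w: "(inv_fact z * inv_fact (int m + int c - 1 - z)) * (inv_fact (r - z) * inv_fact (int (a + b - m) + int c - 1 - (r - z)))
        = hahn_weight N al be s" if s: "s \<in> Y" "z = p0 + int s" for s z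
    proof -
      have sN: "s < N" using s Y(1) by auto
      have low: "inv_fact z * inv_fact (int (a + b - m) + int c - 1 - (r - z)) = 1 / (fact s * fact (s + be))"
      proof (cases "m \<le> b")
        case True
        then have "z = int s" "int (a + b - m) + int c - 1 - (r - z) = int (s + be)" using m s p0 be by (auto simp: r_def)
        then show ?thesis by (simp only: nf) simp
      next
        case False
        then have "z = int (s + be)" "int (a + b - m) + int c - 1 - (r - z) = int s" using m s p0 be by (auto simp: r_def)
        then show ?thesis by (simp only: nf) (simp add: mult.commute)
      qed
      have high: "inv_fact (int m + int c - 1 - z) * inv_fact (r - z) = 1 / (fact (N - 1 - s) * fact (N - 1 - s + al))"
      proof (cases "m \<le> a")
        case True
        then have "int m + int c - 1 - z = int (N - 1 - s)" "r - z = int (N - 1 - s + al)" using sN s N al by (auto simp: r_def)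
        then show ?thesis by (simp only: nf) simp
      next
        case False
        then have "r - z = int (N - 1 - s)" "int m + int c - 1 - z = int (N - 1 - s + al)" using sN s N al by (auto simp: r_def)
        then show ?thesis by (simp only: nf) (simp add: mult.commute)
      qed
      have "(inv_fact z * inv_fact (int m + int c - 1 - z)) * (inv_fact (r - z) * inv_fact (int (a + b - m) + int c - 1 - (r - z)))
        = (inv_fact z * inv_fact (int (a + b - m) + int c - 1 - (r - z))) * (inv_fact (int m + int c - 1 - z) * inv_fact (r - z))" by (simp only: mult_ac)
      also have "\<dots> = hahn_weight N al be s" unfolding low high hahn_weight_def by (simp add: mult_ac)
      finally show ?thesis .
    qed
    have prodw: "(\<Prod>z\<in>Z. (inv_fact z * inv_fact (int m + int c - 1 - z)) * (inv_fact (r - z) * inv_fact (int (a + b - m) + int c - 1 - (r - z))))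
       = (\<Prod>s\<in>Y. hahn_weight N al be s)"
      unfolding Z_def prod.reindex[OF inj] comp_def by (intro prod.cong refl w)
    have "real (card {S\<in>path_families c (a + b) {int a..<int a + int c}. S m = Z}) = real (npaths c m Z) * real (npaths c (a + b - m) ((\<lambda>z. r - z) ` Z))"
      unfolding card_path_families_through[OF Z(1) m] r_def by simp
    also have "real (npaths c m Z) = C * lattice_vdm Z (\<lambda>z. z) * (\<Prod>z\<in>Z. inv_fact z * inv_fact (int m + int c - 1 - z))"
      by (rule C(2)[OF Z])
    also have "real (npaths c (a + b - m) ((\<lambda>z. r - z) ` Z)) = D * lattice_vdm Z (\<lambda>z. z) *
         (\<Prod>z\<in>Z. inv_fact (r - z) * inv_fact (int (a + b - m) + int c - 1 - (r - z)))"
      unfolding D(2)[OF rZ] lattice_vdm_reflect[OF Z(1)] prod.reindex[OF injr] comp_def ..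
    also have "C * lattice_vdm Z (\<lambda>z. z) * (\<Prod>z\<in>Z. inv_fact z * inv_fact (int m + int c - 1 - z)) * (D * lattice_vdm Z (\<lambda>z. z) *
         (\<Prod>z\<in>Z. inv_fact (r - z) * inv_fact (int (a + b - m) + int c - 1 - (r - z))))
      = C * D * ((lattice_vdm Z (\<lambda>z. z))\<^sup>2 * ((\<Prod>z\<in>Z. inv_fact z * inv_fact (int m + int c - 1 - z)) *
         (\<Prod>z\<in>Z. inv_fact (r - z) * inv_fact (int (a + b - m) + int c - 1 - (r - z)))))"
      by (simp only: power2_eq_square mult_ac)
    also have "\<dots> = C * D * (discriminant Y * (\<Prod>s\<in>Y. hahn_weight N al be s))"
      unfolding prod.distrib[symmetric] prodw unfolding Z_def lattice_vdm_square[OF fY] ..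
    finally show ?thesis by (simp add: Z_def)
  qed
  then show ?thesis using C(1) D(1) by (intro exI[of _ "C * D"] conjI allI impI) simp_all
qed

section \<open>Tilings as families of paths\<close>

text \<open>
  Oblique coordinates: \<open>emb u w\<close> lies on the vertical line number \<open>w\<close>, and \<open>u\<close> is its
  coefficient along \<open>cis (pi / 6)\<close> when the other coefficient, along \<open>cis (- pi / 6)\<close>, is \<open>w - u\<close>.
\<close>

definition emb :: "real \<Rightarrow> real \<Rightarrow> complex" where
  "emb u w = Complex (sqrt 3 / 2 * w) (u - w / 2)"

definition cu :: "complex \<Rightarrow> real" where "cu z = Im z + Re z / sqrt 3"
definition cw :: "complex \<Rightarrow> real" where "cw z = 2 * Re z / sqrt 3"

abbreviation pt :: "int \<Rightarrow> int \<Rightarrow> complex" where "pt p k \<equiv> emb (of_int p) (of_int k)"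

lemma cu_emb [simp]: "cu (emb u w) = u" and cw_emb [simp]: "cw (emb u w) = w"
  by (simp_all add: cu_def cw_def emb_def)

lemma emb_cu_cw [simp]: "emb (cu z) (cw z) = z"
  by (simp add: emb_def cu_def cw_def complex_eq_iff)

lemma cu_add: "cu (x + y) = cu x + cu y" and cw_add: "cw (x + y) = cw x + cw y"
  and cu_scaleR: "cu (r *\<^sub>R x) = r * cu x" and cw_scaleR: "cw (r *\<^sub>R x) = r * cw x"
  by (simp_all add: cu_def cw_def add_divide_distrib algebra_simps)

lemma emb_eq_iff [simp]: "emb u w = emb u' w' \<longleftrightarrow> u = u' \<and> w = w'"
  by (metis cu_emb cw_emb)

lemma emb_add: "emb u w + emb u' w' = emb (u + u') (w + w')"
  by (simp add: emb_def complex_eq_iff algebra_simps add_divide_distrib)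

lemma emb_scaleR: "r *\<^sub>R emb u w = emb (r * u) (r * w)"
  by (simp add: emb_def complex_eq_iff algebra_simps)

lemma cis_emb:
  "cis (pi / 6) = emb 1 1" "cis (- pi / 6) = emb 0 1" "cis (5 * pi / 6) = emb 0 (-1)" "\<i> = emb 1 0" "0 = emb 0 0"
proof -
  have 1: "cos (5 * pi / 6) = - (sqrt 3 / 2)" "sin (5 * pi / 6) = 1 / 2"
    using cos_pi_minus[of "pi / 6"] sin_pi_minus[of "pi / 6"] by (simp_all add: cos_30 sin_30 field_simps)
  show "cis (pi / 6) = emb 1 1" "cis (- pi / 6) = emb 0 1" "\<i> = emb 1 0" "0 = emb 0 0"
    by (simp_all add: emb_def complex_eq_iff cos_30 sin_30)
  show "cis (5 * pi / 6) = emb 0 (-1)"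
    unfolding complex_eq_iff emb_def cis.sel 1 by simp
qed

lemma of_nat_times_emb: "of_nat n * emb u w = emb (real n * u) (real n * w)"
  and of_int_times_emb: "of_int i * emb u w = emb (of_int i * u) (of_int i * w)"
  and of_real_times_emb: "of_real x * emb u w = emb (x * u) (x * w)"
  by (simp_all add: emb_def complex_eq_iff algebra_simps)

lemma tri_lattice_eq: "tri_lattice = (\<lambda>(p, k). pt p k) ` UNIV"
proof (intro equalityI subsetI)
  fix z assume "z \<in> tri_lattice"
  then obtain k j :: int where "z = of_int k * cis (pi / 6) + of_int j * cis (- pi / 6)" by (auto simp: tri_lattice_def)
  then have "z = pt k (k + j)" unfolding cis_emb of_int_times_emb emb_add by simp
  then show "z \<in> (\<lambda>(p, k). pt p k) ` UNIV" by (intro image_eqI[of _ _ "(k, k + j)"]) auto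
next
  fix z assume "z \<in> (\<lambda>(p, k). pt p k) ` UNIV"
  then obtain p k where "z = pt p k" by auto
  then have "z = of_int p * cis (pi / 6) + of_int (k - p) * cis (- pi / 6)" unfolding cis_emb of_int_times_emb emb_add by simp
  then show "z \<in> tri_lattice" unfolding tri_lattice_def by blast
qed

lemma continuous_on_cu: "continuous_on UNIV cu" and continuous_on_cw: "continuous_on UNIV cw"
  unfolding cu_def cw_def by (intro continuous_intros; simp)+

lemma convex_coord_strip:
  "convex {z. l \<le> \<kappa> * cu z + \<eta> * cw z \<and> \<kappa> * cu z + \<eta> * cw z \<le> r}"
proof (rule convexI)
  fix x y :: complex and s t :: real
  assume x: "x \<in> {z. l \<le> \<kappa> * cu z + \<eta> * cw z \<and> \<kappa> * cu z + \<eta> * cw z \<le> r}" and y: "y \<in> {z. l \<le> \<kappa> * cu z + \<eta> * cw z \<and> \<kappa> * cu z + \<eta> * cw z \<le> r}"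
    and st: "0 \<le> s" "0 \<le> t" "s + t = 1"
  define X Y where "X = \<kappa> * cu x + \<eta> * cw x" and "Y = \<kappa> * cu y + \<eta> * cw y"
  have XY: "l \<le> X" "X \<le> r" "l \<le> Y" "Y \<le> r" using x y by (auto simp: X_def Y_def)
  have e: "\<kappa> * cu (s *\<^sub>R x + t *\<^sub>R y) + \<eta> * cw (s *\<^sub>R x + t *\<^sub>R y) = s * X + t * Y"
    by (simp add: X_def Y_def cu_add cw_add cu_scaleR cw_scaleR algebra_simps)
  have "l \<le> s * X + t * Y" using convex_bound_le[of "- X" "- l" "- Y" s t] XY st by simp
  moreover have "s * X + t * Y \<le> r" using convex_bound_le[of X r Y s t] XY st by simp
  ultimately show "s *\<^sub>R x + t *\<^sub>R y \<in> {z. l \<le> \<kappa> * cu z + \<eta> * cw z \<and> \<kappa> * cu z + \<eta> * cw z \<le> r}" unfolding mem_Collect_eq e by simp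
qed

text \<open>Every rhombus is a unit square in two of the three coordinates w, u and u - w, taken
  relative to its base point.\<close>

definition tile_shape :: "rhombus_type \<Rightarrow> real \<Rightarrow> real \<Rightarrow> bool" where
  "tile_shape ty u w = (case ty of
      TypeI \<Rightarrow> 0 \<le> w \<and> w \<le> 1 \<and> 0 \<le> u - w \<and> u - w \<le> 1
    | TypeII \<Rightarrow> 0 \<le> w \<and> w \<le> 1 \<and> 0 \<le> u \<and> u \<le> 1
    | TypeIII \<Rightarrow> 0 \<le> u \<and> u \<le> 1 \<and> 0 \<le> u - w \<and> u - w \<le> 1)"

definition tile_core :: "rhombus_type \<Rightarrow> real \<Rightarrow> real \<Rightarrow> bool" where
  "tile_core ty u w = (case ty of
      TypeI \<Rightarrow> 0 < w \<and> w < 1 \<and> 0 < u - w \<and> u - w < 1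
    | TypeII \<Rightarrow> 0 < w \<and> w < 1 \<and> 0 < u \<and> u < 1
    | TypeIII \<Rightarrow> 0 < u \<and> u < 1 \<and> 0 < u - w \<and> u - w < 1)"

lemma parallelogram_in_hull:
  fixes z x y :: complex
  assumes "0 \<le> s" "s \<le> 1" "0 \<le> t" "t \<le> 1"
  shows "z + s *\<^sub>R x + t *\<^sub>R y \<in> convex hull {z, z + x, z + x + y, z + y}"
proof -
  define H where "H = convex hull {z, z + x, z + x + y, z + y}"
  have H: "convex H" by (simp add: H_def)
  have v: "z \<in> H" "z + x \<in> H" "z + x + y \<in> H" "z + y \<in> H" unfolding H_def by (auto intro: hull_inc)
  note side = convexD_alt[OF H v(1,2) assms(1,2)] convexD_alt[OF H v(4,3) assms(1,2)]
  have "(1 - t) *\<^sub>R ((1 - s) *\<^sub>R z + s *\<^sub>R (z + x)) + t *\<^sub>R ((1 - s) *\<^sub>R (z + y) + s *\<^sub>R (z + x + y)) \<in> H"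
    by (rule convexD_alt[OF H side assms(3,4)])
  also have "(1 - t) *\<^sub>R ((1 - s) *\<^sub>R z + s *\<^sub>R (z + x)) + t *\<^sub>R ((1 - s) *\<^sub>R (z + y) + s *\<^sub>R (z + x + y)) = z + s *\<^sub>R x + t *\<^sub>R y"
    by (simp add: algebra_simps)
  finally show ?thesis by (simp add: H_def)
qed

lemma rhombus_mem_iff: "z \<in> rhombus (ty, emb p k) \<longleftrightarrow> tile_shape ty (cu z - p) (cw z - k)"
proof
  assume z: "z \<in> rhombus (ty, emb p k)"
  have hull: "z \<in> S" if "convex S" "z \<in> convex hull V" "V \<subseteq> S" for S V using that hull_minimal by blast
  show "tile_shape ty (cu z - p) (cw z - k)"
  proof (cases ty)
    case TypeI
    have "z \<in> {z. k \<le> 0 * cu z + 1 * cw z \<and> 0 * cu z + 1 * cw z \<le> k + 1} \<inter> {z. p - k \<le> 1 * cu z + (-1) * cw z \<and> 1 * cu z + (-1) * cw z \<le> p - k + 1}"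
      using z unfolding TypeI rhombus.simps side_vectors.simps cis_emb Let_def prod.case emb_add
      by (rule hull[rotated]; (intro convex_Int convex_coord_strip)?; auto)
    then show ?thesis by (auto simp: tile_shape_def TypeI)
  next
    case TypeII
    have "z \<in> {z. k \<le> 0 * cu z + 1 * cw z \<and> 0 * cu z + 1 * cw z \<le> k + 1} \<inter> {z. p \<le> 1 * cu z + 0 * cw z \<and> 1 * cu z + 0 * cw z \<le> p + 1}"
      using z unfolding TypeII rhombus.simps side_vectors.simps cis_emb Let_def prod.case emb_add
      by (rule hull[rotated]; (intro convex_Int convex_coord_strip)?; auto)
    then show ?thesis by (auto simp: tile_shape_def TypeII)
  next
    case TypeIII
    have "z \<in> {z. p \<le> 1 * cu z + 0 * cw z \<and> 1 * cu z + 0 * cw z \<le> p + 1} \<inter> {z. p - k \<le> 1 * cu z + (-1) * cw z \<and> 1 * cu z + (-1) * cw z \<le> p - k + 1}"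
      using z unfolding TypeIII rhombus.simps side_vectors.simps cis_emb Let_def prod.case emb_add
      by (rule hull[rotated]; (intro convex_Int convex_coord_strip)?; auto)
    then show ?thesis by (auto simp: tile_shape_def TypeIII)
  qed
next
  define U W where "U = cu z - p" and "W = cw z - k"
  have z: "z = emb (p + U) (k + W)" by (simp add: U_def W_def)
  assume "tile_shape ty (cu z - p) (cw z - k)"
  then have ts: "tile_shape ty U W" by (simp add: U_def W_def)
  show "z \<in> rhombus (ty, emb p k)"
  proof (cases ty)
    case TypeI
    have "z = emb p k + W *\<^sub>R emb 1 1 + (U - W) *\<^sub>R emb 1 0" unfolding z by (simp add: emb_add emb_scaleR)
    then show ?thesis using ts parallelogram_in_hull[of W "U - W" "emb p k" "emb 1 1" "emb 1 0"]
      unfolding TypeI rhombus.simps side_vectors.simps cis_emb Let_def prod.case by (simp add: tile_shape_def)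
  next
    case TypeII
    have "z = emb p k + W *\<^sub>R emb 0 1 + U *\<^sub>R emb 1 0" unfolding z by (simp add: emb_add emb_scaleR)
    then show ?thesis using ts parallelogram_in_hull[of W U "emb p k" "emb 0 1" "emb 1 0"]
      unfolding TypeII rhombus.simps side_vectors.simps cis_emb Let_def prod.case by (simp add: tile_shape_def)
  next
    case TypeIII
    have "z = emb p k + U *\<^sub>R emb 1 1 + (U - W) *\<^sub>R emb 0 (-1)" unfolding z by (simp add: emb_add emb_scaleR)
    then show ?thesis using ts parallelogram_in_hull[of U "U - W" "emb p k" "emb 1 1" "emb 0 (-1)"]
      unfolding TypeIII rhombus.simps side_vectors.simps cis_emb Let_def prod.case by (simp add: tile_shape_def)
  qed
qed

text \<open>An interior point may be moved by d in both senses along both coordinate directions; the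
  closed inequalities at the four moved points make those at the point itself strict.\<close>

lemma interior_rhombus_iff: "z \<in> interior (rhombus (ty, emb p k)) \<longleftrightarrow> tile_core ty (cu z - p) (cw z - k)"
proof
  assume "z \<in> interior (rhombus (ty, emb p k))"
  then obtain e where e: "0 < e" "ball z e \<subseteq> rhombus (ty, emb p k)" by (auto simp: mem_interior)
  define d where "d = e / 2"
  have d: "0 < d" "d < e" using e(1) by (auto simp: d_def)
  have n1: "norm (emb 1 0) = 1" "norm (emb 0 1) = 1" unfolding cis_emb(2,4)[symmetric] by simp_all
  have near: "tile_shape ty (cu z + r * x - p) (cw z + r * y - k)" if "norm (emb x y) = 1" "\<bar>r\<bar> = d" for r x y
  proof -
    have "z + r *\<^sub>R emb x y \<in> ball z e" using that d(2) by (simp add: dist_norm)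
    then have "z + r *\<^sub>R emb x y \<in> rhombus (ty, emb p k)" using e(2) by blast
    then show ?thesis unfolding rhombus_mem_iff by (simp add: cu_add cw_add cu_scaleR cw_scaleR)
  qed
  show "tile_core ty (cu z - p) (cw z - k)"
    using near[OF n1(1), of d] near[OF n1(1), of "- d"] near[OF n1(2), of d] near[OF n1(2), of "- d"] d(1)
    by (cases ty) (auto simp: tile_core_def tile_shape_def)
next
  assume z: "tile_core ty (cu z - p) (cw z - k)"
  define S where "S = {z. tile_core ty (cu z - p) (cw z - k)}"
  have "open S"
    unfolding S_def tile_core_def
    by (cases ty) (auto intro!: open_Collect_conj open_Collect_less continuous_intros continuous_on_cu continuous_on_cw
        intro: continuous_on_subset[OF continuous_on_cu] continuous_on_subset[OF continuous_on_cw])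
  moreover have "S \<subseteq> rhombus (ty, emb p k)"
  proof
    fix y assume "y \<in> S"
    then have "tile_core ty (cu y - p) (cw y - k)" by (simp add: S_def)
    then have "tile_shape ty (cu y - p) (cw y - k)" by (cases ty) (auto simp: tile_core_def tile_shape_def)
    then show "y \<in> rhombus (ty, emb p k)" by (simp only: rhombus_mem_iff)
  qed
  ultimately have "S \<subseteq> interior (rhombus (ty, emb p k))" by (rule interior_maximal[rotated])
  then show "z \<in> interior (rhombus (ty, emb p k))" using z by (auto simp: S_def)
qed

section \<open>The hexagon and its triangles\<close>

definition hex_region :: "nat \<Rightarrow> nat \<Rightarrow> nat \<Rightarrow> real \<Rightarrow> real \<Rightarrow> bool" where
  "hex_region a b c u w \<longleftrightarrow> 0 \<le> u \<and> u \<le> a + c \<and> 0 \<le> w \<and> w \<le> a + b \<and> w - b \<le> u \<and> u \<le> w + c"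

lemma hexagon_vertices:
  "P1 a b c = emb 0 0" "P2 a b c = emb 0 b" "P3 a b c = emb a (a + b)" "P4 a b c = emb (a + c) (a + b)"
  "P5 a b c = emb (a + c) a" "P6 a b c = emb c 0"
  unfolding P1_def P2_def P3_def P4_def P5_def P6_def cis_emb mult.commute[of "emb 1 0"] of_nat_times_emb emb_add
  by simp_all

text \<open>For the converse, \<open>lo\<close> and \<open>hi\<close> put the ends of the vertical
  section through z into the hull, each on one of two adjacent sides, and z lies between
  them.\<close>

lemma hexagon_mem_iff:
  assumes "0 < a" "0 < b"
  shows "z \<in> hexagon a b c \<longleftrightarrow> hex_region a b c (cu z) (cw z)"
proof
  assume z: "z \<in> hexagon a b c"
  have "hexagon a b c \<subseteq> {z. 0 \<le> 1 * cu z + 0 * cw z \<and> 1 * cu z + 0 * cw z \<le> a + c} \<inter> {z. 0 \<le> 0 * cu z + 1 * cw z \<and> 0 * cu z + 1 * cw z \<le> a + b}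
      \<inter> {z. - real b \<le> 1 * cu z + (-1) * cw z \<and> 1 * cu z + (-1) * cw z \<le> c}"
    unfolding hexagon_def hexagon_vertices
    by (intro hull_minimal convex_Int convex_coord_strip) auto
  then show "hex_region a b c (cu z) (cw z)" using z by (auto simp: hex_region_def)
next
  define H where "H = hexagon a b c"
  have H: "convex H" by (simp add: H_def hexagon_def)
  have v: "emb 0 0 \<in> H" "emb 0 b \<in> H" "emb a (a + b) \<in> H" "emb (a + c) (a + b) \<in> H" "emb (a + c) a \<in> H" "emb c 0 \<in> H"
    unfolding H_def hexagon_def hexagon_vertices by (auto intro: hull_inc)
  have comb: "emb ((1 - t) * u + t * u') ((1 - t) * w + t * w') \<in> H" if "emb u w \<in> H" "emb u' w' \<in> H" "0 \<le> t" "t \<le> 1" for u w u' w' t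
    using convexD_alt[OF H that] by (simp add: emb_scaleR emb_add)
  define u w where "u = cu z" and "w = cw z"
  assume "hex_region a b c (cu z) (cw z)"
  then have h: "0 \<le> u" "u \<le> a + c" "0 \<le> w" "w \<le> a + b" "w - b \<le> u" "u \<le> w + c" by (auto simp: hex_region_def u_def w_def)
  have lo: "emb (max 0 (w - b)) w \<in> H"
  proof (cases "w \<le> b")
    case True
    then show ?thesis using comb[OF v(1,2), of "w / b"] h assms by simp
  next
    case False
    have "(1 - (w - b) / a) * b + (w - b) / a * (a + b) = w" using assms by (simp add: field_simps)
    then show ?thesis using comb[OF v(2,3), of "(w - b) / a"] h assms False by simp
  qed
  have hi: "emb (min (w + c) (a + c)) w \<in> H"
  proof (cases "w \<le> a")
    case True
    have "(1 - w / a) * c + w / a * (a + c) = w + c" using assms by (simp add: field_simps)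
    then show ?thesis using comb[OF v(6,5), of "w / a"] h assms True by simp
  next
    case False
    have "(1 - (w - a) / b) * a + (w - a) / b * (a + b) = w" using assms by (simp add: field_simps)
    moreover have "(1 - (w - a) / b) * (a + c) + (w - a) / b * (a + c) = a + c" by (simp add: algebra_simps)
    ultimately show ?thesis using comb[OF v(5,4), of "(w - a) / b"] h assms False by simp
  qed
  define l r where "l = max 0 (w - b)" and "r = min (w + c) (a + c)"
  have lr: "l \<le> u" "u \<le> r" using h by (auto simp: l_def r_def)
  have "emb u w \<in> H"
  proof (cases "l = r")
    case True
    then show ?thesis using lo lr by (simp add: l_def)
  next
    case False
    then have "l < r" using lr by simp
    then have "(u - l) / (r - l) * (r - l) = u - l" by simp
    then have "(1 - (u - l) / (r - l)) * l + (u - l) / (r - l) * r = u" by (simp only: algebra_simps)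
    moreover have "(1 - (u - l) / (r - l)) * w + (u - l) / (r - l) * w = w" by (simp add: algebra_simps)
    ultimately show ?thesis using comb[OF lo[folded l_def] hi[folded r_def], of "(u - l) / (r - l)"] lr \<open>l < r\<close> by simp
  qed
  then show "z \<in> hexagon a b c" by (simp add: H_def u_def w_def)
qed

text \<open>
  Each vertical strip of the triangular lattice is cut into triangles; \<open>(p, k)\<close> names both the triangle to the
  right and the triangle to the left of the vertical edge from \<open>pt p k\<close> to \<open>pt (p + 1) k\<close>. A rhombus at
  \<open>pt p k\<close> consists of the right triangle \<open>(p, k)\<close> and the left triangle given by \<open>partner\<close>.
\<close>

declare rhombus.simps [simp del]

fun partner :: "rhombus_type \<times> int \<times> int \<Rightarrow> int \<times> int" where
  "partner (TypeI, p, k) = (p + 1, k + 1)"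
| "partner (TypeII, p, k) = (p, k + 1)"
| "partner (TypeIII, p, k) = (p, k)"

text \<open>The offsets (2/3, 1/3) here and (1/3, -1/3) below locate the centroids of the right and
  the left triangle named (p, k). A closed rhombus contains a centroid only in its interior, so
  triangles can be tested by single points.\<close>

lemma tile_core_right: "tile_core ty (2 / 3) (1 / 3)"
  by (cases ty) (auto simp: tile_core_def)

lemma tile_shape_right:
  assumes "tile_shape ty (of_int p + 2 / 3 - of_int p') (of_int k + 1 / 3 - of_int k')"
  shows "(p', k') = (p, k)"
proof -
  define P K where "P = p - p'" and "K = k - k'"
  have ts: "tile_shape ty (of_int P + 2 / 3) (of_int K + 1 / 3)" using assms by (simp add: P_def K_def algebra_simps)
  have "P = 0 \<and> K = 0"
  proof (cases ty)
    case TypeI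
    have "- 1 < real_of_int K" "real_of_int K < 1" "- 1 < real_of_int P - real_of_int K" "real_of_int P - real_of_int K < 1"
      using ts by (auto simp: TypeI tile_shape_def)
    then have "K = 0" "P = K" by linarith+
    then show ?thesis by simp
  next
    case TypeII
    have "- 1 < real_of_int K" "real_of_int K < 1" "- 1 < real_of_int P" "real_of_int P < 1"
      using ts by (auto simp: TypeII tile_shape_def)
    then have "K = 0" "P = 0" by linarith+
    then show ?thesis by simp
  next
    case TypeIII
    have "- 1 < real_of_int P" "real_of_int P < 1" "- 1 < real_of_int P - real_of_int K" "real_of_int P - real_of_int K < 1"
      using ts by (auto simp: TypeIII tile_shape_def)
    then have "P = 0" "K = P" by linarith+
    then show ?thesis by simp
  qed
  then show ?thesis by (simp add: P_def K_def)
qed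

lemma tile_core_left:
  assumes "partner (ty, p', k') = (p, k)"
  shows "tile_core ty (of_int p + 1 / 3 - of_int p') (of_int k - 1 / 3 - of_int k')"
  using assms by (cases ty) (auto simp: tile_core_def)

lemma tile_shape_left:
  assumes "tile_shape ty (of_int p + 1 / 3 - of_int p') (of_int k - 1 / 3 - of_int k')"
  shows "partner (ty, p', k') = (p, k)"
proof -
  define P K where "P = p - p'" and "K = k - k'"
  have ts: "tile_shape ty (of_int P + 1 / 3) (of_int K - 1 / 3)" using assms by (simp add: P_def K_def algebra_simps)
  show ?thesis
  proof (cases ty)
    case TypeI
    have "0 < real_of_int K" "real_of_int K < 2" "- 1 < real_of_int P - real_of_int K" "real_of_int P - real_of_int K < 1"
      using ts by (auto simp: TypeI tile_shape_def)
    then have "K = 1" "P = K" by linarith+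
    then show ?thesis by (auto simp: TypeI P_def K_def)
  next
    case TypeII
    have "0 < real_of_int K" "real_of_int K < 2" "- 1 < real_of_int P" "real_of_int P < 1"
      using ts by (auto simp: TypeII tile_shape_def)
    then have "K = 1" "P = 0" by linarith+
    then show ?thesis by (auto simp: TypeII P_def K_def)
  next
    case TypeIII
    have "- 1 < real_of_int P" "real_of_int P < 1" "- 1 < real_of_int P - real_of_int K" "real_of_int P - real_of_int K < 1"
      using ts by (auto simp: TypeIII tile_shape_def)
    then have "P = 0" "K = P" by linarith+
    then show ?thesis by (auto simp: TypeIII P_def K_def)
  qed
qed

text \<open>Interiors of lattice rhombi meet only if a right or a left triangle is shared:
  integrality of the base points turns the strict inequalities into equations.\<close>

lemma tile_cores_meet:
  assumes "tile_core ty (u - of_int p) (w - of_int k)" "tile_core ty' (u - of_int p') (w - of_int k')"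
  shows "(p, k) = (p', k') \<or> partner (ty, p, k) = partner (ty', p', k')"
proof -
  define P K U W where "P = p' - p" and "K = k' - k" and "U = u - of_int p" and "W = w - of_int k"
  have 1: "tile_core ty U W" and 2: "tile_core ty' (U - of_int P) (W - of_int K)"
    using assms by (simp_all add: P_def K_def U_def W_def algebra_simps)
  have p: "p' = p + P" "k' = k + K" by (simp_all add: P_def K_def)
  show ?thesis
  proof (cases "ty = ty'")
    case same: True
    show ?thesis
    proof (cases ty)
      case TypeI
      then have "- 1 < real_of_int K" "real_of_int K < 1" "- 1 < real_of_int P - of_int K" "real_of_int P - of_int K < 1"
        using 1 2 same by (auto simp: tile_core_def)
      then have "K = 0" "P = K" by linarith+
      then show ?thesis by (simp add: p)
    next
      case TypeII
      then have "- 1 < real_of_int K" "real_of_int K < 1" "- 1 < real_of_int P" "real_of_int P < 1"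
        using 1 2 same by (auto simp: tile_core_def)
      then have "K = 0" "P = 0" by linarith+
      then show ?thesis by (simp add: p)
    next
      case TypeIII
      then have "- 1 < real_of_int P" "real_of_int P < 1" "- 1 < real_of_int P - of_int K" "real_of_int P - of_int K < 1"
        using 1 2 same by (auto simp: tile_core_def)
      then have "P = 0" "P = K" by linarith+
      then show ?thesis by (simp add: p)
    qed
  next
    case False
    then show ?thesis using 1 2 by (cases ty; cases ty'; simp add: tile_core_def p; linarith)
  qed
qed

text \<open>Labels of the vertical unit edges of line k inside the hexagon, by lower endpoint; the
  upper endpoint of the top edge lies on an excluded side.\<close>

definition slice :: "nat \<Rightarrow> nat \<Rightarrow> nat \<Rightarrow> int \<Rightarrow> int set" where
  "slice a b c k = {max 0 (k - int b)..<min (int a) k + int c}"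

definition right_triangles :: "nat \<Rightarrow> nat \<Rightarrow> nat \<Rightarrow> (int \<times> int) set" where
  "right_triangles a b c = {(p, k). 0 \<le> k \<and> k < int a + int b \<and> p \<in> slice a b c k}"

definition left_triangles :: "nat \<Rightarrow> nat \<Rightarrow> nat \<Rightarrow> (int \<times> int) set" where
  "left_triangles a b c = {(p, k). 1 \<le> k \<and> k \<le> int a + int b \<and> p \<in> slice a b c k}"

lemma hex_region_right:
  "hex_region a b c (of_int p + 2 / 3) (of_int k + 1 / 3) \<longleftrightarrow> (p, k) \<in> right_triangles a b c"
  unfolding hex_region_def right_triangles_def slice_def by auto

lemma hex_region_left:
  "hex_region a b c (of_int p + 1 / 3) (of_int k - 1 / 3) \<longleftrightarrow> (p, k) \<in> left_triangles a b c"
  unfolding hex_region_def left_triangles_def slice_def by auto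

lemma tile_in_hexagon:
  assumes "(p, k) \<in> right_triangles a b c" "partner (ty, p, k) \<in> left_triangles a b c" "tile_shape ty (u - of_int p) (w - of_int k)"
  shows "hex_region a b c u w"
  using assms unfolding right_triangles_def left_triangles_def slice_def tile_shape_def hex_region_def
  by (cases ty; simp; linarith)

definition in_right :: "real \<Rightarrow> real \<Rightarrow> int \<Rightarrow> int \<Rightarrow> bool" where
  "in_right u w p k \<longleftrightarrow> of_int k \<le> w \<and> w - of_int k \<le> u - of_int p \<and> u \<le> of_int p + 1"

definition in_left :: "real \<Rightarrow> real \<Rightarrow> int \<Rightarrow> int \<Rightarrow> bool" where
  "in_left u w p k \<longleftrightarrow> of_int p \<le> u \<and> w \<le> of_int k \<and> u - of_int p - 1 \<le> w - of_int k"

lemma in_right_tile: "in_right u w p k \<Longrightarrow> tile_shape ty (u - of_int p) (w - of_int k)"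
  unfolding in_right_def tile_shape_def by (cases ty) auto

lemma in_left_tile: "in_left u w p k \<Longrightarrow> partner (ty, p', k') = (p, k) \<Longrightarrow> tile_shape ty (u - of_int p') (w - of_int k')"
  unfolding in_left_def tile_shape_def by (cases ty) auto

text \<open>
  The half-open cells found with \<open>floor\<close> miss the upper sides of the hexagon, whose points lie on the boundary of
  the cell below.
\<close>

lemma hexagon_covered:
  assumes pos: "0 < a" "0 < b" "0 < c" and h: "hex_region a b c u w"
  obtains p k where "(p, k) \<in> right_triangles a b c" "in_right u w p k"
    | p k where "(p, k) \<in> left_triangles a b c" "in_left u w p k"
proof -
  define p where "p = \<lfloor>u\<rfloor>"
  \<comment> \<open>The cap puts the points of the right vertical side into the last strip.\<close>
  define k where "k = min \<lfloor>w\<rfloor> (int a + int b - 1)"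
  have h': "0 \<le> u" "u \<le> a + c" "0 \<le> w" "w \<le> a + b" "w - b \<le> u" "u \<le> w + c" using h by (auto simp: hex_region_def)
  have pu: "of_int p \<le> u" "u < of_int p + 1" unfolding p_def by linarith+
  have kw: "of_int k \<le> w" "w \<le> of_int k + 1"
  proof -
    show "of_int k \<le> w" unfolding k_def by linarith
    show "w \<le> of_int k + 1"
    proof (cases "\<lfloor>w\<rfloor> \<le> int a + int b - 1")
      case False
      then have "k = int a + int b - 1" by (simp add: k_def)
      then show ?thesis using h'(4) by simp
    qed (simp add: k_def; linarith)
  qed
  have k0: "0 \<le> k" "k + 1 \<le> int a + int b" using h'(3) pos unfolding k_def by auto
  have p0: "0 \<le> p" "p \<le> int a + int c" using h'(1,2) unfolding p_def by (simp, linarith)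
  show ?thesis
  proof (cases "w - of_int k < u - of_int p")
    case True
    have "p < k + int c" "k - int b \<le> p" using True h' pu kw by linarith+
    show ?thesis
    proof (cases "p < int a + int c")
      case True
      then have "(p, k) \<in> right_triangles a b c" using \<open>p < k + int c\<close> \<open>k - int b \<le> p\<close> k0 p0 by (auto simp: right_triangles_def slice_def)
      moreover have "in_right u w p k" using \<open>w - _ < _\<close> pu kw by (simp add: in_right_def)
      ultimately show ?thesis by (rule that(1))
    next
      case False
      then show ?thesis using True p0 h' pu kw by auto
    qed
  next
    case ge: False
    have kb: "k - int b \<le> p" using ge h' pu kw by linarith
    show ?thesis
    \<comment> \<open>Equality puts the point on the lower right side of the hexagon, which here is
      the diagonal shared with the right triangle (p, k).\<close>
    proof (cases "p = k - int b")
      case True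
      have "in_right u w p k" using True pu kw h' by (simp add: in_right_def)
      moreover have "(p, k) \<in> right_triangles a b c" using True k0 p0 pos by (auto simp: right_triangles_def slice_def)
      ultimately show ?thesis by (rule that(1)[rotated])
    next
      case False
      then have kb: "k + 1 - int b \<le> p" using kb by simp
      \<comment> \<open>Besides the generic case there are lattice points of the upper left side and
        points of the upper right side.\<close>
      consider "p < int a + int c" "p < k + 1 + int c" | "k + 1 + int c \<le> p" | "p = int a + int c" "p < k + 1 + int c"
        using p0 by linarith
      then show ?thesis
      proof cases
        case 1
        have "in_left u w p (k + 1)" using ge pu kw by (simp add: in_left_def)
        moreover have "(p, k + 1) \<in> left_triangles a b c" using 1 k0 p0 kb by (auto simp: left_triangles_def slice_def)
        ultimately show ?thesis by (rule that(2)[rotated])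
      next
        case 2
        have "p \<le> k + 1 + int c" using pu kw h' by linarith
        from 2 have "real_of_int k + 1 + real c \<le> real_of_int p" by linarith
        then have "in_left u w (p - 1) (k + 1)" using pu kw h' by (simp add: in_left_def)
        moreover have "(p - 1, k + 1) \<in> left_triangles a b c" using 2 k0 p0 kb pos \<open>p \<le> k + 1 + int c\<close> by (auto simp: left_triangles_def slice_def)
        ultimately show ?thesis by (rule that(2)[rotated])
      next
        case 3
        then have "in_right u w (p - 1) k" using pu kw h' by (simp add: in_right_def)
        moreover have "(p - 1, k) \<in> right_triangles a b c" using 3 k0 p0 kb pos by (auto simp: right_triangles_def slice_def)
        ultimately show ?thesis by (rule that(1)[rotated])
      qed
    qed
  qed
qed

section \<open>Tilings as perfect matchings of triangles\<close>

definition matchings :: "nat \<Rightarrow> nat \<Rightarrow> nat \<Rightarrow> (rhombus_type \<times> int \<times> int) set set" where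
  "matchings a b c = {X. bij_betw snd X (right_triangles a b c) \<and> bij_betw partner X (left_triangles a b c)}"

definition place :: "rhombus_type \<times> int \<times> int \<Rightarrow> rhombus_type \<times> complex" where
  "place x = (fst x, pt (fst (snd x)) (snd (snd x)))"

lemma place_simp [simp]: "place (ty, p, k) = (ty, pt p k)" by (simp add: place_def)

lemma inj_place: "inj place"
  by (auto simp: inj_def place_def prod_eq_iff)

text \<open>Evaluated at centroids, disjointness of interiors gives injectivity of
  \<open>snd\<close> and \<open>partner\<close>, and covering gives surjectivity: every triangle is
  used exactly once.\<close>

lemma tiling_imp_matching:
  assumes pos: "0 < a" "0 < b" and T: "T \<in> tilings a b c"
  shows "\<exists>X\<in>matchings a b c. T = place ` X"
proof
  define X where "X = {x. place x \<in> T}"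
  have T': "T \<subseteq> UNIV \<times> tri_lattice" "(\<Union>r\<in>T. rhombus r) = hexagon a b c"
    "\<And>r s. r \<in> T \<Longrightarrow> s \<in> T \<Longrightarrow> r \<noteq> s \<Longrightarrow> interior (rhombus r) \<inter> interior (rhombus s) = {}" using T by (auto simp: tilings_def)
  show "T = place ` X"
  proof (intro equalityI subsetI)
    fix r assume r: "r \<in> T"
    obtain ty z where z: "r = (ty, z)" by (cases r)
    have "z \<in> tri_lattice" using r T'(1) z by blast
    then obtain p k where "z = pt p k" unfolding tri_lattice_eq by auto
    then have "r = place (ty, p, k)" using z by simp
    then show "r \<in> place ` X" using r unfolding X_def by blast
  qed (auto simp: X_def)
  have meet: "x = y" if "x \<in> X" "y \<in> X" "z \<in> interior (rhombus (place x))" "z \<in> interior (rhombus (place y))" for x y z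
  proof (rule ccontr)
    assume "x \<noteq> y"
    then have "place x \<noteq> place y" using injD[OF inj_place] by blast
    then show False using T'(3)[of "place x" "place y"] that by (auto simp: X_def)
  qed
  have cover: "\<exists>x\<in>X. emb u w \<in> rhombus (place x)" if "hex_region a b c u w" for u w
  proof -
    have "emb u w \<in> hexagon a b c" using that by (simp add: hexagon_mem_iff[OF pos])
    then obtain r where "r \<in> T" "emb u w \<in> rhombus r" using T'(2) by blast
    then show ?thesis using \<open>T = place ` X\<close> by blast
  qed
  have inside: "hex_region a b c u w" if "x \<in> X" "emb u w \<in> interior (rhombus (place x))" for x u w
  proof -
    have "emb u w \<in> hexagon a b c" using that interior_subset T'(2) by (auto simp: X_def)
    then show ?thesis by (simp add: hexagon_mem_iff[OF pos])
  qed
  define R L where "R p k = emb (of_int p + 2 / 3) (of_int k + 1 / 3)" and "L p k = emb (of_int p + 1 / 3) (of_int k - 1 / 3)" for p k :: int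
  have R: "R p k \<in> interior (rhombus (place x))" if "snd x = (p, k)" for p k x
    using that tile_core_right by (cases x) (simp add: R_def interior_rhombus_iff)
  have L: "L p k \<in> interior (rhombus (place x))" if "partner x = (p, k)" for p k x
    using tile_core_left[of "fst x" "fst (snd x)" "snd (snd x)" p k] that by (cases x) (simp add: L_def interior_rhombus_iff)
  have R': "snd x = (p, k)" if "R p k \<in> rhombus (place x)" for p k x
    using that tile_shape_right[of "fst x" p "fst (snd x)" k "snd (snd x)"] by (cases x) (simp add: R_def rhombus_mem_iff)
  have L': "partner x = (p, k)" if "L p k \<in> rhombus (place x)" for p k x
    using that tile_shape_left[of "fst x" p "fst (snd x)" k "snd (snd x)"] by (cases x) (simp add: L_def rhombus_mem_iff)
  have "bij_betw snd X (right_triangles a b c)"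
  proof (rule bij_betw_imageI)
    show "inj_on snd X"
    proof (rule inj_onI)
      fix x y assume xy: "x \<in> X" "y \<in> X" "snd x = snd y"
      obtain p k where "snd x = (p, k)" by (cases "snd x")
      then show "x = y" using meet[OF xy(1,2) R R, of p k] xy(3) by simp
    qed
    show "snd ` X = right_triangles a b c"
    proof (intro equalityI subsetI)
      fix q assume "q \<in> snd ` X"
      then obtain x where "x \<in> X" "q = snd x" by blast
      moreover obtain p k where "q = (p, k)" by (cases q)
      ultimately have x: "x \<in> X" "snd x = (p, k)" "q = (p, k)" by simp_all
      then show "q \<in> right_triangles a b c" using inside[OF x(1) R[OF x(2), unfolded R_def]] by (simp add: hex_region_right)
    next
      fix q assume q: "q \<in> right_triangles a b c"
      obtain p k where pk: "q = (p, k)" by (cases q)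
      then obtain x where "x \<in> X" "R p k \<in> rhombus (place x)" using cover[of "of_int p + 2 / 3" "of_int k + 1 / 3"] q by (auto simp: hex_region_right R_def)
      then show "q \<in> snd ` X" using R'[of p k x] pk by (intro image_eqI[of _ _ x]) simp_all
    qed
  qed
  moreover have "bij_betw partner X (left_triangles a b c)"
  proof (rule bij_betw_imageI)
    show "inj_on partner X"
    proof (rule inj_onI)
      fix x y assume xy: "x \<in> X" "y \<in> X" "partner x = partner y"
      obtain p k where "partner x = (p, k)" by (cases "partner x")
      then show "x = y" using meet[OF xy(1,2) L L, of p k] xy(3) by simp
    qed
    show "partner ` X = left_triangles a b c"
    proof (intro equalityI subsetI)
      fix q assume "q \<in> partner ` X"
      then obtain x where "x \<in> X" "q = partner x" by blast
      moreover obtain p k where "q = (p, k)" by (cases q)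
      ultimately have x: "x \<in> X" "partner x = (p, k)" "q = (p, k)" by simp_all
      then show "q \<in> left_triangles a b c" using inside[OF x(1) L[OF x(2), unfolded L_def]] by (simp add: hex_region_left)
    next
      fix q assume q: "q \<in> left_triangles a b c"
      obtain p k where pk: "q = (p, k)" by (cases q)
      then obtain x where "x \<in> X" "L p k \<in> rhombus (place x)" using cover[of "of_int p + 1 / 3" "of_int k - 1 / 3"] q by (auto simp: hex_region_left L_def)
      then show "q \<in> partner ` X" using L'[of p k x] pk by (intro image_eqI[of _ _ x]) simp_all
    qed
  qed
  ultimately show "X \<in> matchings a b c" by (simp add: matchings_def)
qed

text \<open>The closed triangles cover the hexagon and each lies in its matched rhombus; rhombi
  whose interiors meet share a triangle, hence coincide by injectivity.\<close>

lemma matching_imp_tiling: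
  assumes pos: "0 < a" "0 < b" "0 < c" and X: "X \<in> matchings a b c"
  shows "place ` X \<in> tilings a b c"
proof -
  have s: "inj_on snd X" "snd ` X = right_triangles a b c" and l: "inj_on partner X" "partner ` X = left_triangles a b c"
    using X by (auto simp: matchings_def bij_betw_def)
  have "place ` X \<subseteq> UNIV \<times> tri_lattice" unfolding tri_lattice_eq place_def by auto
  moreover have "(\<Union>r\<in>place ` X. rhombus r) = hexagon a b c"
  proof (intro equalityI subsetI)
    fix z assume "z \<in> (\<Union>r\<in>place ` X. rhombus r)"
    then obtain ty p k where x: "(ty, p, k) \<in> X" "z \<in> rhombus (ty, pt p k)" by auto
    have "(p, k) \<in> right_triangles a b c" "partner (ty, p, k) \<in> left_triangles a b c" using imageI[OF x(1), of snd] imageI[OF x(1), of partner] s(2) l(2) by simp_all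
    then show "z \<in> hexagon a b c" using tile_in_hexagon[of p k a b c ty "cu z" "cw z"] x(2)
      by (simp add: hexagon_mem_iff[OF pos(1,2)] rhombus_mem_iff)
  next
    fix z assume "z \<in> hexagon a b c"
    then have hr: "hex_region a b c (cu z) (cw z)" by (simp add: hexagon_mem_iff[OF pos(1,2)])
    show "z \<in> (\<Union>r\<in>place ` X. rhombus r)"
    proof (cases rule: hexagon_covered[OF pos hr])
      case (1 p k)
      then have "(p, k) \<in> snd ` X" using s(2) by simp
      then obtain ty where x: "(ty, p, k) \<in> X" by auto
      have "z \<in> rhombus (place (ty, p, k))" using in_right_tile[OF 1(2)] by (simp add: rhombus_mem_iff)
      then show ?thesis using x by blast
    next
      case (2 p k)
      then have "(p, k) \<in> partner ` X" using l(2) by simp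
      then obtain x' where "x' \<in> X" "(p, k) = partner x'" by blast
      moreover obtain ty p' k' where "x' = (ty, p', k')" by (cases x')
      ultimately have x: "(ty, p', k') \<in> X" "partner (ty, p', k') = (p, k)" by simp_all
      have "z \<in> rhombus (place (ty, p', k'))" using in_left_tile[OF 2(2) x(2)] by (simp add: rhombus_mem_iff)
      then show ?thesis using x by blast
    qed
  qed
  moreover have core: "interior (rhombus (place x)) \<inter> interior (rhombus (place y)) = {}" if "x \<in> X" "y \<in> X" "place x \<noteq> place y" for x y
  proof (rule ccontr)
    assume "interior (rhombus (place x)) \<inter> interior (rhombus (place y)) \<noteq> {}"
    then obtain z where z: "z \<in> interior (rhombus (place x))" "z \<in> interior (rhombus (place y))" by blast
    obtain ty p k where x: "x = (ty, p, k)" by (cases x)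
    obtain ty' p' k' where y: "y = (ty', p', k')" by (cases y)
    note xy = x y
    have "(p, k) = (p', k') \<or> partner x = partner y"
      using z unfolding xy place_simp interior_rhombus_iff by (rule tile_cores_meet)
    then have "snd x = snd y \<or> partner x = partner y" by (simp add: xy)
    then have "x = y" using s(1) l(1) that(1,2) by (auto simp: inj_on_def)
    then show False using that(3) by simp
  qed
  moreover have "\<forall>r\<in>place ` X. \<forall>s\<in>place ` X. r \<noteq> s \<longrightarrow> interior (rhombus r) \<inter> interior (rhombus s) = {}"
  proof (intro ballI impI)
    fix r s assume "r \<in> place ` X" "s \<in> place ` X" "r \<noteq> s"
    then obtain x y where "x \<in> X" "y \<in> X" "r = place x" "s = place y" by blast
    then show "interior (rhombus r) \<inter> interior (rhombus s) = {}" using core[of x y] \<open>r \<noteq> s\<close> by simp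
  qed
  ultimately show ?thesis unfolding tilings_def by (intro CollectI conjI)
qed

lemma tilings_eq_matchings:
  assumes "0 < a" "0 < b" "0 < c"
  shows "bij_betw ((`) place) (matchings a b c) (tilings a b c)"
proof (rule bij_betw_imageI)
  show "inj_on ((`) place) (matchings a b c)" by (rule inj_onI) (simp only: inj_image_eq_iff[OF inj_place])
  show "(`) place ` matchings a b c = tilings a b c"
  proof (intro equalityI subsetI)
    fix T assume "T \<in> tilings a b c"
    from tiling_imp_matching[OF assms(1,2) this] obtain X where "X \<in> matchings a b c" "T = place ` X" ..
    then show "T \<in> (`) place ` matchings a b c" by (intro image_eqI[of _ _ X])
  next
    fix T assume "T \<in> (`) place ` matchings a b c"
    then obtain X where "X \<in> matchings a b c" "T = place ` X" by (rule imageE)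
    then show "T \<in> tilings a b c" using matching_imp_tiling[OF assms] by simp
  qed
qed

section \<open>Matchings as families of paths\<close>

definition matching_paths :: "nat \<Rightarrow> nat \<Rightarrow> nat \<Rightarrow> (rhombus_type \<times> int \<times> int) set \<Rightarrow> nat \<Rightarrow> int set" where
  "matching_paths a b c X k = (if k < a + b then {p. \<exists>ty. ty \<noteq> TypeIII \<and> (ty, p, int k) \<in> X}
     else if k = a + b then {int a..<int a + int c} else {})"

lemma slice_ends:
  "slice a b c 0 = {0..<int c}" "slice a b c (int a + int b) = {int a..<int a + int c}"
  by (auto simp: slice_def)

context
  fixes a b c :: nat and X :: "(rhombus_type \<times> int \<times> int) set"
  assumes X: "X \<in> matchings a b c"
begin

lemma matching_own_unique: "(ty, p, k) \<in> X \<Longrightarrow> (ty', p, k) \<in> X \<Longrightarrow> ty = ty'"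
  using X inj_onD[of snd X "(ty, p, k)" "(ty', p, k)"] by (simp add: matchings_def bij_betw_def)

lemma matching_partner_unique: "x \<in> X \<Longrightarrow> y \<in> X \<Longrightarrow> partner x = partner y \<Longrightarrow> x = y"
  using X inj_onD[of partner X x y] by (simp add: matchings_def bij_betw_def)

lemma matching_own_mem: "(ty, p, k) \<in> X \<Longrightarrow> (p, k) \<in> right_triangles a b c"
  using X by (force simp: matchings_def bij_betw_def)

lemma matching_partner_mem: "x \<in> X \<Longrightarrow> partner x \<in> left_triangles a b c"
  using X by (auto simp: matchings_def bij_betw_def)

lemma matching_own_ex:
  assumes "(p, k) \<in> right_triangles a b c"
  obtains ty where "(ty, p, k) \<in> X"
proof -
  have "(p, k) \<in> snd ` X" using X assms by (simp add: matchings_def bij_betw_def)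
  then show ?thesis using that by auto
qed

lemma matching_partner_ex:
  assumes "(p, k) \<in> left_triangles a b c"
  obtains x where "x \<in> X" "partner x = (p, k)"
proof -
  have "(p, k) \<in> partner ` X" using X assms by (simp add: matchings_def bij_betw_def)
  then obtain x where "x \<in> X" "(p, k) = partner x" by (rule imageE)
  then show ?thesis using that by simp
qed

lemma matching_paths_mem:
  assumes "k < a + b"
  shows "p \<in> matching_paths a b c X k \<longleftrightarrow> (TypeI, p, int k) \<in> X \<or> (TypeII, p, int k) \<in> X"
proof -
  have "ty \<noteq> TypeIII \<longleftrightarrow> ty = TypeI \<or> ty = TypeII" for ty by (cases ty) auto
  then show ?thesis using assms by (auto simp: matching_paths_def)
qed

lemma matching_paths_slice: "k \<le> a + b \<Longrightarrow> matching_paths a b c X k \<subseteq> slice a b c (int k)"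
  using matching_own_mem slice_ends(2)[of a b c] by (auto simp: matching_paths_def right_triangles_def)

lemma matching_paths_complement:
  assumes "k < a + b" "p \<in> slice a b c (int k)"
  shows "p \<notin> matching_paths a b c X k \<longleftrightarrow> (TypeIII, p, int k) \<in> X"
proof -
  have "(p, int k) \<in> right_triangles a b c" using assms by (auto simp: right_triangles_def)
  then obtain ty where ty: "(ty, p, int k) \<in> X" by (rule matching_own_ex)
  show ?thesis using ty matching_own_unique[OF ty] unfolding matching_paths_mem[OF assms(1)] by (cases ty) auto
qed

text \<open>The left triangle (z, k + 1) belongs to a type I rhombus based at z - 1 or a type II
  rhombus based at z on line k, or to a type III rhombus on line k + 1. Horizontal rhombi thus hand
  particles from line to line, with type I as the upward step.\<close>

lemma matching_paths_step:
  assumes k: "k < a + b"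
  defines "U \<equiv> {z. (TypeI, z - 1, int k) \<in> X}" and "Y \<equiv> matching_paths a b c X"
  shows "U \<subseteq> Y (Suc k)" "inj_on (shift_down U) (Y (Suc k))" "Y k = shift_down U ` Y (Suc k)"
proof -
  \<comment> \<open>An arrival is a particle, since a type III rhombus at z would claim the same
    left triangle. On the last line all sites count as particles.\<close>
  have target: "z \<in> Y (Suc k)" if x: "x \<in> X" "partner x = (z, int (Suc k))" "fst x \<noteq> TypeIII" for x z
  proof -
    have sl: "z \<in> slice a b c (int (Suc k))" using matching_partner_mem[OF x(1)] x(2) by (auto simp: left_triangles_def)
    show ?thesis
    proof (cases "Suc k = a + b")
      case True
      have "int (Suc k) = int a + int b" using True by simp
      then show ?thesis using sl True slice_ends(2)[of a b c] by (simp add: Y_def matching_paths_def)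
    next
      case False
      have "(TypeIII, z, int (Suc k)) \<notin> X"
      proof
        assume "(TypeIII, z, int (Suc k)) \<in> X"
        then have "(TypeIII, z, int (Suc k)) = x" using x(2) by (intro matching_partner_unique[OF _ x(1)]) simp_all
        then show False using x(3) by auto
      qed
      then show ?thesis using matching_paths_complement[of "Suc k" z] sl k False by (simp add: Y_def)
    qed
  qed
  have source: "(if z \<in> U then (TypeI, z - 1, int k) else (TypeII, z, int k)) \<in> X" if z: "z \<in> Y (Suc k)" for z
  proof -
    have sl: "z \<in> slice a b c (int (Suc k))" using matching_paths_slice[of "Suc k"] z k by (auto simp: Y_def)
    then have "(z, int (Suc k)) \<in> left_triangles a b c" using k by (auto simp: left_triangles_def)
    then obtain x where x: "x \<in> X" "partner x = (z, int (Suc k))" by (rule matching_partner_ex)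
    obtain ty p l where xx: "x = (ty, p, l)" by (cases x)
    show ?thesis
    proof (cases ty)
      case TypeI
      then have "p = z - 1" "l = int k" using x(2) by (auto simp: xx)
      then show ?thesis using x(1) by (simp add: xx TypeI U_def)
    next
      case TypeII
      then have pl: "p = z" "l = int k" using x(2) by (auto simp: xx)
      have "z \<notin> U"
      proof
        assume "z \<in> U"
        then have "(TypeI, z - 1, int k) = x" using x(2) by (intro matching_partner_unique[OF _ x(1)]) (simp_all add: U_def)
        then show False using TypeII xx by auto
      qed
      then show ?thesis using x(1) pl by (simp add: xx TypeII)
    next
      case TypeIII
      then have pl: "p = z" "l = int (Suc k)" using x(2) by (auto simp: xx)
      have III: "(TypeIII, z, int (Suc k)) \<in> X" using x(1) by (simp only: xx TypeIII pl)
      then have "Suc k < a + b" using matching_own_mem[OF III] by (auto simp: right_triangles_def)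
      then show ?thesis using matching_paths_complement[of "Suc k" z] sl III z by (simp add: Y_def)
    qed
  qed
  have sd: "(ty, shift_down U z, int k) \<in> X \<Longrightarrow> partner (ty, shift_down U z, int k) = (z, int (Suc k))"
    if "z \<in> Y (Suc k)" "ty = (if z \<in> U then TypeI else TypeII)" for z ty using that by (auto simp: shift_down_def)
  have mem: "((if z \<in> U then TypeI else TypeII), shift_down U z, int k) \<in> X" if "z \<in> Y (Suc k)" for z
    using source[OF that] by (auto simp: shift_down_def)
  show "U \<subseteq> Y (Suc k)"
  proof
    fix z assume "z \<in> U"
    then show "z \<in> Y (Suc k)" by (intro target[of "(TypeI, z - 1, int k)"]) (simp_all add: U_def)
  qed
  show "inj_on (shift_down U) (Y (Suc k))"
  proof (rule inj_onI)
    fix z z' assume z: "z \<in> Y (Suc k)" "z' \<in> Y (Suc k)" "shift_down U z = shift_down U z'"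
    have "(if z \<in> U then TypeI else TypeII) = (if z' \<in> U then TypeI else TypeII)"
      using mem[OF z(1)] mem[OF z(2)] z(3) by (auto dest: matching_own_unique)
    then show "z = z'" using z(3) by (auto simp: shift_down_def split: if_splits)
  qed
  show "Y k = shift_down U ` Y (Suc k)"
  proof (intro equalityI subsetI)
    fix p assume "p \<in> Y k"
    then consider "(TypeI, p, int k) \<in> X" | "(TypeII, p, int k) \<in> X" unfolding Y_def matching_paths_mem[OF k] by blast
    then show "p \<in> shift_down U ` Y (Suc k)"
    proof cases
      case 1
      then have "p + 1 \<in> U" by (simp add: U_def)
      moreover have "p + 1 \<in> Y (Suc k)" by (rule target[OF 1]) simp_all
      ultimately show ?thesis by (intro image_eqI[of _ _ "p + 1"]) (simp_all add: shift_down_def)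
    next
      case 2
      have z: "p \<in> Y (Suc k)" by (rule target[OF 2]) simp_all
      have "p \<notin> U"
      proof
        assume "p \<in> U"
        then have "(TypeI, p - 1, int k) = (TypeII, p, int k)" by (intro matching_partner_unique[OF _ 2]) (simp_all add: U_def)
        then show False by simp
      qed
      then show ?thesis using z by (intro image_eqI[of _ _ p]) (simp_all add: shift_down_def)
    qed
  next
    fix p assume "p \<in> shift_down U ` Y (Suc k)"
    then obtain z where "z \<in> Y (Suc k)" "p = shift_down U z" by (rule imageE)
    then show "p \<in> Y k" using mem[of z] unfolding Y_def matching_paths_mem[OF k] by (auto split: if_splits)
  qed
qed

lemma matching_paths_family:
  assumes "0 < a + b"
  shows "matching_paths a b c X \<in> path_families c (a + b) {int a..<int a + int c}"
proof -
  have "p \<in> matching_paths a b c X 0 \<longleftrightarrow> p \<in> slice a b c 0" for p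
  proof -
    have "(TypeIII, p, 0) \<notin> X" using matching_partner_mem[of "(TypeIII, p, 0)"] by (auto simp: left_triangles_def)
    then show ?thesis using matching_paths_complement[of 0 p] matching_paths_slice[of 0] assms by auto
  qed
  then have "matching_paths a b c X 0 = slice a b c 0" by blast
  then have "matching_paths a b c X 0 = {0..<int c}" by (simp only: slice_ends(1))
  moreover have "path_step (matching_paths a b c X k) (matching_paths a b c X (Suc k))" if "k < a + b" for k
    unfolding path_step_def
    by (rule exI[of _ "{z. (TypeI, z - 1, int k) \<in> X}"], intro conjI matching_paths_step[OF that])
  moreover have "matching_paths a b c X (a + b) = {int a..<int a + int c}" by (simp add: matching_paths_def)
  moreover have "matching_paths a b c X k = {}" if "k > a + b" for k using that by (simp add: matching_paths_def)
  ultimately show ?thesis by (simp add: path_families_def)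
qed

end

text \<open>Consecutive position sets determine the shifts and with them the type I rhombi; missing
  positions are those of type III, and type II is what remains.\<close>

lemma matching_paths_inj:
  assumes X: "X \<in> matchings a b c" "X' \<in> matchings a b c" and eq: "matching_paths a b c X = matching_paths a b c X'"
    and pos: "0 < a + b"
  shows "X \<subseteq> X'"
proof (rule subsetI)
  fix x assume x: "x \<in> X"
  obtain ty p l where xx: "x = (ty, p, l)" by (cases x)
  have R: "(p, l) \<in> right_triangles a b c" using matching_own_mem[OF X(1)] x by (simp add: xx)
  define k where "k = nat l"
  have l: "l = int k" "k < a + b" "p \<in> slice a b c (int k)" using R by (auto simp: right_triangles_def k_def)
  obtain ty' where ty': "(ty', p, l) \<in> X'" using matching_own_ex[OF X(2) R] .
  have fin: "finite (matching_paths a b c X (Suc k))"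
    using matching_paths_slice[OF X(1), of "Suc k"] l(2) by (intro finite_subset[OF _ finite_atLeastLessThan_int]) (auto simp: slice_def)
  note s = matching_paths_step[OF X(1) l(2)] and s' = matching_paths_step[OF X(2) l(2), folded eq]
  have "{z. (TypeI, z - 1, int k) \<in> X} = {z. (TypeI, z - 1, int k) \<in> X'}"
    by (rule shift_down_image_unique[OF fin s(1) s'(1) s(2) s'(2)]) (use s(3) s'(3) in simp)
  then have I: "(TypeI, p, l) \<in> X \<longleftrightarrow> (TypeI, p, l) \<in> X'" unfolding set_eq_iff l(1) by (auto dest!: spec[of _ "p + 1"])
  have III: "(TypeIII, p, l) \<in> X \<longleftrightarrow> (TypeIII, p, l) \<in> X'"
    using matching_paths_complement[OF X(1) l(2,3)] matching_paths_complement[OF X(2) l(2,3)] eq l(1) by simp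
  have "(s, p, l) \<in> X \<longleftrightarrow> s = ty" for s using matching_own_unique[OF X(1), of s p l ty] x by (auto simp: xx)
  moreover have "(s, p, l) \<in> X' \<longleftrightarrow> s = ty'" for s using matching_own_unique[OF X(2), of s p l ty'] ty' by auto
  ultimately have "ty = ty'" using I III by (cases ty; cases ty'; simp)
  then show "x \<in> X'" using ty' by (simp add: xx)
qed

lemma matching_paths_surj:
  assumes S: "S \<in> path_families c (a + b) {int a..<int a + int c}" and pos: "0 < a + b"
  shows "\<exists>X\<in>matchings a b c. matching_paths a b c X = S"
proof -
  have S': "S 0 = {0..<int c}" "S (a + b) = {int a..<int a + int c}" "\<And>k. a + b < k \<Longrightarrow> S k = {}"
    "\<And>k. k < a + b \<Longrightarrow> path_step (S k) (S (Suc k))" using S by (auto simp: path_families_def)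
  have sl: "S k \<subseteq> slice a b c (int k)" if "k \<le> a + b" for k
    using path_families_bounds(1)[OF S that] by (simp add: slice_def of_nat_min)
  have "\<forall>k. \<exists>V. k < a + b \<longrightarrow> V \<subseteq> S (Suc k) \<and> inj_on (shift_down V) (S (Suc k)) \<and> S k = shift_down V ` S (Suc k)"
    using S'(4) unfolding path_step_def by blast
  from choice[OF this] have "\<exists>U. \<forall>k<a + b. U k \<subseteq> S (Suc k) \<and> inj_on (shift_down (U k)) (S (Suc k)) \<and> S k = shift_down (U k) ` S (Suc k)"
    by blast
  then obtain U where U: "\<And>k. k < a + b \<Longrightarrow> U k \<subseteq> S (Suc k)" "\<And>k. k < a + b \<Longrightarrow> inj_on (shift_down (U k)) (S (Suc k))"
    "\<And>k. k < a + b \<Longrightarrow> S k = shift_down (U k) ` S (Suc k)" by blast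
  \<comment> \<open>\<open>own\<close> gives a right triangle its rhombus: type III off the paths,
    otherwise I or II by the step taken. \<open>g\<close> inverts \<open>partner\<close> after
    \<open>own\<close>: at a path position it goes back along the step, elsewhere the rhombus is the
    type III one with the same label.\<close>
  define t where "t p l = (if p \<notin> S (nat l) then TypeIII else if p + 1 \<in> U (nat l) then TypeI else TypeII)" for p l
  define own where "own = (\<lambda>(p, l). (t p l, p, l))"
  define X where "X = own ` right_triangles a b c"
  define g where "g = (\<lambda>(q, l). if q \<in> S (nat l) then (shift_down (U (nat (l - 1))) q, l - 1) else (q, l))"
  have up: "partner (t p (int k), p, int k) = (z, int (Suc k)) \<and> p \<in> S k"
    if k: "k < a + b" and z: "z \<in> S (Suc k)" "p = shift_down (U k) z" for k z p
  proof -
    have pS: "p \<in> S k" using U(3)[OF k] z by simp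
    show ?thesis
    proof (cases "p + 1 \<in> U k")
      case True
      then have "shift_down (U k) (p + 1) = shift_down (U k) z" using z(2) by (simp add: shift_down_def)
      then have "z = p + 1" using U(2)[OF k] z(1) U(1)[OF k] True by (auto dest!: inj_onD)
      then show ?thesis using True pS by (simp add: t_def)
    next
      case False
      then have "z = p" using z(2) by (auto simp: shift_down_def split: if_splits)
      then show ?thesis using False pS by (simp add: t_def)
    qed
  qed
  have bij_partner: "bij_betw (\<lambda>q. partner (own q)) (right_triangles a b c) (left_triangles a b c)"
  proof (rule bij_betw_byWitness[where f' = g])
    have case_right: "(\<exists>k z. l = int k \<and> k < a + b \<and> z \<in> S (Suc k) \<and> p = shift_down (U k) z \<and> partner (own (p, l)) = (z, int (Suc k)))
        \<or> (p \<notin> S (nat l) \<and> partner (own (p, l)) = (p, l) \<and> 1 \<le> l)"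
      if "(p, l) \<in> right_triangles a b c" for p l
    proof -
      define k where "k = nat l"
      have l: "l = int k" "k < a + b" "p \<in> slice a b c (int k)" using that by (auto simp: right_triangles_def k_def)
      show ?thesis
      proof (cases "p \<in> S k")
        case True
        then obtain z where z: "z \<in> S (Suc k)" "p = shift_down (U k) z" using U(3)[OF l(2)] by blast
        then have "partner (own (p, l)) = (z, int (Suc k))" using up[OF l(2) z] by (simp add: own_def l(1))
        then show ?thesis using z l by blast
      next
        case False
        have "k \<noteq> 0" using False l(3) S'(1) slice_ends(1)[of a b c] by (intro notI) simp
        then show ?thesis using False l by (simp add: own_def t_def)
      qed
    qed
    have case_left: "(\<exists>k. l = int (Suc k) \<and> k < a + b \<and> q \<in> S (Suc k)) \<or> (q \<notin> S (nat l) \<and> l < int a + int b)"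
      if "(q, l) \<in> left_triangles a b c" for q l
    proof -
      define k where "k = nat (l - 1)"
      have l: "l = int (Suc k)" "Suc k \<le> a + b" "q \<in> slice a b c l" using that by (auto simp: left_triangles_def k_def)
      show ?thesis
      proof (cases "q \<in> S (Suc k)")
        case True
        then show ?thesis using l by auto
      next
        case False
        have "Suc k \<noteq> a + b"
        proof
          assume e: "Suc k = a + b"
          then have "l = int a + int b" using l(1) by simp
          then show False using False l(3) slice_ends(2)[of a b c] S'(2) e by simp
        qed
        then have "nat l = Suc k" "l < int a + int b" using l by auto
        then show ?thesis using False by simp
      qed
    qed
    show "\<forall>q\<in>right_triangles a b c. g (partner (own q)) = q"
    proof
      fix q assume q: "q \<in> right_triangles a b c"
      obtain p l where pl: "q = (p, l)" by (cases q)
      from case_right[OF q[unfolded pl]] show "g (partner (own q)) = q" unfolding pl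
      proof (elim disjE exE conjE)
        fix k z assume *: "l = int k" "z \<in> S (Suc k)" "p = shift_down (U k) z" "partner (own (p, l)) = (z, int (Suc k))"
        have "nat (int (Suc k)) = Suc k" "nat (int (Suc k) - 1) = k" by auto
        then show "g (partner (own (p, l))) = (p, l)" unfolding *(4) g_def using *(1-3) by simp
      qed (simp add: g_def)
    qed
    show "\<forall>q\<in>left_triangles a b c. partner (own (g q)) = q"
    proof
      fix q' assume q: "q' \<in> left_triangles a b c"
      obtain q l where pl: "q' = (q, l)" by (cases q')
      from case_left[OF q[unfolded pl]] show "partner (own (g q')) = q'" unfolding pl
      proof (elim disjE exE conjE)
        fix k assume *: "l = int (Suc k)" "k < a + b" "q \<in> S (Suc k)"
        have "g (q, l) = (shift_down (U k) q, int k)" using * by (simp add: g_def nat_add_distrib)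
        then show "partner (own (g (q, l))) = (q, l)" using up[OF *(2,3) refl] *(1) by (simp add: own_def)
      qed (simp add: g_def own_def t_def)
    qed
    show "(\<lambda>q. partner (own q)) ` right_triangles a b c \<subseteq> left_triangles a b c"
    proof (rule image_subsetI)
      fix q assume q: "q \<in> right_triangles a b c"
      obtain p l where pl: "q = (p, l)" by (cases q)
      from case_right[OF q[unfolded pl]] show "partner (own q) \<in> left_triangles a b c" unfolding pl
      proof (elim disjE exE conjE)
        fix k z assume *: "k < a + b" "z \<in> S (Suc k)" "partner (own (p, l)) = (z, int (Suc k))"
        show "partner (own (p, l)) \<in> left_triangles a b c"
          using sl[of "Suc k"] *(1,2) unfolding *(3) left_triangles_def by auto
      qed (use q pl in \<open>auto simp: left_triangles_def right_triangles_def\<close>)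
    qed
    show "g ` left_triangles a b c \<subseteq> right_triangles a b c"
    proof (rule image_subsetI)
      fix q' assume q: "q' \<in> left_triangles a b c"
      obtain q l where pl: "q' = (q, l)" by (cases q')
      from case_left[OF q[unfolded pl]] show "g q' \<in> right_triangles a b c" unfolding pl
      proof (elim disjE exE conjE)
        fix k assume *: "l = int (Suc k)" "k < a + b" "q \<in> S (Suc k)"
        have "g (q, l) = (shift_down (U k) q, int k)" using * by (simp add: g_def nat_add_distrib)
        moreover have "shift_down (U k) q \<in> slice a b c (int k)" using sl[of k] up[OF *(2,3) refl] *(2) by auto
        ultimately show "g (q, l) \<in> right_triangles a b c" using *(2) by (simp add: right_triangles_def)
      qed (use q pl in \<open>auto simp: left_triangles_def right_triangles_def g_def\<close>)
    qed
  qed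
  have bij_own: "bij_betw own (right_triangles a b c) X"
    unfolding X_def by (rule inj_on_imp_bij_betw) (auto simp: inj_on_def own_def)
  have "bij_betw snd X (right_triangles a b c)"
    unfolding X_def by (rule bij_betw_byWitness[where f' = own]) (auto simp: own_def)
  moreover have "bij_betw partner X (left_triangles a b c)"
    using bij_betw_comp_iff[OF bij_own, of partner "left_triangles a b c"] bij_partner by (simp add: comp_def)
  moreover have "matching_paths a b c X k = S k" for k
  proof -
    consider "k < a + b" | "k = a + b" | "k > a + b" by linarith
    then show ?thesis
    proof cases
      case 1
      have "p \<in> S k \<longleftrightarrow> (\<exists>ty. ty \<noteq> TypeIII \<and> (ty, p, int k) \<in> X)" for p
      proof -
        have "(ty, p, int k) \<in> X \<longleftrightarrow> (p, int k) \<in> right_triangles a b c \<and> ty = t p (int k)" for ty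
          unfolding X_def own_def by auto
        moreover have "p \<in> S k \<Longrightarrow> (p, int k) \<in> right_triangles a b c" using sl[of k] 1 by (auto simp: right_triangles_def)
        moreover have "t p (int k) \<noteq> TypeIII \<longleftrightarrow> p \<in> S k" by (simp add: t_def)
        ultimately show ?thesis by auto
      qed
      then show ?thesis using 1 by (auto simp: matching_paths_def)
    qed (simp_all add: matching_paths_def S')
  qed
  ultimately show ?thesis unfolding matchings_def by (intro bexI[of _ X]) auto
qed

theorem matchings_path_families:
  assumes "0 < a + b"
  shows "bij_betw (matching_paths a b c) (matchings a b c) (path_families c (a + b) {int a..<int a + int c})"
proof (rule bij_betw_imageI)
  show "inj_on (matching_paths a b c) (matchings a b c)"
  proof (rule inj_onI)
    fix X X' assume "X \<in> matchings a b c" "X' \<in> matchings a b c" "matching_paths a b c X = matching_paths a b c X'"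
    then show "X = X'" using matching_paths_inj[OF _ _ _ assms] by (intro equalityI) simp_all
  qed
  show "matching_paths a b c ` matchings a b c = path_families c (a + b) {int a..<int a + int c}"
  proof (intro equalityI image_subsetI subsetI)
    fix S assume "S \<in> path_families c (a + b) {int a..<int a + int c}"
    from matching_paths_surj[OF this assms] obtain X where "X \<in> matchings a b c" "matching_paths a b c X = S" ..
    then show "S \<in> matching_paths a b c ` matchings a b c" by (intro image_eqI[of _ _ X]) simp_all
  qed (rule matching_paths_family[OF _ assms])
qed

section \<open>Vertical lines and the law of their particles\<close>

lemma emb_closed_segment:
  "emb x y \<in> closed_segment (emb u w) (emb u' w') \<longleftrightarrow> (\<exists>t. 0 \<le> t \<and> t \<le> 1 \<and> x = (1 - t) * u + t * u' \<and> y = (1 - t) * w + t * w')"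
  unfolding closed_segment_def mem_Collect_eq emb_scaleR emb_add emb_eq_iff by blast

text \<open>The closed section of the hexagon has one lattice point beyond the slice, its top point,
  which lies on the segment from \<open>P4\<close> to \<open>P5\<close> if a \<le> m and on that
  from \<open>P5\<close> to \<open>P6\<close> otherwise.\<close>

lemma vline_eq:
  assumes pos: "0 < a" "0 < b" and m: "m \<le> a + b"
  shows "vline a b c m = (\<lambda>p. pt p (int m)) ` slice a b c (int m)"
proof (intro equalityI subsetI)
  fix z assume "z \<in> vline a b c m"
  then have z: "z \<in> tri_lattice" "z \<in> hexagon a b c" "z \<notin> closed_segment (P4 a b c) (P5 a b c)"
    "z \<notin> closed_segment (P5 a b c) (P6 a b c)" "Re z = sqrt 3 / 2 * real m" by (auto simp: vline_def lattice_region_def)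
  obtain p k where pk: "z = pt p k" using z(1) unfolding tri_lattice_eq by auto
  have "cw z = 2 * (sqrt 3 / 2 * real m) / sqrt 3" by (simp only: cw_def z(5))
  then have "cw z = real m" by simp
  then have k: "k = int m" unfolding pk cw_emb by linarith
  have h: "hex_region a b c (of_int p) (real m)" using z(2) by (simp add: hexagon_mem_iff[OF pos] pk k)
  then have h': "0 \<le> p" "p \<le> int a + int c" "int m - int b \<le> p" "p \<le> int m + int c" unfolding hex_region_def by linarith+
  have "p \<noteq> min (int a) (int m) + int c"
  proof
    assume p: "p = min (int a) (int m) + int c"
    show False
    proof (cases "a \<le> m")
      case True
      have "real m = (1 - (a + b - m) / b) * (a + b) + (a + b - m) / b * a" "real_of_int p = (1 - (a + b - m) / b) * (a + c) + (a + b - m) / b * (a + c)"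
        using pos True p m by (simp_all add: of_nat_diff field_simps)
      then have "pt p (int m) \<in> closed_segment (P4 a b c) (P5 a b c)"
        unfolding hexagon_vertices emb_closed_segment of_int_of_nat_eq using m pos True
        by (intro exI[of _ "real (a + b - m) / real b"]) (simp add: of_nat_diff)
      then show False using z(3) pk k by simp
    next
      case False
      have "real m = (1 - (a - m) / a) * a + (a - m) / a * 0" "real_of_int p = (1 - (a - m) / a) * (a + c) + (a - m) / a * c"
        using pos False p by (simp_all add: of_nat_diff field_simps)
      then have "pt p (int m) \<in> closed_segment (P5 a b c) (P6 a b c)"
        unfolding hexagon_vertices emb_closed_segment of_int_of_nat_eq using pos False
        by (intro exI[of _ "real (a - m) / real a"]) (simp add: of_nat_diff)
      then show False using z(4) pk k by simp
    qed
  qed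
  then have "p \<in> slice a b c (int m)" using h' by (auto simp: slice_def)
  then show "z \<in> (\<lambda>p. pt p (int m)) ` slice a b c (int m)" using pk k by blast
next
  fix z assume "z \<in> (\<lambda>p. pt p (int m)) ` slice a b c (int m)"
  then obtain p where z: "z = pt p (int m)" and p: "max 0 (int m - int b) \<le> p" "p < min (int a) (int m) + int c" by (auto simp: slice_def)
  have rp: "0 \<le> real_of_int p" "real m - real b \<le> real_of_int p" "real_of_int p < real a + real c" "real_of_int p < real m + real c"
    using p by linarith+
  have "z \<in> hexagon a b c" using rp m by (simp add: hexagon_mem_iff[OF pos] z hex_region_def)
  moreover have "z \<in> tri_lattice" unfolding z tri_lattice_eq by (rule image_eqI[of _ _ "(p, int m)"]) simp_all
  moreover have "z \<notin> closed_segment (P4 a b c) (P5 a b c)"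
    using rp unfolding z hexagon_vertices emb_closed_segment by (auto simp: algebra_simps)
  moreover have "z \<notin> closed_segment (P5 a b c) (P6 a b c)"
    using rp unfolding z hexagon_vertices emb_closed_segment by (auto simp: algebra_simps)
  moreover have "Re z = sqrt 3 / 2 * real m" by (simp add: z emb_def)
  ultimately show "z \<in> vline a b c m" by (simp add: vline_def lattice_region_def)
qed

lemma card_vline:
  assumes "0 < a" "0 < b" "m \<le> a + b"
  shows "int (card (vline a b c m)) = int (min a m) + int c - max 0 (int m - int b)"
proof -
  have "card (vline a b c m) = card (slice a b c (int m))"
    unfolding vline_eq[OF assms] by (intro card_image) (auto simp: inj_on_def)
  then show ?thesis using assms by (auto simp: slice_def)
qed

text \<open>\<open>arg_min_on\<close> is a choice among minimal points, so the minimum is shown to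
  be unique.\<close>

lemma lowest_point_eq:
  assumes "0 < a" "0 < b" "0 < c" "m \<le> a + b"
  shows "lowest_point a b c m = pt (max 0 (int m - int b)) (int m)"
proof -
  define p0 where "p0 = max 0 (int m - int b)"
  have p0: "p0 \<in> slice a b c (int m)" using assms by (auto simp: slice_def p0_def)
  have im: "Im (pt p (int m)) = of_int p - real m / 2" for p by (simp add: emb_def)
  have "is_arg_min Im (\<lambda>z. z \<in> vline a b c m) z \<longleftrightarrow> z = pt p0 (int m)" for z
  proof
    assume z: "is_arg_min Im (\<lambda>z. z \<in> vline a b c m) z"
    then obtain p where p: "z = pt p (int m)" "p \<in> slice a b c (int m)" unfolding vline_eq[OF assms(1,2,4)] is_arg_min_def by blast
    have "\<not> Im (pt p0 (int m)) < Im z" using z p0 unfolding vline_eq[OF assms(1,2,4)] is_arg_min_def by blast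
    then have "p \<le> p0" unfolding p(1) im by simp
    moreover have "p0 \<le> p" using p(2) by (auto simp: slice_def p0_def)
    ultimately show "z = pt p0 (int m)" using p(1) by simp
  next
    assume z: "z = pt p0 (int m)"
    have "\<not> Im (pt p (int m)) < Im z" if "p \<in> slice a b c (int m)" for p
      unfolding z im using that by (auto simp: slice_def p0_def)
    then show "is_arg_min Im (\<lambda>z. z \<in> vline a b c m) z"
      using p0 z unfolding vline_eq[OF assms(1,2,4)] is_arg_min_def by blast
  qed
  then have "is_arg_min Im (\<lambda>z. z \<in> vline a b c m) = (\<lambda>z. z = pt p0 (int m))" by (rule ext)
  then show ?thesis unfolding lowest_point_def arg_min_on_def arg_min_def p0_def[symmetric] by simp
qed

lemma is_hole_place:
  assumes "0 < a" "0 < b" "0 < c" "m \<le> a + b"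
  shows "is_hole a b c m (place ` X) (real s) \<longleftrightarrow> (TypeIII, max 0 (int m - int b) + int s, int m) \<in> X"
proof -
  have "lowest_point a b c m + \<i> * of_real (real s) = pt (max 0 (int m - int b) + int s) (int m)"
    unfolding lowest_point_eq[OF assms] mult.commute[of \<i>] unfolding cis_emb(4) of_real_times_emb emb_add by simp
  then have "is_hole a b c m (place ` X) (real s) \<longleftrightarrow> place (TypeIII, max 0 (int m - int b) + int s, int m) \<in> place ` X"
    unfolding is_hole_def by (simp only: place_simp)
  then show ?thesis by (simp only: inj_image_mem_iff[OF inj_place])
qed

text \<open>Tilings with particle set Y on the line correspond to path families through the shifted
  set, so their number is K times the ensemble weight, and K cancels in the quotient for any event
  Q.\<close>

theorem random_tiling_line:
  fixes a b c m :: nat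
  assumes pos: "0 < a" "0 < b" "0 < c" and m: "m < a + b"
    and N: "N = card (vline a b c m)" and al: "al = nat \<bar>int m - int a\<bar>" and be: "be = nat \<bar>int m - int b\<bar>"
  defines "W \<equiv> \<lambda>Y. discriminant Y * (\<Prod>s\<in>Y. hahn_weight N al be s)"
    and "Ys \<equiv> {Y. Y \<subseteq> {..<N} \<and> card Y = c}"
  shows "measure_pmf.prob (random_tiling a b c) {T. Q {s. s < N \<and> \<not> is_hole a b c m T (real s)}}
    = (\<Sum>Y\<in>{Y\<in>Ys. Q Y}. W Y) / (\<Sum>Y\<in>Ys. W Y)"
proof -
  define p0 where "p0 = max 0 (int m - int b)"
  define F where "F = path_families c (a + b) {int a..<int a + int c}"
  define M where "M = matchings a b c"
  define part where "part T = {s. s < N \<and> \<not> is_hole a b c m T (real s)}" for T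
  define sh where "sh Y = (\<lambda>s. p0 + int s) ` Y" for Y
  have ab: "0 < a + b" "m \<le> a + b" using pos m by auto
  have N': "int N = int (min a m) + int c - p0" unfolding N p0_def by (rule card_vline[OF pos(1,2) ab(2)])
  have sl: "slice a b c (int m) = sh {..<N}"
  proof (intro equalityI subsetI)
    fix p assume p: "p \<in> slice a b c (int m)"
    then have "p = p0 + int (nat (p - p0))" "nat (p - p0) < N" using N' by (auto simp: slice_def p0_def)
    then show "p \<in> sh {..<N}" unfolding sh_def by blast
  qed (use N' in \<open>auto simp: slice_def p0_def sh_def\<close>)
  have inj_sh: "inj (\<lambda>s. p0 + int s)" by (auto simp: inj_def)
  have bF: "bij_betw (matching_paths a b c) M F" unfolding M_def F_def by (rule matchings_path_families[OF ab(1)])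
  have bT: "bij_betw ((`) place) M (tilings a b c)" unfolding M_def by (rule tilings_eq_matchings[OF pos])
  have finF: "finite F" unfolding F_def using card_path_families by blast
  have finM: "finite M" using bij_betw_finite[OF bF] finF by simp
  have finT: "finite (tilings a b c)" using bij_betw_finite[OF bT] finM by simp
  have part_eq: "sh (part (place ` X)) = matching_paths a b c X m" if X: "X \<in> M" for X
  proof -
    have sub: "matching_paths a b c X m \<subseteq> sh {..<N}" using matching_paths_slice[OF X[unfolded M_def], of m] ab unfolding sl by simp
    have iff: "p0 + int s \<in> matching_paths a b c X m \<longleftrightarrow> s \<in> part (place ` X)" if "s < N" for s
    proof -
      have "p0 + int s \<in> slice a b c (int m)" unfolding sl sh_def using that by blast
      from matching_paths_complement[OF X[unfolded M_def] m this]
      show ?thesis using that unfolding part_def p0_def is_hole_place[OF pos ab(2)] by auto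
    qed
    have part: "s < N" if "s \<in> part T" for s T using that by (simp add: part_def)
    show ?thesis
    proof (intro equalityI subsetI)
      fix p assume "p \<in> sh (part (place ` X))"
      then obtain s where "s \<in> part (place ` X)" "p = p0 + int s" unfolding sh_def by (rule imageE)
      then show "p \<in> matching_paths a b c X m" using iff[of s] part[of s] by simp
    next
      fix p assume p: "p \<in> matching_paths a b c X m"
      then have "p \<in> sh {..<N}" using sub by (rule subsetD[rotated])
      then obtain s where "s < N" "p = p0 + int s" unfolding sh_def by auto
      then show "p \<in> sh (part (place ` X))" using iff[of s] p unfolding sh_def by simp
    qed
  qed
  have partYs: "part T \<in> Ys" if T: "T \<in> tilings a b c" for T
  proof -
    have "T \<in> (`) place ` M" using bij_betw_imp_surj_on[OF bT] T by simp
    then obtain X where X: "X \<in> M" "T = place ` X" by (rule imageE)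
    have "matching_paths a b c X \<in> F" using bF X(1) by (auto simp: bij_betw_def)
    from path_families_bounds(3)[OF this[unfolded F_def] ab(2)]
    have "card (sh (part T)) = c" unfolding X(2) part_eq[OF X(1)] .
    then have "card (part T) = c" unfolding sh_def using card_image[OF inj_on_subset[OF inj_sh subset_UNIV], of "part T"] by simp
    then show ?thesis by (auto simp: Ys_def part_def)
  qed
  from path_families_hahn_ensemble[OF ab(2) p0_def N' al be] obtain K where K: "0 < K"
    and K': "\<forall>Y. Y \<subseteq> {..<N} \<longrightarrow> card Y = c \<longrightarrow> real (card {S\<in>F. S m = sh Y}) = K * W Y"
    unfolding W_def F_def sh_def by (elim exE conjE)
  then have K: "0 < K" "\<And>Y. Y \<in> Ys \<Longrightarrow> real (card {S\<in>F. S m = sh Y}) = K * W Y" by (simp_all add: Ys_def)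
  have fiber: "real (card {T\<in>tilings a b c. part T = Y}) = K * W Y" if Y: "Y \<in> Ys" for Y
  proof -
    have iff: "part (place ` X) = Y \<longleftrightarrow> matching_paths a b c X m = sh Y" if X: "X \<in> M" for X
      unfolding part_eq[OF X, symmetric] sh_def by (simp only: inj_image_eq_iff[OF inj_sh])
    have 1: "{T\<in>tilings a b c. part T = Y} = (`) place ` {X\<in>M. matching_paths a b c X m = sh Y}"
    proof (intro equalityI subsetI)
      fix T assume T: "T \<in> {T\<in>tilings a b c. part T = Y}"
      then have "T \<in> (`) place ` M" using bij_betw_imp_surj_on[OF bT] by simp
      then obtain X where X: "X \<in> M" "T = place ` X" by (rule imageE)
      then show "T \<in> (`) place ` {X\<in>M. matching_paths a b c X m = sh Y}" using iff[OF X(1)] T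
        by (intro image_eqI[of _ _ X]) simp_all
    next
      fix T assume "T \<in> (`) place ` {X\<in>M. matching_paths a b c X m = sh Y}"
      then obtain X where X: "X \<in> M" "matching_paths a b c X m = sh Y" "T = place ` X" by auto
      then show "T \<in> {T\<in>tilings a b c. part T = Y}" using iff[OF X(1)] bij_betw_apply[OF bT X(1)] by simp
    qed
    have 2: "{S\<in>F. S m = sh Y} = matching_paths a b c ` {X\<in>M. matching_paths a b c X m = sh Y}"
      unfolding bij_betw_imp_surj_on[OF bF, symmetric] by auto
    have "inj_on ((`) place) {X\<in>M. matching_paths a b c X m = sh Y}"
      by (rule inj_on_subset[OF bij_betw_imp_inj_on[OF bT]]) auto
    moreover have "inj_on (matching_paths a b c) {X\<in>M. matching_paths a b c X m = sh Y}"
      by (rule inj_on_subset[OF bij_betw_imp_inj_on[OF bF]]) auto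
    ultimately have "card {T\<in>tilings a b c. part T = Y} = card {S\<in>F. S m = sh Y}" unfolding 1 2 by (simp only: card_image)
    then show ?thesis using K(2)[OF Y] by simp
  qed
  have finYs: "finite Ys" unfolding Ys_def by (rule finite_subset[of _ "Pow {..<N}"]) auto
  have total: "real (card {T\<in>tilings a b c. R (part T)}) = K * (\<Sum>Y\<in>{Y\<in>Ys. R Y}. W Y)" for R
  proof -
    have "card {T\<in>tilings a b c. R (part T)} = (\<Sum>Y\<in>{Y\<in>Ys. R Y}. card {T\<in>{T\<in>tilings a b c. R (part T)}. part T = Y})"
      using sum.group[of "{T\<in>tilings a b c. R (part T)}" "{Y\<in>Ys. R Y}" part "\<lambda>_. 1 :: nat"] finT finYs partYs by (simp add: image_subset_iff)
    also have "\<dots> = (\<Sum>Y\<in>{Y\<in>Ys. R Y}. card {T\<in>tilings a b c. part T = Y})"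
      by (intro sum.cong refl arg_cong[where f = card]) auto
    finally show ?thesis using fiber by (simp add: sum_distrib_left)
  qed
  have Wpos: "0 < W Y" if "Y \<in> Ys" for Y
    unfolding W_def discriminant_def by (intro mult_pos_pos prod_pos ballI hahn_weight_pos) auto
  have "c \<le> N" using N' ab(2) unfolding p0_def by auto
  then have "{..<c} \<in> Ys" by (auto simp: Ys_def)
  then have "0 < (\<Sum>Y\<in>Ys. W Y)" using finYs Wpos by (intro sum_pos) auto
  then have "0 < K * (\<Sum>Y\<in>Ys. W Y)" using K(1) by simp
  then have "0 < card (tilings a b c)" using total[of "\<lambda>_. True"] by simp
  then have "tilings a b c \<noteq> {}" by auto
  then have "measure_pmf.prob (random_tiling a b c) {T. Q (part T)} = real (card (tilings a b c \<inter> {T. Q (part T)})) / real (card (tilings a b c))"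
    unfolding random_tiling_def by (rule measure_pmf_of_set) (rule finT)
  also have "tilings a b c \<inter> {T. Q (part T)} = {T\<in>tilings a b c. Q (part T)}" by auto
  also have "real (card {T\<in>tilings a b c. Q (part T)}) / real (card (tilings a b c)) = (\<Sum>Y\<in>{Y\<in>Ys. Q Y}. W Y) / (\<Sum>Y\<in>Ys. W Y)"
    using total[of Q] total[of "\<lambda>_. True"] K(1) by simp
  finally show ?thesis by (simp add: part_def)
qed

theorem theorem3p13:
  fixes \<AA> \<BB> \<CC> \<tau> A B c x \<alpha> \<beta> :: real
    and n \<aa> \<bb> \<cc> m N j :: "nat \<Rightarrow> nat"
    and M p :: nat
    and \<mu> :: "real measure"
  assumes "0 < \<BB>" "\<BB> \<le> \<AA>" "0 < \<CC>" "0 < \<tau>" "\<tau> < \<AA> + \<BB>"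
    and "\<And>k. 0 < n k" "filterlim n at_top sequentially"
    and "\<And>k. real (\<aa> k) = \<AA> * real (n k)"
        "\<And>k. real (\<bb> k) = \<BB> * real (n k)"
        "\<And>k. real (\<cc> k) = \<CC> * real (n k)"
        "\<And>k. real (m k) = \<tau> * real (n k)"
    and "\<And>k. N k = card (vline (\<aa> k) (\<bb> k) (\<cc> k) (m k))"
    and "\<And>k. c = (real (N k) - real (\<cc> k)) / real (N k)"
        "\<And>k. A = \<bar>real (m k) - real (\<aa> k)\<bar> / real (N k)"
        "\<And>k. B = \<bar>real (m k) - real (\<bb> k)\<bar> / real (N k)"
    and "0 < A" "0 < B" "c \<noteq> c_crit_A A B" "c \<noteq> c_crit_B A B"
    and "is_equilibrium_measure A B c \<mu>"
    and "is_band c \<mu> \<alpha> \<beta>"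
    and "0 < x" "\<And>k. real (N k) * x \<in> real ` {..<N k}" "x \<in> {\<alpha><..<\<beta>}"
    and "j 0 = 0" "inj_on j {..M}" "\<And>k. j ` {..M} \<subseteq> {..<N k}"
  shows "(\<lambda>k. measure_pmf.prob (random_tiling (\<aa> k) (\<bb> k) (\<cc> k))
            {T. card {\<xi> \<in> (\<lambda>i. real (N k) * x + real (j i)) ` {..M}.
                   is_hole (\<aa> k) (\<bb> k) (\<cc> k) (m k) T \<xi>} = p})
         \<longlonglongrightarrow> 1 / fact p * ((-1) ^ p *
               (deriv ^^ p)
                 (\<lambda>t. Determinant.det
                   (1\<^sub>m (Suc M) - t \<cdot>\<^sub>m sine_matrix (c * density_at \<mu> x) M j)) 1)"
proof -
  have np: "0 < real (n k)" for k using assms(6) by simp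
  have pos: "0 < \<aa> k" "0 < \<bb> k" "0 < \<cc> k" "0 < m k" for k
  proof -
    have "0 < real (\<aa> k)" "0 < real (\<bb> k)" "0 < real (\<cc> k)" "0 < real (m k)"
      unfolding assms(8-11) using assms(1-4) np by auto
    then show "0 < \<aa> k" "0 < \<bb> k" "0 < \<cc> k" "0 < m k" by simp_all
  qed
  have m: "m k < \<aa> k + \<bb> k" for k
  proof -
    have "real (m k) < \<AA> * real (n k) + \<BB> * real (n k)"
      unfolding assms(11) distrib_right[symmetric] using assms(5) np by simp
    then have "real (m k) < real (\<aa> k) + real (\<bb> k)" by (simp only: assms(8,9))
    then show ?thesis by linarith
  qed
  have NN: "int (N k) = int (min (\<aa> k) (m k)) + int (\<cc> k) - max 0 (int (m k) - int (\<bb> k))" for k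
    unfolding assms(12) using card_vline[OF pos(1,2)] m[of k] by simp
  \<comment> \<open>Strictness comes from 0 < m < a + b; it makes the hole fraction c
    positive.\<close>
  have Nc: "\<cc> k < N k" for k using NN[of k] pos[of k] m[of k] by (auto simp: min_def max_def split: if_splits)
  have N0: "0 < N k" for k using Nc[of k] by simp
  have Nr: "0 < real (N k)" for k using N0 by simp
  have cc: "real (\<cc> k) = (1 - c) * real (N k)" for k
    using assms(13)[of k] Nr[of k] by (simp add: field_simps)
  have c: "0 < c" "c < 1" unfolding assms(13)[of 0] using Nr[of 0] Nc[of 0] pos(3)[of 0] by simp_all
  define al be where "al k = nat \<bar>int (m k) - int (\<aa> k)\<bar>" and "be k = nat \<bar>int (m k) - int (\<bb> k)\<bar>" for k
  have al: "real (al k) = A * real (N k)" for k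
  proof -
    have "real (al k) = \<bar>real (m k) - real (\<aa> k)\<bar>" by (simp add: al_def)
    then show ?thesis using assms(14)[of k] Nr[of k] by simp
  qed
  have be: "real (be k) = B * real (N k)" for k
  proof -
    have "real (be k) = \<bar>real (m k) - real (\<bb> k)\<bar>" by (simp add: be_def)
    then show ?thesis using assms(15)[of k] Nr[of k] by simp
  qed
  have Nlim: "filterlim N at_top sequentially"
    unfolding filterlim_at_top
  proof
    fix Z
    have "eventually (\<lambda>k. nat \<lceil>real Z / \<CC>\<rceil> \<le> n k) sequentially"
      using assms(7) unfolding filterlim_at_top by (rule spec)
    then show "eventually (\<lambda>k. Z \<le> N k) sequentially"
    proof eventually_elim
      case (elim k)
      then have "real Z / \<CC> \<le> real (n k)" by linarith
      then have "real Z \<le> real (\<cc> k)" unfolding assms(10) using assms(3) by (simp add: field_simps)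
      then show ?case using Nc[of k] by simp
    qed
  qed
  have "\<forall>k. \<exists>i. i < N k \<and> real (N k) * x = real i" using assms(23) by auto
  from choice[OF this] obtain s where s: "\<And>k. s k < N k" "\<And>k. real (N k) * x = real (s k)" by blast
  have x: "0 < x" "x < 1"
  proof -
    have "real (N 0) * x < real (N 0)" using s[of 0] by simp
    then show "x < 1" using Nr[of 0] by simp
  qed (rule assms(22))
  have sx: "(\<lambda>k. real (s k) / real (N k)) \<longlonglongrightarrow> x"
    using Nr s(2)[symmetric] by (simp add: less_imp_neq[THEN not_sym])
  define W where "W k Y = discriminant Y * (\<Prod>r\<in>Y. hahn_weight (N k) (al k) (be k) r)" for k Y
  define Ys where "Ys k = {Y. Y \<subseteq> {..<N k} \<and> card Y = \<cc> k}" for k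
  \<comment> \<open>The particle fraction is 1 - c; here the spectral density of the particles is
    exchanged for the variational density of the holes.\<close>
  have q: "c * density_at \<mu> x = 1 - hahn_density A B (1 - c) x"
    by (rule equilibrium_density[OF Nlim N0 al be assms(16,17) cc c assms(20) x])
  have lim: "(\<lambda>k. (\<Sum>Y\<in>{Y\<in>Ys k. card {u. u < Suc M \<and> s k + j u \<notin> Y} = p}. W k Y) / (\<Sum>Y\<in>Ys k. W k Y))
     \<longlonglongrightarrow> 1 / fact p * ((-1) ^ p * (deriv ^^ p) (\<lambda>t. Determinant.det
            (1\<^sub>m (Suc M) - t \<cdot>\<^sub>m sine_matrix (c * density_at \<mu> x) M j)) 1)"
    unfolding q W_def Ys_def using c
    by (intro hahn_ensemble_gap_probability[OF Nlim N0 al be assms(16,17) cc _ _ sx x assms(26)]) auto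
  define J where "J = Max (j ` {..M})"
  have J: "j u \<le> J" if "u \<le> M" for u unfolding J_def using that by (intro Max_ge) auto
  \<comment> \<open>As x < 1, the line has room for the whole shifted window once N (1 - x) exceeds
    the largest offset; from then on a window site carries a hole exactly when it is missing from
    the particle set.\<close>
  have "eventually (\<lambda>k. nat \<lceil>real J / (1 - x)\<rceil> + 1 \<le> N k) sequentially" using Nlim by (simp add: filterlim_at_top)
  then have ev: "eventually (\<lambda>k. (\<Sum>Y\<in>{Y\<in>Ys k. card {u. u < Suc M \<and> s k + j u \<notin> Y} = p}. W k Y) / (\<Sum>Y\<in>Ys k. W k Y)
     = measure_pmf.prob (random_tiling (\<aa> k) (\<bb> k) (\<cc> k))
            {T. card {\<xi> \<in> (\<lambda>i. real (N k) * x + real (j i)) ` {..M}. is_hole (\<aa> k) (\<bb> k) (\<cc> k) (m k) T \<xi>} = p}) sequentially"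
  proof eventually_elim
    case (elim k)
    then have "real J / (1 - x) < real (N k)" by linarith
    then have "real J < real (N k) * (1 - x)" using x by (simp add: field_simps)
    then have "real (s k) + real J < real (N k)" using s(2)[of k] by (simp add: algebra_simps)
    then have jN: "s k + j u < N k" if "u \<le> M" for u using J[OF that] by linarith
    have "card {\<xi> \<in> (\<lambda>i. real (N k) * x + real (j i)) ` {..M}. is_hole (\<aa> k) (\<bb> k) (\<cc> k) (m k) T \<xi>}
       = card {u. u < Suc M \<and> s k + j u \<notin> {i. i < N k \<and> \<not> is_hole (\<aa> k) (\<bb> k) (\<cc> k) (m k) T (real i)}}" for T
    proof -
      define V where "V = {u. u < Suc M \<and> s k + j u \<notin> {i. i < N k \<and> \<not> is_hole (\<aa> k) (\<bb> k) (\<cc> k) (m k) T (real i)}}"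
      have V: "u \<in> V \<longleftrightarrow> u \<le> M \<and> is_hole (\<aa> k) (\<bb> k) (\<cc> k) (m k) T (real (s k + j u))" for u
        using jN[of u] by (auto simp: V_def less_Suc_eq_le)
      have "{\<xi> \<in> (\<lambda>i. real (N k) * x + real (j i)) ` {..M}. is_hole (\<aa> k) (\<bb> k) (\<cc> k) (m k) T \<xi>} = (\<lambda>u. real (s k + j u)) ` V"
        unfolding s(2) of_nat_add[symmetric] using V by auto
      moreover have "inj_on (\<lambda>u. real (s k + j u)) V"
        using assms(26) V by (auto simp: inj_on_def)
      ultimately show ?thesis unfolding V_def[symmetric] by (simp only: card_image)
    qed
    then show ?case
      using random_tiling_line[OF pos(1,2,3) m assms(12) al_def be_def, of k "\<lambda>Y. card {u. u < Suc M \<and> s k + j u \<notin> Y} = p"]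
      unfolding W_def Ys_def by simp
  qed
  show ?thesis by (rule Lim_transform_eventually[OF lim ev])
qed

end
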